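(* Let $k_1,k_2,h\in\mathrm{Supp}_{BV}(Q)$ and let $F,G\in\mathcal S(L_2(Q))$ with corresponding measures $f,g\in\mathcal M(L_2(Q))$. Assume that $h^2=k_1k_2$ $m_L^2$-a.e. on $Q$. For $j\in\{1,2\}$ let $\mathbf s(h,k_j)$ be a function in $\mathrm{Supp}_{BV}(Q)$ with $\mathbf s(h,k_j)^2=h^2+k_j^2$ $m_L^2$-a.e. on $Q$. Then, for all nonzero real $q$, $$T_{q,h}^{(1)}\big((F*G)_q^{(k_1,k_2)}\big)(y)=T_{q,\mathbf s(h,k_1)/\sqrt2}^{(1)}(F)\Big(\frac{y}{\sqrt2}\Big)\,T_{q,\mathbf s(h,k_2)/\sqrt2}^{(1)}(G)\Big(\frac{y}{\sqrt2}\Big)$$ for s-a.e. $y\in C_0(Q)$. In particular, $$T_{q,h}^{(1)}\big((F*G)_q^{(h,h)}\big)(y)=T_{q,h}^{(1)}(F)\Big(\frac{y}{\sqrt2}\Big)\,T_{q,h}^{(1)}(G)\Big(\frac{y}{\sqrt2}\Big)$$ for s-a.e. $y\in C_0(Q)$.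
   Context: Fix $S,T>0$, let $Q=[0,S]\times[0,T]$, $m_L^2$ = Lebesgue measure on $Q$, and $L_2(Q)$ the real Hilbert space with inner product $(\cdot,\cdot)_2$ and norm $\|\cdot\|_2$. $C_0(Q)$ is the space of real continuous $x$ on $Q$ with $x(s,0)=x(0,t)=0$, with (completed) Yeh--Wiener measure $m_{\mathrm y}$, i.e. the centered Gaussian measure with $\int x(s,t)x(s',t')\,dm_{\mathrm y}(x)=\min(s,s')\min(t,t')$. A set $E$ is scale-invariant measurable if $\rho E$ is measurable for every $\rho>0$, a scale-invariant measurable set $N$ is scale-invariant null if $m_{\mathrm y}(\rho N)=0$ for every $\rho>0$; "s-a.e." means off a scale-invariant null set. A functional $F$ is scale-invariant measurable if it is defined on a scale-invariant measurable set and $F(\rho\,\cdot)$ is measurable for every $\rho>0$. PWZ integral: fix a complete orthonormal set $\{\phi_n\}$ of $L_2(Q)$ consisting of functions of bounded variation (Hardy--Krause sense); for $v\in L_2(Q)$, $\langle v,x\rangle=\lim_{n}\int_Q\sum_{j=1}^n(v,\phi_j)_2\phi_j\,dx$ where the limit exists (it exists for s-a.e. $x$ and is essentially independent of $\{\phi_n\}$). $\mathrm{Supp}_{BV}(Q)$ is the set of real functions $h$ on $Q$ of bounded variation (Hardy--Krause sense) with $h\neq0$ $m_L^2$-a.e. For such $h$, $\mathcal Y_h(x;s,t)=\langle\chi_{[0,s]\times[0,t]}h,x\rangle$; its sample paths $\mathcal Y_h(x;\cdot,\cdot)$ lie in $C_0(Q)$. $\mathcal M(L_2(Q))$ is the space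 of complex countably additive Borel measures on $L_2(Q)$. $\mathcal S(L_2(Q))$ is the set of functionals $F$ on $C_0(Q)$ of the form $F(x)=\int_{L_2(Q)}\exp\{i\langle u,x\rangle\}df(u)$ for s-a.e. $x$, for some $f\in\mathcal M(L_2(Q))$. Evaluation along Gaussian paths uses this formula together with $\langle u,\mathcal Y_h(x;\cdot,\cdot)\rangle=\langle uh,x\rangle$, i.e. for real $b,c$, $F(by+c\mathcal Y_h(x;\cdot,\cdot))=\int\exp\{ib\langle u,y\rangle+ic\langle uh,x\rangle\}df(u)$. Transform: let $\mathbb C_+=\{\mathrm{Re}\,\lambda>0\}$ and $h\in\mathrm{Supp}_{BV}(Q)$. $T_{\lambda,h}(F)(y)$, $\lambda\in\mathbb C_+$, is the analytic continuation to $\mathbb C_+$ (if it exists) of $\lambda\mapsto\int_{C_0(Q)}F(y+\lambda^{-1/2}\mathcal Y_h(x;\cdot,\cdot))dm_{\mathrm y}(x)$, $\lambda>0$. For real $q\ne0$, $T_{q,h}^{(1)}(F)(y)=\lim_{\lambda\to-iq,\,\lambda\in\mathbb C_+}T_{\lambda,h}(F)(y)$ for s-a.e. $y$, whenever this limit exists. Convolution product: for $k_1,k_2\in\mathrm{Supp}_{BV}(Q)$ and real $q\neq0$, $(F*G)_q^{(k_1,k_2)}(y)$ is the limit as $\lambda\to-iq$, $\lambda\in\mathbb C_+$, of the analytic continuation to $\mathbb C_+$ of $$\lambda\mapsto\int_{C_0(Q)}F\Big(\tfrac{y+\lambda^{-1/2}\mathcal Y_{k_1}(x;\cdot,\cdot)}{\sqrt2}\Big)G\Big(\tfrac{y-\lambda^{-1/2}\mathcal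 Y_{k_2}(x;\cdot,\cdot)}{\sqrt2}\Big)dm_{\mathrm y}(x),\quad\lambda>0,$$ if it exists. For $F,G\in\mathcal S(L_2(Q))$ this product exists for s-a.e. $y$ and belongs to $\mathcal S(L_2(Q))$. *)

theory Defs
  imports "HOL-Probability.Probability"
begin

type_synonym sheet = "real \<times> real \<Rightarrow> real"

definition Qrect :: "real \<Rightarrow> real \<Rightarrow> (real \<times> real) set" where
  "Qrect S T = {0..S} \<times> {0..T}"

section \<open>Yeh--Wiener space\<close>

text \<open>A function on \<open>Q\<close> is encoded as a total function vanishing off \<open>Q\<close>, so that
  \<open>C\<^sub>0(Q)\<close> is closed under the pointwise vector space operations.\<close>

definition C0 :: "real \<Rightarrow> real \<Rightarrow> sheet set" where
  "C0 S T = {x. continuous_on (Qrect S T) x \<and> (\<forall>s\<in>{0..S}. x (s, 0) = 0) \<and>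
     (\<forall>t\<in>{0..T}. x (0, t) = 0) \<and> (\<forall>p. p \<notin> Qrect S T \<longrightarrow> x p = 0)}"

text \<open>The \<open>\<sigma>\<close>-algebra generated by the evaluations; it is the Borel \<open>\<sigma>\<close>-algebra of the
  uniform norm.\<close>

definition C0_borel :: "real \<Rightarrow> real \<Rightarrow> sheet measure" where
  "C0_borel S T = sigma (C0 S T)
     {{x \<in> C0 S T. x p \<in> B} | p B. p \<in> Qrect S T \<and> B \<in> sets (borel :: real measure)}"

definition centered_normal :: "real measure \<Rightarrow> bool" where
  "centered_normal D \<longleftrightarrow>
     D = return borel 0 \<or> (\<exists>\<sigma>>0. D = density lborel (normal_density 0 \<sigma>))"

text \<open>These conditions determine the measure uniquely.\<close>

definition yeh_wiener_measure :: "real \<Rightarrow> real \<Rightarrow> sheet measure \<Rightarrow> bool" where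
  "yeh_wiener_measure S T my \<longleftrightarrow> (\<exists>M. my = completion M \<and>
     space M = C0 S T \<and> sets M = sets (C0_borel S T) \<and> prob_space M \<and>
     (\<forall>I a. finite I \<and> I \<subseteq> Qrect S T \<longrightarrow>
        centered_normal (distr M borel (\<lambda>x. \<Sum>p\<in>I. a p * x p))) \<and>
     (\<forall>s\<in>{0..S}. \<forall>t\<in>{0..T}. \<forall>s'\<in>{0..S}. \<forall>t'\<in>{0..T}.
        (\<integral>x. x (s, t) * x (s', t') \<partial>M) = min s s' * min t t'))"

definition scale :: "real \<Rightarrow> sheet \<Rightarrow> sheet" where
  "scale r x = (\<lambda>p. r * x p)"

definition si_measurable_set :: "sheet measure \<Rightarrow> sheet set \<Rightarrow> bool" where
  "si_measurable_set my E \<longleftrightarrow> (\<forall>\<rho>>0. scale \<rho> ` E \<in> sets my)"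

definition si_null :: "sheet measure \<Rightarrow> sheet set \<Rightarrow> bool" where
  "si_null my N \<longleftrightarrow> si_measurable_set my N \<and> (\<forall>\<rho>>0. emeasure my (scale \<rho> ` N) = 0)"

definition s_ae :: "sheet measure \<Rightarrow> (sheet \<Rightarrow> bool) \<Rightarrow> bool" where
  "s_ae my P \<longleftrightarrow> (\<exists>N. si_null my N \<and> (\<forall>x \<in> space my - N. P x))"

section \<open>The space \<open>L\<^sub>2(Q)\<close>\<close>

text \<open>Elements of \<open>L\<^sub>2(Q)\<close> are represented by functions, without passing to the quotient by
  a.e. equality on \<open>Q\<close>. Sets that are open for the seminorm are unions of a.e.-classes, so
  \<open>L2_borel\<close> is the pullback of the Borel \<open>\<sigma>\<close>-algebra of the quotient Hilbert space, and
  measures on either one correspond bijectively.\<close>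

definition L2 :: "real \<Rightarrow> real \<Rightarrow> sheet set" where
  "L2 S T = {u \<in> borel_measurable (lebesgue_on (Qrect S T)).
     integrable (lebesgue_on (Qrect S T)) (\<lambda>p. (u p)\<^sup>2)}"

definition inner2 :: "real \<Rightarrow> real \<Rightarrow> sheet \<Rightarrow> sheet \<Rightarrow> real" where
  "inner2 S T u v = (\<integral>p. u p * v p \<partial>lebesgue_on (Qrect S T))"

definition norm2 :: "real \<Rightarrow> real \<Rightarrow> sheet \<Rightarrow> real" where
  "norm2 S T u = sqrt (inner2 S T u u)"

definition L2_open :: "real \<Rightarrow> real \<Rightarrow> sheet set \<Rightarrow> bool" where
  "L2_open S T U \<longleftrightarrow> U \<subseteq> L2 S T \<and>
     (\<forall>u\<in>U. \<exists>e>0. \<forall>v\<in>L2 S T. norm2 S T (\<lambda>p. u p - v p) < e \<longrightarrow> v \<in> U)"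

definition L2_borel :: "real \<Rightarrow> real \<Rightarrow> sheet measure" where
  "L2_borel S T = sigma (L2 S T) {U. L2_open S T U}"

section \<open>Functions of bounded variation in the sense of Hardy and Krause\<close>

text \<open>\<open>grid a b n s\<close>: the points \<open>a = s 0 \<le> \<dots> \<le> s n = b\<close> (repetitions allowed; they contribute
  zero increments).\<close>

definition grid :: "real \<Rightarrow> real \<Rightarrow> nat \<Rightarrow> (nat \<Rightarrow> real) \<Rightarrow> bool" where
  "grid a b n s \<longleftrightarrow> s 0 = a \<and> s n = b \<and> (\<forall>i<n. s i \<le> s (Suc i))"

definition rect_incr :: "sheet \<Rightarrow> (nat \<Rightarrow> real) \<Rightarrow> (nat \<Rightarrow> real) \<Rightarrow> nat \<Rightarrow> nat \<Rightarrow> real" where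
  "rect_incr h s t i j =
     h (s (Suc i), t (Suc j)) - h (s (Suc i), t j) - h (s i, t (Suc j)) + h (s i, t j)"

definition bv1 :: "real \<Rightarrow> real \<Rightarrow> (real \<Rightarrow> real) \<Rightarrow> bool" where
  "bv1 a b g \<longleftrightarrow>
     (\<exists>K. \<forall>n s. grid a b n s \<longrightarrow> (\<Sum>i<n. \<bar>g (s (Suc i)) - g (s i)\<bar>) \<le> K)"

text \<open>Given finite Vitali variation, bounded variation on one line parallel to each axis is
  equivalent to bounded variation on all of them; the axes themselves are used.\<close>

definition bv_hk :: "real \<Rightarrow> real \<Rightarrow> sheet \<Rightarrow> bool" where
  "bv_hk S T h \<longleftrightarrow>
     (\<exists>K. \<forall>m n s t. grid 0 S m s \<and> grid 0 T n t \<longrightarrow>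
        (\<Sum>i<m. \<Sum>j<n. \<bar>rect_incr h s t i j\<bar>) \<le> K) \<and>
     bv1 0 S (\<lambda>s. h (s, 0)) \<and> bv1 0 T (\<lambda>t. h (0, t))"

definition Supp_BV :: "real \<Rightarrow> real \<Rightarrow> sheet set" where
  "Supp_BV S T = {h. bv_hk S T h \<and> (AE p in lebesgue_on (Qrect S T). h p \<noteq> 0)}"

section \<open>The Paley--Wiener--Zygmund integral\<close>

text \<open>Riemann--Stieltjes integral over \<open>Q\<close>. The tags form a product grid \<open>(\<xi> i, \<eta> j)\<close>. With tags
  chosen independently in every cell the limit would fail to exist for \<open>m\<^sub>y\<close>-almost every path
  even for smooth integrands; with product tags it exists for all integrands of bounded
  variation and all continuous \<open>x\<close>, by summation by parts.\<close>

definition has_rs_integral :: "real \<Rightarrow> real \<Rightarrow> sheet \<Rightarrow> sheet \<Rightarrow> real \<Rightarrow> bool" where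
  "has_rs_integral S T v x I \<longleftrightarrow>
     (\<forall>\<epsilon>>0. \<exists>\<delta>>0. \<forall>m n s t \<xi> \<eta>.
        grid 0 S m s \<and> grid 0 T n t \<and>
        (\<forall>i<m. s (Suc i) - s i < \<delta> \<and> \<xi> i \<in> {s i..s (Suc i)}) \<and>
        (\<forall>j<n. t (Suc j) - t j < \<delta> \<and> \<eta> j \<in> {t j..t (Suc j)}) \<longrightarrow>
        \<bar>(\<Sum>i<m. \<Sum>j<n. v (\<xi> i, \<eta> j) * rect_incr x s t i j) - I\<bar> < \<epsilon>)"

definition rs_integral :: "real \<Rightarrow> real \<Rightarrow> sheet \<Rightarrow> sheet \<Rightarrow> real" where
  "rs_integral S T v x = (THE I. has_rs_integral S T v x I)"

definition bv_complete_orthonormal :: "real \<Rightarrow> real \<Rightarrow> (nat \<Rightarrow> sheet) \<Rightarrow> bool" where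
  "bv_complete_orthonormal S T \<phi> \<longleftrightarrow>
     (\<forall>n. \<phi> n \<in> L2 S T \<and> bv_hk S T (\<phi> n)) \<and>
     (\<forall>m n. inner2 S T (\<phi> m) (\<phi> n) = (if m = n then 1 else 0)) \<and>
     (\<forall>u\<in>L2 S T. (\<forall>n. inner2 S T u (\<phi> n) = 0) \<longrightarrow>
        (AE p in lebesgue_on (Qrect S T). u p = 0))"

text \<open>\<open>\<langle>v,x\<rangle>\<close>; unspecified where the limit does not exist.\<close>

definition pwz :: "real \<Rightarrow> real \<Rightarrow> (nat \<Rightarrow> sheet) \<Rightarrow> sheet \<Rightarrow> sheet \<Rightarrow> real" where
  "pwz S T \<phi> v x =
     lim (\<lambda>n. rs_integral S T (\<lambda>p. \<Sum>j<n. inner2 S T v (\<phi> j) * \<phi> j p) x)"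

section \<open>Complex measures\<close>

definition complex_measure :: "'a measure \<Rightarrow> ('a set \<Rightarrow> complex) \<Rightarrow> bool" where
  "complex_measure M f \<longleftrightarrow> f {} = 0 \<and>
     (\<forall>A. range A \<subseteq> sets M \<and> disjoint_family A \<longrightarrow> (\<lambda>n::nat. f (A n)) sums f (\<Union>n. A n))"

text \<open>Upper variation of a real set function (positive part of its Jordan decomposition).\<close>

definition upper_variation :: "'a measure \<Rightarrow> ('a set \<Rightarrow> real) \<Rightarrow> 'a measure" where
  "upper_variation M r = measure_of (space M) (sets M)
     (\<lambda>A. ennreal (SUP B\<in>{B \<in> sets M. B \<subseteq> A}. r B))"

definition cm_integral :: "'a measure \<Rightarrow> ('a set \<Rightarrow> complex) \<Rightarrow> ('a \<Rightarrow> complex) \<Rightarrow> complex" where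
  "cm_integral M f \<psi> =
     (\<integral>u. \<psi> u \<partial>upper_variation M (\<lambda>A. Re (f A))) -
     (\<integral>u. \<psi> u \<partial>upper_variation M (\<lambda>A. - Re (f A))) +
     \<i> * ((\<integral>u. \<psi> u \<partial>upper_variation M (\<lambda>A. Im (f A))) -
          (\<integral>u. \<psi> u \<partial>upper_variation M (\<lambda>A. - Im (f A))))"

section \<open>The class \<open>\<S>(L\<^sub>2(Q))\<close>\<close>

text \<open>Functionals are total; the values on a scale-invariant null set are immaterial.\<close>

definition corresponds ::
  "real \<Rightarrow> real \<Rightarrow> sheet measure \<Rightarrow> (nat \<Rightarrow> sheet) \<Rightarrow> (sheet \<Rightarrow> complex) \<Rightarrow> (sheet set \<Rightarrow> complex) \<Rightarrow> bool"
  where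
  "corresponds S T my \<phi> F f \<longleftrightarrow> complex_measure (L2_borel S T) f \<and>
     s_ae my (\<lambda>x. F x = cm_integral (L2_borel S T) f
       (\<lambda>u. exp (\<i> * complex_of_real (pwz S T \<phi> u x))))"

definition S_class ::
  "real \<Rightarrow> real \<Rightarrow> sheet measure \<Rightarrow> (nat \<Rightarrow> sheet) \<Rightarrow> (sheet \<Rightarrow> complex) set" where
  "S_class S T my \<phi> = {F. \<exists>f. corresponds S T my \<phi> F f}"

text \<open>The corresponding measure; it is unique on the Borel sets.\<close>

definition measure_for ::
  "real \<Rightarrow> real \<Rightarrow> sheet measure \<Rightarrow> (nat \<Rightarrow> sheet) \<Rightarrow> (sheet \<Rightarrow> complex) \<Rightarrow> sheet set \<Rightarrow> complex" where
  "measure_for S T my \<phi> F = (SOME f. corresponds S T my \<phi> F f)"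

text \<open>\<open>F(b y + c \<Y>\<^sub>h(x;\<cdot>,\<cdot>))\<close> for \<open>F \<in> \<S>(L\<^sub>2(Q))\<close>. As the law of a Gaussian path is in general
  singular to that of all multiples of \<open>x\<close>, equality s-a.e. does not determine such values
  pointwise; they are by convention those of the integral representation, with
  \<open>\<langle>u, \<Y>\<^sub>h(x;\<cdot>,\<cdot>)\<rangle> = \<langle>u h, x\<rangle>\<close>.\<close>

definition gauss_eval ::
  "real \<Rightarrow> real \<Rightarrow> sheet measure \<Rightarrow> (nat \<Rightarrow> sheet) \<Rightarrow> (sheet \<Rightarrow> complex) \<Rightarrow>
    real \<Rightarrow> sheet \<Rightarrow> real \<Rightarrow> sheet \<Rightarrow> sheet \<Rightarrow> complex" where
  "gauss_eval S T my \<phi> F b y c h x =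
     cm_integral (L2_borel S T) (measure_for S T my \<phi> F)
       (\<lambda>u. exp (\<i> * complex_of_real b * complex_of_real (pwz S T \<phi> u y) +
                 \<i> * complex_of_real c * complex_of_real (pwz S T \<phi> (\<lambda>p. u p * h p) x)))"

section \<open>Analytic Feynman-type limits, transform and convolution product\<close>

definition Cplus :: "complex set" where
  "Cplus = {z. 0 < Re z}"

text \<open>\<open>L\<close> is the limit, as \<open>l \<longrightarrow> -\<i>q\<close> in \<open>\<complex>\<^sub>+\<close>, of the analytic continuation of
  \<open>l \<mapsto> \<integral> K l x dm\<^sub>y(x)\<close>, \<open>l > 0\<close>.\<close>

definition has_analytic_limit ::
  "sheet measure \<Rightarrow> real \<Rightarrow> (real \<Rightarrow> sheet \<Rightarrow> complex) \<Rightarrow> complex \<Rightarrow> bool" where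
  "has_analytic_limit my q K L \<longleftrightarrow>
     (\<forall>l>0. integrable my (K l)) \<and>
     (\<exists>J. J holomorphic_on Cplus \<and>
          (\<forall>l>0. J (complex_of_real l) = (\<integral>x. K l x \<partial>my)) \<and>
          (J \<longlongrightarrow> L) (at (- \<i> * complex_of_real q) within Cplus))"

definition has_transform ::
  "real \<Rightarrow> real \<Rightarrow> sheet measure \<Rightarrow> (nat \<Rightarrow> sheet) \<Rightarrow> real \<Rightarrow> sheet \<Rightarrow>
    (sheet \<Rightarrow> complex) \<Rightarrow> sheet \<Rightarrow> complex \<Rightarrow> bool" where
  "has_transform S T my \<phi> q h F y L \<longleftrightarrow> F \<in> S_class S T my \<phi> \<and>
     has_analytic_limit my q (\<lambda>l x. gauss_eval S T my \<phi> F 1 y (1 / sqrt l) h x) L"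

definition transform_exists ::
  "real \<Rightarrow> real \<Rightarrow> sheet measure \<Rightarrow> (nat \<Rightarrow> sheet) \<Rightarrow> real \<Rightarrow> sheet \<Rightarrow>
    (sheet \<Rightarrow> complex) \<Rightarrow> sheet \<Rightarrow> bool" where
  "transform_exists S T my \<phi> q h F y \<longleftrightarrow> (\<exists>L. has_transform S T my \<phi> q h F y L)"

definition transform ::
  "real \<Rightarrow> real \<Rightarrow> sheet measure \<Rightarrow> (nat \<Rightarrow> sheet) \<Rightarrow> real \<Rightarrow> sheet \<Rightarrow>
    (sheet \<Rightarrow> complex) \<Rightarrow> sheet \<Rightarrow> complex" where
  "transform S T my \<phi> q h F y = (THE L. has_transform S T my \<phi> q h F y L)"

definition has_conv_product ::
  "real \<Rightarrow> real \<Rightarrow> sheet measure \<Rightarrow> (nat \<Rightarrow> sheet) \<Rightarrow> real \<Rightarrow> sheet \<Rightarrow> sheet \<Rightarrow>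
    (sheet \<Rightarrow> complex) \<Rightarrow> (sheet \<Rightarrow> complex) \<Rightarrow> sheet \<Rightarrow> complex \<Rightarrow> bool" where
  "has_conv_product S T my \<phi> q k1 k2 F G y L \<longleftrightarrow>
     F \<in> S_class S T my \<phi> \<and> G \<in> S_class S T my \<phi> \<and>
     has_analytic_limit my q
       (\<lambda>l x. gauss_eval S T my \<phi> F (1 / sqrt 2) y (1 / sqrt l / sqrt 2) k1 x *
               gauss_eval S T my \<phi> G (1 / sqrt 2) y (- (1 / sqrt l / sqrt 2)) k2 x) L"

definition conv_product_exists ::
  "real \<Rightarrow> real \<Rightarrow> sheet measure \<Rightarrow> (nat \<Rightarrow> sheet) \<Rightarrow> real \<Rightarrow> sheet \<Rightarrow> sheet \<Rightarrow>
    (sheet \<Rightarrow> complex) \<Rightarrow> (sheet \<Rightarrow> complex) \<Rightarrow> sheet \<Rightarrow> bool" where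
  "conv_product_exists S T my \<phi> q k1 k2 F G y \<longleftrightarrow>
     (\<exists>L. has_conv_product S T my \<phi> q k1 k2 F G y L)"

definition conv_product ::
  "real \<Rightarrow> real \<Rightarrow> sheet measure \<Rightarrow> (nat \<Rightarrow> sheet) \<Rightarrow> real \<Rightarrow> sheet \<Rightarrow> sheet \<Rightarrow>
    (sheet \<Rightarrow> complex) \<Rightarrow> (sheet \<Rightarrow> complex) \<Rightarrow> sheet \<Rightarrow> complex" where
  "conv_product S T my \<phi> q k1 k2 F G y = (THE L. has_conv_product S T my \<phi> q k1 k2 F G y L)"

end

theory Submission
  imports Defs "HOL-Complex_Analysis.Complex_Analysis"
begin

text \<open>
  For \<open>F = \<integral> exp(i\<langle>u,\<cdot>\<rangle>) df(u)\<close> Fubini's theorem and the Gaussian characteristic function turn the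
  analytic limit defining the transform into \<open>\<integral> exp(i\<langle>u,y\<rangle> - i\<parallel>uh\<parallel>\<^sup>2/(2q)) df(u)\<close>, and the one defining the
  convolution product into
  \<open>\<integral>\<integral> exp(i\<langle>u+v,y\<rangle>/\<surd>2 - i\<parallel>uk\<^sub>1 - vk\<^sub>2\<parallel>\<^sup>2/(4q)) df(u) dg(v)\<close>. The latter is again of the form
  \<open>\<integral> exp(i\<langle>w,y\<rangle>) d\<nu>(w)\<close>, \<open>\<nu>\<close> being the image of a density times \<open>f \<times> g\<close> under \<open>(u,v) \<mapsto> (u+v)/\<surd>2\<close>; as the
  representing measure is unique, the transform of the product can be computed with \<open>\<nu>\<close>. The theorem
  then is the identity
  \<open>\<parallel>(u+v)h\<parallel>\<^sup>2 + \<parallel>uk\<^sub>1 - vk\<^sub>2\<parallel>\<^sup>2 = \<parallel>us\<^sub>1\<parallel>\<^sup>2 + \<parallel>vs\<^sub>2\<parallel>\<^sup>2\<close>, in which \<open>h\<^sup>2 = k\<^sub>1k\<^sub>2\<close> cancels the cross term.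

  Uniqueness: integrating against the Yeh--Wiener measure all dilations of the equation
  \<open>\<integral> exp(i\<langle>w,y\<rangle>) d\<nu>(w) = \<integral> exp(i\<langle>w,y\<rangle>) d\<nu>'(w)\<close>, shifted by \<open>d\<close>, shows that \<open>\<nu>\<close> and \<open>\<nu>'\<close> agree on all
  Gaussian bumps \<open>exp(- a\<parallel>w - d\<parallel>\<^sup>2)\<close>; products of bumps are multiples of bumps, and indicators of finite
  intersections of balls are bounded limits of combinations of such products.

  The Gaussian law of \<open>\<langle>u,x\<rangle>\<close> is inherited from Riemann sums, because on finite combinations of
  evaluations \<open>x p \<mapsto> indicator [0,p]\<close> extends to an isometry into \<open>L\<^sub>2(Q)\<close>.
\<close>

section \<open>Complex measures\<close>

text \<open>Two obstacles shape the development. The transform of the product is evaluated through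
  \<open>measure_for\<close>, an arbitrary choice among the representing measures, so nothing can be
  computed with \<open>\<nu>\<close> before uniqueness is known. And \<open>pw v x\<close> is a bare
  \<open>lim\<close>: additivity in \<open>v\<close> and homogeneity in \<open>x\<close> are
  available only where the series converge, and the exceptional null set of paths depends on
  \<open>v\<close>. Every identity between integrals over \<open>v\<close> therefore takes almost
  sure convergence for each single \<open>v\<close>, followed by an exchange of the two "almost all"
  quantifiers by Fubini. Convergence is drawn from fourth moments of block sums, for which the
  one-dimensional Gaussian laws suffice.

  As elements of L2(Q) are plain functions, a map into L2(Q) is handled through its coefficients
  \<open>co u j\<close>: measurability, square norms and \<open>pw\<close> are all expressed by
  series in them. Complex measures are traded at once for a complex density against one finite
  positive measure, which opens the way to product measures and dominated convergence.\<close>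

definition signed_measure :: "'a measure \<Rightarrow> ('a set \<Rightarrow> real) \<Rightarrow> bool" where
  "signed_measure M r \<longleftrightarrow> r {} = 0 \<and>
     (\<forall>A. range A \<subseteq> sets M \<and> disjoint_family A \<longrightarrow> (\<lambda>n::nat. r (A n)) sums r (\<Union>n. A n))"

lemma signed_measure_Un:
  assumes r: "signed_measure M r" and A: "A \<in> sets M" "B \<in> sets M" "A \<inter> B = {}"
  shows "r (A \<union> B) = r A + r B"
proof -
  have "range (binaryset A B) \<subseteq> sets M" "disjoint_family (binaryset A B)"
    using A by (auto simp: range_binaryset_eq disjoint_family_on_def binaryset_def)
  then have "(\<lambda>n. r (binaryset A B n)) sums r (A \<union> B)"
    using r by (metis signed_measure_def UN_binaryset_eq)
  moreover have "(\<lambda>n. r (binaryset A B n)) sums (r A + r B)"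
    using r by (intro binaryset_sums) (auto simp: signed_measure_def)
  ultimately show ?thesis by (rule sums_unique2)
qed

lemma signed_measure_Diff:
  assumes r: "signed_measure M r" and A: "A \<in> sets M" "B \<in> sets M" "B \<subseteq> A"
  shows "r (A - B) = r A - r B"
proof -
  have "A = (A - B) \<union> B" using A by auto
  then show ?thesis using signed_measure_Un[OF r, of "A - B" B] A by (metis Diff_disjoint inf_commute sets.Diff add_diff_cancel_right')
qed

lemma signed_measure_minus: "signed_measure M r \<Longrightarrow> signed_measure M (\<lambda>A. - r A)"
  by (auto simp: signed_measure_def sums_minus)

text \<open>A set on whose subsets \<open>r\<close> is unbounded loses a piece of value at least 1
  in modulus and leaves an unbounded remainder. Iteration yields disjoint pieces whose values would
  have to form a convergent series. Boundedness is what gives the real suprema in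
  \<open>upper_variation\<close> their meaning.\<close>

lemma signed_measure_bounded:
  assumes r: "signed_measure M r"
  obtains K where "\<And>B. B \<in> sets M \<Longrightarrow> \<bar>r B\<bar> \<le> K"
proof -
  define bad where "bad A \<longleftrightarrow> A \<in> sets M \<and> (\<forall>K. \<exists>B\<in>sets M. B \<subseteq> A \<and> \<bar>r B\<bar> > K)" for A
  have step: "\<exists>B. bad B \<and> B \<subseteq> A \<and> \<bar>r (A - B)\<bar> \<ge> 1" if A: "bad A" for A
  proof -
    \<comment> \<open>The margin \<open>\<bar>r A\<bar> + 1\<close> makes both \<open>r B\<close>
      and \<open>r (A - B)\<close> exceed 1 in modulus, so it does not matter which of the two parts
      stays unbounded.\<close>
    obtain B where B: "B \<in> sets M" "B \<subseteq> A" "\<bar>r B\<bar> > \<bar>r A\<bar> + 1" using A unfolding bad_def by blast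
    have AM: "A \<in> sets M" using A by (simp add: bad_def)
    have AB: "r (A - B) = r A - r B" by (rule signed_measure_Diff[OF r AM B(1,2)])
    have "bad B \<or> bad (A - B)"
    proof (rule ccontr)
      assume "\<not> ?thesis"
      then obtain K1 K2 where K: "\<And>C. C \<in> sets M \<Longrightarrow> C \<subseteq> B \<Longrightarrow> \<bar>r C\<bar> \<le> K1"
        "\<And>C. C \<in> sets M \<Longrightarrow> C \<subseteq> A - B \<Longrightarrow> \<bar>r C\<bar> \<le> K2"
        using B AM unfolding bad_def by (metis linorder_not_le sets.Diff)
      obtain C where C: "C \<in> sets M" "C \<subseteq> A" "\<bar>r C\<bar> > K1 + K2" using A unfolding bad_def by blast
      have "r C = r (C \<inter> B) + r (C - B)"
        using signed_measure_Un[OF r, of "C \<inter> B" "C - B"] C B by (auto simp: Int_Diff_Un)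
      moreover have "\<bar>r (C \<inter> B)\<bar> \<le> K1" using K(1) C B by auto
      moreover have "\<bar>r (C - B)\<bar> \<le> K2" by (rule K(2)) (use C B in auto)
      ultimately show False using C by linarith
    qed
    then show ?thesis
    proof
      assume "bad B" then show ?thesis using B AB by (intro exI[of _ B]) auto
    next
      assume "bad (A - B)"
      moreover have "A - (A - B) = B" using B by auto
      ultimately show ?thesis using B by (intro exI[of _ "A - B"]) auto
    qed
  qed
  have "\<not> bad (space M)"
  proof
    assume 0: "bad (space M)"
    obtain B where B: "B 0 = space M" "\<And>n. bad (B n)" "\<And>n. B (Suc n) \<subseteq> B n \<and> \<bar>r (B n - B (Suc n))\<bar> \<ge> 1"
      using dependent_nat_choice[of "\<lambda>n A. bad A \<and> (n = 0 \<longrightarrow> A = space M)" "\<lambda>n A B. B \<subseteq> A \<and> \<bar>r (A - B)\<bar> \<ge> 1"]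
        0 step by (metis old.nat.distinct(1))
    define D where "D n = B n - B (Suc n)" for n
    have mono: "B n \<subseteq> B m" if "m \<le> n" for m n using that by (rule lift_Suc_antimono_le[rotated]) (use B in auto)
    have "disjoint_family D"
      unfolding disjoint_family_on_def
    proof (intro ballI impI)
      fix m n :: nat assume "m \<noteq> n"
      then consider "Suc m \<le> n" | "Suc n \<le> m" by linarith
      then show "D m \<inter> D n = {}" using mono[of "Suc m" n] mono[of "Suc n" m] by cases (auto simp: D_def)
    qed
    moreover have "range D \<subseteq> sets M" using B by (auto simp: D_def bad_def)
    ultimately have "(\<lambda>n. r (D n)) sums r (\<Union>n. D n)" using r by (auto simp: signed_measure_def)
    then have "(\<lambda>n. r (D n)) \<longlonglongrightarrow> 0" by (intro summable_LIMSEQ_zero) (rule sums_summable)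
    then have "eventually (\<lambda>n. dist (r (D n)) 0 < 1) sequentially" by (rule tendstoD) simp
    moreover have "\<not> dist (r (D n)) 0 < 1" for n using B(3)[of n] by (simp add: D_def)
    ultimately show False by simp
  qed
  then show ?thesis using that unfolding bad_def by (metis linorder_not_le sets.sets_into_space sets.top)
qed

section \<open>Jordan decomposition of a real set function\<close>

definition upvar :: "'a measure \<Rightarrow> ('a set \<Rightarrow> real) \<Rightarrow> 'a set \<Rightarrow> real" where
  "upvar M r A = (SUP B\<in>{B \<in> sets M. B \<subseteq> A}. r B)"

lemma upvar_upper:
  assumes r: "signed_measure M r" and "B \<in> sets M" "B \<subseteq> A"
  shows "r B \<le> upvar M r A"
proof -
  obtain K where K: "\<And>B. B \<in> sets M \<Longrightarrow> \<bar>r B\<bar> \<le> K" using signed_measure_bounded[OF r] by blast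
  have "bdd_above (r ` {B \<in> sets M. B \<subseteq> A})" by (rule bdd_aboveI[of _ K]) (use K in force)
  then show ?thesis unfolding upvar_def using assms by (intro cSUP_upper) auto
qed

lemma upvar_least:
  assumes "\<And>B. B \<in> sets M \<Longrightarrow> B \<subseteq> A \<Longrightarrow> r B \<le> K"
  shows "upvar M r A \<le> K"
  unfolding upvar_def using assms by (intro cSUP_least) (auto intro!: exI[of _ "{}"])

lemma upvar_nonneg: "signed_measure M r \<Longrightarrow> 0 \<le> upvar M r A"
  using upvar_upper[of M r "{}" A] by (auto simp: signed_measure_def)

lemma upvar_mono: "signed_measure M r \<Longrightarrow> A \<subseteq> B \<Longrightarrow> upvar M r A \<le> upvar M r B"
  by (rule upvar_least) (auto intro: upvar_upper)

lemma upvar_superadd: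
  assumes r: "signed_measure M r" and A: "A \<in> sets M" "B \<in> sets M" "A \<inter> B = {}"
  shows "upvar M r A + upvar M r B \<le> upvar M r (A \<union> B)"
proof -
  have "upvar M r A \<le> upvar M r (A \<union> B) - upvar M r B"
  proof (rule upvar_least)
    fix C assume C: "C \<in> sets M" "C \<subseteq> A"
    have "upvar M r B \<le> upvar M r (A \<union> B) - r C"
    proof (rule upvar_least)
      fix D assume D: "D \<in> sets M" "D \<subseteq> B"
      have "r (C \<union> D) = r C + r D" by (rule signed_measure_Un[OF r]) (use A C D in auto)
      moreover have "r (C \<union> D) \<le> upvar M r (A \<union> B)" by (rule upvar_upper[OF r]) (use A C D in auto)
      ultimately show "r D \<le> upvar M r (A \<union> B) - r C" by simp
    qed
    then show "r C \<le> upvar M r (A \<union> B) - upvar M r B" by simp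
  qed
  then show ?thesis by simp
qed

text \<open>Superadditivity on finite unions bounds the series from above; cutting a competitor
  \<open>B\<close> along the sets \<open>A n\<close> bounds the supremum by the series.\<close>

lemma upvar_sums:
  assumes r: "signed_measure M r" and A: "range A \<subseteq> sets M" "disjoint_family A"
  shows "(\<lambda>n::nat. upvar M r (A n)) sums upvar M r (\<Union>n. A n)"
proof -
  let ?p = "upvar M r"
  have fin: "(\<Sum>n<N. ?p (A n)) \<le> ?p (\<Union>n<N. A n)" for N
  proof (induction N)
    case 0 then show ?case by (simp add: upvar_nonneg[OF r])
  next
    case (Suc N)
    have "?p (\<Union>n<N. A n) + ?p (A N) \<le> ?p ((\<Union>n<N. A n) \<union> A N)"
      proof (intro upvar_superadd[OF r])
      show "(\<Union>n<N. A n) \<inter> A N = {}" using A(2) unfolding disjoint_family_on_def by (metis (lifting) UN_simps(4) UN_E UNIV_I disjoint_iff lessThan_iff less_irrefl)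
    qed (use A in auto)
    moreover have "(\<Union>n<N. A n) \<union> A N = (\<Union>n<Suc N. A n)" by (auto simp: less_Suc_eq)
    ultimately show ?case using Suc by simp
  qed
  have bnd: "(\<Sum>n<N. ?p (A n)) \<le> ?p (\<Union>n. A n)" for N
    using fin[of N] upvar_mono[OF r, of "\<Union>n<N. A n" "\<Union>n. A n"] by fastforce
  have summ: "summable (\<lambda>n. ?p (A n))"
    by (rule summableI_nonneg_bounded[where x="?p (\<Union>n. A n)"]) (use bnd upvar_nonneg[OF r] in auto)
  have "?p (\<Union>n. A n) \<le> (\<Sum>n. ?p (A n))"
  proof (rule upvar_least)
    fix B assume B: "B \<in> sets M" "B \<subseteq> (\<Union>n. A n)"
    have "(\<lambda>n. r (B \<inter> A n)) sums r (\<Union>n. B \<inter> A n)"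
      using r[unfolded signed_measure_def, THEN conjunct2, rule_format, of "\<lambda>n. B \<inter> A n"] A B
      by (fastforce simp: disjoint_family_on_def)
    moreover have "(\<Union>n. B \<inter> A n) = B" using B by auto
    ultimately have s: "(\<lambda>n. r (B \<inter> A n)) sums r B" by simp
    show "r B \<le> (\<Sum>n. ?p (A n))"
      using s summ by (rule sums_le[OF _ _ summable_sums, rotated]) (use A B in \<open>auto intro!: upvar_upper[OF r]\<close>)
  qed
  moreover have "(\<Sum>n. ?p (A n)) \<le> ?p (\<Union>n. A n)" by (rule suminf_le_const[OF summ bnd])
  ultimately show ?thesis using summ by (simp add: sums_iff)
qed

text \<open>The \<open>emeasure\<close> of a \<open>measure_of\<close> is the given set function
  only if that function is countably additive, which \<open>upvar_sums\<close> supplies.\<close>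

lemma
  assumes r: "signed_measure M r"
  shows emeasure_upper_variation: "A \<in> sets M \<Longrightarrow> emeasure (upper_variation M r) A = ennreal (upvar M r A)"
    and sets_upper_variation[measurable_cong, simp]: "sets (upper_variation M r) = sets M"
    and space_upper_variation[simp]: "space (upper_variation M r) = space M"
    and finite_measure_upper_variation: "finite_measure (upper_variation M r)"
proof -
  have eq: "upper_variation M r = measure_of (space M) (sets M) (\<lambda>A. ennreal (upvar M r A))"
    by (simp add: upper_variation_def upvar_def)
  show 1: "sets (upper_variation M r) = sets M" "space (upper_variation M r) = space M"
    by (simp_all add: eq)
  have p0: "upvar M r {} = 0" using r by (intro antisym upvar_least upvar_nonneg) (auto simp: signed_measure_def)
  have ca: "countably_additive (sets M) (\<lambda>A. ennreal (upvar M r A))"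
    unfolding countably_additive_def
  proof (intro allI impI)
    fix A :: "nat \<Rightarrow> 'a set" assume "range A \<subseteq> sets M" "disjoint_family A"
    from upvar_sums[OF r this] show "(\<Sum>i. ennreal (upvar M r (A i))) = ennreal (upvar M r (\<Union> (range A)))"
      by (simp add: sums_iff suminf_ennreal2 upvar_nonneg[OF r])
  qed
  show em: "emeasure (upper_variation M r) A = ennreal (upvar M r A)" if "A \<in> sets M" for A
    unfolding eq using ca that p0
    by (intro emeasure_measure_of_sigma) (auto simp: sets.sigma_algebra_axioms positive_def)
  show "finite_measure (upper_variation M r)"
    by (rule finite_measureI) (use em[of "space M"] 1 in simp)
qed

lemma measure_upper_variation:
  assumes r: "signed_measure M r" and A: "A \<in> sets M"
  shows "measure (upper_variation M r) A = upvar M r A"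
  using emeasure_upper_variation[OF r A] upvar_nonneg[OF r, of A] by (simp add: measure_def)

text \<open>Complements inside \<open>A\<close> exchange the two variations:
  \<open>r B = r A - r (A - B)\<close> turns a supremum of \<open>r\<close> into \<open>r A\<close>
  plus a supremum of \<open>- r\<close>.\<close>

lemma upvar_Jordan:
  assumes r: "signed_measure M r" and A: "A \<in> sets M"
  shows "upvar M r A - upvar M (\<lambda>A. - r A) A = r A"
proof -
  note r' = signed_measure_minus[OF r]
  have "upvar M r A \<le> r A + upvar M (\<lambda>A. - r A) A"
  proof (rule upvar_least)
    fix B assume B: "B \<in> sets M" "B \<subseteq> A"
    show "r B \<le> r A + upvar M (\<lambda>A. - r A) A"
      using upvar_upper[OF r', of "A - B" A] signed_measure_Diff[OF r A B] A B by auto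
  qed
  moreover have "upvar M (\<lambda>A. - r A) A \<le> upvar M r A - r A"
  proof (rule upvar_least)
    fix B assume B: "B \<in> sets M" "B \<subseteq> A"
    show "- r B \<le> upvar M r A - r A"
      using upvar_upper[OF r, of "A - B" A] signed_measure_Diff[OF r A B] A B by auto
  qed
  ultimately show ?thesis by simp
qed

section \<open>Complex measures as complex densities\<close>

lemma add_measure_ex:
  assumes "finite_measure N1" "finite_measure N2" "sets N1 = sets M" "sets N2 = sets M"
  obtains N where "finite_measure N" "sets N = sets M"
    "\<And>A. A \<in> sets M \<Longrightarrow> emeasure N A = emeasure N1 A + emeasure N2 A"
proof -
  interpret N1: finite_measure N1 by fact
  interpret N2: finite_measure N2 by fact
  define N where "N = measure_of (space M) (sets M) (\<lambda>A. emeasure N1 A + emeasure N2 A)"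
  have ca: "countably_additive (sets M) (\<lambda>A. emeasure N1 A + emeasure N2 A)"
    unfolding countably_additive_def
    using assms by (auto simp flip: suminf_add simp: suminf_emeasure)
  have em: "emeasure N A = emeasure N1 A + emeasure N2 A" if "A \<in> sets M" for A
    unfolding N_def using ca that
    by (intro emeasure_measure_of_sigma) (auto simp: sets.sigma_algebra_axioms positive_def)
  show ?thesis
  proof (rule that[OF _ _ em])
    show "finite_measure N"
      by (rule finite_measureI) (use em[of "space M"] in \<open>simp add: N_def\<close>)
  qed (simp_all add: N_def)
qed

text \<open>Radon-Nikodym with a real-valued, integrable density: finiteness of \<open>K\<close>
  makes the extended density finite almost everywhere.\<close>

lemma dominated_density_ex:
  fixes N K :: "'a measure"
  assumes N: "finite_measure N" and K: "finite_measure K" "sets K = sets N"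
    and le: "\<And>A. A \<in> sets N \<Longrightarrow> emeasure K A \<le> emeasure N A"
  obtains d :: "'a \<Rightarrow> real" where "integrable N d"
    "\<And>\<psi> :: 'a \<Rightarrow> complex. \<psi> \<in> borel_measurable N \<Longrightarrow> (\<integral>u. \<psi> u \<partial>K) = (\<integral>u. d u *\<^sub>R \<psi> u \<partial>N)"
proof -
  interpret N: finite_measure N by fact
  interpret K: finite_measure K by fact
  have ac: "absolutely_continuous N K"
    unfolding absolutely_continuous_def using le K(2) by (auto simp: null_sets_def) (metis le_zero_eq)
  from N.Radon_Nikodym[OF ac K(2)] obtain f where f: "f \<in> borel_measurable N" "density N f = K" by blast
  have "(\<integral>\<^sup>+u. f u \<partial>N) = emeasure K (space N)"
    using f by (subst f(2)[symmetric], subst emeasure_density) (auto intro!: nn_integral_cong)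
  then have fin: "(\<integral>\<^sup>+u. f u \<partial>N) < \<infinity>" by (simp add: K.emeasure_finite less_top[symmetric])
  then have ae: "AE u in N. f u \<noteq> \<infinity>" using f by (intro nn_integral_PInf_AE) auto
  define d where "d u = enn2real (f u)" for u
  have dm[measurable]: "d \<in> borel_measurable N" unfolding d_def[abs_def] using f(1) by measurable
  have ae': "AE u in N. f u = ennreal (d u)" using ae by eventually_elim (simp add: d_def less_top)
  then have Kd: "K = density N (\<lambda>u. ennreal (d u))"
    using f by (subst f(2)[symmetric]) (intro density_cong, auto)
  have d0: "d u \<ge> 0" for u by (simp add: d_def)
  have di: "integrable N d"
    using fin nn_integral_cong_AE[OF ae'] d0 by (intro integrableI_nonneg) auto
  show ?thesis
  proof (rule that[OF di])
    fix \<psi> :: "'a \<Rightarrow> complex" assume "\<psi> \<in> borel_measurable N"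
    then show "(\<integral>u. \<psi> u \<partial>K) = (\<integral>u. d u *\<^sub>R \<psi> u \<partial>N)"
      unfolding Kd using d0 by (intro integral_density) auto
  qed
qed

lemma signed_measure_Re_Im:
  assumes "complex_measure M f"
  shows "signed_measure M (\<lambda>A. Re (f A))" "signed_measure M (\<lambda>A. Im (f A))"
  using assms by (auto simp: complex_measure_def signed_measure_def sums_Re sums_Im)

text \<open>All four variations are dominated by their sum \<open>N\<close>, so the four integrals
  of \<open>cm_integral\<close> merge into one integral against a complex density. Fubini and
  dominated convergence are applied in this form.\<close>

lemma cm_integral_density_ex:
  fixes M :: "'a measure"
  assumes f: "complex_measure M f"
  obtains N :: "'a measure" and z :: "'a \<Rightarrow> complex"
  where "finite_measure N" "sets N = sets M" "integrable N z"
    "\<And>\<psi> K. \<psi> \<in> borel_measurable M \<Longrightarrow> (\<And>u. cmod (\<psi> u) \<le> K) \<Longrightarrow> cm_integral M f \<psi> = (\<integral>u. z u * \<psi> u \<partial>N)"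
    "\<And>A. A \<in> sets M \<Longrightarrow> f A = (\<integral>u. z u * indicator A u \<partial>N)"
proof -
  note R = signed_measure_Re_Im(1)[OF f] and I = signed_measure_Re_Im(2)[OF f]
  note R' = signed_measure_minus[OF R] and I' = signed_measure_minus[OF I]
  let ?A = "upper_variation M (\<lambda>A. Re (f A))" and ?B = "upper_variation M (\<lambda>A. - Re (f A))"
  let ?C = "upper_variation M (\<lambda>A. Im (f A))" and ?D = "upper_variation M (\<lambda>A. - Im (f A))"
  note fm = finite_measure_upper_variation
  note sv = sets_upper_variation
  obtain N1 where N1: "finite_measure N1" "sets N1 = sets M"
    "\<And>A. A \<in> sets M \<Longrightarrow> emeasure N1 A = emeasure ?A A + emeasure ?B A"
    using add_measure_ex[OF fm[OF R] fm[OF R'] sv[OF R] sv[OF R']] by blast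
  obtain N2 where N2: "finite_measure N2" "sets N2 = sets M"
    "\<And>A. A \<in> sets M \<Longrightarrow> emeasure N2 A = emeasure ?C A + emeasure ?D A"
    using add_measure_ex[OF fm[OF I] fm[OF I'] sv[OF I] sv[OF I']] by blast
  obtain N where N: "finite_measure N" "sets N = sets M"
    "\<And>A. A \<in> sets M \<Longrightarrow> emeasure N A = emeasure N1 A + emeasure N2 A"
    using add_measure_ex[OF N1(1) N2(1) N1(2) N2(2)] by blast
  interpret N: finite_measure N by fact
  have le: "emeasure ?A A \<le> emeasure N A" "emeasure ?B A \<le> emeasure N A"
    "emeasure ?C A \<le> emeasure N A" "emeasure ?D A \<le> emeasure N A" if "A \<in> sets N" for A
    using that N N1 N2 by (simp_all add: add_increasing add_increasing2)
  obtain a where a: "integrable N a"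
    "\<And>\<psi> :: 'a \<Rightarrow> complex. \<psi> \<in> borel_measurable N \<Longrightarrow> (\<integral>u. \<psi> u \<partial>?A) = (\<integral>u. a u *\<^sub>R \<psi> u \<partial>N)"
    using dominated_density_ex[OF N(1) fm[OF R], OF _ le(1)] sv[OF R] N(2) by metis
  obtain b where b: "integrable N b"
    "\<And>\<psi> :: 'a \<Rightarrow> complex. \<psi> \<in> borel_measurable N \<Longrightarrow> (\<integral>u. \<psi> u \<partial>?B) = (\<integral>u. b u *\<^sub>R \<psi> u \<partial>N)"
    using dominated_density_ex[OF N(1) fm[OF R'], OF _ le(2)] sv[OF R'] N(2) by metis
  obtain c where c: "integrable N c"
    "\<And>\<psi> :: 'a \<Rightarrow> complex. \<psi> \<in> borel_measurable N \<Longrightarrow> (\<integral>u. \<psi> u \<partial>?C) = (\<integral>u. c u *\<^sub>R \<psi> u \<partial>N)"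
    using dominated_density_ex[OF N(1) fm[OF I], OF _ le(3)] sv[OF I] N(2) by metis
  obtain d where d: "integrable N d"
    "\<And>\<psi> :: 'a \<Rightarrow> complex. \<psi> \<in> borel_measurable N \<Longrightarrow> (\<integral>u. \<psi> u \<partial>?D) = (\<integral>u. d u *\<^sub>R \<psi> u \<partial>N)"
    using dominated_density_ex[OF N(1) fm[OF I'], OF _ le(4)] sv[OF I'] N(2) by metis
  define z where "z u = Complex (a u - b u) (c u - d u)" for u
  have zeq: "z u = complex_of_real (a u - b u) + \<i> * complex_of_real (c u - d u)" for u
    by (simp add: z_def complex_eq_iff)
  have zi: "integrable N z"
    unfolding zeq using a(1) b(1) c(1) d(1) by auto
  have main: "cm_integral M f \<psi> = (\<integral>u. z u * \<psi> u \<partial>N)"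
    if \<psi>: "\<psi> \<in> borel_measurable M" "\<And>u. cmod (\<psi> u) \<le> K" for \<psi> K
  proof -
    have m: "\<psi> \<in> borel_measurable N" using \<psi>(1) N(2) by (simp cong: measurable_cong_sets)
    have i: "integrable N (\<lambda>u. e u *\<^sub>R \<psi> u)" if e: "integrable N e" for e :: "'a \<Rightarrow> real"
    proof (rule Bochner_Integration.integrable_bound[where f="\<lambda>u. K * e u"])
      show "AE u in N. norm (e u *\<^sub>R \<psi> u) \<le> norm (K * e u)"
      proof (rule AE_I2)
        fix u
        have "cmod (\<psi> u) * \<bar>e u\<bar> \<le> \<bar>K\<bar> * \<bar>e u\<bar>" using \<psi>(2)[of u] by (intro mult_right_mono) auto
        then show "norm (e u *\<^sub>R \<psi> u) \<le> norm (K * e u)" by (simp add: abs_mult mult.commute)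
      qed
    qed (use e m in auto)
    have "cm_integral M f \<psi> = (\<integral>u. a u *\<^sub>R \<psi> u - b u *\<^sub>R \<psi> u + \<i> * (c u *\<^sub>R \<psi> u - d u *\<^sub>R \<psi> u) \<partial>N)"
      unfolding cm_integral_def a(2)[OF m] b(2)[OF m] c(2)[OF m] d(2)[OF m]
      using i[OF a(1)] i[OF b(1)] i[OF c(1)] i[OF d(1)] by simp
    also have "\<dots> = (\<integral>u. z u * \<psi> u \<partial>N)"
      by (intro Bochner_Integration.integral_cong) (auto simp: zeq scaleR_conv_of_real algebra_simps)
    finally show ?thesis .
  qed
  have ind: "f A = (\<integral>u. z u * indicator A u \<partial>N)" if A: "A \<in> sets M" for A
  proof -
    have i: "(\<integral>u. indicator A u \<partial>upper_variation M r) = complex_of_real (upvar M r A)" if r: "signed_measure M r" for r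
    proof -
      interpret finite_measure "upper_variation M r" by (rule finite_measure_upper_variation[OF r])
      have "(\<integral>u. indicator A u \<partial>upper_variation M r) = (\<integral>u. complex_of_real (indicator A u) \<partial>upper_variation M r)"
        by (intro Bochner_Integration.integral_cong) (auto simp: indicator_def)
      also have "\<dots> = complex_of_real (\<integral>u. indicator A u \<partial>upper_variation M r)"
        by (rule integral_complex_of_real)
      finally show ?thesis using A measure_upper_variation[OF r A] sets_upper_variation[OF r]
        by (simp add: sets.sets_into_space[of A "upper_variation M r"] Int_absorb1)
    qed
    have "cm_integral M f (indicator A) = f A"
      unfolding cm_integral_def i[OF R] i[OF R'] i[OF I] i[OF I']
      by (simp flip: of_real_diff add: upvar_Jordan[OF R A] upvar_Jordan[OF I A] complex_eq_iff)
    moreover have "cm_integral M f (indicator A) = (\<integral>u. z u * indicator A u \<partial>N)"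
      by (rule main[of _ 1]) (use A in \<open>auto simp: indicator_def\<close>)
    ultimately show ?thesis by simp
  qed
  show ?thesis by (rule that[OF N(1,2) zi]) (rule main, assumption, assumption, rule ind)
qed

text \<open>Indicators extend to bounded functions through simple functions of modulus at most twice
  that of \<open>\<psi>\<close>. The maps \<open>\<pi>\<close> and \<open>\<pi>'\<close> let the two
  densities live on different spaces, because later a product measure is compared with a measure on
  L2(Q).\<close>

lemma complex_density_ext:
  fixes z :: "'b \<Rightarrow> complex" and z' :: "'c \<Rightarrow> complex" and \<psi> :: "'a \<Rightarrow> complex"
  assumes z: "integrable N z" and \<pi>[measurable]: "\<pi> \<in> measurable N M"
    and z': "integrable N' z'" and \<pi>'[measurable]: "\<pi>' \<in> measurable N' M"
    and eq: "\<And>A. A \<in> sets M \<Longrightarrow>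
      (\<integral>w. z w * indicator A (\<pi> w) \<partial>N) = (\<integral>w. z' w * indicator A (\<pi>' w) \<partial>N')"
    and \<psi>: "\<psi> \<in> borel_measurable M" and bnd: "\<And>u. cmod (\<psi> u) \<le> K"
  shows "(\<integral>w. z w * \<psi> (\<pi> w) \<partial>N) = (\<integral>w. z' w * \<psi> (\<pi>' w) \<partial>N')"
proof -
  have zm[measurable]: "z \<in> borel_measurable N" "z' \<in> borel_measurable N'" using z z' by auto
  obtain s where s: "\<And>i. simple_function M (s i)" "\<And>x. x \<in> space M \<Longrightarrow> (\<lambda>i. s i x) \<longlonglongrightarrow> \<psi> x"
    "\<And>i x. x \<in> space M \<Longrightarrow> dist (s i x) 0 \<le> 2 * dist (\<psi> x) 0"
    using borel_measurable_implies_sequence_metric[OF \<psi>, of 0] by blast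
  have [measurable]: "s i \<in> borel_measurable M" for i using s(1) by (rule borel_measurable_simple_function)
  have sb: "cmod (s i x) \<le> 2 * K" if "x \<in> space M" for i x
    using s(3)[OF that, of i] bnd[of x] by (simp add: dist_norm)
  have simp_eq: "(\<integral>w. y w * s i (p w) \<partial>L) =
      (\<Sum>c\<in>s i ` space M. c * (\<integral>w. y w * indicator (s i -` {c} \<inter> space M) (p w) \<partial>L))"
    if y: "integrable L y" and p[measurable]: "p \<in> measurable L M" for i and L :: "'d measure" and y :: "'d \<Rightarrow> complex" and p
  proof -
    have ym[measurable]: "y \<in> borel_measurable L" using y by auto
    have ind[measurable]: "s i -` {c} \<inter> space M \<in> sets M" for c using s(1)[of i] by (simp add: simple_functionD)
    have ii: "integrable L (\<lambda>w. y w * indicator (s i -` {c} \<inter> space M) (p w))" for c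
      by (rule Bochner_Integration.integrable_bound[OF y]) (auto simp: indicator_def norm_mult intro!: AE_I2 borel_measurable_times measurable_compose[OF p borel_measurable_indicator])
    have "(\<integral>w. y w * s i (p w) \<partial>L) =
        (\<integral>w. (\<Sum>c\<in>s i ` space M. c * (y w * indicator (s i -` {c} \<inter> space M) (p w))) \<partial>L)"
    proof (rule Bochner_Integration.integral_cong[OF refl])
      fix w assume "w \<in> space L"
      then have "p w \<in> space M" using p by (rule measurable_space[rotated])
      then have "s i (p w) = (\<Sum>c\<in>s i ` space M. indicator (s i -` {c} \<inter> space M) (p w) *\<^sub>R c)"
        using simple_function_indicator_representation_banach[OF s(1)] by blast
      from arg_cong[OF this, of "\<lambda>v. y w * v"]
      show "y w * s i (p w) = (\<Sum>c\<in>s i ` space M. c * (y w * indicator (s i -` {c} \<inter> space M) (p w)))"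
        by (rule trans) (unfold sum_distrib_left, intro sum.cong, auto simp: indicator_def)
    qed
    also have "\<dots> = (\<Sum>c\<in>s i ` space M. c * (\<integral>w. y w * indicator (s i -` {c} \<inter> space M) (p w) \<partial>L))"
      using ii by (subst Bochner_Integration.integral_sum) auto
    finally show ?thesis .
  qed
  have lim: "(\<lambda>i. \<integral>w. y w * s i (p w) \<partial>L) \<longlonglongrightarrow> (\<integral>w. y w * \<psi> (p w) \<partial>L)"
    if y: "integrable L y" and p[measurable]: "p \<in> measurable L M" for L :: "'d measure" and y :: "'d \<Rightarrow> complex" and p
  proof (rule integral_dominated_convergence[where w="\<lambda>w. 2 * K * norm (y w)"])
    have ym[measurable]: "y \<in> borel_measurable L" using y by auto
    show "(\<lambda>w. y w * \<psi> (p w)) \<in> borel_measurable L" "\<And>i. (\<lambda>w. y w * s i (p w)) \<in> borel_measurable L"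
      using \<psi> by auto
    show "AE w in L. (\<lambda>i. y w * s i (p w)) \<longlonglongrightarrow> y w * \<psi> (p w)"
      using s(2) measurable_space[OF p] by (intro AE_I2 tendsto_mult tendsto_const) auto
    show "AE w in L. norm (y w * s i (p w)) \<le> 2 * K * norm (y w)" for i
      using sb measurable_space[OF p] by (intro AE_I2) (auto simp: norm_mult mult.commute intro!: mult_left_mono)
  qed (use y in auto)
  have "(\<integral>w. z w * s i (\<pi> w) \<partial>N) = (\<integral>w. z' w * s i (\<pi>' w) \<partial>N')" for i
    unfolding simp_eq[OF z \<pi>] simp_eq[OF z' \<pi>']
    using s(1)[of i] by (intro sum.cong refl arg_cong2[where f="(*)"] eq) (simp add: simple_functionD)
  then show ?thesis using lim[OF z \<pi>] lim[OF z' \<pi>'] LIMSEQ_unique by auto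
qed

lemma complex_measure_density:
  fixes z :: "'b \<Rightarrow> complex"
  assumes z: "integrable N z" and \<pi>[measurable]: "\<pi> \<in> measurable N M"
  shows "complex_measure M (\<lambda>A. \<integral>w. z w * indicator A (\<pi> w) \<partial>N)"
  unfolding complex_measure_def
proof (intro conjI allI impI)
  have zm[measurable]: "z \<in> borel_measurable N" using z by auto
  fix A :: "nat \<Rightarrow> 'a set" assume A: "range A \<subseteq> sets M \<and> disjoint_family A"
  then have Am[measurable]: "A n \<in> sets M" for n by auto
  have "(\<lambda>n. \<integral>w. z w * indicator (\<Union>i<n. A i) (\<pi> w) \<partial>N) \<longlonglongrightarrow> (\<integral>w. z w * indicator (\<Union>n. A n) (\<pi> w) \<partial>N)"
  proof (rule integral_dominated_convergence[where w="\<lambda>w. norm (z w)"])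
    show "AE w in N. (\<lambda>n. z w * indicator (\<Union>i<n. A i) (\<pi> w)) \<longlonglongrightarrow> z w * indicator (\<Union>n. A n) (\<pi> w)"
      by (intro AE_I2 tendsto_mult tendsto_const LIMSEQ_indicator_UN)
  qed (use z in \<open>auto simp: indicator_def norm_mult intro!: AE_I2 borel_measurable_times measurable_compose[OF \<pi> borel_measurable_indicator]\<close>)
  moreover have "(\<integral>w. z w * indicator (\<Union>i<n. A i) (\<pi> w) \<partial>N) = (\<Sum>i<n. \<integral>w. z w * indicator (A i) (\<pi> w) \<partial>N)" for n
  proof -
    have ii: "integrable N (\<lambda>w. z w * indicator (A i) (\<pi> w))" for i
      by (rule Bochner_Integration.integrable_bound[OF z]) (auto simp: indicator_def norm_mult intro!: AE_I2 borel_measurable_times measurable_compose[OF \<pi> borel_measurable_indicator])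
    have dj: "disjoint_family_on A {..<n}" using A by (auto simp: disjoint_family_on_def)
    have "(indicator (\<Union>i<n. A i) x :: complex) = (\<Sum>i<n. indicator (A i) x)" for x
      using indicator_UN_disjoint[OF _ dj, of x] by simp
    then show ?thesis using ii by (simp only: sum_distrib_left) (rule Bochner_Integration.integral_sum, simp)
  qed
  ultimately show "(\<lambda>n. \<integral>w. z w * indicator (A n) (\<pi> w) \<partial>N) sums (\<integral>w. z w * indicator (\<Union> (range A)) (\<pi> w) \<partial>N)"
    by (simp add: sums_def)
qed simp

text \<open>The variations of the image measure need not be computed: some density for it exists by
  \<open>cm_integral_density_ex\<close>, and \<open>complex_density_ext\<close> compares that
  density with \<open>z\<close>.\<close>

lemma cm_integral_density:
  fixes z :: "'b \<Rightarrow> complex" and M :: "'a measure"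
  assumes z: "integrable N z" and \<pi>: "\<pi> \<in> measurable N M"
    and \<psi>: "\<psi> \<in> borel_measurable M" and bnd: "\<And>u. cmod (\<psi> u) \<le> K"
  shows "cm_integral M (\<lambda>A. \<integral>w. z w * indicator A (\<pi> w) \<partial>N) \<psi> = (\<integral>w. z w * \<psi> (\<pi> w) \<partial>N)"
proof -
  obtain N' :: "'a measure" and z' :: "'a \<Rightarrow> complex" where N: "finite_measure N'" "sets N' = sets M" "integrable N' z'"
    "\<And>\<psi> K. \<psi> \<in> borel_measurable M \<Longrightarrow> (\<And>u. cmod (\<psi> u) \<le> K) \<Longrightarrow>
      cm_integral M (\<lambda>A. \<integral>w. z w * indicator A (\<pi> w) \<partial>N) \<psi> = (\<integral>u. z' u * \<psi> u \<partial>N')"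
    "\<And>A. A \<in> sets M \<Longrightarrow> (\<integral>w. z w * indicator A (\<pi> w) \<partial>N) = (\<integral>u. z' u * indicator A u \<partial>N')"
    using cm_integral_density_ex[OF complex_measure_density[OF z \<pi>]] by blast
  have "(\<lambda>x. x) \<in> measurable N' M" using N(2) by (simp add: measurable_ident_sets)
  from complex_density_ext[OF z \<pi> N(3) this N(5) \<psi> bnd] N(4)[OF \<psi> bnd] show ?thesis by simp
qed

section \<open>The space \<open>L\<^sub>2(Q)\<close>\<close>

locale rectangle =
  fixes S T :: real
  assumes S_pos: "S > 0" and T_pos: "T > 0"
begin

abbreviation "Q \<equiv> Qrect S T"
abbreviation "LQ \<equiv> lebesgue_on (Qrect S T)"
abbreviation "LL \<equiv> L2 S T"
abbreviation "ip \<equiv> inner2 S T"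
abbreviation "nsq u \<equiv> inner2 S T u u"

lemma Q_lmeasurable: "Q \<in> lmeasurable"
  and measure_Q: "measure lebesgue Q = S * T"
proof -
  have Q: "Q = cbox (0, 0) (S, T)" by (auto simp: Qrect_def)
  show "Q \<in> lmeasurable" unfolding Q by simp
  have "measure lebesgue (cbox (0::real \<times> real) (S, T)) = S * T"
    using S_pos T_pos by (simp add: measure_completion content_Pair zero_prod_def)
  then show "measure lebesgue Q = S * T" unfolding Q by (simp add: zero_prod_def)
qed

lemma finite_measure_LQ: "finite_measure LQ"
proof (rule finite_measureI)
  have "emeasure LQ (space LQ) = emeasure lebesgue Q"
    using fmeasurableD[OF Q_lmeasurable] by (subst emeasure_restrict_space) (auto simp: space_restrict_space)
  then show "emeasure LQ (space LQ) \<noteq> \<infinity>" using fmeasurableD2[OF Q_lmeasurable] by simp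
qed

sublocale LQ: finite_measure LQ by (rule finite_measure_LQ)

lemma L2_measurable: "u \<in> LL \<Longrightarrow> u \<in> borel_measurable LQ"
  and L2_square: "u \<in> LL \<Longrightarrow> integrable LQ (\<lambda>p. (u p)\<^sup>2)"
  unfolding L2_def by blast+

lemma L2_prod:
  assumes "u \<in> LL" "v \<in> LL" shows "integrable LQ (\<lambda>p. u p * v p)"
proof (rule Bochner_Integration.integrable_bound)
  show "integrable LQ (\<lambda>p. (u p)\<^sup>2 + (v p)\<^sup>2)" using assms by (auto intro: L2_square)
  show "AE p in LQ. norm (u p * v p) \<le> norm ((u p)\<^sup>2 + (v p)\<^sup>2)"
  proof (rule AE_I2)
    fix p
    have "0 \<le> (\<bar>u p\<bar> - \<bar>v p\<bar>)\<^sup>2" by simp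
    then have "2 * \<bar>u p * v p\<bar> \<le> (u p)\<^sup>2 + (v p)\<^sup>2" by (simp add: power2_diff abs_mult)
    moreover have "0 \<le> \<bar>u p * v p\<bar>" by simp
    ultimately show "norm (u p * v p) \<le> norm ((u p)\<^sup>2 + (v p)\<^sup>2)" by simp
  qed
qed (intro borel_measurable_times L2_measurable assms)

lemma L2_scale: "u \<in> LL \<Longrightarrow> (\<lambda>p. c * u p) \<in> LL"
  by (auto simp: L2_def power_mult_distrib)

lemma L2_add: assumes "u \<in> LL" "v \<in> LL" shows "(\<lambda>p. u p + v p) \<in> LL"
proof -
  have "integrable LQ (\<lambda>p. (u p)\<^sup>2 + (v p)\<^sup>2 + 2 * (u p * v p))"
    using assms by (intro Bochner_Integration.integrable_add integrable_mult_right L2_prod L2_square)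
  then have "integrable LQ (\<lambda>p. (u p + v p)\<^sup>2)" by (simp add: power2_sum mult.assoc)
  then show ?thesis using assms by (auto simp: L2_def)
qed

lemma L2_diff: assumes "u \<in> LL" "v \<in> LL" shows "(\<lambda>p. u p - v p) \<in> LL"
  using L2_add[OF assms(1) L2_scale[OF assms(2), of "-1"]] by simp

lemma L2_zero: "(\<lambda>p. 0) \<in> LL" by (simp add: L2_def)

lemma L2_sum: "(\<And>i. i \<in> I \<Longrightarrow> u i \<in> LL) \<Longrightarrow> (\<lambda>p. \<Sum>i\<in>I. u i p) \<in> LL"
  by (induction I rule: infinite_finite_induct) (auto intro: L2_zero L2_add)

lemma L2_bounded:
  assumes "u \<in> borel_measurable LQ" "\<And>p. p \<in> Q \<Longrightarrow> \<bar>u p\<bar> \<le> K"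
  shows "u \<in> LL"
proof -
  have "integrable LQ (\<lambda>p. (u p)\<^sup>2)"
  proof (rule LQ.integrable_const_bound[where B="K\<^sup>2"])
    show "AE p in LQ. norm ((u p)\<^sup>2) \<le> K\<^sup>2"
    proof (rule AE_I2)
      fix p assume "p \<in> space LQ"
      then have "\<bar>u p\<bar> \<le> K" using assms by simp
      then have "\<bar>u p\<bar>\<^sup>2 \<le> K\<^sup>2" by (rule power_mono) simp
      then show "norm ((u p)\<^sup>2) \<le> K\<^sup>2" by simp
    qed
  qed (use assms in auto)
  then show ?thesis using assms by (simp add: L2_def)
qed

lemma L2_mult_bounded:
  assumes u: "u \<in> LL" and h: "h \<in> borel_measurable LQ" "\<And>p. p \<in> Q \<Longrightarrow> \<bar>h p\<bar> \<le> K"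
  shows "(\<lambda>p. u p * h p) \<in> LL"
proof -
  have "integrable LQ (\<lambda>p. (u p * h p)\<^sup>2)"
  proof (rule Bochner_Integration.integrable_bound)
    show "integrable LQ (\<lambda>p. K\<^sup>2 * (u p)\<^sup>2)" using u by (auto intro: L2_square)
    show "AE p in LQ. norm ((u p * h p)\<^sup>2) \<le> norm (K\<^sup>2 * (u p)\<^sup>2)"
    proof (rule AE_I2)
      fix p assume "p \<in> space LQ"
      then have "\<bar>h p\<bar> \<le> K" using h by simp
      then have "\<bar>h p\<bar>\<^sup>2 \<le> K\<^sup>2" by (rule power_mono) simp
      then have "(h p)\<^sup>2 * (u p)\<^sup>2 \<le> K\<^sup>2 * (u p)\<^sup>2" by (intro mult_right_mono) auto
      then show "norm ((u p * h p)\<^sup>2) \<le> norm (K\<^sup>2 * (u p)\<^sup>2)" by (simp add: power_mult_distrib mult.commute)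
    qed
  qed (use u h in \<open>auto dest: L2_measurable\<close>)
  then show ?thesis using u h by (auto simp: L2_def)
qed

lemma ip_commute: "ip u v = ip v u" by (simp add: inner2_def mult.commute)

lemma ip_add_left: "u \<in> LL \<Longrightarrow> v \<in> LL \<Longrightarrow> w \<in> LL \<Longrightarrow> ip (\<lambda>p. u p + v p) w = ip u w + ip v w"
  unfolding inner2_def by (simp add: distrib_right L2_prod)

lemma ip_diff_left: "u \<in> LL \<Longrightarrow> v \<in> LL \<Longrightarrow> w \<in> LL \<Longrightarrow> ip (\<lambda>p. u p - v p) w = ip u w - ip v w"
  unfolding inner2_def by (simp add: left_diff_distrib L2_prod)

lemma ip_scale_left: "ip (\<lambda>p. c * u p) w = c * ip u w"
  unfolding inner2_def by (simp add: mult.assoc)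

lemma ip_zero_left: "ip (\<lambda>p. 0) w = 0" by (simp add: inner2_def)

lemma ip_sum_left:
  "(\<And>i. i \<in> I \<Longrightarrow> u i \<in> LL) \<Longrightarrow> w \<in> LL \<Longrightarrow> ip (\<lambda>p. \<Sum>i\<in>I. u i p) w = (\<Sum>i\<in>I. ip (u i) w)"
  by (induction I rule: infinite_finite_induct) (auto simp: ip_zero_left ip_add_left L2_sum)

lemma nsq_nonneg: "0 \<le> nsq u" by (simp add: inner2_def)

lemma nsq_add: "u \<in> LL \<Longrightarrow> v \<in> LL \<Longrightarrow> nsq (\<lambda>p. u p + v p) = nsq u + 2 * ip u v + nsq v"
  using ip_add_left[of u v "\<lambda>p. u p + v p"] ip_add_left[of u v u] ip_add_left[of u v v]
    ip_commute[of u "\<lambda>p. u p + v p"] ip_commute[of v "\<lambda>p. u p + v p"] ip_commute[of v u]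
  by (simp only: L2_add)

lemma nsq_scale: "nsq (\<lambda>p. c * u p) = c\<^sup>2 * nsq u"
  unfolding inner2_def by (simp add: power2_eq_square mult.left_commute mult.assoc flip: integral_mult_right_zero)

lemma nsq_diff: "u \<in> LL \<Longrightarrow> v \<in> LL \<Longrightarrow> nsq (\<lambda>p. u p - v p) = nsq u - 2 * ip u v + nsq v"
  using nsq_add[of u "\<lambda>p. (-1) * v p"] L2_scale[of v "-1"] nsq_scale[of "-1" v] ip_scale_left[of "-1" v u]
    ip_commute[of u v] ip_commute[of u "\<lambda>p. (-1) * v p"]
  by simp

lemma nsq_diff_commute: "nsq (\<lambda>p. u p - v p) = nsq (\<lambda>p. v p - u p)"
  unfolding inner2_def by (intro Bochner_Integration.integral_cong) (auto simp: algebra_simps)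

lemma nsq_add_le: "u \<in> LL \<Longrightarrow> v \<in> LL \<Longrightarrow> nsq (\<lambda>p. u p + v p) \<le> 2 * nsq u + 2 * nsq v"
  using nsq_add[of u v] nsq_diff[of u v] nsq_nonneg[of "\<lambda>p. u p - v p"] by simp

lemma nsq_triangle: 
  assumes "u \<in> LL" "v \<in> LL" "w \<in> LL"
  shows "nsq (\<lambda>p. u p - w p) \<le> 2 * nsq (\<lambda>p. u p - v p) + 2 * nsq (\<lambda>p. v p - w p)"
  using nsq_add_le[of "\<lambda>p. u p - v p" "\<lambda>p. v p - w p"] assms by (simp add: L2_diff)

lemma Cauchy_Schwarz_sq:
  assumes u: "u \<in> LL" and v: "v \<in> LL" shows "(ip u v)\<^sup>2 \<le> nsq u * nsq v"
proof -
  have q: "0 \<le> nsq u + 2 * t * ip u v + t\<^sup>2 * nsq v" for t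
    using nsq_add[OF u L2_scale[OF v, of t]] nsq_nonneg[of "\<lambda>p. u p + t * v p"]
      ip_commute[of u "\<lambda>p. t * v p"] ip_commute[of u v] by (simp add: nsq_scale ip_scale_left)
  show ?thesis
  proof (cases "nsq v = 0")
    case True
    have "ip u v = 0"
    proof (rule ccontr)
      assume "ip u v \<noteq> 0"
      \<comment> \<open>This value of \<open>t\<close> turns the quadratic, linear here because
        \<open>nsq v = 0\<close>, into \<open>- 1\<close>.\<close>
      then show False using q[of "- (nsq u + 1) / (2 * ip u v)"] True by (simp add: field_simps)
    qed
    then show ?thesis using True by simp
  next
    case False
    then have "nsq v > 0" using nsq_nonneg[of v] by simp
    then show ?thesis using q[of "- ip u v / nsq v"] by (simp add: field_simps power2_eq_square)
  qed
qed

lemma norm2_sq: "(norm2 S T u)\<^sup>2 = nsq u"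
  by (simp add: norm2_def nsq_nonneg)

lemma Cauchy_Schwarz_abs: "u \<in> LL \<Longrightarrow> v \<in> LL \<Longrightarrow> \<bar>ip u v\<bar> \<le> norm2 S T u * norm2 S T v"
proof -
  assume "u \<in> LL" "v \<in> LL"
  from Cauchy_Schwarz_sq[OF this] have "\<bar>ip u v\<bar>\<^sup>2 \<le> (norm2 S T u * norm2 S T v)\<^sup>2"
    by (simp add: power_mult_distrib norm2_sq)
  moreover have "0 \<le> norm2 S T u * norm2 S T v" by (simp add: norm2_def nsq_nonneg)
  ultimately show ?thesis by (rule power2_le_imp_le)
qed

text \<open>A rapidly Cauchy subsequence converges a.e.; Fatou's lemma turns this into convergence in mean square.\<close>

lemma Riesz_Fischer:
  assumes s: "\<And>n::nat. s n \<in> LL"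
    and C: "\<And>e. e > 0 \<Longrightarrow> \<exists>N. \<forall>m\<ge>N. \<forall>n\<ge>N. nsq (\<lambda>p. s m p - s n p) < e"
  obtains u where "u \<in> LL" "(\<lambda>n. nsq (\<lambda>p. s n p - u p)) \<longlonglongrightarrow> 0"
proof -
  have [measurable]: "s n \<in> borel_measurable LQ" for n by (rule L2_measurable[OF s])
  have "\<exists>N. \<forall>m\<ge>N. \<forall>n\<ge>N. nsq (\<lambda>p. s m p - s n p) < (1/4)^k" for k :: nat by (rule C) simp
  then obtain N where N: "\<And>k m n. m \<ge> N k \<Longrightarrow> n \<ge> N k \<Longrightarrow> nsq (\<lambda>p. s m p - s n p) < (1/4)^k"
    by metis
  \<comment> \<open>Strictly increasing and at least \<open>N k\<close>, so consecutive terms of the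
    subsequence have squared distance below \<open>(1/4)^k\<close>.\<close>
  define r where "r k = (\<Sum>i\<le>k. N i) + k" for k
  have rN: "N k \<le> r k" for k unfolding r_def by (rule trans_le_add1) (simp add: member_le_sum)
  have rmono: "strict_mono r" by (rule strict_monoI_Suc) (simp add: r_def)
  define d where "d k p = s (r (Suc k)) p - s (r k) p" for k p
  have dL: "d k \<in> LL" for k unfolding d_def[abs_def] by (intro L2_diff s)
  have [measurable]: "d k \<in> borel_measurable LQ" for k by (rule L2_measurable[OF dL])
  have nd: "nsq (d k) < (1/4)^k" for k
    unfolding d_def[abs_def] using rN[of k] rmono by (intro N) (auto intro: order_trans[OF _ less_imp_le] simp: strict_mono_def)
  have bnd: "(\<integral>\<^sup>+p. ennreal \<bar>d k p\<bar> \<partial>LQ) \<le> ennreal ((S * T + 1) * (1/2)^k)" for k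
  proof -
    have i1: "integrable LQ (\<lambda>p. (1/2)^k + 2^k * (d k p)\<^sup>2)" using L2_square[OF dL] by simp
    have "(\<integral>\<^sup>+p. ennreal \<bar>d k p\<bar> \<partial>LQ) \<le> (\<integral>\<^sup>+p. ennreal ((1/2)^k + 2^k * (d k p)\<^sup>2) \<partial>LQ)"
    proof (intro nn_integral_mono ennreal_leI)
      fix p
      \<comment> \<open>Yields \<open>2 * \<bar>d\<bar> \<le> (1/2)^k + 2^k * d^2\<close>; the
        weight \<open>2^k\<close> is the one for which both summands integrate to order
        \<open>(1/2)^k\<close>, the second because \<open>nsq (d k) < (1/4)^k\<close>.\<close>
      have "0 \<le> (1 - 2^k * \<bar>d k p\<bar>)\<^sup>2" by simp
      then have "2 * (2^k * \<bar>d k p\<bar>) \<le> 1 + (2^k)\<^sup>2 * (d k p)\<^sup>2" by (simp add: power2_diff power_mult_distrib)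
      then have "(1/2)^k * (2 * (2^k * \<bar>d k p\<bar>)) \<le> (1/2)^k * (1 + (2^k)\<^sup>2 * (d k p)\<^sup>2)" by (intro mult_left_mono) auto
      then have "2 * \<bar>d k p\<bar> \<le> (1/2)^k + 2^k * (d k p)\<^sup>2" by (simp add: field_simps power2_eq_square)
      then show "\<bar>d k p\<bar> \<le> (1/2)^k + 2^k * (d k p)\<^sup>2" by simp
    qed
    also have "\<dots> = ennreal (\<integral>p. (1/2)^k + 2^k * (d k p)\<^sup>2 \<partial>LQ)"
      using i1 by (intro nn_integral_eq_integral) auto
    also have "(\<integral>p. (1/2)^k + 2^k * (d k p)\<^sup>2 \<partial>LQ) = S * T * (1/2)^k + 2^k * nsq (d k)"
      using L2_square[OF dL] Q_lmeasurable measure_Q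
      by (simp add: inner2_def power2_eq_square measure_restrict_space fmeasurableD)
    also have "ennreal \<dots> \<le> ennreal ((S * T + 1) * (1/2)^k)"
    proof (rule ennreal_leI)
      have "2^k * nsq (d k) \<le> 2^k * (1/4)^k" using nd[of k] by (intro mult_left_mono) auto
      also have "\<dots> = (1/2)^k" by (simp flip: power_mult_distrib)
      finally show "S * T * (1/2)^k + 2^k * nsq (d k) \<le> (S * T + 1) * (1/2)^k" by (simp add: algebra_simps)
    qed
    finally show ?thesis .
  qed
  have "(\<integral>\<^sup>+p. (\<Sum>k. ennreal \<bar>d k p\<bar>) \<partial>LQ) = (\<Sum>k. \<integral>\<^sup>+p. ennreal \<bar>d k p\<bar> \<partial>LQ)"
    by (rule nn_integral_suminf) simp
  also have "\<dots> \<le> (\<Sum>k. ennreal ((S * T + 1) * (1/2)^k))" by (intro suminf_le bnd) auto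
  also have "\<dots> < \<infinity>"
    using S_pos T_pos by (subst suminf_ennreal2) (auto intro!: summable_mult summable_geometric)
  finally have "AE p in LQ. (\<Sum>k. ennreal \<bar>d k p\<bar>) \<noteq> \<infinity>" by (intro nn_integral_PInf_AE) auto
  then have conv: "AE p in LQ. (\<lambda>k. s (r k) p) \<longlonglongrightarrow> lim (\<lambda>k. s (r k) p)"
  proof eventually_elim
    case (elim p)
    then have "summable (\<lambda>k. \<bar>d k p\<bar>)" by (intro summable_suminf_not_top) auto
    then have "summable (\<lambda>k. d k p)" by (rule summable_rabs_cancel)
    then have "convergent (\<lambda>n. \<Sum>k<n. d k p)" by (simp add: summable_iff_convergent)
    moreover have "(\<Sum>k<n. d k p) = s (r n) p - s (r 0) p" for n
      unfolding d_def by (rule sum_lessThan_telescope)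
    ultimately have "convergent (\<lambda>n. s (r n) p - s (r 0) p)" by simp
    then have "convergent (\<lambda>n. (s (r n) p - s (r 0) p) + s (r 0) p)" by (intro convergent_add convergent_const)
    then show ?case by (simp add: convergent_LIMSEQ_iff)
  qed
  define u where "u p = lim (\<lambda>k. s (r k) p)" for p
  have um[measurable]: "u \<in> borel_measurable LQ" unfolding u_def by measurable
  have key: "integrable LQ (\<lambda>p. (s m p - u p)\<^sup>2) \<and> nsq (\<lambda>p. s m p - u p) \<le> e"
    if e: "e > 0" and M: "\<forall>m\<ge>M. \<forall>n\<ge>M. nsq (\<lambda>p. s m p - s n p) < e" and m: "m \<ge> M" for e m M
  proof -
    have "(\<integral>\<^sup>+p. ennreal ((s m p - u p)\<^sup>2) \<partial>LQ) = (\<integral>\<^sup>+p. liminf (\<lambda>k. ennreal ((s m p - s (r k) p)\<^sup>2)) \<partial>LQ)"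
    proof (rule nn_integral_cong_AE)
      show "AE p in LQ. ennreal ((s m p - u p)\<^sup>2) = liminf (\<lambda>k. ennreal ((s m p - s (r k) p)\<^sup>2))"
        using conv
      proof eventually_elim
        case (elim p)
        then have "(\<lambda>k. ennreal ((s m p - s (r k) p)\<^sup>2)) \<longlonglongrightarrow> ennreal ((s m p - u p)\<^sup>2)"
          unfolding u_def by (intro tendsto_intros)
        then show ?case by (intro lim_imp_Liminf[symmetric]) auto
      qed
    qed
    also have "\<dots> \<le> liminf (\<lambda>k. \<integral>\<^sup>+p. ennreal ((s m p - s (r k) p)\<^sup>2) \<partial>LQ)"
      by (rule nn_integral_liminf) simp
    also have "\<dots> \<le> liminf (\<lambda>k::nat. ennreal e)"
    proof (rule Liminf_mono)
      show "\<forall>\<^sub>F k in sequentially. (\<integral>\<^sup>+p. ennreal ((s m p - s (r k) p)\<^sup>2) \<partial>LQ) \<le> ennreal e"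
        using eventually_ge_at_top[of M]
      proof eventually_elim
        case (elim k)
        then have "r k \<ge> M" using strict_mono_imp_increasing[OF rmono, of k] by linarith
        then have "nsq (\<lambda>p. s m p - s (r k) p) < e" using M m by blast
        moreover have "(\<integral>\<^sup>+p. ennreal ((s m p - s (r k) p)\<^sup>2) \<partial>LQ) = ennreal (nsq (\<lambda>p. s m p - s (r k) p))"
          unfolding inner2_def power2_eq_square[symmetric] by (intro nn_integral_eq_integral L2_square L2_diff s) auto
        ultimately show ?case by (simp add: ennreal_leI)
      qed
    qed
    also have "\<dots> = ennreal e" by (simp add: Liminf_const)
    finally have le: "(\<integral>\<^sup>+p. ennreal ((s m p - u p)\<^sup>2) \<partial>LQ) \<le> ennreal e" .
    then have i: "integrable LQ (\<lambda>p. (s m p - u p)\<^sup>2)"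
      by (intro integrableI_nonneg) (auto intro: le_less_trans)
    then have "ennreal (nsq (\<lambda>p. s m p - u p)) \<le> ennreal e"
      using le unfolding inner2_def power2_eq_square[symmetric] by (subst (asm) nn_integral_eq_integral) auto
    then show ?thesis using i e by simp
  qed
  obtain M1 where M1: "\<forall>m\<ge>M1. \<forall>n\<ge>M1. nsq (\<lambda>p. s m p - s n p) < 1" using C[of 1] by auto
  have "(\<lambda>p. s M1 p - u p) \<in> LL" using key[OF _ M1, of M1] by (auto simp: L2_def)
  then have "(\<lambda>p. s M1 p - (s M1 p - u p)) \<in> LL" by (rule L2_diff[OF s])
  then have uL: "u \<in> LL" by simp
  show ?thesis
  proof (rule that[OF uL], rule LIMSEQ_I)
    fix e :: real assume e: "e > 0"
    then obtain M where M: "\<forall>m\<ge>M. \<forall>n\<ge>M. nsq (\<lambda>p. s m p - s n p) < e / 2" using C[of "e/2"] by auto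
    show "\<exists>no. \<forall>n\<ge>no. norm (nsq (\<lambda>p. s n p - u p) - 0) < e"
      using key[OF _ M] e nsq_nonneg by (intro exI[of _ M]) fastforce
  qed
qed

end

section \<open>Orthonormal expansions and separability\<close>

locale rectangle_basis = rectangle +
  fixes \<phi> :: "nat \<Rightarrow> sheet"
  assumes basis: "bv_complete_orthonormal S T \<phi>"
begin

abbreviation "co u j \<equiv> inner2 S T u (\<phi> j)"

lemma phi_L2: "\<phi> n \<in> LL" and phi_bv: "bv_hk S T (\<phi> n)"
  and phi_orth: "ip (\<phi> m) (\<phi> n) = (if m = n then 1 else 0)"
  and phi_complete: "u \<in> LL \<Longrightarrow> (\<And>n. co u n = 0) \<Longrightarrow> AE p in LQ. u p = 0"
  using basis by (auto simp: bv_complete_orthonormal_def)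

lemma comb_L2: "(\<lambda>p. \<Sum>j\<in>J. c j * \<phi> j p) \<in> LL"
  by (intro L2_sum L2_scale phi_L2)

lemma ip_comb: "w \<in> LL \<Longrightarrow> ip (\<lambda>p. \<Sum>j\<in>J. c j * \<phi> j p) w = (\<Sum>j\<in>J. c j * co w j)"
  by (subst ip_sum_left) (auto simp: L2_scale phi_L2 ip_scale_left ip_commute)

lemma co_comb: "finite J \<Longrightarrow> co (\<lambda>p. \<Sum>j\<in>J. c j * \<phi> j p) k = (if k \<in> J then c k else 0)"
  by (subst ip_comb) (simp_all add: phi_L2 phi_orth if_distrib[of "\<lambda>x. _ * x"] sum.delta cong: if_cong)

lemma nsq_comb: "finite J \<Longrightarrow> nsq (\<lambda>p. \<Sum>j\<in>J. c j * \<phi> j p) = (\<Sum>j\<in>J. (c j)\<^sup>2)"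
  by (subst ip_comb) (auto simp: comb_L2 co_comb power2_eq_square intro!: sum.cong)

lemma nsq_minus_partial:
  assumes u: "u \<in> LL"
  shows "nsq (\<lambda>p. u p - (\<Sum>j<n. co u j * \<phi> j p)) = nsq u - (\<Sum>j<n. (co u j)\<^sup>2)"
  by (subst nsq_diff) (auto simp: u comb_L2 nsq_comb ip_commute[of u "\<lambda>p. \<Sum>j<n. co u j * \<phi> j p"] ip_comb power2_eq_square)

text \<open>Completeness of the basis only says that a function orthogonal to all
  \<open>\<phi> n\<close> vanishes almost everywhere. Hence the partial sums are first given a limit
  \<open>v\<close> by Riesz-Fischer; \<open>v\<close> has the coefficients of \<open>u\<close>, so
  it equals \<open>u\<close> almost everywhere, and the remainder
  \<open>nsq u - (\<Sum>j<n. (co u j)\<^sup>2)\<close> tends to 0.\<close>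

lemma Parseval:
  assumes u: "u \<in> LL" shows "(\<lambda>j. (co u j)\<^sup>2) sums nsq u"
proof -
  define s where "s n p = (\<Sum>j<n. co u j * \<phi> j p)" for n :: nat and p
  have sL: "s n \<in> LL" for n unfolding s_def[abs_def] by (rule comb_L2)
  have Bessel: "(\<Sum>j<n. (co u j)\<^sup>2) \<le> nsq u" for n
    using nsq_minus_partial[OF u, of n] nsq_nonneg[of "\<lambda>p. u p - (\<Sum>j<n. co u j * \<phi> j p)"] by simp
  have summ: "summable (\<lambda>j. (co u j)\<^sup>2)"
    by (rule summableI_nonneg_bounded[where x="nsq u"]) (use Bessel in auto)
  have sd: "nsq (\<lambda>p. s n p - s m p) = (\<Sum>j=m..<n. (co u j)\<^sup>2)" if "m \<le> n" for m n
  proof -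
    have "s n p - s m p = (\<Sum>j=m..<n. co u j * \<phi> j p)" for p
    proof -
      have "{..<n} = {..<m} \<union> {m..<n}" using that by auto
      then show ?thesis unfolding s_def by (simp add: sum.union_disjoint ivl_disj_int)
    qed
    then show ?thesis by (simp add: nsq_comb)
  qed
  have "\<exists>N. \<forall>m\<ge>N. \<forall>n\<ge>N. nsq (\<lambda>p. s m p - s n p) < e" if e: "e > 0" for e
  proof -
    obtain N where N: "\<And>m n. m \<ge> N \<Longrightarrow> norm (\<Sum>j=m..<n. (co u j)\<^sup>2) < e"
      using summ e unfolding summable_Cauchy by blast
    have "nsq (\<lambda>p. s m p - s n p) < e" if mn: "m \<ge> N" "n \<ge> N" for m n
    proof (cases "m \<le> n")
      case True
      then show ?thesis using sd[OF True] N[OF mn(1), of n] nsq_diff_commute[of "s m" "s n"] by simp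
    next
      case False
      then show ?thesis using sd[of n m] N[OF mn(2), of m] by simp
    qed
    then show ?thesis by blast
  qed
  then obtain v where v: "v \<in> LL" "(\<lambda>n. nsq (\<lambda>p. s n p - v p)) \<longlonglongrightarrow> 0"
    by (rule Riesz_Fischer[OF sL])
  have cov: "co v k = co u k" for k
  proof -
    have "(\<lambda>n. ip (\<lambda>p. s n p - v p) (\<phi> k)) \<longlonglongrightarrow> 0"
    proof (rule tendsto_rabs_zero_cancel, rule tendsto_sandwich[of "\<lambda>n. 0" _ _ "\<lambda>n. sqrt (nsq (\<lambda>p. s n p - v p))"])
      show "\<forall>\<^sub>F n in sequentially. \<bar>ip (\<lambda>p. s n p - v p) (\<phi> k)\<bar> \<le> sqrt (nsq (\<lambda>p. s n p - v p))"
        using Cauchy_Schwarz_abs[OF L2_diff[OF sL v(1)] phi_L2, of _ k]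
        by (intro always_eventually) (simp add: norm2_def phi_orth)
      show "(\<lambda>n. sqrt (nsq (\<lambda>p. s n p - v p))) \<longlonglongrightarrow> 0" using tendsto_real_sqrt[OF v(2)] by simp
    qed auto
    moreover have "\<forall>\<^sub>F n in sequentially. ip (\<lambda>p. s n p - v p) (\<phi> k) = co u k - co v k"
      using eventually_gt_at_top[of k]
    proof eventually_elim
      case (elim n)
      then show ?case using co_comb[of "{..<n}" "co u" k]
        by (subst ip_diff_left[OF sL v(1) phi_L2]) (simp add: s_def[abs_def])
    qed
    ultimately have "(\<lambda>n. co u k - co v k) \<longlonglongrightarrow> 0" by (rule Lim_transform_eventually)
    then show ?thesis by (simp add: tendsto_const_iff)
  qed
  have "AE p in LQ. u p - v p = 0"
    by (rule phi_complete) (simp_all add: L2_diff u v ip_diff_left phi_L2 cov)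
  then have ae: "AE p in LQ. u p = v p" by simp
  have "nsq (\<lambda>p. s n p - v p) = nsq u - (\<Sum>j<n. (co u j)\<^sup>2)" for n
  proof -
    have "nsq (\<lambda>p. s n p - v p) = nsq (\<lambda>p. u p - s n p)"
      unfolding inner2_def by (rule integral_cong_AE) (use ae u v sL[of n] in \<open>auto dest!: L2_measurable simp: algebra_simps\<close>)
    then show ?thesis using nsq_minus_partial[OF u, of n] by (simp add: s_def)
  qed
  then have "(\<lambda>n. nsq u - (nsq u - (\<Sum>j<n. (co u j)\<^sup>2))) \<longlonglongrightarrow> nsq u - 0"
    using v(2) by (intro tendsto_diff tendsto_const) simp
  then show ?thesis by (simp add: sums_def)
qed

text \<open>Indexed by lists of rationals, so that the countability of this dense family is a matter
  of its type.\<close>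

definition rat_comb :: "rat list \<Rightarrow> sheet" where
  "rat_comb l = (\<lambda>p. \<Sum>j<length l. real_of_rat (l ! j) * \<phi> j p)"

lemma rat_comb_L2: "rat_comb l \<in> LL"
  unfolding rat_comb_def by (rule comb_L2)

lemma rat_comb_dense:
  assumes u: "u \<in> LL" and e: "e > 0"
  obtains l where "nsq (\<lambda>p. u p - rat_comb l p) < e"
proof -
  have "(\<lambda>n. nsq u - (\<Sum>j<n. (co u j)\<^sup>2)) \<longlonglongrightarrow> nsq u - nsq u"
    using Parseval[OF u] by (intro tendsto_diff tendsto_const) (simp add: sums_def)
  then have "\<forall>\<^sub>F n in sequentially. nsq u - (\<Sum>j<n. (co u j)\<^sup>2) < e / 4"
    using e by (intro order_tendstoD(2)[of _ 0]) auto
  then obtain n where n: "nsq u - (\<Sum>j<n. (co u j)\<^sup>2) < e / 4" by (auto simp: eventually_sequentially)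
  \<comment> \<open>At most \<open>n\<close> coefficient errors below \<open>\<delta>\<close> have
    squares adding up to at most \<open>e / 4\<close>. Together with the truncation error below
    \<open>e / 4\<close> and the factor 2 in \<open>nsq_triangle\<close> this stays below
    \<open>e\<close>.\<close>
  define \<delta> where "\<delta> = sqrt (e / (4 * (real n + 1)))"
  have \<delta>: "\<delta> > 0" using e by (simp add: \<delta>_def)
  have "\<exists>q. \<bar>co u j - real_of_rat q\<bar> < \<delta>" for j
  proof -
    obtain q where "co u j - \<delta> < real_of_rat q" "real_of_rat q < co u j"
      using of_rat_dense[of "co u j - \<delta>" "co u j"] \<delta> by auto
    then show ?thesis by (intro exI[of _ q]) auto
  qed
  then obtain q where q: "\<And>j. \<bar>co u j - real_of_rat (q j)\<bar> < \<delta>" by metis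
  define l where "l = map q [0..<n]"
  have "nsq (\<lambda>p. (\<Sum>j<n. co u j * \<phi> j p) - rat_comb l p) = nsq (\<lambda>p. \<Sum>j<n. (co u j - real_of_rat (q j)) * \<phi> j p)"
    by (simp add: rat_comb_def l_def sum_subtractf left_diff_distrib)
  also have "\<dots> = (\<Sum>j<n. (co u j - real_of_rat (q j))\<^sup>2)" by (simp add: nsq_comb)
  also have "\<dots> \<le> (\<Sum>j<n. \<delta>\<^sup>2)"
    using q \<delta> by (intro sum_mono) (metis abs_le_square_iff abs_of_pos less_imp_le)
  also have "\<dots> \<le> e / 4" using e by (simp add: \<delta>_def field_simps)
  finally have 1: "nsq (\<lambda>p. (\<Sum>j<n. co u j * \<phi> j p) - rat_comb l p) \<le> e / 4" .
  have "nsq (\<lambda>p. u p - rat_comb l p) < e"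
    using nsq_triangle[OF u comb_L2[where J="{..<n}" and c="co u"] rat_comb_L2[of l]] 1 n nsq_minus_partial[OF u, of n] by simp
  then show ?thesis by (rule that)
qed

section \<open>Borel sets of L2(Q) by balls and by coefficients\<close>

definition closed_ball :: "sheet \<Rightarrow> real \<Rightarrow> sheet set" where
  "closed_ball d r = {u \<in> LL. nsq (\<lambda>p. u p - d p) \<le> r}"

text \<open>Separability in the form used below: the union runs over a countable index type, so a
  sigma-algebra containing balls around the dense family contains the open sets.\<close>

lemma L2_open_eq_balls:
  assumes U: "L2_open S T U"
  shows "U = (\<Union>(l, q)\<in>{(l, q). closed_ball (rat_comb l) (real_of_rat q) \<subseteq> U}. closed_ball (rat_comb l) (real_of_rat q))"
proof (intro equalityI subsetI)
  fix u assume u: "u \<in> U"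
  then have uL: "u \<in> LL" using U by (auto simp: L2_open_def)
  obtain e where e: "e > 0" "\<And>v. v \<in> LL \<Longrightarrow> norm2 S T (\<lambda>p. u p - v p) < e \<Longrightarrow> v \<in> U"
    using U u by (auto simp: L2_open_def)
  \<comment> \<open>\<open>nsq_triangle\<close> doubles each leg, so two legs of at most
    \<open>e^2 / 8\<close> give at most \<open>e^2 / 2\<close>, below the required
    \<open>e^2\<close>.\<close>
  obtain l where l: "nsq (\<lambda>p. u p - rat_comb l p) < e\<^sup>2 / 8"
    using rat_comb_dense[OF uL, of "e\<^sup>2/8"] e(1) by auto
  obtain q where q: "nsq (\<lambda>p. u p - rat_comb l p) < real_of_rat q" "real_of_rat q < e\<^sup>2 / 8"
    using of_rat_dense[OF l] by auto
  have "closed_ball (rat_comb l) (real_of_rat q) \<subseteq> U"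
  proof
    fix v assume v: "v \<in> closed_ball (rat_comb l) (real_of_rat q)"
    then have vL: "v \<in> LL" by (simp add: closed_ball_def)
    have "nsq (\<lambda>p. u p - v p) < e\<^sup>2"
      using nsq_triangle[OF uL rat_comb_L2 vL, of l] v q nsq_diff_commute[of v "rat_comb l"] e(1) zero_less_power[OF e(1), of 2]
      unfolding closed_ball_def mem_Collect_eq by linarith
    then have "norm2 S T (\<lambda>p. u p - v p) < e"
      using e(1) by (simp add: norm2_def real_sqrt_less_iff real_less_lsqrt nsq_nonneg)
    then show "v \<in> U" using e(2) vL by blast
  qed
  then show "u \<in> (\<Union>(l, q)\<in>{(l, q). closed_ball (rat_comb l) (real_of_rat q) \<subseteq> U}. closed_ball (rat_comb l) (real_of_rat q))"
    using q uL by (auto simp: closed_ball_def intro!: exI[of _ l] exI[of _ q])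
qed auto

lemma space_L2_borel[simp]: "space (L2_borel S T) = LL"
  by (auto simp: L2_borel_def L2_open_def intro!: space_measure_of)

lemma sets_L2_borel: "sets (L2_borel S T) = sigma_sets LL {U. L2_open S T U}"
  unfolding L2_borel_def by (rule sets_measure_of) (auto simp: L2_open_def)

text \<open>By Parseval the squared distance to a fixed centre is a series in the coefficients.
  Measurable coefficients thus make preimages of balls measurable, and preimages of open sets with
  them.\<close>

lemma L2_borel_measurableI:
  assumes g: "\<And>w. w \<in> space M \<Longrightarrow> g w \<in> LL"
    and m[measurable]: "\<And>j. (\<lambda>w. co (g w) j) \<in> borel_measurable M"
  shows "g \<in> measurable M (L2_borel S T)"
  unfolding L2_borel_def
proof (rule measurable_measure_of)
  show "{U. L2_open S T U} \<subseteq> Pow LL" by (auto simp: L2_open_def)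
  show "g \<in> space M \<rightarrow> LL" using g by auto
  fix U assume "U \<in> {U. L2_open S T U}"
  then have U: "L2_open S T U" by simp
  have ball: "g -` closed_ball d r \<inter> space M \<in> sets M" if d: "d \<in> LL" for d r
  proof -
    have eq: "nsq (\<lambda>p. g w p - d p) = (\<Sum>j. (co (g w) j - co d j)\<^sup>2)" if "w \<in> space M" for w
      using Parseval[OF L2_diff[OF g[OF that] d]] g[OF that] d by (simp add: sums_iff ip_diff_left phi_L2)
    have "g -` closed_ball d r \<inter> space M = {w \<in> space M. (\<Sum>j. (co (g w) j - co d j)\<^sup>2) \<le> r}"
      using g eq by (auto simp: closed_ball_def)
    then show ?thesis by simp
  qed
  have "g -` U \<inter> space M = (\<Union>(l, q)\<in>{(l, q). closed_ball (rat_comb l) (real_of_rat q) \<subseteq> U}.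
      g -` closed_ball (rat_comb l) (real_of_rat q) \<inter> space M)"
    by (subst L2_open_eq_balls[OF U]) auto
  also have "\<dots> \<in> sets M"
    using ball[OF rat_comb_L2] by (intro sets.countable_UN' countableI_type) auto
  finally show "g -` U \<inter> space M \<in> sets M" .
qed

lemma ip_measurable:
  assumes w: "w \<in> LL" shows "(\<lambda>u. ip u w) \<in> borel_measurable (L2_borel S T)"
proof (rule borel_measurableI)
  fix A :: "real set" assume A: "open A"
  have "L2_open S T ((\<lambda>u. ip u w) -` A \<inter> LL)"
    unfolding L2_open_def
  proof (intro conjI ballI)
    fix u assume u: "u \<in> (\<lambda>u. ip u w) -` A \<inter> LL"
    then obtain e where e: "e > 0" "\<And>y. \<bar>y - ip u w\<bar> < e \<Longrightarrow> y \<in> A"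
      using A by (force simp: open_real)
    \<comment> \<open>The summand 1 permits division by \<open>K\<close> when \<open>w\<close> has
      norm 0.\<close>
    define K where "K = norm2 S T w + 1"
    have K: "K > 0" "norm2 S T w \<le> K" by (auto simp: K_def norm2_def nsq_nonneg add_nonneg_pos)
    show "\<exists>e>0. \<forall>v\<in>LL. norm2 S T (\<lambda>p. u p - v p) < e \<longrightarrow> v \<in> (\<lambda>u. ip u w) -` A \<inter> LL"
    proof (intro exI[of _ "e / K"] conjI ballI impI)
      fix v assume v: "v \<in> LL" "norm2 S T (\<lambda>p. u p - v p) < e / K"
      have "\<bar>ip u w - ip v w\<bar> \<le> norm2 S T (\<lambda>p. u p - v p) * norm2 S T w"
        using u v w Cauchy_Schwarz_abs[OF L2_diff, of u v w] by (auto simp: ip_diff_left)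
      also have "\<dots> \<le> norm2 S T (\<lambda>p. u p - v p) * K" using K by (intro mult_left_mono) (auto simp: norm2_def nsq_nonneg)
      also have "\<dots> < e" using v K by (simp add: pos_less_divide_eq)
      finally show "v \<in> (\<lambda>u. ip u w) -` A \<inter> LL" using e v by (auto simp: abs_minus_commute)
    qed (use e K in auto)
  qed auto
  then show "(\<lambda>u. ip u w) -` A \<inter> space (L2_borel S T) \<in> sets (L2_borel S T)"
    unfolding sets_L2_borel by (auto intro: sigma_sets.Basic)
qed

lemma nsq_measurable:
  assumes g: "\<And>w. w \<in> space M \<Longrightarrow> g w \<in> LL"
    and m[measurable]: "\<And>j. (\<lambda>w. co (g w) j) \<in> borel_measurable M"
  shows "(\<lambda>w. nsq (g w)) \<in> borel_measurable M"
proof -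
  have "(\<lambda>w. \<Sum>j. (co (g w) j)\<^sup>2) \<in> borel_measurable M" by measurable
  then show ?thesis by (rule measurable_cong[THEN iffD1, rotated]) (use Parseval[OF g] in \<open>simp add: sums_iff\<close>)
qed

text \<open>An intersection-stable generator, for the induction over complements and disjoint unions
  in the uniqueness proof. The factor \<open>LL\<close> gives the empty intersection its proper
  value.\<close>

definition ball_algebra :: "sheet set set" where
  "ball_algebra = {LL \<inter> \<Inter>((\<lambda>(d, r). closed_ball d r) ` I) | I. finite I \<and> I \<subseteq> LL \<times> UNIV}"

lemma Int_stable_ball_algebra: "Int_stable ball_algebra"
proof (rule Int_stableI)
  fix a b assume "a \<in> ball_algebra" "b \<in> ball_algebra"
  then obtain I J where "finite I" "I \<subseteq> LL \<times> UNIV" "a = LL \<inter> \<Inter>((\<lambda>(d, r). closed_ball d r) ` I)"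
    "finite J" "J \<subseteq> LL \<times> UNIV" "b = LL \<inter> \<Inter>((\<lambda>(d, r). closed_ball d r) ` J)"
    unfolding ball_algebra_def by blast
  then show "a \<inter> b \<in> ball_algebra" unfolding ball_algebra_def by (intro CollectI exI[of _ "I \<union> J"]) auto
qed

lemma closed_ball_sets:
  assumes d: "d \<in> LL" shows "closed_ball d r \<in> sets (L2_borel S T)"
proof -
  have "(\<lambda>u. nsq (\<lambda>p. u p - d p)) \<in> borel_measurable (L2_borel S T)"
  proof (rule nsq_measurable)
    fix j
    have "(\<lambda>u. co u j - co d j) \<in> borel_measurable (L2_borel S T)"
      using ip_measurable[OF phi_L2] by measurable
    then show "(\<lambda>u. co (\<lambda>p. u p - d p) j) \<in> borel_measurable (L2_borel S T)"
      by (rule measurable_cong[THEN iffD1, rotated]) (simp add: ip_diff_left d phi_L2)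
  qed (simp add: L2_diff d)
  then have "{u \<in> space (L2_borel S T). nsq (\<lambda>p. u p - d p) \<le> r} \<in> sets (L2_borel S T)" by measurable
  then show ?thesis by (simp add: closed_ball_def)
qed

lemma sets_L2_borel_balls: "sets (L2_borel S T) = sigma_sets LL ball_algebra"
proof
  have b: "closed_ball (rat_comb l) r \<in> sigma_sets LL ball_algebra" for l r
    by (rule sigma_sets.Basic, unfold ball_algebra_def)
      (auto intro!: exI[of _ "{(rat_comb l, r)}"] simp: rat_comb_L2 closed_ball_def)
  interpret sigma_algebra LL "sigma_sets LL ball_algebra"
    by (rule sigma_algebra_sigma_sets) (auto simp: ball_algebra_def)
  show "sets (L2_borel S T) \<subseteq> sigma_sets LL ball_algebra"
    unfolding sets_L2_borel
  proof (rule sigma_sets_mono, clarify)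
    fix U assume "L2_open S T U"
    note U = L2_open_eq_balls[OF this]
    show "U \<in> sigma_sets LL ball_algebra"
      by (subst U, rule countable_UN') (auto intro: b)
  qed
  show "sigma_sets LL ball_algebra \<subseteq> sets (L2_borel S T)"
  proof -
    have "ball_algebra \<subseteq> sets (L2_borel S T)"
    proof
      fix a assume "a \<in> ball_algebra"
      then obtain I where I: "finite I" "I \<subseteq> LL \<times> UNIV" "a = LL \<inter> \<Inter>((\<lambda>(d, r). closed_ball d r) ` I)"
        unfolding ball_algebra_def by blast
      have "LL \<inter> \<Inter>((\<lambda>(d, r). closed_ball d r) ` I) \<in> sets (L2_borel S T)"
        using I(1,2)
      proof (induction I)
        case empty then show ?case using sets.top[of "L2_borel S T"] by simp
      next
        case (insert x F)
        obtain d r where x: "x = (d, r)" by (cases x)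
        have "LL \<inter> \<Inter>((\<lambda>(d, r). closed_ball d r) ` insert x F) = closed_ball d r \<inter> (LL \<inter> \<Inter>((\<lambda>(d, r). closed_ball d r) ` F))"
          by (auto simp: x)
        then show ?case using insert closed_ball_sets[of d r] by (auto simp: x)
      qed
      then show "a \<in> sets (L2_borel S T)" using I by simp
    qed
    then show ?thesis using sets.sigma_sets_subset[of ball_algebra "L2_borel S T"] by simp
  qed
qed

end

section \<open>Functions of bounded variation\<close>

lemma grid_mono: "grid a b n s \<Longrightarrow> i \<le> j \<Longrightarrow> j \<le> n \<Longrightarrow> s i \<le> s j"
proof (induction j)
  case (Suc j)
  then show ?case by (cases "i = Suc j") (auto simp: grid_def intro: order_trans[of _ "s j"])
qed simp

lemma grid_bounds: assumes "grid a b n s" "i \<le> n" shows "a \<le> s i" "s i \<le> b"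
  using grid_mono[OF assms(1), of 0 i] grid_mono[OF assms(1), of i n] assms by (auto simp: grid_def)

text \<open>Serves to put finitely many arbitrary heights on one common grid, on which the bound on
  the Vitali sums applies to all of them at once. The grid is the sorted list of \<open>P\<close>
  with the two endpoints.\<close>

lemma grid_through:
  fixes a b :: real
  assumes P: "finite P" "P \<subseteq> {a..b}" and "a \<le> b"
  obtains n t where "grid a b n t" "\<And>p. p \<in> P \<Longrightarrow> \<exists>k\<le>n. t k = p"
proof -
  define P' where "P' = insert a (insert b P)"
  define L where "L = sorted_list_of_set P'"
  have fin: "finite P'" and ne: "P' \<noteq> {}" using P by (auto simp: P'_def)
  have set: "set L = P'" and srt: "sorted L" using fin by (auto simp: L_def)
  have Lne: "L \<noteq> []" using set ne by auto
  have hd: "L ! 0 = a"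
  proof -
    obtain k where k: "k < length L" "L ! k = a" using set by (metis P'_def in_set_conv_nth insertI1)
    have "L ! 0 \<le> a" using sorted_nth_mono[OF srt, of 0 k] k by auto
    moreover have "L ! 0 \<in> P'" using set Lne by (metis length_greater_0_conv nth_mem)
    ultimately show ?thesis using P \<open>a \<le> b\<close> by (auto simp: P'_def)
  qed
  have last: "L ! (length L - 1) = b"
  proof -
    obtain k where k: "k < length L" "L ! k = b" using set by (metis P'_def in_set_conv_nth insertI1 insertI2)
    have "b \<le> L ! (length L - 1)" using sorted_nth_mono[OF srt, of k "length L - 1"] k by auto
    moreover have "L ! (length L - 1) \<in> P'" using set Lne by (metis diff_less length_greater_0_conv nth_mem zero_less_one)
    ultimately show ?thesis using P \<open>a \<le> b\<close> by (auto simp: P'_def)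
  qed
  have "grid a b (length L - 1) (\<lambda>j. L ! j)"
    unfolding grid_def using hd last by (intro conjI allI impI sorted_nth_mono[OF srt]) auto
  moreover have "\<exists>k\<le>length L - 1. L ! k = p" if "p \<in> P" for p
  proof -
    have "p \<in> set L" unfolding set P'_def using that by simp
    then obtain k where "k < length L" "L ! k = p" unfolding in_set_conv_nth by blast
    then have "k \<le> length L - 1 \<and> L ! k = p" by linarith
    then show ?thesis by blast
  qed
  ultimately show ?thesis by (rule that)
qed

lemma grid_extend:
  assumes "grid a s m \<sigma>" "s \<le> s'"
  shows "grid a s' (Suc m) (\<sigma>(Suc m := s'))"
  using assms by (auto simp: grid_def less_Suc_eq)

text \<open>The increments of \<open>h\<close> in its first variable are dominated by those of the supremum of
  \<open>\<Sum>i. \<bar>h (s (i+1), \<tau> i) - h (s i, \<tau> i)\<bar>\<close> over grids of \<open>[0, s]\<close> and arbitrary heights \<open>\<tau>\<close>.\<close>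

lemma bv_dominated_half:
  assumes S: "0 \<le> S" and T: "0 \<le> T"
    and K1: "\<And>m n s t. grid 0 S m s \<Longrightarrow> grid 0 T n t \<Longrightarrow> (\<Sum>i<m. \<Sum>j<n. \<bar>rect_incr h s t i j\<bar>) \<le> K1"
    and K2: "\<And>m s. grid 0 S m s \<Longrightarrow> (\<Sum>i<m. \<bar>h (s (Suc i), 0) - h (s i, 0)\<bar>) \<le> K2"
  obtains A where "\<And>s s' t. 0 \<le> s \<Longrightarrow> s \<le> s' \<Longrightarrow> s' \<le> S \<Longrightarrow> 0 \<le> t \<Longrightarrow> t \<le> T \<Longrightarrow> \<bar>h (s', t) - h (s, t)\<bar> \<le> A s' - A s"
proof -
  define vs where "vs m \<sigma> \<tau> = (\<Sum>i<m. \<bar>h (\<sigma> (Suc i), \<tau> i) - h (\<sigma> i, \<tau> i)\<bar>)" for m :: nat and \<sigma> \<tau>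
  define V where "V s = {vs m \<sigma> \<tau> | m \<sigma> \<tau>. grid 0 s m \<sigma> \<and> (\<forall>i<m. 0 \<le> \<tau> i \<and> \<tau> i \<le> T)}" for s
  define A where "A s = Sup (V s)" for s
  have bnd: "c \<le> K2 + K1" if s: "s \<le> S" and c: "c \<in> V s" for s c
  proof -
    obtain m \<sigma> \<tau> where g: "grid 0 s m \<sigma>" "\<forall>i<m. 0 \<le> \<tau> i \<and> \<tau> i \<le> T" and c: "c = vs m \<sigma> \<tau>"
      using c unfolding V_def by blast
    \<comment> \<open>A last cell up to \<open>S\<close> turns a grid of \<open>[0, s]\<close> into
      one of \<open>[0, S]\<close>, the only interval for which \<open>K1\<close> and
      \<open>K2\<close> are stated.\<close>
    define \<sigma>' where "\<sigma>' = \<sigma>(Suc m := S)"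
    have g': "grid 0 S (Suc m) \<sigma>'" unfolding \<sigma>'_def using g(1) s by (rule grid_extend)
    obtain n t where t: "grid 0 T n t" "\<And>p. p \<in> \<tau> ` {..<m} \<Longrightarrow> \<exists>k\<le>n. t k = p"
    proof (rule grid_through[of "\<tau> ` {..<m}" 0 T])
      show "\<tau> ` {..<m} \<subseteq> {0..T}" using g(2) by auto
    qed (use T in auto)
    \<comment> \<open>The difference at height \<open>\<tau> i\<close> is the difference on the axis
      plus the telescoping rectangle increments of the strip below that height. Each rectangle is
      counted for one index \<open>i\<close> only, so the sum over \<open>i\<close> is at most
      \<open>K2 + K1\<close>.\<close>
    have one: "\<bar>h (\<sigma> (Suc i), \<tau> i) - h (\<sigma> i, \<tau> i)\<bar> \<le> \<bar>h (\<sigma>' (Suc i), 0) - h (\<sigma>' i, 0)\<bar> + (\<Sum>j<n. \<bar>rect_incr h \<sigma>' t i j\<bar>)"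
      if i: "i < m" for i
    proof -
      obtain k where k: "k \<le> n" "t k = \<tau> i" using t(2) i by blast
      have t0: "t 0 = 0" using t(1) by (simp add: grid_def)
      have "(\<Sum>j<k. rect_incr h \<sigma>' t i j) = (\<Sum>j<k. (h (\<sigma>' (Suc i), t (Suc j)) - h (\<sigma>' i, t (Suc j))) - (h (\<sigma>' (Suc i), t j) - h (\<sigma>' i, t j)))"
        by (simp add: rect_incr_def algebra_simps)
      also have "\<dots> = (h (\<sigma>' (Suc i), t k) - h (\<sigma>' i, t k)) - (h (\<sigma>' (Suc i), t 0) - h (\<sigma>' i, t 0))"
        by (rule sum_lessThan_telescope)
      finally have "h (\<sigma>' (Suc i), \<tau> i) - h (\<sigma>' i, \<tau> i) = (h (\<sigma>' (Suc i), 0) - h (\<sigma>' i, 0)) + (\<Sum>j<k. rect_incr h \<sigma>' t i j)"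
        using k t0 by simp
      moreover have "\<bar>\<Sum>j<k. rect_incr h \<sigma>' t i j\<bar> \<le> (\<Sum>j<n. \<bar>rect_incr h \<sigma>' t i j\<bar>)"
        using k by (intro order_trans[OF sum_abs] sum_mono2) auto
      moreover have "\<sigma>' (Suc i) = \<sigma> (Suc i)" "\<sigma>' i = \<sigma> i" using i by (auto simp: \<sigma>'_def)
      ultimately show ?thesis by simp
    qed
    have "c \<le> (\<Sum>i<m. \<bar>h (\<sigma>' (Suc i), 0) - h (\<sigma>' i, 0)\<bar> + (\<Sum>j<n. \<bar>rect_incr h \<sigma>' t i j\<bar>))"
      unfolding c vs_def using one by (intro sum_mono) auto
    also have "\<dots> \<le> (\<Sum>i<Suc m. \<bar>h (\<sigma>' (Suc i), 0) - h (\<sigma>' i, 0)\<bar> + (\<Sum>j<n. \<bar>rect_incr h \<sigma>' t i j\<bar>))"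
      by (intro sum_mono2) (auto intro!: add_nonneg_nonneg sum_nonneg)
    also have "\<dots> \<le> K2 + K1" unfolding sum.distrib by (intro add_mono K1[OF g' t(1)] K2[OF g'])
    finally show ?thesis .
  qed
  \<comment> \<open>A grid of \<open>[0, s]\<close> prolonged by the cell from \<open>s\<close> to
    \<open>s'\<close> at height \<open>t\<close> competes in the supremum for \<open>s'\<close>;
    this makes \<open>A\<close> grow by at least the increment of \<open>h\<close>.\<close>
  have ext: "c + \<bar>h (s', t) - h (s, t)\<bar> \<in> V s'" if cV: "c \<in> V s" and "s \<le> s'" "0 \<le> t" "t \<le> T" for c s s' t
  proof -
    obtain m \<sigma> \<tau> where g: "grid 0 s m \<sigma>" "\<forall>i<m. 0 \<le> \<tau> i \<and> \<tau> i \<le> T" and c: "c = vs m \<sigma> \<tau>"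
      using cV unfolding V_def by blast
    have "vs (Suc m) (\<sigma>(Suc m := s')) (\<tau>(m := t)) = c + \<bar>h (s', t) - h (s, t)\<bar>"
      using g(1) unfolding vs_def c by (auto simp: grid_def intro!: sum.cong)
    moreover have "grid 0 s' (Suc m) (\<sigma>(Suc m := s'))" using g(1) that by (intro grid_extend)
    moreover have "\<forall>i<Suc m. 0 \<le> (\<tau>(m := t)) i \<and> (\<tau>(m := t)) i \<le> T" using g(2) that by (auto simp: less_Suc_eq)
    ultimately show ?thesis unfolding V_def mem_Collect_eq
      by (intro exI[of _ "Suc m"] exI[of _ "\<sigma>(Suc m := s')"] exI[of _ "\<tau>(m := t)"]) simp
  qed
  have ne: "V s \<noteq> {}" if "0 \<le> s" for s
  proof -
    have "grid 0 s 1 (\<lambda>i. if i = 0 then 0 else s)" using that by (auto simp: grid_def)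
    then have "vs 1 (\<lambda>i. if i = 0 then 0 else s) (\<lambda>i. 0) \<in> V s" unfolding V_def using T by blast
    then show ?thesis by auto
  qed
  show ?thesis
  proof (rule that[of A])
    fix s s' t :: real assume st: "0 \<le> s" "s \<le> s'" "s' \<le> S" "0 \<le> t" "t \<le> T"
    have "A s \<le> A s' - \<bar>h (s', t) - h (s, t)\<bar>"
      unfolding A_def
    proof (rule cSup_least[OF ne[OF st(1)]])
      fix c assume "c \<in> V s"
      from ext[OF this st(2,4,5)] bnd[OF st(3)] have "c + \<bar>h (s', t) - h (s, t)\<bar> \<le> Sup (V s')"
        by (intro cSup_upper bdd_aboveI) auto
      then show "c \<le> Sup (V s') - \<bar>h (s', t) - h (s, t)\<bar>" by simp
    qed
    then show "\<bar>h (s', t) - h (s, t)\<bar> \<le> A s' - A s" by simp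
  qed
qed

text \<open>The form in which bounded variation enters the step approximations: one monotone
  function per direction, dominating the increments uniformly in the other variable.\<close>

definition dominated_increments :: "real \<Rightarrow> real \<Rightarrow> sheet \<Rightarrow> (real \<Rightarrow> real) \<Rightarrow> (real \<Rightarrow> real) \<Rightarrow> bool" where
  "dominated_increments S T h A B \<longleftrightarrow>
     (\<forall>s s' t. 0 \<le> s \<and> s \<le> s' \<and> s' \<le> S \<and> 0 \<le> t \<and> t \<le> T \<longrightarrow> \<bar>h (s', t) - h (s, t)\<bar> \<le> A s' - A s) \<and>
     (\<forall>s t t'. 0 \<le> s \<and> s \<le> S \<and> 0 \<le> t \<and> t \<le> t' \<and> t' \<le> T \<longrightarrow> \<bar>h (s, t') - h (s, t)\<bar> \<le> B t' - B t)"

lemma bv_hk_dominated: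
  assumes S: "0 \<le> S" and T: "0 \<le> T" and h: "bv_hk S T h"
  obtains A B where "dominated_increments S T h A B"
proof -
  obtain K1 where K1: "\<And>m n s t. grid 0 S m s \<Longrightarrow> grid 0 T n t \<Longrightarrow> (\<Sum>i<m. \<Sum>j<n. \<bar>rect_incr h s t i j\<bar>) \<le> K1"
    using h unfolding bv_hk_def by blast
  obtain K2 where K2: "\<And>m s. grid 0 S m s \<Longrightarrow> (\<Sum>i<m. \<bar>h (s (Suc i), 0) - h (s i, 0)\<bar>) \<le> K2"
    using h unfolding bv_hk_def bv1_def by blast
  obtain K3 where K3: "\<And>m s. grid 0 T m s \<Longrightarrow> (\<Sum>i<m. \<bar>h (0, s (Suc i)) - h (0, s i)\<bar>) \<le> K3"
    using h unfolding bv_hk_def bv1_def by blast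
  define h' where "h' p = h (snd p, fst p)" for p :: "real \<times> real"
  have K1': "(\<Sum>i<m. \<Sum>j<n. \<bar>rect_incr h' s t i j\<bar>) \<le> K1" if "grid 0 T m s" "grid 0 S n t" for m n s t
  proof -
    have "rect_incr h' s t i j = rect_incr h t s j i" for i j by (simp add: rect_incr_def h'_def)
    then have "(\<Sum>i<m. \<Sum>j<n. \<bar>rect_incr h' s t i j\<bar>) = (\<Sum>j<n. \<Sum>i<m. \<bar>rect_incr h t s j i\<bar>)"
      by (subst sum.swap) simp
    then show ?thesis using K1[OF that(2,1)] by simp
  qed
  have K3': "(\<Sum>i<m. \<bar>h' (s (Suc i), 0) - h' (s i, 0)\<bar>) \<le> K3" if "grid 0 T m s" for m s
    using K3[OF that] by (simp add: h'_def)
  obtain A where A: "\<And>s s' t. 0 \<le> s \<Longrightarrow> s \<le> s' \<Longrightarrow> s' \<le> S \<Longrightarrow> 0 \<le> t \<Longrightarrow> t \<le> T \<Longrightarrow> \<bar>h (s', t) - h (s, t)\<bar> \<le> A s' - A s"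
    using bv_dominated_half[OF S T K1 K2] by blast
  obtain B where B: "\<And>s s' t. 0 \<le> s \<Longrightarrow> s \<le> s' \<Longrightarrow> s' \<le> T \<Longrightarrow> 0 \<le> t \<Longrightarrow> t \<le> S \<Longrightarrow> \<bar>h' (s', t) - h' (s, t)\<bar> \<le> B s' - B s"
    using bv_dominated_half[OF T S K1' K3'] by blast
  show ?thesis
    by (rule that[of A B]) (use A B in \<open>auto simp: dominated_increments_def h'_def\<close>)
qed

lemma dominated_increments_mono:
  assumes "dominated_increments S T h A B" "0 \<le> S" "0 \<le> T"
  shows "0 \<le> s \<Longrightarrow> s \<le> s' \<Longrightarrow> s' \<le> S \<Longrightarrow> A s \<le> A s'"
    and "0 \<le> t \<Longrightarrow> t \<le> t' \<Longrightarrow> t' \<le> T \<Longrightarrow> B t \<le> B t'"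
  using assms unfolding dominated_increments_def by (meson abs_ge_zero diff_ge_0_iff_ge order_refl order_trans)+

section \<open>Step functions\<close>

text \<open>Open on the left, so that the cells of a grid are disjoint and cover
  \<open>(0, b]\<close>; the axes, which are missed, form a null set. With this convention a cell is
  exactly a difference of two intervals \<open>[0, c]\<close>.\<close>

definition cell :: "(nat \<Rightarrow> real) \<Rightarrow> nat \<Rightarrow> real \<Rightarrow> real" where
  "cell s i x = indicator {s i<..s (Suc i)} x"

lemma cell_measurable[measurable]: "cell s i \<in> borel_measurable borel"
  unfolding cell_def[abs_def] by simp

lemma cell_select:
  assumes g: "grid 0 b m s" and x: "0 < x" "x \<le> b"
  obtains k where "k < m" "s k < x" "x \<le> s (Suc k)" "\<And>c. (\<Sum>i<m. c i * cell s i x) = c k"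
proof -
  \<comment> \<open>Grid points may repeat; the least index with \<open>x \<le> s (Suc i)\<close> is
    the one for which also \<open>s k < x\<close>.\<close>
  define k where "k = (LEAST i. x \<le> s (Suc i))"
  have m0: "m \<noteq> 0"
  proof
    assume "m = 0"
    with g x show False by (simp add: grid_def)
  qed
  then obtain m' where m': "m = Suc m'" by (cases m) auto
  have "x \<le> s (Suc m')" using g x m' by (auto simp: grid_def)
  then have kP: "x \<le> s (Suc k)" and km: "k \<le> m'" unfolding k_def by (auto intro: LeastI Least_le)
  have sk: "s k < x"
  proof (cases k)
    case 0 then show ?thesis using g x by (simp add: grid_def)
  next
    case (Suc k')
    then have "\<not> x \<le> s (Suc k')" using not_less_Least[of k' "\<lambda>i. x \<le> s (Suc i)"] unfolding k_def by simp
    then show ?thesis using Suc by simp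
  qed
  have "cell s i x = (if i = k then 1 else 0)" if i: "i < m" for i
  proof -
    have "s (Suc i) \<le> s k" if "i < k" using grid_mono[OF g, of "Suc i" k] that km m' by auto
    moreover have "s (Suc k) \<le> s i" if "k < i" using grid_mono[OF g, of "Suc k" i] that i by auto
    ultimately show ?thesis using sk kP by (cases i k rule: linorder_cases) (auto simp: cell_def indicator_def)
  qed
  then have "(\<Sum>i<m. c i * cell s i x) = c k" for c
    using km m' by (simp add: if_distrib[of "\<lambda>z. _ * z"] cong: if_cong)
  then show ?thesis using that[of k] km m' sk kP by simp
qed

text \<open>The step function whose formal stochastic integral against \<open>x\<close> is
  \<open>rs_sum\<close>. Riemann sums are controlled through the distance of \<open>step\<close>
  from \<open>v\<close>.\<close>

definition step :: "sheet \<Rightarrow> nat \<Rightarrow> nat \<Rightarrow> (nat \<Rightarrow> real) \<Rightarrow> (nat \<Rightarrow> real) \<Rightarrow> (nat \<Rightarrow> real) \<Rightarrow> (nat \<Rightarrow> real) \<Rightarrow> sheet" where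
  "step v m n s t \<xi> \<eta> p = (\<Sum>i<m. \<Sum>j<n. v (\<xi> i, \<eta> j) * (cell s i (fst p) * cell t j (snd p)))"

definition rs_sum :: "sheet \<Rightarrow> sheet \<Rightarrow> nat \<Rightarrow> nat \<Rightarrow> (nat \<Rightarrow> real) \<Rightarrow> (nat \<Rightarrow> real) \<Rightarrow> (nat \<Rightarrow> real) \<Rightarrow> (nat \<Rightarrow> real) \<Rightarrow> real" where
  "rs_sum v x m n s t \<xi> \<eta> = (\<Sum>i<m. \<Sum>j<n. v (\<xi> i, \<eta> j) * rect_incr x s t i j)"

definition tagged :: "real \<Rightarrow> real \<Rightarrow> real \<Rightarrow> nat \<Rightarrow> nat \<Rightarrow> (nat \<Rightarrow> real) \<Rightarrow> (nat \<Rightarrow> real) \<Rightarrow> (nat \<Rightarrow> real) \<Rightarrow> (nat \<Rightarrow> real) \<Rightarrow> bool" where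
  "tagged S T \<delta> m n s t \<xi> \<eta> \<longleftrightarrow> grid 0 S m s \<and> grid 0 T n t \<and>
        (\<forall>i<m. s (Suc i) - s i < \<delta> \<and> \<xi> i \<in> {s i..s (Suc i)}) \<and>
        (\<forall>j<n. t (Suc j) - t j < \<delta> \<and> \<eta> j \<in> {t j..t (Suc j)})"

lemma has_rs_integral_iff:
  "has_rs_integral S T v x I \<longleftrightarrow>
     (\<forall>\<epsilon>>0. \<exists>\<delta>>0. \<forall>m n s t \<xi> \<eta>. tagged S T \<delta> m n s t \<xi> \<eta> \<longrightarrow> \<bar>rs_sum v x m n s t \<xi> \<eta> - I\<bar> < \<epsilon>)"
  unfolding has_rs_integral_def tagged_def rs_sum_def ..

definition step_error :: "(real \<Rightarrow> real) \<Rightarrow> (real \<Rightarrow> real) \<Rightarrow> nat \<Rightarrow> nat \<Rightarrow> (nat \<Rightarrow> real) \<Rightarrow> (nat \<Rightarrow> real) \<Rightarrow> sheet" where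
  "step_error A B m n s t p = (\<Sum>i<m. (A (s (Suc i)) - A (s i)) * cell s i (fst p)) +
     (\<Sum>j<n. (B (t (Suc j)) - B (t j)) * cell t j (snd p))"

text \<open>From the tag to \<open>p\<close> one moves in the first coordinate and then in the
  second. Each leg stays within one side of the cell, where the growth of \<open>A\<close> or
  \<open>B\<close> bounds it, whatever jumps \<open>v\<close> has. That the values of
  \<open>step\<close> are values of \<open>v\<close> serves later to bound the error
  uniformly.\<close>

lemma step_close:
  assumes dom: "dominated_increments S T v A B" and tag: "tagged S T \<delta> m n s t \<xi> \<eta>"
    and p: "0 < fst p" "fst p \<le> S" "0 < snd p" "snd p \<le> T"
  shows "\<bar>step v m n s t \<xi> \<eta> p - v p\<bar> \<le> step_error A B m n s t p"
    and "\<exists>q\<in>{0..S} \<times> {0..T}. step v m n s t \<xi> \<eta> p = v q"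
proof -
  have gs: "grid 0 S m s" and gt: "grid 0 T n t" using tag by (auto simp: tagged_def)
  obtain k where k: "k < m" "s k < fst p" "fst p \<le> s (Suc k)" "\<And>c. (\<Sum>i<m. c i * cell s i (fst p)) = c k"
    using cell_select[OF gs p(1,2)] by metis
  obtain l where l: "l < n" "t l < snd p" "snd p \<le> t (Suc l)" "\<And>c. (\<Sum>j<n. c j * cell t j (snd p)) = c l"
    using cell_select[OF gt p(3,4)] by metis
  have "step v m n s t \<xi> \<eta> p = (\<Sum>i<m. (\<Sum>j<n. v (\<xi> i, \<eta> j) * cell t j (snd p)) * cell s i (fst p))"
    unfolding step_def sum_distrib_right by (intro sum.cong refl) (simp add: mult_ac)
  also have "\<dots> = v (\<xi> k, \<eta> l)" by (simp add: l(4) k(4))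
  finally have st: "step v m n s t \<xi> \<eta> p = v (\<xi> k, \<eta> l)" .
  have sk: "0 \<le> s k" "s (Suc k) \<le> S" using grid_bounds[OF gs, of k] grid_bounds[OF gs, of "Suc k"] k by auto
  have tl: "0 \<le> t l" "t (Suc l) \<le> T" using grid_bounds[OF gt, of l] grid_bounds[OF gt, of "Suc l"] l by auto
  have xi: "s k \<le> \<xi> k" "\<xi> k \<le> s (Suc k)" "t l \<le> \<eta> l" "\<eta> l \<le> t (Suc l)" using tag k l by (auto simp: tagged_def)
  show "\<exists>q\<in>{0..S} \<times> {0..T}. step v m n s t \<xi> \<eta> p = v q"
    by (rule bexI[of _ "(\<xi> k, \<eta> l)"]) (use st xi sk tl in auto)
  have mA: "A a \<le> A b" if "0 \<le> a" "a \<le> b" "b \<le> S" for a b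
    by (rule dominated_increments_mono(1)[OF dom]) (use that p in auto)
  have mB: "B a \<le> B b" if "0 \<le> a" "a \<le> b" "b \<le> T" for a b
    by (rule dominated_increments_mono(2)[OF dom]) (use that p in auto)
  have dA: "\<bar>v (b, c) - v (a, c)\<bar> \<le> A b - A a" if "0 \<le> a" "a \<le> b" "b \<le> S" "0 \<le> c" "c \<le> T" for a b c
    using dom that by (simp add: dominated_increments_def)
  have dB: "\<bar>v (c, b) - v (c, a)\<bar> \<le> B b - B a" if "0 \<le> a" "a \<le> b" "b \<le> T" "0 \<le> c" "c \<le> S" for a b c
    using dom that by (simp add: dominated_increments_def)
  have 1: "\<bar>v (\<xi> k, \<eta> l) - v (fst p, \<eta> l)\<bar> \<le> A (s (Suc k)) - A (s k)"
  proof (cases "\<xi> k \<le> fst p")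
    case True
    then have "\<bar>v (\<xi> k, \<eta> l) - v (fst p, \<eta> l)\<bar> \<le> A (fst p) - A (\<xi> k)"
      using dA[of "\<xi> k" "fst p" "\<eta> l"] xi sk tl p by (simp add: abs_minus_commute)
    moreover have "A (fst p) \<le> A (s (Suc k))" "A (s k) \<le> A (\<xi> k)" using k xi sk p by (auto intro!: mA)
    ultimately show ?thesis by linarith
  next
    case False
    then have "\<bar>v (\<xi> k, \<eta> l) - v (fst p, \<eta> l)\<bar> \<le> A (\<xi> k) - A (fst p)"
      using dA[of "fst p" "\<xi> k" "\<eta> l"] xi sk tl p by simp
    moreover have "A (\<xi> k) \<le> A (s (Suc k))" "A (s k) \<le> A (fst p)" using k xi sk p by (auto intro!: mA)
    ultimately show ?thesis by linarith
  qed
  have 2: "\<bar>v (fst p, \<eta> l) - v p\<bar> \<le> B (t (Suc l)) - B (t l)"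
  proof (cases "\<eta> l \<le> snd p")
    case True
    then have "\<bar>v (fst p, \<eta> l) - v p\<bar> \<le> B (snd p) - B (\<eta> l)"
      using dB[of "\<eta> l" "snd p" "fst p"] xi sk tl p by (simp add: abs_minus_commute)
    moreover have "B (snd p) \<le> B (t (Suc l))" "B (t l) \<le> B (\<eta> l)" using l xi tl p by (auto intro!: mB)
    ultimately show ?thesis by linarith
  next
    case False
    then have "\<bar>v (fst p, \<eta> l) - v p\<bar> \<le> B (\<eta> l) - B (snd p)"
      using dB[of "snd p" "\<eta> l" "fst p"] xi sk tl p by simp
    moreover have "B (\<eta> l) \<le> B (t (Suc l))" "B (t l) \<le> B (snd p)" using l xi tl p by (auto intro!: mB)
    ultimately show ?thesis by linarith
  qed
  have "step_error A B m n s t p = (A (s (Suc k)) - A (s k)) + (B (t (Suc l)) - B (t l))"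
    unfolding step_error_def k(4) l(4) ..
  then show "\<bar>step v m n s t \<xi> \<eta> p - v p\<bar> \<le> step_error A B m n s t p" using 1 2 st by linarith
qed

section \<open>Measurability and step approximation of functions of bounded variation\<close>

context rectangle
begin

lemma borel_measurable_fst_snd:
  fixes f :: "real \<Rightarrow> real"
  assumes "f \<in> borel_measurable borel"
  shows "(\<lambda>p::real \<times> real. f (fst p)) \<in> borel_measurable borel"
    and "(\<lambda>p::real \<times> real. f (snd p)) \<in> borel_measurable borel"
  by (rule measurable_compose[OF _ assms], intro borel_measurable_continuous_onI continuous_intros)+

text \<open>The factors are cut off to their intervals, integrated by Fubini over the product of
  one-dimensional Lebesgue measures, and carried over to the completion.\<close>

lemma LQ_prod:
  fixes f g :: "real \<Rightarrow> real"
  assumes [measurable]: "f \<in> borel_measurable borel" "g \<in> borel_measurable borel"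
    and f: "has_bochner_integral lborel (\<lambda>x. indicator {0..S} x * f x) I"
    and g: "has_bochner_integral lborel (\<lambda>x. indicator {0..T} x * g x) J"
  shows "has_bochner_integral LQ (\<lambda>p. f (fst p) * g (snd p)) (I * J)"
proof -
  define F where "F x = indicator {0..S} x * f x" for x
  define G where "G x = indicator {0..T} x * g x" for x
  have [measurable]: "F \<in> borel_measurable borel" "G \<in> borel_measurable borel"
    unfolding F_def[abs_def] G_def[abs_def] by measurable
  have F: "integrable lborel F" "integral\<^sup>L lborel F = I" and G: "integrable lborel G" "integral\<^sup>L lborel G = J"
    using f g by (auto simp: F_def[abs_def] G_def[abs_def] has_bochner_integral_iff)
  let ?h = "\<lambda>p. F (fst p) * G (snd p)"
  have i: "integrable (lborel \<Otimes>\<^sub>M lborel) ?h"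
  proof (rule lborel_pair.Fubini_integrable)
    have "(\<lambda>x. \<integral>y. norm (?h (x, y)) \<partial>lborel) = (\<lambda>x. \<bar>F x\<bar> * (\<integral>y. \<bar>G y\<bar> \<partial>lborel))"
      by (simp add: abs_mult)
    then show "integrable lborel (\<lambda>x. \<integral>y. norm (?h (x, y)) \<partial>lborel)" using F by simp
  qed (use G in auto)
  have "(\<integral>p. ?h p \<partial>(lborel \<Otimes>\<^sub>M lborel)) = (\<integral>x. \<integral>y. ?h (x, y) \<partial>lborel \<partial>lborel)"
    by (rule lborel_pair.integral_fst'[OF i, symmetric])
  also have "\<dots> = I * J" using F G by simp
  finally have "has_bochner_integral lborel ?h (I * J)"
    using i by (simp add: lborel_prod has_bochner_integral_iff)
  moreover have "?h \<in> borel_measurable lborel"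
    using borel_measurable_fst_snd(1)[of F] borel_measurable_fst_snd(2)[of G] by simp
  ultimately have "has_bochner_integral lebesgue ?h (I * J)"
    by (simp only: has_bochner_integral_iff integrable_completion integral_completion)
  moreover have "?h = (\<lambda>p. indicator Q p *\<^sub>R (f (fst p) * g (snd p)))"
    by (auto simp: F_def G_def Qrect_def indicator_def)
  ultimately show ?thesis
    using fmeasurableD[OF Q_lmeasurable]
    by (simp add: has_bochner_integral_iff integrable_restrict_space integral_restrict_space)
qed

lemma LQ_measurable_of_borel: "f \<in> borel_measurable borel \<Longrightarrow> f \<in> borel_measurable LQ"
  by (rule measurable_restrict_space1) (auto intro: measurable_completion)

lemma cell_integral:
  assumes "grid 0 b m s" "i < m"
  shows "has_bochner_integral lborel (\<lambda>x. indicator {0..b} x * cell s i x) (s (Suc i) - s i)"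
proof -
  have b: "0 \<le> s i" "s (Suc i) \<le> b" "s i \<le> s (Suc i)"
    using grid_bounds[OF assms(1), of i] grid_bounds[OF assms(1), of "Suc i"] grid_mono[OF assms(1), of i "Suc i"] assms by auto
  have "(\<lambda>x. indicator {0..b} x * cell s i x) = indicator {s i<..s (Suc i)}"
    using b by (auto simp: cell_def indicator_def)
  then show ?thesis using b by (auto simp: has_bochner_integral_iff)
qed

lemma interval_integral: "0 \<le> b \<Longrightarrow> has_bochner_integral lborel (\<lambda>x::real. indicator {0..b} x * 1) b"
  by (simp add: has_bochner_integral_iff)

text \<open>Every cell is narrower than \<open>\<delta>\<close> and the increments of
  \<open>A\<close> and \<open>B\<close> telescope, so the mean error is of order
  \<open>\<delta>\<close> without any continuity of \<open>v\<close>.\<close>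

lemma step_error_integral:
  assumes dom: "dominated_increments S T v A B" and tag: "tagged S T \<delta> m n s t \<xi> \<eta>"
  shows "integrable LQ (step_error A B m n s t)"
    and "(\<integral>p. step_error A B m n s t p \<partial>LQ) \<le> \<delta> * (T * (A S - A 0) + S * (B T - B 0))"
proof -
  have gs: "grid 0 S m s" and gt: "grid 0 T n t" using tag by (auto simp: tagged_def)
  have 1: "has_bochner_integral LQ (\<lambda>p. (A (s (Suc i)) - A (s i)) * cell s i (fst p)) ((A (s (Suc i)) - A (s i)) * ((s (Suc i) - s i) * T))"
    if "i < m" for i
    using LQ_prod[of "cell s i" "\<lambda>_. 1", OF cell_measurable borel_measurable_const cell_integral[OF gs that] interval_integral] T_pos
    by (auto intro!: has_bochner_integral_mult_right)
  have 2: "has_bochner_integral LQ (\<lambda>p. (B (t (Suc j)) - B (t j)) * cell t j (snd p)) ((B (t (Suc j)) - B (t j)) * (S * (t (Suc j) - t j)))"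
    if "j < n" for j
    using LQ_prod[of "\<lambda>_. 1" "cell t j", OF borel_measurable_const cell_measurable interval_integral cell_integral[OF gt that]] S_pos
    by (auto intro!: has_bochner_integral_mult_right)
  have hb: "has_bochner_integral LQ (step_error A B m n s t)
     ((\<Sum>i<m. (A (s (Suc i)) - A (s i)) * ((s (Suc i) - s i) * T)) + (\<Sum>j<n. (B (t (Suc j)) - B (t j)) * (S * (t (Suc j) - t j))))"
    unfolding step_error_def[abs_def]
    by (intro has_bochner_integral_add has_bochner_integral_sum 1 2) auto
  then show "integrable LQ (step_error A B m n s t)" by (rule integrable.intros)
  have "(\<Sum>i<m. (A (s (Suc i)) - A (s i)) * ((s (Suc i) - s i) * T)) \<le> (\<Sum>i<m. (A (s (Suc i)) - A (s i)) * (\<delta> * T))"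
  proof (intro sum_mono mult_left_mono mult_right_mono)
    fix i assume "i \<in> {..<m}"
    then show "s (Suc i) - s i \<le> \<delta>" "0 \<le> A (s (Suc i)) - A (s i)"
      using tag dominated_increments_mono(1)[OF dom, of "s i" "s (Suc i)"] grid_bounds[OF gs, of i] grid_bounds[OF gs, of "Suc i"] S_pos T_pos
      by (auto simp: tagged_def grid_def)
  qed (use T_pos in auto)
  also have "\<dots> = (A S - A 0) * (\<delta> * T)"
    unfolding sum_distrib_right[symmetric] using sum_lessThan_telescope[of "\<lambda>i. A (s i)" m] gs by (simp add: grid_def)
  finally have a: "(\<Sum>i<m. (A (s (Suc i)) - A (s i)) * ((s (Suc i) - s i) * T)) \<le> (A S - A 0) * (\<delta> * T)" .
  have "(\<Sum>j<n. (B (t (Suc j)) - B (t j)) * (S * (t (Suc j) - t j))) \<le> (\<Sum>j<n. (B (t (Suc j)) - B (t j)) * (S * \<delta>))"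
  proof (intro sum_mono mult_left_mono)
    fix j assume "j \<in> {..<n}"
    then show "t (Suc j) - t j \<le> \<delta>" "0 \<le> B (t (Suc j)) - B (t j)"
      using tag dominated_increments_mono(2)[OF dom, of "t j" "t (Suc j)"] grid_bounds[OF gt, of j] grid_bounds[OF gt, of "Suc j"] S_pos T_pos
      by (auto simp: tagged_def grid_def)
  qed (use S_pos in auto)
  also have "\<dots> = (B T - B 0) * (S * \<delta>)"
    unfolding sum_distrib_right[symmetric] using sum_lessThan_telescope[of "\<lambda>i. B (t i)" n] gt by (simp add: grid_def)
  finally show "(\<integral>p. step_error A B m n s t p \<partial>LQ) \<le> \<delta> * (T * (A S - A 0) + S * (B T - B 0))"
    using a has_bochner_integral_integral_eq[OF hb] by (simp add: algebra_simps)
qed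

text \<open>Serves both as grid and as tags, the tags then being the lower left corners.
  \<open>Suc N\<close> cells avoid division by zero.\<close>

definition unif :: "real \<Rightarrow> nat \<Rightarrow> nat \<Rightarrow> real" where
  "unif b N i = b * real i / real (Suc N)"

lemma unif_tagged:
  assumes "\<delta> > max S T / real (Suc N)"
  shows "tagged S T \<delta> (Suc N) (Suc N) (unif S N) (unif T N) (unif S N) (unif T N)"
proof -
  have d: "unif b N (Suc i) - unif b N i = b / real (Suc N)" for b i
    by (simp add: unif_def diff_divide_distrib[symmetric] algebra_simps del: of_nat_Suc) (simp add: algebra_simps)
  have e: "unif b N 0 = 0" "unif b N (Suc N) = b" for b by (simp_all add: unif_def del: of_nat_Suc)
  have m: "S / real (Suc N) \<le> max S T / real (Suc N)" "T / real (Suc N) \<le> max S T / real (Suc N)"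
    by (intro divide_right_mono; simp)+
  have p: "0 \<le> S / real (Suc N)" "0 \<le> T / real (Suc N)" using S_pos T_pos by simp_all
  have m': "unif S N i \<le> unif S N (Suc i)" "unif T N i \<le> unif T N (Suc i)" for i using d[of S i] d[of T i] p by linarith+
  show ?thesis unfolding tagged_def grid_def d e using m m' assms by auto
qed

lemma LQ_AE_pos: "AE p in LQ. 0 < fst p \<and> fst p \<le> S \<and> 0 < snd p \<and> snd p \<le> T"
proof -
  have "negligible {p. ((1, 0) :: real \<times> real) \<bullet> p = 0}" "negligible {p. ((0, 1) :: real \<times> real) \<bullet> p = 0}"
    by (rule negligible_hyperplane; simp add: zero_prod_def)+
  then have "AE p in lebesgue. p \<notin> {p. ((1, 0) :: real \<times> real) \<bullet> p = 0}" "AE p in lebesgue. p \<notin> {p. ((0, 1) :: real \<times> real) \<bullet> p = 0}"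
    unfolding negligible_iff_null_sets by (blast intro: AE_not_in)+
  then have "AE p in lebesgue. p \<in> Q \<longrightarrow> 0 < fst p \<and> fst p \<le> S \<and> 0 < snd p \<and> snd p \<le> T"
    by eventually_elim (auto simp: Qrect_def less_le inner_prod_def)
  then show ?thesis using fmeasurableD[OF Q_lmeasurable] by (subst AE_restrict_space_iff) auto
qed

lemma step_measurable: "step v m n s t \<xi> \<eta> \<in> borel_measurable LQ"
  unfolding step_def[abs_def]
  by (intro LQ_measurable_of_borel borel_measurable_sum borel_measurable_times borel_measurable_const
      borel_measurable_fst_snd cell_measurable)

text \<open>Completeness of Lebesgue measure, transported to its restriction to
  \<open>Q\<close>.\<close>

lemma borel_measurable_LQ_AE:
  fixes f g :: sheet
  assumes f: "f \<in> borel_measurable LQ" and ae: "AE p in LQ. f p = g p"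
  shows "g \<in> borel_measurable LQ"
proof -
  have Q: "Q \<in> sets lebesgue" using Q_lmeasurable by (rule fmeasurableD)
  have "(\<lambda>p. indicator Q p *\<^sub>R f p) \<in> borel_measurable lebesgue"
    using f Q by (subst (asm) borel_measurable_restrict_space_iff) auto
  moreover have "AE p in lebesgue. indicator Q p *\<^sub>R f p = indicator Q p *\<^sub>R g p"
    using ae Q by (subst (asm) AE_restrict_space_iff) (auto elim!: eventually_mono simp: indicator_def)
  ultimately have "(\<lambda>p. indicator Q p *\<^sub>R g p) \<in> borel_measurable lebesgue" by (rule borel_measurable_AE)
  then show ?thesis using Q by (subst borel_measurable_restrict_space_iff) auto
qed

abbreviation "ustep v N \<equiv> step v (Suc N) (Suc N) (unif S N) (unif T N) (unif S N) (unif T N)"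

text \<open>As long as \<open>v\<close> is not known to be measurable, the error
  \<open>ustep v N p - v p\<close> cannot be integrated. Its measurable majorant \<open>w N\<close>
  is, and tends to 0 in mean; along a subsequence it tends to 0 almost everywhere, which exhibits
  \<open>v\<close> as an almost everywhere limit of step functions.\<close>

lemma bv_measurable:
  assumes v: "bv_hk S T v" shows "v \<in> borel_measurable LQ"
proof -
  obtain A B where dom: "dominated_increments S T v A B"
    using bv_hk_dominated[OF _ _ v] S_pos T_pos by (metis less_imp_le)
  define w where "w N = step_error A B (Suc N) (Suc N) (unif S N) (unif T N)" for N
  define K where "K = T * (A S - A 0) + S * (B T - B 0)"
  \<comment> \<open>The factor 2 provides the strict inequality between cell width and mesh that
    \<open>unif_tagged\<close> asks for.\<close>
  have tag: "tagged S T (2 * max S T / real (Suc N)) (Suc N) (Suc N) (unif S N) (unif T N) (unif S N) (unif T N)" for N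
    using S_pos T_pos by (intro unif_tagged divide_strict_right_mono) auto
  have wi: "integrable LQ (w N)" for N unfolding w_def by (rule step_error_integral(1)[OF dom tag])
  have wb: "(\<integral>p. w N p \<partial>LQ) \<le> 2 * max S T / real (Suc N) * K" for N
    unfolding w_def K_def by (rule step_error_integral(2)[OF dom tag])
  have close: "AE p in LQ. \<bar>ustep v N p - v p\<bar> \<le> w N p" for N
    using LQ_AE_pos by eventually_elim (use step_close(1)[OF dom tag] in \<open>auto simp: w_def\<close>)
  have close': "AE p in LQ. \<forall>N. \<bar>ustep v N p - v p\<bar> \<le> w N p" using close by (simp add: AE_all_countable)
  have "(\<lambda>N. \<integral>p. norm (w N p) \<partial>LQ) \<longlonglongrightarrow> 0"
  proof (rule tendsto_sandwich[of "\<lambda>N. 0" _ _ "\<lambda>N. 2 * max S T * K * (1 / real (Suc N))"])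
    show "\<forall>\<^sub>F N in sequentially. (\<integral>p. norm (w N p) \<partial>LQ) \<le> 2 * max S T * K * (1 / real (Suc N))"
    proof (rule always_eventually, rule allI)
      fix N
      have "(\<integral>p. norm (w N p) \<partial>LQ) = (\<integral>p. w N p \<partial>LQ)"
        by (rule integral_cong_AE) (use wi[of N] close[of N] in \<open>auto elim!: eventually_mono intro: borel_measurable_integrable\<close>)
      then show "(\<integral>p. norm (w N p) \<partial>LQ) \<le> 2 * max S T * K * (1 / real (Suc N))" using wb[of N] by simp
    qed
    show "(\<lambda>N. 2 * max S T * K * (1 / real (Suc N))) \<longlonglongrightarrow> 0"
      using tendsto_mult_left[OF lim_inverse_n', of "2 * max S T * K"] LIMSEQ_Suc[of "\<lambda>n. 2 * max S T * K * (1 / real n)" 0]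
      by (simp add: lim_1_over_n tendsto_mult_right_zero)
  qed auto
  then obtain r where r: "strict_mono r" "AE p in LQ. (\<lambda>N. w (r N) p) \<longlonglongrightarrow> 0"
    using tendsto_L1_AE_subseq[of LQ w] wi by blast
  have "AE p in LQ. lim (\<lambda>N. ustep v (r N) p) = v p"
    using r(2) close'
  proof eventually_elim
    case (elim p)
    have "(\<lambda>N. ustep v (r N) p - v p) \<longlonglongrightarrow> 0"
      by (rule Lim_null_comparison[OF _ elim(1)]) (use elim(2) in auto)
    then have "(\<lambda>N. ustep v (r N) p) \<longlonglongrightarrow> v p" by (simp add: LIM_zero_iff)
    then show ?case by (rule limI)
  qed
  moreover have "(\<lambda>p. lim (\<lambda>N. ustep v (r N) p)) \<in> borel_measurable LQ"
    by (rule borel_measurable_lim_metric) (rule step_measurable)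
  ultimately show ?thesis by (rule borel_measurable_LQ_AE[rotated])
qed

lemma bv_bounded:
  assumes v: "bv_hk S T v" obtains K where "\<And>p. p \<in> Q \<Longrightarrow> \<bar>v p\<bar> \<le> K"
proof -
  obtain A B where dom: "dominated_increments S T v A B"
    using bv_hk_dominated[OF _ _ v] S_pos T_pos by (metis less_imp_le)
  note mono = dominated_increments_mono[OF dom]
  show ?thesis
  proof (rule that)
    fix p assume "p \<in> Q"
    then obtain a b where p: "p = (a, b)" "0 \<le> a" "a \<le> S" "0 \<le> b" "b \<le> T" by (auto simp: Qrect_def)
    have "\<bar>v (a, b) - v (0, b)\<bar> \<le> A a - A 0" "\<bar>v (0, b) - v (0, 0)\<bar> \<le> B b - B 0"
      using dom p by (auto simp: dominated_increments_def)
    moreover have "A a \<le> A S" "B b \<le> B T" using mono p by auto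
    ultimately show "\<bar>v p\<bar> \<le> \<bar>v (0, 0)\<bar> + (A S - A 0) + (B T - B 0)" unfolding p(1) by linarith
  qed
qed

lemma bv_L2: "bv_hk S T v \<Longrightarrow> v \<in> LL"
  by (metis L2_bounded bv_bounded bv_measurable)

lemma step_L1:
  assumes dom: "dominated_increments S T v A B" and v: "v \<in> borel_measurable LQ"
    and tag: "tagged S T \<delta> m n s t \<xi> \<eta>"
  shows "integrable LQ (\<lambda>p. step v m n s t \<xi> \<eta> p - v p)"
    and "(\<integral>p. \<bar>step v m n s t \<xi> \<eta> p - v p\<bar> \<partial>LQ) \<le> \<delta> * (T * (A S - A 0) + S * (B T - B 0))"
proof -
  note e = step_error_integral[OF dom tag]
  have m[measurable]: "(\<lambda>p. step v m n s t \<xi> \<eta> p - v p) \<in> borel_measurable LQ"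
    using v step_measurable by (rule borel_measurable_diff[rotated])
  have close: "AE p in LQ. \<bar>step v m n s t \<xi> \<eta> p - v p\<bar> \<le> step_error A B m n s t p"
    using LQ_AE_pos by eventually_elim (use step_close(1)[OF dom tag] in auto)
  show i: "integrable LQ (\<lambda>p. step v m n s t \<xi> \<eta> p - v p)"
    by (rule Bochner_Integration.integrable_bound[OF e(1) m]) (use close in \<open>auto elim!: eventually_mono\<close>)
  have "(\<integral>p. \<bar>step v m n s t \<xi> \<eta> p - v p\<bar> \<partial>LQ) \<le> (\<integral>p. step_error A B m n s t p \<partial>LQ)"
    using i e(1) close by (intro integral_mono_AE) auto
  then show "(\<integral>p. \<bar>step v m n s t \<xi> \<eta> p - v p\<bar> \<partial>LQ) \<le> \<delta> * (T * (A S - A 0) + S * (B T - B 0))"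
    using e(2) by simp
qed

end

section \<open>Existence of the Riemann--Stieltjes integral\<close>

lemma Abel_summation:
  fixes a y :: "nat \<Rightarrow> real"
  shows "(\<Sum>i<m. a i * (y (Suc i) - y i)) = a m * y m - a 0 * y 0 - (\<Sum>i<m. y (Suc i) * (a (Suc i) - a i))"
  by (induction m) (auto simp: algebra_simps)

lemma rect_incr_simps:
  "rect_incr (\<lambda>p. x p + y p) s t i j = rect_incr x s t i j + rect_incr y s t i j"
  "rect_incr (\<lambda>p. x p - y p) s t i j = rect_incr x s t i j - rect_incr y s t i j"
  "rect_incr (\<lambda>p. c * x p) s t i j = c * rect_incr x s t i j"
  by (simp_all add: rect_incr_def algebra_simps)

lemma rs_sum_simps:
  "rs_sum v (\<lambda>p. x p + y p) m n s t \<xi> \<eta> = rs_sum v x m n s t \<xi> \<eta> + rs_sum v y m n s t \<xi> \<eta>"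
  "rs_sum v (\<lambda>p. x p - y p) m n s t \<xi> \<eta> = rs_sum v x m n s t \<xi> \<eta> - rs_sum v y m n s t \<xi> \<eta>"
  "rs_sum v (\<lambda>p. c * x p) m n s t \<xi> \<eta> = c * rs_sum v x m n s t \<xi> \<eta>"
  "rs_sum (\<lambda>p. v p + w p) x m n s t \<xi> \<eta> = rs_sum v x m n s t \<xi> \<eta> + rs_sum w x m n s t \<xi> \<eta>"
  "rs_sum (\<lambda>p. c * v p) x m n s t \<xi> \<eta> = c * rs_sum v x m n s t \<xi> \<eta>"
  "rs_sum (\<lambda>p. 0) x m n s t \<xi> \<eta> = 0"
  by (simp_all add: rs_sum_def rect_incr_simps sum.distrib sum_subtractf sum_distrib_left algebra_simps)

lemma has_rs_integral_add:
  assumes I: "\<And>m n s t \<xi> \<eta>. rs_sum w z m n s t \<xi> \<eta> = rs_sum v x m n s t \<xi> \<eta> + rs_sum v' x' m n s t \<xi> \<eta>"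
    and x: "has_rs_integral S T v x I" and y: "has_rs_integral S T v' x' J"
  shows "has_rs_integral S T w z (I + J)"
  unfolding has_rs_integral_iff
proof (intro allI impI)
  fix \<epsilon> :: real assume "\<epsilon> > 0"
  then have "\<epsilon> / 2 > 0" by simp
  obtain d where d: "d > 0" "\<And>m n s t \<xi> \<eta>. tagged S T d m n s t \<xi> \<eta> \<Longrightarrow> \<bar>rs_sum v x m n s t \<xi> \<eta> - I\<bar> < \<epsilon> / 2"
    using x \<open>\<epsilon> / 2 > 0\<close> unfolding has_rs_integral_iff by blast
  obtain e where e: "e > 0" "\<And>m n s t \<xi> \<eta>. tagged S T e m n s t \<xi> \<eta> \<Longrightarrow> \<bar>rs_sum v' x' m n s t \<xi> \<eta> - J\<bar> < \<epsilon> / 2"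
    using y \<open>\<epsilon> / 2 > 0\<close> unfolding has_rs_integral_iff by blast
  show "\<exists>\<delta>>0. \<forall>m n s t \<xi> \<eta>. tagged S T \<delta> m n s t \<xi> \<eta> \<longrightarrow> \<bar>rs_sum w z m n s t \<xi> \<eta> - (I + J)\<bar> < \<epsilon>"
  proof (intro exI[of _ "min d e"] conjI allI impI)
    fix m n s t \<xi> \<eta> assume "tagged S T (min d e) m n s t \<xi> \<eta>"
    then have "tagged S T d m n s t \<xi> \<eta>" "tagged S T e m n s t \<xi> \<eta>" by (auto simp: tagged_def)
    from d(2)[OF this(1)] e(2)[OF this(2)] show "\<bar>rs_sum w z m n s t \<xi> \<eta> - (I + J)\<bar> < \<epsilon>"
      unfolding I by linarith
  qed (use d e in auto)
qed

lemma has_rs_integral_scale: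
  assumes I: "\<And>m n s t \<xi> \<eta>. rs_sum w z m n s t \<xi> \<eta> = c * rs_sum v x m n s t \<xi> \<eta>"
    and x: "has_rs_integral S T v x I"
  shows "has_rs_integral S T w z (c * I)"
  unfolding has_rs_integral_iff
proof (intro allI impI)
  fix \<epsilon> :: real assume "\<epsilon> > 0"
  then have "\<epsilon> / (\<bar>c\<bar> + 1) > 0" by simp
  then obtain d where d: "d > 0" "\<And>m n s t \<xi> \<eta>. tagged S T d m n s t \<xi> \<eta> \<Longrightarrow> \<bar>rs_sum v x m n s t \<xi> \<eta> - I\<bar> < \<epsilon> / (\<bar>c\<bar> + 1)"
    using x unfolding has_rs_integral_iff by blast
  show "\<exists>\<delta>>0. \<forall>m n s t \<xi> \<eta>. tagged S T \<delta> m n s t \<xi> \<eta> \<longrightarrow> \<bar>rs_sum w z m n s t \<xi> \<eta> - c * I\<bar> < \<epsilon>"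
  proof (intro exI[of _ d] conjI allI impI)
    fix m n s t \<xi> \<eta> assume "tagged S T d m n s t \<xi> \<eta>"
    from d(2)[OF this] have *: "\<bar>rs_sum v x m n s t \<xi> \<eta> - I\<bar> * (\<bar>c\<bar> + 1) < \<epsilon>"
      by (simp add: pos_less_divide_eq)
    have "\<bar>rs_sum w z m n s t \<xi> \<eta> - c * I\<bar> = \<bar>c\<bar> * \<bar>rs_sum v x m n s t \<xi> \<eta> - I\<bar>"
      unfolding I by (simp flip: right_diff_distrib abs_mult)
    also have "\<dots> \<le> \<bar>rs_sum v x m n s t \<xi> \<eta> - I\<bar> * (\<bar>c\<bar> + 1)" by (simp add: algebra_simps)
    finally show "\<bar>rs_sum w z m n s t \<xi> \<eta> - c * I\<bar> < \<epsilon>" using * by simp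
  qed (use d in auto)
qed

text \<open>Polynomials as a linear span of monomials, because the increments of a monomial over a
  rectangle factor and Riemann sums are linear in the path.\<close>

inductive mono_span :: "sheet \<Rightarrow> bool" where
  mono: "mono_span (\<lambda>p. fst p ^ k * snd p ^ l)"
| add: "mono_span f \<Longrightarrow> mono_span g \<Longrightarrow> mono_span (\<lambda>p. f p + g p)"
| scale: "mono_span f \<Longrightarrow> mono_span (\<lambda>p. c * f p)"

lemma mono_span_mult: "mono_span f \<Longrightarrow> mono_span g \<Longrightarrow> mono_span (\<lambda>p. f p * g p)"
proof (induction f rule: mono_span.induct)
  case (mono k l)
  then show ?case
  proof (induction g rule: mono_span.induct)
    case (mono k' l')
    have "(\<lambda>p::real \<times> real. fst p ^ k * snd p ^ l * (fst p ^ k' * snd p ^ l')) = (\<lambda>p. fst p ^ (k + k') * snd p ^ (l + l'))"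
      by (simp add: power_add mult_ac)
    then show ?case by (simp only: mono_span.mono)
  next
    case (add f g)
    then show ?case using mono_span.add[OF add.IH] by (simp add: distrib_left)
  next
    case (scale f c)
    then show ?case using mono_span.scale[OF scale.IH, of c] by (simp add: mult_ac)
  qed
next
  case (add f f')
  then show ?case using mono_span.add[OF add.IH] by (simp add: distrib_right)
next
  case (scale f c)
  then show ?case using mono_span.scale[OF scale.IH, of c] by (simp add: mult_ac)
qed

lemma mono_span_real_polynomial_function: "real_polynomial_function f \<Longrightarrow> mono_span f"
proof (induction f rule: real_polynomial_function.induct)
  case (linear f)
  then interpret bounded_linear f .
  have "f p = f (1, 0) * (fst p ^ 1 * snd p ^ 0) + f (0, 1) * (fst p ^ 0 * snd p ^ 1)" for p
  proof -
    have "p = fst p *\<^sub>R (1, 0) + snd p *\<^sub>R (0, 1)" by (cases p) simp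
    then have "f p = f (fst p *\<^sub>R (1, 0) + snd p *\<^sub>R (0, 1))" by simp
    also have "\<dots> = fst p * f (1, 0) + snd p * f (0, 1)" unfolding add scale by simp
    finally show ?thesis by simp
  qed
  then have eq: "f = (\<lambda>p. f (1, 0) * (fst p ^ 1 * snd p ^ 0) + f (0, 1) * (fst p ^ 0 * snd p ^ 1))" by blast
  have "mono_span (\<lambda>p. f (1, 0) * (fst p ^ 1 * snd p ^ 0) + f (0, 1) * (fst p ^ 0 * snd p ^ 1))"
    by (intro mono_span.add mono_span.scale mono_span.mono)
  then show ?case by (rule ssubst[where P=mono_span, OF eq])
next
  case (const c)
  have "mono_span (\<lambda>p. c * (fst p ^ 0 * snd p ^ 0))" by (intro mono_span.scale mono_span.mono)
  then show ?case by simp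
qed (auto intro: mono_span.add mono_span_mult)

context rectangle
begin

abbreviation "urs v x N \<equiv> rs_sum v x (Suc N) (Suc N) (unif S N) (unif T N) (unif S N) (unif T N)"

text \<open>Tagged partitions of every mesh exist, so an integral, if there is one, is the limit of
  one fixed sequence of finite sums. This gives uniqueness of the integral and, later, its
  measurability in the path.\<close>

lemma has_rs_integral_urs:
  assumes "has_rs_integral S T v x I" shows "(\<lambda>N. urs v x N) \<longlonglongrightarrow> I"
proof (rule LIMSEQ_I)
  fix e :: real assume "e > 0"
  then obtain d where d: "d > 0" "\<And>m n s t \<xi> \<eta>. tagged S T d m n s t \<xi> \<eta> \<Longrightarrow> \<bar>rs_sum v x m n s t \<xi> \<eta> - I\<bar> < e"
    using assms unfolding has_rs_integral_iff by blast
  obtain N0 :: nat where N0: "real N0 > max S T / d" using reals_Archimedean2 by blast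
  show "\<exists>no. \<forall>N\<ge>no. norm (urs v x N - I) < e"
  proof (intro exI[of _ N0] allI impI)
    fix N assume "N \<ge> N0"
    then have "real (Suc N) > max S T / d" using N0 by simp
    then have "max S T / real (Suc N) < d" using d by (simp add: field_simps del: of_nat_Suc)
    from d(2)[OF unif_tagged[OF this]] show "norm (urs v x N - I) < e" by simp
  qed
qed

lemma rs_integral_eq:
  assumes "has_rs_integral S T v x I" shows "rs_integral S T v x = I"
  unfolding rs_integral_def
proof (rule the_equality)
  show "has_rs_integral S T v x I" by (rule assms)
  show "J = I" if "has_rs_integral S T v x J" for J
    using has_rs_integral_urs[OF that] has_rs_integral_urs[OF assms] by (rule LIMSEQ_unique)
qed

text \<open>For \<open>k = 0\<close> the truncated exponent \<open>k - 1\<close> is harmless: the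
  factor \<open>real k\<close> vanishes, and so does \<open>b ^ 0 - a ^ 0\<close>.\<close>

lemma monomial_integral:
  assumes "0 \<le> a" "a \<le> b" "b \<le> c"
  shows "has_bochner_integral lborel (\<lambda>x::real. indicator {0..c} x * (indicator {a<..b} x * (real k * x ^ (k - 1)))) (b ^ k - a ^ k)"
proof -
  have "has_bochner_integral lborel (\<lambda>x. (real k * x ^ (k - 1)) * indicator {a..b} x) (b ^ k - a ^ k)"
    by (rule has_bochner_integral_FTC_Icc_real[OF assms(2)]) (auto intro!: derivative_eq_intros)
  moreover have "AE x in lborel. (real k * x ^ (k - 1)) * indicator {a..b} x = indicator {0..c} x * (indicator {a<..b} x * (real k * x ^ (k - 1)))"
    using AE_lborel_singleton[of a] by eventually_elim (use assms in \<open>auto simp: indicator_def\<close>)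
  ultimately show ?thesis by (subst (asm) has_bochner_integral_cong_AE) auto
qed

text \<open>The increment over a cell is the integral of the mixed derivative \<open>d\<close> over
  that cell. The Riemann sum is therefore the Lebesgue integral of \<open>step * d\<close>, and the
  mean closeness of \<open>step\<close> to \<open>v\<close> gives the limit, the integral of
  \<open>v * d\<close>.\<close>

lemma has_rs_integral_monomial:
  assumes v: "bv_hk S T v"
  shows "\<exists>I. has_rs_integral S T v (\<lambda>p. fst p ^ k * snd p ^ l) I"
proof -
  obtain A B where dom: "dominated_increments S T v A B"
    using bv_hk_dominated[OF _ _ v] S_pos T_pos by (metis less_imp_le)
  define d1 where "d1 x = real k * x ^ (k - 1)" for x :: real
  define d2 where "d2 x = real l * x ^ (l - 1)" for x :: real
  define d where "d p = d1 (fst p) * d2 (snd p)" for p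
  define K where "K = (real k * S ^ (k - 1)) * (real l * T ^ (l - 1))"
  have K0: "K \<ge> 0" using S_pos T_pos by (simp add: K_def)
  have dm1[measurable]: "d1 \<in> borel_measurable borel" "d2 \<in> borel_measurable borel"
    unfolding d1_def[abs_def] d2_def[abs_def] by measurable
  have dm: "d \<in> borel_measurable LQ"
    unfolding d_def[abs_def] by (intro LQ_measurable_of_borel borel_measurable_times borel_measurable_fst_snd dm1)
  have dK: "\<bar>d p\<bar> \<le> K" if "p \<in> Q" for p
    using that unfolding d_def d1_def d2_def K_def abs_mult
    by (auto simp: Qrect_def intro!: mult_mono power_mono)
  have vm: "v \<in> borel_measurable LQ" by (rule bv_measurable[OF v])
  obtain Kv where Kv: "\<And>p. p \<in> Q \<Longrightarrow> \<bar>v p\<bar> \<le> Kv" using bv_bounded[OF v] by blast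
  have vd: "integrable LQ (\<lambda>p. v p * d p)" by (rule L2_prod) (auto intro: L2_bounded vm Kv dm dK)
  define I where "I = (\<integral>p. v p * d p \<partial>LQ)"
  define C where "C = T * (A S - A 0) + S * (B T - B 0)"
  have C0: "C \<ge> 0" unfolding C_def using S_pos T_pos dominated_increments_mono[OF dom] by simp
  have main: "\<bar>rs_sum v (\<lambda>p. fst p ^ k * snd p ^ l) m n s t \<xi> \<eta> - I\<bar> \<le> K * (\<delta> * C)"
    if tag: "tagged S T \<delta> m n s t \<xi> \<eta>" for \<delta> m n s t \<xi> \<eta>
  proof -
    have gs: "grid 0 S m s" and gt: "grid 0 T n t" using tag by (auto simp: tagged_def)
    have one: "has_bochner_integral LQ (\<lambda>p. v (\<xi> i, \<eta> j) * ((cell s i (fst p) * d1 (fst p)) * (cell t j (snd p) * d2 (snd p))))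
        (v (\<xi> i, \<eta> j) * rect_incr (\<lambda>p. fst p ^ k * snd p ^ l) s t i j)" if ij: "i < m" "j < n" for i j
    proof -
      have b: "0 \<le> s i" "s i \<le> s (Suc i)" "s (Suc i) \<le> S" "0 \<le> t j" "t j \<le> t (Suc j)" "t (Suc j) \<le> T"
        using ij grid_bounds[OF gs, of i] grid_bounds[OF gs, of "Suc i"] grid_mono[OF gs, of i "Suc i"]
          grid_bounds[OF gt, of j] grid_bounds[OF gt, of "Suc j"] grid_mono[OF gt, of j "Suc j"] by auto
      have e: "rect_incr (\<lambda>p. fst p ^ k * snd p ^ l) s t i j = (s (Suc i) ^ k - s i ^ k) * (t (Suc j) ^ l - t j ^ l)"
        by (simp add: rect_incr_def algebra_simps)
      show ?thesis unfolding e
        by (intro has_bochner_integral_mult_right LQ_prod[of "\<lambda>x. cell s i x * d1 x" "\<lambda>x. cell t j x * d2 x"])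
          (use monomial_integral[OF b(1-3), of k] monomial_integral[OF b(4-6), of l] in \<open>simp_all add: cell_def d1_def d2_def\<close>)
    qed
    have "has_bochner_integral LQ (\<lambda>p. \<Sum>i<m. \<Sum>j<n. v (\<xi> i, \<eta> j) * ((cell s i (fst p) * d1 (fst p)) * (cell t j (snd p) * d2 (snd p))))
        (rs_sum v (\<lambda>p. fst p ^ k * snd p ^ l) m n s t \<xi> \<eta>)"
      unfolding rs_sum_def by (intro has_bochner_integral_sum one) auto
    moreover have "(\<lambda>p. \<Sum>i<m. \<Sum>j<n. v (\<xi> i, \<eta> j) * ((cell s i (fst p) * d1 (fst p)) * (cell t j (snd p) * d2 (snd p)))) =
        (\<lambda>p. step v m n s t \<xi> \<eta> p * d p)"
      unfolding step_def d_def sum_distrib_right by (intro ext sum.cong refl) (simp add: mult_ac)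
    ultimately have hb: "has_bochner_integral LQ (\<lambda>p. step v m n s t \<xi> \<eta> p * d p) (rs_sum v (\<lambda>p. fst p ^ k * snd p ^ l) m n s t \<xi> \<eta>)"
      by simp
    note L1 = step_L1[OF dom vm tag]
    have "rs_sum v (\<lambda>p. fst p ^ k * snd p ^ l) m n s t \<xi> \<eta> - I = (\<integral>p. step v m n s t \<xi> \<eta> p * d p - v p * d p \<partial>LQ)"
      using hb vd by (simp add: I_def has_bochner_integral_iff)
    also have "\<bar>\<dots>\<bar> \<le> (\<integral>p. \<bar>step v m n s t \<xi> \<eta> p * d p - v p * d p\<bar> \<partial>LQ)" by (rule integral_abs_bound)
    also have "\<dots> \<le> (\<integral>p. K * \<bar>step v m n s t \<xi> \<eta> p - v p\<bar> \<partial>LQ)"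
    proof (rule integral_mono)
      show "integrable LQ (\<lambda>p. \<bar>step v m n s t \<xi> \<eta> p * d p - v p * d p\<bar>)"
        using hb vd by (auto simp: has_bochner_integral_iff)
      show "integrable LQ (\<lambda>p. K * \<bar>step v m n s t \<xi> \<eta> p - v p\<bar>)" using L1(1) by auto
      fix p assume "p \<in> space LQ"
      then have "\<bar>d p\<bar> \<le> K" using dK by simp
      then have "\<bar>d p\<bar> * \<bar>step v m n s t \<xi> \<eta> p - v p\<bar> \<le> K * \<bar>step v m n s t \<xi> \<eta> p - v p\<bar>" by (intro mult_right_mono) auto
      moreover have "step v m n s t \<xi> \<eta> p * d p - v p * d p = d p * (step v m n s t \<xi> \<eta> p - v p)"
        by (simp add: algebra_simps)
      ultimately show "\<bar>step v m n s t \<xi> \<eta> p * d p - v p * d p\<bar> \<le> K * \<bar>step v m n s t \<xi> \<eta> p - v p\<bar>"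
        by (simp only: abs_mult)
    qed
    also have "\<dots> \<le> K * (\<delta> * C)" using L1(2) K0 by (simp add: C_def mult_left_mono)
    finally show ?thesis .
  qed
  have "has_rs_integral S T v (\<lambda>p. fst p ^ k * snd p ^ l) I"
    unfolding has_rs_integral_iff
  proof (intro allI impI)
    fix e :: real assume e: "e > 0"
    show "\<exists>\<delta>>0. \<forall>m n s t \<xi> \<eta>. tagged S T \<delta> m n s t \<xi> \<eta> \<longrightarrow> \<bar>rs_sum v (\<lambda>p. fst p ^ k * snd p ^ l) m n s t \<xi> \<eta> - I\<bar> < e"
    proof (intro exI[of _ "e / (K * C + 1)"] conjI allI impI)
      have KC: "K * C \<ge> 0" using K0 C0 by simp
      then show "e / (K * C + 1) > 0" using e by simp
      fix m n s t \<xi> \<eta> assume "tagged S T (e / (K * C + 1)) m n s t \<xi> \<eta>"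
      from main[OF this] have "\<bar>rs_sum v (\<lambda>p. fst p ^ k * snd p ^ l) m n s t \<xi> \<eta> - I\<bar> \<le> K * (e / (K * C + 1) * C)" .
      also have "\<dots> < e" using e KC by (simp add: field_simps)
      finally show "\<bar>rs_sum v (\<lambda>p. fst p ^ k * snd p ^ l) m n s t \<xi> \<eta> - I\<bar> < e" .
    qed
  qed
  then show ?thesis by blast
qed

lemma has_rs_integral_mono_span:
  assumes v: "bv_hk S T v" shows "mono_span x \<Longrightarrow> \<exists>I. has_rs_integral S T v x I"
proof (induction x rule: mono_span.induct)
  case (mono k l) then show ?case by (rule has_rs_integral_monomial[OF v])
next
  case (add f g) then show ?case using has_rs_integral_add[OF rs_sum_simps(1)] by blast
next
  case (scale f c) then show ?case using has_rs_integral_scale[OF rs_sum_simps(3)] by blast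
qed

text \<open>Summation by parts in both variables moves the increments from \<open>y\<close> to
  \<open>v\<close>. As \<open>y\<close> vanishes on the axes, there remain a corner term at
  \<open>(S, T)\<close>, the variations of \<open>v\<close> along the far sides and the Vitali sum;
  these are the four summands of \<open>C\<close>, and none of them depends on the
  partition.\<close>

lemma rs_sum_bound:
  assumes v: "bv_hk S T v"
  obtains C where "C \<ge> 0" "\<And>y \<epsilon> \<delta> m n s t \<xi> \<eta>. tagged S T \<delta> m n s t \<xi> \<eta> \<Longrightarrow>
    (\<And>t. t \<in> {0..T} \<Longrightarrow> y (0, t) = 0) \<Longrightarrow> (\<And>s. s \<in> {0..S} \<Longrightarrow> y (s, 0) = 0) \<Longrightarrow>
    (\<And>p. p \<in> Q \<Longrightarrow> \<bar>y p\<bar> \<le> \<epsilon>) \<Longrightarrow> \<bar>rs_sum v y m n s t \<xi> \<eta>\<bar> \<le> C * \<epsilon>"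
proof -
  obtain A B where dom: "dominated_increments S T v A B"
    using bv_hk_dominated[OF _ _ v] S_pos T_pos by (metis less_imp_le)
  note mA = dominated_increments_mono(1)[OF dom less_imp_le[OF S_pos] less_imp_le[OF T_pos]]
  note mB = dominated_increments_mono(2)[OF dom less_imp_le[OF S_pos] less_imp_le[OF T_pos]]
  obtain K1 where K1: "\<And>m n s t. grid 0 S m s \<Longrightarrow> grid 0 T n t \<Longrightarrow> (\<Sum>i<m. \<Sum>j<n. \<bar>rect_incr v s t i j\<bar>) \<le> K1"
    using v unfolding bv_hk_def by blast
  define C where "C = \<bar>v (S, T)\<bar> + (A S - A 0) + (B T - B 0) + \<bar>K1\<bar>"
  show ?thesis
  proof (rule that[of C])
    show "C \<ge> 0" unfolding C_def using mA[of 0 S] mB[of 0 T] S_pos T_pos by simp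
    fix y :: sheet and \<epsilon> \<delta> m n s t \<xi> \<eta>
    assume tag: "tagged S T \<delta> m n s t \<xi> \<eta>"
      and y1: "\<And>t. t \<in> {0..T} \<Longrightarrow> y (0, t) = 0" and y2: "\<And>s. s \<in> {0..S} \<Longrightarrow> y (s, 0) = 0"
      and yb: "\<And>p. p \<in> Q \<Longrightarrow> \<bar>y p\<bar> \<le> \<epsilon>"
    have gs: "grid 0 S m s" and gt: "grid 0 T n t" using tag by (auto simp: tagged_def)
    have e0: "\<epsilon> \<ge> 0" using yb[of "(0,0)"] S_pos T_pos by (auto simp: Qrect_def)
    have sb: "0 \<le> s i" "s i \<le> S" if "i \<le> m" for i using grid_bounds[OF gs that] by auto
    have tb: "0 \<le> t j" "t j \<le> T" if "j \<le> n" for j using grid_bounds[OF gt that] by auto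
    \<comment> \<open>The tags continued by the endpoint at index \<open>m\<close>, so that the
      boundary terms of the summation by parts involve the values of \<open>v\<close> at
      \<open>S\<close> and, with \<open>Y\<close>, at \<open>T\<close>.\<close>
    define X where "X i = (if i < m then \<xi> i else S)" for i
    define Y where "Y j = (if j < n then \<eta> j else T)" for j
    define a where "a i j = v (X i, Y j)" for i j
    define x where "x i j = y (s i, t j)" for i j
    have xi: "s i \<le> \<xi> i" "\<xi> i \<le> s (Suc i)" if "i < m" for i using tag that by (auto simp: tagged_def)
    have eta: "t j \<le> \<eta> j" "\<eta> j \<le> t (Suc j)" if "j < n" for j using tag that by (auto simp: tagged_def)
    have X: "0 \<le> X i" "X i \<le> S" for i
      using xi[of i] sb[of i] sb[of "Suc i"] S_pos unfolding X_def by (auto simp: not_less)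
    have Y: "0 \<le> Y j" "Y j \<le> T" for j
      using eta[of j] tb[of j] tb[of "Suc j"] T_pos unfolding Y_def by (auto simp: not_less)
    have Xm: "X i \<le> X (Suc i)" for i
    proof (cases "Suc i < m")
      case True then show ?thesis using xi[of i] xi[of "Suc i"] by (simp add: X_def)
    next
      case False then show ?thesis using X[of i] by (simp add: X_def)
    qed
    have Ym: "Y j \<le> Y (Suc j)" for j
    proof (cases "Suc j < n")
      case True then show ?thesis using eta[of j] eta[of "Suc j"] by (simp add: Y_def)
    next
      case False then show ?thesis using Y[of j] by (simp add: Y_def)
    qed
    have x0: "x 0 j = 0" if "j \<le> n" for j using y1[of "t j"] tb[OF that] gs by (simp add: x_def grid_def)
    have x0': "x i 0 = 0" if "i \<le> m" for i using y2[of "s i"] sb[OF that] gt by (simp add: x_def grid_def)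
    have xb: "\<bar>x i j\<bar> \<le> \<epsilon>" if "i \<le> m" "j \<le> n" for i j
      unfolding x_def using sb[OF that(1)] tb[OF that(2)] by (intro yb) (auto simp: Qrect_def)
    define e where "e i j = a i (Suc j) - a i j" for i j
    have "rs_sum v y m n s t \<xi> \<eta> = (\<Sum>i<m. \<Sum>j<n. a i j * ((x (Suc i) (Suc j) - x i (Suc j)) - (x (Suc i) j - x i j)))"
      unfolding rs_sum_def by (intro sum.cong refl) (simp add: a_def X_def Y_def x_def rect_incr_def algebra_simps)
    also have "\<dots> = (\<Sum>i<m. a i n * (x (Suc i) n - x i n) - (\<Sum>j<n. (x (Suc i) (Suc j) - x i (Suc j)) * e i j))"
    proof (intro sum.cong refl)
      fix i assume "i \<in> {..<m}"
      then show "(\<Sum>j<n. a i j * ((x (Suc i) (Suc j) - x i (Suc j)) - (x (Suc i) j - x i j))) =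
          a i n * (x (Suc i) n - x i n) - (\<Sum>j<n. (x (Suc i) (Suc j) - x i (Suc j)) * e i j)"
        by (subst Abel_summation) (simp add: x0' e_def)
    qed
    also have "\<dots> = (\<Sum>i<m. a i n * (x (Suc i) n - x i n)) - (\<Sum>j<n. \<Sum>i<m. e i j * (x (Suc i) (Suc j) - x i (Suc j)))"
    proof -
      have "(\<Sum>j<n. \<Sum>i<m. e i j * (x (Suc i) (Suc j) - x i (Suc j))) = (\<Sum>i<m. \<Sum>j<n. e i j * (x (Suc i) (Suc j) - x i (Suc j)))"
        by (rule sum.swap)
      then show ?thesis by (simp add: sum_subtractf mult.commute)
    qed
    also have "(\<Sum>i<m. a i n * (x (Suc i) n - x i n)) = a m n * x m n - (\<Sum>i<m. x (Suc i) n * (a (Suc i) n - a i n))"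
      by (subst Abel_summation) (simp add: x0)
    also have "(\<Sum>j<n. \<Sum>i<m. e i j * (x (Suc i) (Suc j) - x i (Suc j))) =
        (\<Sum>j<n. e m j * x m (Suc j) - (\<Sum>i<m. x (Suc i) (Suc j) * (e (Suc i) j - e i j)))"
    proof (intro sum.cong refl)
      fix j assume "j \<in> {..<n}"
      then show "(\<Sum>i<m. e i j * (x (Suc i) (Suc j) - x i (Suc j))) = e m j * x m (Suc j) - (\<Sum>i<m. x (Suc i) (Suc j) * (e (Suc i) j - e i j))"
        using Abel_summation[of "\<lambda>i. e i j" "\<lambda>i. x i (Suc j)" m] x0[of "Suc j"] by simp
    qed
    finally have eq: "rs_sum v y m n s t \<xi> \<eta> = a m n * x m n - (\<Sum>i<m. x (Suc i) n * (a (Suc i) n - a i n))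
      - ((\<Sum>j<n. e m j * x m (Suc j)) - (\<Sum>j<n. \<Sum>i<m. x (Suc i) (Suc j) * (e (Suc i) j - e i j)))"
      by (simp add: sum_subtractf)
    have b1: "\<bar>a m n * x m n\<bar> \<le> \<bar>v (S, T)\<bar> * \<epsilon>"
      using xb[of m n] by (simp add: a_def X_def Y_def abs_mult mult_left_mono)
    have b2: "\<bar>\<Sum>i<m. x (Suc i) n * (a (Suc i) n - a i n)\<bar> \<le> (A S - A 0) * \<epsilon>"
    proof -
      have "\<bar>\<Sum>i<m. x (Suc i) n * (a (Suc i) n - a i n)\<bar> \<le> (\<Sum>i<m. (A (X (Suc i)) - A (X i)) * \<epsilon>)"
      proof (rule order_trans[OF sum_abs], rule sum_mono)
        fix i assume "i \<in> {..<m}"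
        then have "\<bar>x (Suc i) n\<bar> \<le> \<epsilon>" by (intro xb) auto
        moreover have "\<bar>a (Suc i) n - a i n\<bar> \<le> A (X (Suc i)) - A (X i)"
          using dom X[of i] X[of "Suc i"] Xm[of i] Y[of n] by (auto simp: dominated_increments_def a_def)
        ultimately have "\<bar>a (Suc i) n - a i n\<bar> * \<bar>x (Suc i) n\<bar> \<le> (A (X (Suc i)) - A (X i)) * \<epsilon>"
          using mA[OF X(1) Xm X(2), of i] by (intro mult_mono) auto
        then show "\<bar>x (Suc i) n * (a (Suc i) n - a i n)\<bar> \<le> (A (X (Suc i)) - A (X i)) * \<epsilon>"
          by (simp add: abs_mult mult.commute)
      qed
      also have "\<dots> = (A (X m) - A (X 0)) * \<epsilon>"
        unfolding sum_distrib_right[symmetric] sum_lessThan_telescope[of "\<lambda>i. A (X i)" m] ..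
      also have "\<dots> \<le> (A S - A 0) * \<epsilon>"
        using mA[of 0 "X 0"] X[of 0] e0 by (intro mult_right_mono) (auto simp: X_def split: if_splits)
      finally show ?thesis .
    qed
    have b3: "\<bar>\<Sum>j<n. e m j * x m (Suc j)\<bar> \<le> (B T - B 0) * \<epsilon>"
    proof -
      have "\<bar>\<Sum>j<n. e m j * x m (Suc j)\<bar> \<le> (\<Sum>j<n. (B (Y (Suc j)) - B (Y j)) * \<epsilon>)"
      proof (rule order_trans[OF sum_abs], rule sum_mono)
        fix j assume "j \<in> {..<n}"
        then have "\<bar>x m (Suc j)\<bar> \<le> \<epsilon>" by (intro xb) auto
        moreover have "\<bar>e m j\<bar> \<le> B (Y (Suc j)) - B (Y j)"
          using dom Y[of j] Y[of "Suc j"] Ym[of j] X[of m] by (auto simp: dominated_increments_def a_def e_def)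
        ultimately show "\<bar>e m j * x m (Suc j)\<bar> \<le> (B (Y (Suc j)) - B (Y j)) * \<epsilon>"
          unfolding abs_mult using mB[OF Y(1) Ym Y(2), of j] by (intro mult_mono) auto
      qed
      also have "\<dots> = (B (Y n) - B (Y 0)) * \<epsilon>"
        unfolding sum_distrib_right[symmetric] sum_lessThan_telescope[of "\<lambda>i. B (Y i)" n] ..
      also have "\<dots> \<le> (B T - B 0) * \<epsilon>"
        using mB[of 0 "Y 0"] Y[of 0] e0 by (intro mult_right_mono) (auto simp: Y_def split: if_splits)
      finally show ?thesis .
    qed
    have b4: "\<bar>\<Sum>j<n. \<Sum>i<m. x (Suc i) (Suc j) * (e (Suc i) j - e i j)\<bar> \<le> \<bar>K1\<bar> * \<epsilon>"
    proof -
      \<comment> \<open>With 0 put in front, the tags themselves form a grid of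
        \<open>[0, S]\<close>, so that \<open>K1\<close> bounds the sums of increments of
        \<open>v\<close> between tags. The shift by one explains the indices \<open>Suc i\<close>
        and \<open>Suc j\<close>.\<close>
      define X' where "X' i = (case i of 0 \<Rightarrow> 0 | Suc k \<Rightarrow> X k)" for i
      define Y' where "Y' i = (case i of 0 \<Rightarrow> 0 | Suc k \<Rightarrow> Y k)" for i
      have XmS: "X m = S" and YnT: "Y n = T" by (simp_all add: X_def Y_def)
      have gX: "grid 0 S (Suc m) X'" unfolding grid_def
        using X(1)[of 0] Xm by (auto simp: X'_def XmS split: nat.split)
      have gY: "grid 0 T (Suc n) Y'" unfolding grid_def
        using Y(1)[of 0] Ym by (auto simp: Y'_def YnT split: nat.split)
      have r: "rect_incr v X' Y' (Suc i) (Suc j) = e (Suc i) j - e i j" for i j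
        by (simp add: rect_incr_def X'_def Y'_def e_def a_def)
      have "\<bar>\<Sum>j<n. \<Sum>i<m. x (Suc i) (Suc j) * (e (Suc i) j - e i j)\<bar> \<le> (\<Sum>j<n. \<Sum>i<m. \<bar>x (Suc i) (Suc j) * (e (Suc i) j - e i j)\<bar>)"
        by (intro order_trans[OF sum_abs] sum_mono sum_abs)
      also have "\<dots> \<le> (\<Sum>j<n. \<Sum>i<m. \<bar>rect_incr v X' Y' (Suc i) (Suc j)\<bar> * \<epsilon>)"
      proof (intro sum_mono)
        fix i j assume "i \<in> {..<m}" "j \<in> {..<n}"
        then have "\<bar>x (Suc i) (Suc j)\<bar> \<le> \<epsilon>" by (intro xb) auto
        then show "\<bar>x (Suc i) (Suc j) * (e (Suc i) j - e i j)\<bar> \<le> \<bar>rect_incr v X' Y' (Suc i) (Suc j)\<bar> * \<epsilon>"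
          unfolding abs_mult r mult.commute[of "\<bar>e (Suc i) j - e i j\<bar>"] by (intro mult_right_mono) auto
      qed
      also have "\<dots> = (\<Sum>i<m. \<Sum>j<n. \<bar>rect_incr v X' Y' (Suc i) (Suc j)\<bar>) * \<epsilon>"
        by (subst sum.swap) (simp add: sum_distrib_right)
      also have "\<dots> \<le> (\<Sum>i<Suc m. \<Sum>j<Suc n. \<bar>rect_incr v X' Y' i j\<bar>) * \<epsilon>"
      proof (rule mult_right_mono[OF _ e0])
        have "(\<Sum>j<n. \<bar>rect_incr v X' Y' (Suc i) (Suc j)\<bar>) \<le> (\<Sum>j<Suc n. \<bar>rect_incr v X' Y' (Suc i) j\<bar>)" for i
          by (subst sum.lessThan_Suc_shift) simp
        then have "(\<Sum>i<m. \<Sum>j<n. \<bar>rect_incr v X' Y' (Suc i) (Suc j)\<bar>) \<le> (\<Sum>i<m. \<Sum>j<Suc n. \<bar>rect_incr v X' Y' (Suc i) j\<bar>)"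
          by (intro sum_mono)
        also have "\<dots> \<le> (\<Sum>i<Suc m. \<Sum>j<Suc n. \<bar>rect_incr v X' Y' i j\<bar>)"
          by (subst sum.lessThan_Suc_shift[of _ m]) (simp add: sum_nonneg del: sum.lessThan_Suc)
        finally show "(\<Sum>i<m. \<Sum>j<n. \<bar>rect_incr v X' Y' (Suc i) (Suc j)\<bar>) \<le> (\<Sum>i<Suc m. \<Sum>j<Suc n. \<bar>rect_incr v X' Y' i j\<bar>)" .
      qed
      also have "\<dots> \<le> \<bar>K1\<bar> * \<epsilon>" using K1[OF gX gY] e0 by (intro mult_right_mono) auto
      finally show ?thesis .
    qed
    show "\<bar>rs_sum v y m n s t \<xi> \<eta>\<bar> \<le> C * \<epsilon>"
      unfolding eq C_def using b1 b2 b3 b4 by (simp add: distrib_right del: sum.lessThan_Suc)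
  qed
qed

text \<open>Polynomials are uniformly dense in the continuous functions on \<open>Q\<close>, and by
  \<open>rs_sum_bound\<close> all Riemann sums are equicontinuous in the path, so integrability
  passes to uniform limits.\<close>

lemma has_rs_integral_C0:
  assumes v: "bv_hk S T v" and x: "x \<in> C0 S T"
  shows "\<exists>I. has_rs_integral S T v x I"
proof -
  obtain C where C: "C \<ge> 0" "\<And>y \<epsilon> \<delta> m n s t \<xi> \<eta>. tagged S T \<delta> m n s t \<xi> \<eta> \<Longrightarrow>
    (\<And>t. t \<in> {0..T} \<Longrightarrow> y (0, t) = 0) \<Longrightarrow> (\<And>s. s \<in> {0..S} \<Longrightarrow> y (s, 0) = 0) \<Longrightarrow>
    (\<And>p. p \<in> Q \<Longrightarrow> \<bar>y p\<bar> \<le> \<epsilon>) \<Longrightarrow> \<bar>rs_sum v y m n s t \<xi> \<eta>\<bar> \<le> C * \<epsilon>"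
    using rs_sum_bound[OF v] by blast
  have Qc: "compact Q" unfolding Qrect_def by (intro compact_Times compact_Icc)
  have "\<exists>g. mono_span g \<and> (\<forall>p\<in>Q. \<bar>x p - g p\<bar> < 1 / real (Suc k))" for k
  proof -
    have "1 / real (Suc k) > 0" by simp
    moreover have "continuous_on Q x" using x by (simp add: C0_def)
    ultimately obtain g where "real_polynomial_function g" "\<And>p. p \<in> Q \<Longrightarrow> \<bar>x p - g p\<bar> < 1 / real (Suc k)"
      using Stone_Weierstrass_real_polynomial_function[OF Qc] by blast
    then show ?thesis using mono_span_real_polynomial_function by blast
  qed
  then obtain g where g: "\<And>k. mono_span (g k)" "\<And>k p. p \<in> Q \<Longrightarrow> \<bar>x p - g k p\<bar> < 1 / real (Suc k)"
    by metis
  obtain I where I: "\<And>k. has_rs_integral S T v (g k) (I k)"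
    using has_rs_integral_mono_span[OF v g(1)] by metis
  define E where "E k = C * (4 * (1 / real (Suc k)))" for k
  have close: "\<bar>rs_sum v x m n s t \<xi> \<eta> - rs_sum v (g k) m n s t \<xi> \<eta>\<bar> \<le> E k"
    if tag: "tagged S T \<delta> m n s t \<xi> \<eta>" for \<delta> m n s t \<xi> \<eta> k
  proof -
    define y where "y p = x p - g k p" for p
    \<comment> \<open>The approximating polynomial need not vanish on the axes, as
      \<open>rs_sum_bound\<close> demands. Subtracting functions of one variable alone restores this
      without changing any rectangle increment, at the price of a factor 4.\<close>
    define y' where "y' p = y p - y (fst p, 0) - y (0, snd p) + y (0, 0)" for p
    have yb: "\<bar>y p\<bar> \<le> 1 / real (Suc k)" if "p \<in> Q" for p using g(2)[OF that, of k] by (simp add: y_def)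
    have "\<bar>rs_sum v y' m n s t \<xi> \<eta>\<bar> \<le> E k"
      unfolding E_def
    proof (rule C(2)[OF tag])
      fix p assume "p \<in> Q"
      then have "p \<in> Q" "(fst p, 0) \<in> Q" "(0, snd p) \<in> Q" "(0, 0) \<in> Q" by (auto simp: Qrect_def)
      from this[THEN yb] show "\<bar>y' p\<bar> \<le> 4 * (1 / real (Suc k))" unfolding y'_def by linarith
    qed (simp_all add: y'_def)
    moreover have "rs_sum v y' m n s t \<xi> \<eta> = rs_sum v y m n s t \<xi> \<eta>"
      unfolding rs_sum_def rect_incr_def y'_def by (intro sum.cong refl) (simp add: algebra_simps)
    moreover have "rs_sum v y m n s t \<xi> \<eta> = rs_sum v x m n s t \<xi> \<eta> - rs_sum v (g k) m n s t \<xi> \<eta>"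
      unfolding y_def by (rule rs_sum_simps)
    ultimately show ?thesis by simp
  qed
  have ctag: "\<bar>urs v (g k) N - urs v (g l) N\<bar> \<le> E k + E l" for k l N
    using close[OF unif_tagged[OF less_add_one], of N k] close[OF unif_tagged[OF less_add_one], of N l] by linarith
  have dI: "\<bar>I k - I l\<bar> \<le> E k + E l" for k l
  proof (rule LIMSEQ_le_const2)
    show "(\<lambda>N. \<bar>urs v (g k) N - urs v (g l) N\<bar>) \<longlonglongrightarrow> \<bar>I k - I l\<bar>"
      by (intro tendsto_rabs tendsto_diff has_rs_integral_urs I)
  qed (use ctag in auto)
  have E0: "E \<longlonglongrightarrow> 0"
  proof -
    have "(\<lambda>k. C * 4 * (1 / real (Suc k))) \<longlonglongrightarrow> C * 4 * 0"
      by (intro tendsto_mult tendsto_const LIMSEQ_Suc lim_1_over_n)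
    then show ?thesis by (simp add: E_def[abs_def] mult.assoc)
  qed
  have "Cauchy I"
  proof (rule metric_CauchyI)
    fix e :: real assume "e > 0"
    then obtain M where M: "\<And>k. k \<ge> M \<Longrightarrow> \<bar>E k\<bar> < e / 2"
      using E0 LIMSEQ_D[of E 0 "e/2"] by auto
    show "\<exists>M. \<forall>m\<ge>M. \<forall>n\<ge>M. dist (I m) (I n) < e"
      using dI M by (intro exI[of _ M]) (smt (verit, best) dist_real_def field_sum_of_halves)
  qed
  then obtain J where J: "I \<longlonglongrightarrow> J" using Cauchy_convergent convergent_def by blast
  have IJ: "\<bar>I k - J\<bar> \<le> E k" for k
  proof (rule LIMSEQ_le)
    show "(\<lambda>l. \<bar>I k - I l\<bar>) \<longlonglongrightarrow> \<bar>I k - J\<bar>" by (intro tendsto_intros J)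
    show "(\<lambda>l. E k + E l) \<longlonglongrightarrow> E k" using tendsto_add[OF tendsto_const E0, of "E k"] by simp
  qed (use dI in auto)
  have "has_rs_integral S T v x J"
    unfolding has_rs_integral_iff
  proof (intro allI impI)
    fix e :: real assume e: "e > 0"
    then obtain k where k: "\<bar>E k\<bar> < e / 3" using LIMSEQ_D[OF E0, of "e/3"] by auto
    obtain d where d: "d > 0" "\<And>m n s t \<xi> \<eta>. tagged S T d m n s t \<xi> \<eta> \<Longrightarrow> \<bar>rs_sum v (g k) m n s t \<xi> \<eta> - I k\<bar> < e / 3"
      using I[of k] e unfolding has_rs_integral_iff by (meson divide_pos_pos zero_less_numeral)
    show "\<exists>\<delta>>0. \<forall>m n s t \<xi> \<eta>. tagged S T \<delta> m n s t \<xi> \<eta> \<longrightarrow> \<bar>rs_sum v x m n s t \<xi> \<eta> - J\<bar> < e"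
    proof (intro exI[of _ d] conjI allI impI)
      fix m n s t \<xi> \<eta> assume tag: "tagged S T d m n s t \<xi> \<eta>"
      show "\<bar>rs_sum v x m n s t \<xi> \<eta> - J\<bar> < e"
        using close[OF tag, of k] d(2)[OF tag] IJ[of k] k by linarith
    qed (rule d(1))
  qed
  then show ?thesis by blast
qed

lemma has_rs_integral_rs_integral:
  "bv_hk S T v \<Longrightarrow> x \<in> C0 S T \<Longrightarrow> has_rs_integral S T v x (rs_integral S T v x)"
  using has_rs_integral_C0 rs_integral_eq by metis

lemma rs_integral_sum:
  assumes v: "\<And>j. j \<in> J \<Longrightarrow> bv_hk S T (v j)" and x: "x \<in> C0 S T"
  shows "has_rs_integral S T (\<lambda>p. \<Sum>j\<in>J. c j * v j p) x (\<Sum>j\<in>J. c j * rs_integral S T (v j) x)"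
  using v
proof (induction J rule: infinite_finite_induct)
  case (insert j J)
  then have "has_rs_integral S T (\<lambda>p. c j * v j p) x (c j * rs_integral S T (v j) x)"
    by (intro has_rs_integral_scale[OF rs_sum_simps(5)] has_rs_integral_rs_integral x) auto
  with insert show ?case by (simp add: has_rs_integral_add[OF rs_sum_simps(4)])
next
  \<comment> \<open>Over an infinite index set both sums are 0 by convention, which leaves the zero
    integrand.\<close>
  case (infinite J)
  then show ?case by (auto simp: has_rs_integral_iff rs_sum_simps(6) intro!: exI[of _ 1])
next
  case empty
  then show ?case by (auto simp: has_rs_integral_iff rs_sum_simps(6) intro!: exI[of _ 1])
qed

end

section \<open>Linear operations on functions of bounded variation\<close>

lemma bv_hk_add:
  assumes h: "bv_hk S T h" and k: "bv_hk S T k"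
  shows "bv_hk S T (\<lambda>p. h p + k p)"
proof -
  obtain K1 K2 K3 where h': "\<And>m n s t. grid 0 S m s \<and> grid 0 T n t \<Longrightarrow> (\<Sum>i<m. \<Sum>j<n. \<bar>rect_incr h s t i j\<bar>) \<le> K1"
    "\<And>n s. grid 0 S n s \<Longrightarrow> (\<Sum>i<n. \<bar>h (s (Suc i), 0) - h (s i, 0)\<bar>) \<le> K2"
    "\<And>n s. grid 0 T n s \<Longrightarrow> (\<Sum>i<n. \<bar>h (0, s (Suc i)) - h (0, s i)\<bar>) \<le> K3"
    using h unfolding bv_hk_def bv1_def by blast
  obtain L1 L2 L3 where k': "\<And>m n s t. grid 0 S m s \<and> grid 0 T n t \<Longrightarrow> (\<Sum>i<m. \<Sum>j<n. \<bar>rect_incr k s t i j\<bar>) \<le> L1"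
    "\<And>n s. grid 0 S n s \<Longrightarrow> (\<Sum>i<n. \<bar>k (s (Suc i), 0) - k (s i, 0)\<bar>) \<le> L2"
    "\<And>n s. grid 0 T n s \<Longrightarrow> (\<Sum>i<n. \<bar>k (0, s (Suc i)) - k (0, s i)\<bar>) \<le> L3"
    using k unfolding bv_hk_def bv1_def by blast
  have 1: "(\<Sum>i<m. \<Sum>j<n. \<bar>rect_incr (\<lambda>p. h p + k p) s t i j\<bar>) \<le> K1 + L1" if "grid 0 S m s \<and> grid 0 T n t" for m n s t
  proof -
    have "(\<Sum>i<m. \<Sum>j<n. \<bar>rect_incr (\<lambda>p. h p + k p) s t i j\<bar>) \<le> (\<Sum>i<m. \<Sum>j<n. \<bar>rect_incr h s t i j\<bar> + \<bar>rect_incr k s t i j\<bar>)"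
      unfolding rect_incr_simps by (intro sum_mono abs_triangle_ineq)
    then show ?thesis using h'(1)[OF that] k'(1)[OF that] by (simp add: sum.distrib)
  qed
  have 2: "(\<Sum>i<n. \<bar>(h (s (Suc i), 0) + k (s (Suc i), 0)) - (h (s i, 0) + k (s i, 0))\<bar>) \<le> K2 + L2" if "grid 0 S n s" for n s
  proof -
    have "(\<Sum>i<n. \<bar>(h (s (Suc i), 0) + k (s (Suc i), 0)) - (h (s i, 0) + k (s i, 0))\<bar>) \<le>
        (\<Sum>i<n. \<bar>h (s (Suc i), 0) - h (s i, 0)\<bar> + \<bar>k (s (Suc i), 0) - k (s i, 0)\<bar>)"
      by (intro sum_mono) linarith
    then show ?thesis using h'(2)[OF that] k'(2)[OF that] by (simp add: sum.distrib)
  qed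
  have 3: "(\<Sum>i<n. \<bar>(h (0, s (Suc i)) + k (0, s (Suc i))) - (h (0, s i) + k (0, s i))\<bar>) \<le> K3 + L3" if "grid 0 T n s" for n s
  proof -
    have "(\<Sum>i<n. \<bar>(h (0, s (Suc i)) + k (0, s (Suc i))) - (h (0, s i) + k (0, s i))\<bar>) \<le>
        (\<Sum>i<n. \<bar>h (0, s (Suc i)) - h (0, s i)\<bar> + \<bar>k (0, s (Suc i)) - k (0, s i)\<bar>)"
      by (intro sum_mono) linarith
    then show ?thesis using h'(3)[OF that] k'(3)[OF that] by (simp add: sum.distrib)
  qed
  show ?thesis unfolding bv_hk_def bv1_def using 1 2 3 by blast
qed

lemma bv_hk_scale:
  assumes h: "bv_hk S T h" shows "bv_hk S T (\<lambda>p. c * h p)"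
proof -
  have e: "\<bar>c * a - c * b\<bar> = \<bar>c\<bar> * \<bar>a - b\<bar>" for a b :: real by (simp flip: right_diff_distrib abs_mult)
  have m: "\<bar>c\<bar> * x \<le> \<bar>c\<bar> * K" if "x \<le> K" for x K :: real using that by (intro mult_left_mono) auto
  show ?thesis
    using h unfolding bv_hk_def bv1_def rect_incr_simps e abs_mult sum_distrib_left[symmetric] by (meson m)
qed

lemma bv_hk_sum: "(\<And>j. j \<in> J \<Longrightarrow> bv_hk S T (v j)) \<Longrightarrow> bv_hk S T (\<lambda>p. \<Sum>j\<in>J. c j * v j p)"
proof (induction J rule: infinite_finite_induct)
  case (insert j J)
  then show ?case by (simp add: bv_hk_add bv_hk_scale)
qed (auto simp: bv_hk_def bv1_def rect_incr_def)

section \<open>Gaussian functionals\<close>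

lemma normal_density_distr:
  assumes "\<sigma> > 0"
  shows "density lborel (normal_density 0 \<sigma>) = distr std_normal_distribution lborel (\<lambda>x. \<sigma> * x)"
proof -
  interpret N: prob_space std_normal_distribution
    using prob_space_normal_density[of 1 0] by simp
  have "distributed std_normal_distribution lborel (\<lambda>x. x) std_normal_density"
    unfolding distributed_def by (auto simp: distr_id2)
  from N.normal_density_affine[OF this, of \<sigma> 0] assms
  have "distributed std_normal_distribution lborel (\<lambda>x. \<sigma> * x) (normal_density 0 \<sigma>)" by simp
  then show ?thesis by (simp add: distributed_def)
qed

text \<open>The point mass at 0 is the case \<open>V = 0\<close>, so degenerate combinations of
  evaluations obey the same formulas as the others.\<close>

lemma centered_normal_moments:
  fixes D :: "real measure"
  assumes D: "centered_normal D"
  obtains V where "V \<ge> 0" "has_bochner_integral D (\<lambda>x. x\<^sup>2) V" "has_bochner_integral D (\<lambda>x. x ^ 4) (3 * V\<^sup>2)"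
    "\<And>t. (\<integral>x. iexp (t * x) \<partial>D) = complex_of_real (exp (- (t\<^sup>2 * V / 2)))"
proof -
  consider "D = return borel 0" | \<sigma> where "\<sigma> > 0" "D = density lborel (normal_density 0 \<sigma>)"
    using D by (auto simp: centered_normal_def)
  then show ?thesis
  proof cases
    case 1
    have hb: "has_bochner_integral (return borel 0) f (f 0)" if "f \<in> borel_measurable borel" for f :: "real \<Rightarrow> 'b :: {banach, second_countable_topology}"
    proof -
      interpret R: prob_space "return borel (0::real)" by (rule prob_space_return) simp
      have "has_bochner_integral (return borel (0::real)) (\<lambda>_. f 0) (f 0)"
        using R.prob_space by (simp add: has_bochner_integral_iff)
      moreover have "AE x in return borel (0::real). f 0 = f x"
        using that by (subst AE_return) auto
      ultimately show ?thesis using that by (subst (asm) has_bochner_integral_cong_AE) auto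
    qed
    show ?thesis
      by (rule that[of 0]) (use hb[of "\<lambda>x::real. x\<^sup>2"] hb[of "\<lambda>x::real. x^4"] in \<open>auto simp: 1 integral_return\<close>)
  next
    case 2
    have hb: "has_bochner_integral D f I" if "has_bochner_integral lborel (\<lambda>x. normal_density 0 \<sigma> x * f x) I" "f \<in> borel_measurable borel" for f :: "real \<Rightarrow> real" and I
      unfolding 2(2) using that by (intro has_bochner_integral_density) auto
    have m2: "has_bochner_integral D (\<lambda>x. x\<^sup>2) (\<sigma>\<^sup>2)"
      using hb[of "\<lambda>x. x\<^sup>2"] normal_moment_even[OF 2(1), of 0 1] by (simp add: numeral_2_eq_2)
    have m4: "has_bochner_integral D (\<lambda>x. x ^ 4) (3 * (\<sigma>\<^sup>2)\<^sup>2)"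
      using hb[of "\<lambda>x. x^4"] normal_moment_even[OF 2(1), of 0 2] 2(1)
      by (simp add: fact_numeral field_simps power2_eq_square)
    have ch: "(\<integral>x. iexp (t * x) \<partial>D) = complex_of_real (exp (- (t\<^sup>2 * \<sigma>\<^sup>2 / 2)))" for t
    proof -
      have "(\<integral>x. iexp (t * x) \<partial>D) = char std_normal_distribution (t * \<sigma>)"
        unfolding 2(2) normal_density_distr[OF 2(1)] char_def
        by (subst integral_distr) (auto simp: mult_ac)
      then show ?thesis by (simp add: char_std_normal_distribution power_mult_distrib)
    qed
    show ?thesis by (rule that[OF _ m2 m4 ch]) simp
  qed
qed

section \<open>The isometry between evaluations and indicators of boxes\<close>

context rectangle
begin

definition box_ind :: "real \<times> real \<Rightarrow> sheet" where
  "box_ind p q = indicator {0..fst p} (fst q) * indicator {0..snd p} (snd q)"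

text \<open>The graph of the isometry sending the evaluation at \<open>p\<close> to the indicator of
  \<open>[0,p]\<close>. Being a relation, it asks for no choice of \<open>I\<close> and
  \<open>a\<close>.\<close>

definition lin_pair :: "(sheet \<Rightarrow> real) \<Rightarrow> sheet \<Rightarrow> bool" where
  "lin_pair l g \<longleftrightarrow> (\<exists>I a. finite I \<and> I \<subseteq> Q \<and> (\<forall>x. l x = (\<Sum>p\<in>I. a p * x p)) \<and> (\<forall>q. g q = (\<Sum>p\<in>I. a p * box_ind p q)))"

lemma lin_pair_eval: "p \<in> Q \<Longrightarrow> lin_pair (\<lambda>x. x p) (box_ind p)"
  unfolding lin_pair_def by (intro exI[of _ "{p}"] exI[of _ "\<lambda>_. 1"]) auto

lemma lin_pair_scale: "lin_pair l g \<Longrightarrow> lin_pair (\<lambda>x. c * l x) (\<lambda>q. c * g q)"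
proof -
  assume "lin_pair l g"
  then obtain I a where "finite I" "I \<subseteq> Q" "\<And>x. l x = (\<Sum>p\<in>I. a p * x p)" "\<And>q. g q = (\<Sum>p\<in>I. a p * box_ind p q)"
    unfolding lin_pair_def by blast
  then show ?thesis unfolding lin_pair_def
    by (intro exI[of _ I] exI[of _ "\<lambda>p. c * a p"]) (auto simp: sum_distrib_left mult.assoc)
qed

lemma lin_pair_add: "lin_pair l g \<Longrightarrow> lin_pair l' g' \<Longrightarrow> lin_pair (\<lambda>x. l x + l' x) (\<lambda>q. g q + g' q)"
proof -
  assume "lin_pair l g" "lin_pair l' g'"
  then obtain I a J b where I: "finite I" "I \<subseteq> Q" "\<And>x. l x = (\<Sum>p\<in>I. a p * x p)" "\<And>q. g q = (\<Sum>p\<in>I. a p * box_ind p q)"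
    and J: "finite J" "J \<subseteq> Q" "\<And>x. l' x = (\<Sum>p\<in>J. b p * x p)" "\<And>q. g' q = (\<Sum>p\<in>J. b p * box_ind p q)"
    unfolding lin_pair_def by blast
  have s: "(\<Sum>p\<in>I \<union> J. ((if p \<in> I then a p else 0) + (if p \<in> J then b p else 0)) * f p) = (\<Sum>p\<in>I. a p * f p) + (\<Sum>p\<in>J. b p * f p)" for f :: "real \<times> real \<Rightarrow> real"
  proof -
    have "(\<Sum>p\<in>I \<union> J. (if p \<in> I then a p else 0) * f p) = (\<Sum>p\<in>I. a p * f p)"
      using I(1) J(1) by (intro sum.mono_neutral_cong_right) auto
    moreover have "(\<Sum>p\<in>I \<union> J. (if p \<in> J then b p else 0) * f p) = (\<Sum>p\<in>J. b p * f p)"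
      using I(1) J(1) by (intro sum.mono_neutral_cong_right) auto
    ultimately show ?thesis by (simp add: distrib_right sum.distrib)
  qed
  show ?thesis unfolding lin_pair_def
    using I J by (intro exI[of _ "I \<union> J"] exI[of _ "\<lambda>p. (if p \<in> I then a p else 0) + (if p \<in> J then b p else 0)"]) (simp add: s)
qed

lemma lin_pair_zero: "lin_pair (\<lambda>x. 0) (\<lambda>q. 0)"
  unfolding lin_pair_def by (intro exI[of _ "{}"]) auto

lemma lin_pair_sum: "(\<And>i. i \<in> I \<Longrightarrow> lin_pair (l i) (g i)) \<Longrightarrow> lin_pair (\<lambda>x. \<Sum>i\<in>I. l i x) (\<lambda>q. \<Sum>i\<in>I. g i q)"
  by (induction I rule: infinite_finite_induct) (auto simp: lin_pair_zero lin_pair_add)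

text \<open>By inclusion and exclusion of four boxes the partner of a rectangle increment is the
  indicator of the half-open cell; linearity turns a Riemann sum into its step function.\<close>

lemma lin_pair_rs_sum:
  assumes tag: "tagged S T \<delta> m n s t \<xi> \<eta>"
  shows "lin_pair (\<lambda>x. rs_sum v x m n s t \<xi> \<eta>) (step v m n s t \<xi> \<eta>)"
proof -
  have gs: "grid 0 S m s" and gt: "grid 0 T n t" using tag by (auto simp: tagged_def)
  have "lin_pair (\<lambda>x. rect_incr x s t i j) (\<lambda>q. cell s i (fst q) * cell t j (snd q))" if ij: "i < m" "j < n" for i j
  proof -
    have b: "0 \<le> s i" "s i \<le> s (Suc i)" "s (Suc i) \<le> S" "0 \<le> t j" "t j \<le> t (Suc j)" "t (Suc j) \<le> T"
      using ij grid_bounds[OF gs, of i] grid_bounds[OF gs, of "Suc i"] grid_mono[OF gs, of i "Suc i"]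
        grid_bounds[OF gt, of j] grid_bounds[OF gt, of "Suc j"] grid_mono[OF gt, of j "Suc j"] by auto
    have "lin_pair (\<lambda>x. (x (s (Suc i), t (Suc j)) + (-1) * x (s (Suc i), t j)) + ((-1) * x (s i, t (Suc j)) + x (s i, t j)))
      (\<lambda>q. (box_ind (s (Suc i), t (Suc j)) q + (-1) * box_ind (s (Suc i), t j) q) + ((-1) * box_ind (s i, t (Suc j)) q + box_ind (s i, t j) q))"
      using b by (intro lin_pair_add lin_pair_scale lin_pair_eval) (auto simp: Qrect_def)
    moreover have "(\<lambda>q. (box_ind (s (Suc i), t (Suc j)) q + (-1) * box_ind (s (Suc i), t j) q) + ((-1) * box_ind (s i, t (Suc j)) q + box_ind (s i, t j) q))
      = (\<lambda>q. cell s i (fst q) * cell t j (snd q))"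
    proof
      fix q :: "real \<times> real"
      have 1: "cell s i x = indicator {0..s (Suc i)} x - indicator {0..s i} x" for x
        using b by (auto simp: cell_def indicator_def)
      have 2: "cell t j x = indicator {0..t (Suc j)} x - indicator {0..t j} x" for x
        using b by (auto simp: cell_def indicator_def)
      show "(box_ind (s (Suc i), t (Suc j)) q + (-1) * box_ind (s (Suc i), t j) q) + ((-1) * box_ind (s i, t (Suc j)) q + box_ind (s i, t j) q)
        = cell s i (fst q) * cell t j (snd q)"
        unfolding 1 2 box_ind_def fst_conv snd_conv by (simp add: algebra_simps del: indicator_simps)
    qed
    ultimately show ?thesis by (simp add: rect_incr_def algebra_simps)
  qed
  then show ?thesis unfolding rs_sum_def step_def[abs_def]
    by (intro lin_pair_sum lin_pair_scale) auto
qed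

lemma box_ind_L2: "box_ind p \<in> LL"
proof (rule L2_bounded[where K=1])
  show "box_ind p \<in> borel_measurable LQ"
    unfolding box_ind_def[abs_def]
    by (intro LQ_measurable_of_borel borel_measurable_times borel_measurable_fst_snd) auto
qed (auto simp: box_ind_def indicator_def)

lemma ip_box_ind:
  assumes "p \<in> Q" "q \<in> Q"
  shows "ip (box_ind p) (box_ind q) = min (fst p) (fst q) * min (snd p) (snd q)"
proof -
  have i: "has_bochner_integral lborel (\<lambda>x. indicator {0..c} x * (indicator {0..a} x * indicator {0..b} x)) (min a b)"
    if "0 \<le> a" "a \<le> c" "0 \<le> b" "b \<le> c" for a b c :: real
  proof -
    have "(\<lambda>x. indicator {0..c} x * (indicator {0..a} x * indicator {0..b} x)) = (indicator {0..min a b} :: real \<Rightarrow> real)"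
      using that by (auto simp: indicator_def)
    then show ?thesis using that by (simp add: has_bochner_integral_iff)
  qed
  have "has_bochner_integral LQ (\<lambda>z. (indicator {0..fst p} (fst z) * indicator {0..fst q} (fst z)) * (indicator {0..snd p} (snd z) * indicator {0..snd q} (snd z)))
    (min (fst p) (fst q) * min (snd p) (snd q))"
    using assms
    by (intro LQ_prod[of "\<lambda>x. indicator {0..fst p} x * indicator {0..fst q} x" "\<lambda>x. indicator {0..snd p} x * indicator {0..snd q} x"] i)
      (auto simp: Qrect_def)
  moreover have "(\<lambda>z. (indicator {0..fst p} (fst z) * indicator {0..fst q} (fst z)) * (indicator {0..snd p} (snd z) * indicator {0..snd q} (snd z)))
     = (\<lambda>z. box_ind p z * box_ind q z)" by (auto simp: box_ind_def)
  ultimately show ?thesis by (simp add: inner2_def has_bochner_integral_integral_eq)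
qed

text \<open>Mean convergence of the steps improves to mean square convergence because their values
  are values of \<open>v\<close>: an error bounded by \<open>2 * K\<close> satisfies
  \<open>d^2 \<le> 2 * K * \<bar>d\<bar>\<close>.\<close>

lemma ustep_nsq:
  assumes v: "bv_hk S T v" shows "(\<lambda>N. nsq (ustep v N)) \<longlonglongrightarrow> nsq v"
proof -
  obtain A B where dom: "dominated_increments S T v A B"
    using bv_hk_dominated[OF _ _ v] S_pos T_pos by (metis less_imp_le)
  obtain K where K: "\<And>p. p \<in> Q \<Longrightarrow> \<bar>v p\<bar> \<le> K" using bv_bounded[OF v] by blast
  have K0: "0 \<le> K" using K[of "(0,0)"] S_pos T_pos by (auto simp: Qrect_def)
  note vm = bv_measurable[OF v] and vL = bv_L2[OF v]
  define C where "C = T * (A S - A 0) + S * (B T - B 0)"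
  have tag: "tagged S T (2 * max S T / real (Suc N)) (Suc N) (Suc N) (unif S N) (unif T N) (unif S N) (unif T N)" for N
    using S_pos T_pos by (intro unif_tagged divide_strict_right_mono) auto
  note L1 = step_L1[OF dom vm tag]
  define d where "d N p = ustep v N p - v p" for N p
  have dK: "AE p in LQ. \<bar>d N p\<bar> \<le> 2 * K" for N
    using LQ_AE_pos
  proof eventually_elim
    case (elim p)
    then obtain q where "q \<in> Q" "ustep v N p = v q"
      using step_close(2)[OF dom tag, of p N] unfolding Qrect_def by blast
    moreover have "p \<in> Q" using elim by (cases p) (auto simp: Qrect_def)
    ultimately show ?case using K[of q] K[of p] by (simp add: d_def)
  qed
  have dm: "d N \<in> borel_measurable LQ" for N
    unfolding d_def[abs_def] using vm step_measurable by (rule borel_measurable_diff[rotated])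
  have dsq: "AE p in LQ. norm ((d N p)\<^sup>2) \<le> norm (2 * K * \<bar>d N p\<bar>)" for N
    using dK[of N]
  proof eventually_elim
    case (elim p)
    then have "\<bar>d N p\<bar> * \<bar>d N p\<bar> \<le> 2 * K * \<bar>d N p\<bar>" by (intro mult_right_mono) auto
    then show ?case using K0 by (simp add: power2_eq_square abs_mult)
  qed
  have di: "integrable LQ (\<lambda>p. 2 * K * \<bar>d N p\<bar>)" for N
    using L1(1)[of N] by (auto simp: d_def)
  have dL: "d N \<in> LL" for N
    unfolding L2_def using dm[of N] Bochner_Integration.integrable_bound[OF di _ dsq[of N]] by auto
  have nb: "nsq (d N) \<le> 2 * K * (2 * max S T / real (Suc N) * C)" for N
  proof -
    have "nsq (d N) = (\<integral>p. (d N p)\<^sup>2 \<partial>LQ)" by (simp add: inner2_def power2_eq_square)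
    also have "\<dots> \<le> (\<integral>p. 2 * K * \<bar>d N p\<bar> \<partial>LQ)"
      using dsq[of N] K0 by (intro integral_mono_AE L2_square dL di) (auto elim!: eventually_mono)
    also have "\<dots> = 2 * K * (\<integral>p. \<bar>d N p\<bar> \<partial>LQ)" by simp
    also have "\<dots> \<le> 2 * K * (2 * max S T / real (Suc N) * C)"
      using L1(2)[of N] K0 unfolding C_def d_def by (intro mult_left_mono) auto
    finally show ?thesis .
  qed
  have lim0: "(\<lambda>N. nsq (d N)) \<longlonglongrightarrow> 0"
  proof (rule tendsto_sandwich[of "\<lambda>_. 0" _ _ "\<lambda>N. 4 * K * max S T * C * (1 / real (Suc N))"])
    have "(\<lambda>N. 4 * K * max S T * C * (1 / real (Suc N))) \<longlonglongrightarrow> 4 * K * max S T * C * 0"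
      by (intro tendsto_mult tendsto_const LIMSEQ_Suc lim_1_over_n)
    then show "(\<lambda>N. 4 * K * max S T * C * (1 / real (Suc N))) \<longlonglongrightarrow> 0" by simp
    show "\<forall>\<^sub>F N in sequentially. nsq (d N) \<le> 4 * K * max S T * C * (1 / real (Suc N))"
      using nb by (intro always_eventually allI) (simp add: mult_ac)
  qed (auto simp: nsq_nonneg)
  have ip0: "(\<lambda>N. ip v (d N)) \<longlonglongrightarrow> 0"
  proof (rule tendsto_rabs_zero_cancel, rule tendsto_sandwich[of "\<lambda>_. 0" _ _ "\<lambda>N. norm2 S T v * sqrt (nsq (d N))"])
    show "(\<lambda>N. norm2 S T v * sqrt (nsq (d N))) \<longlonglongrightarrow> 0"
      using tendsto_mult[OF tendsto_const tendsto_real_sqrt[OF lim0], of "norm2 S T v"] by simp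
    show "\<forall>\<^sub>F N in sequentially. \<bar>ip v (d N)\<bar> \<le> norm2 S T v * sqrt (nsq (d N))"
      using Cauchy_Schwarz_abs[OF vL dL] by (intro always_eventually allI) (simp add: norm2_def)
  qed auto
  have "nsq (ustep v N) = nsq v + 2 * ip v (d N) + nsq (d N)" for N
  proof -
    have "ustep v N = (\<lambda>p. v p + d N p)" by (auto simp: d_def)
    then show ?thesis using nsq_add[OF vL dL, of N] by simp
  qed
  moreover have "(\<lambda>N. nsq v + 2 * ip v (d N) + nsq (d N)) \<longlonglongrightarrow> nsq v + 2 * 0 + 0"
    by (intro tendsto_add tendsto_mult tendsto_const ip0 lim0)
  ultimately show ?thesis by simp
qed

end

text \<open>\<open>M\<close> is the Yeh-Wiener measure before completion. Product measures and
  measurability are handled on \<open>M\<close>; \<open>s_ae_iff\<close> and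
  \<open>integrable_completionI\<close> translate the notions that refer to the completion.\<close>

locale yeh_wiener = rectangle_basis S T \<phi> + prob_space M
  for S T \<phi> and M :: "sheet measure" +
  assumes space_M: "space M = C0 S T" and sets_M: "sets M = sets (C0_borel S T)"
    and gaussian: "finite I \<Longrightarrow> I \<subseteq> Qrect S T \<Longrightarrow> centered_normal (distr M borel (\<lambda>x. \<Sum>p\<in>I. a p * x p))"
    and covariance: "s \<in> {0..S} \<Longrightarrow> t \<in> {0..T} \<Longrightarrow> s' \<in> {0..S} \<Longrightarrow> t' \<in> {0..T} \<Longrightarrow>
        (\<integral>x. x (s, t) * x (s', t') \<partial>M) = min s s' * min t t'"
begin

lemma eval_measurable[measurable]: "(\<lambda>x. x p) \<in> borel_measurable M"
proof (cases "p \<in> Q")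
  case True
  have "{x \<in> C0 S T. x p \<in> B} \<in> sets M" if "B \<in> sets borel" for B
    unfolding sets_M C0_borel_def using True that
    by (subst sets_measure_of, blast, intro sigma_sets.Basic) blast
  moreover have "(\<lambda>x. x p) -` B \<inter> space M = {x \<in> C0 S T. x p \<in> B}" for B by (auto simp: space_M)
  ultimately show ?thesis by (intro measurableI) auto
next
  case False
  have "(\<lambda>x. 0 :: real) \<in> borel_measurable M" by simp
  then show ?thesis by (rule measurable_cong[THEN iffD1, rotated]) (use False in \<open>simp add: space_M C0_def del: split_paired_All\<close>)
qed

lemma rs_sum_measurable[measurable]: "(\<lambda>x. rs_sum v x m n s t \<xi> \<eta>) \<in> borel_measurable M"
  unfolding rs_sum_def rect_incr_def by measurable

text \<open>The covariance of two evaluations is the inner product of their boxes, so the variance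
  of \<open>l\<close> is \<open>nsq g\<close>; a centered normal law is determined by its
  variance.\<close>

lemma lin_pair_Gaussian:
  assumes "lin_pair l g"
  shows "l \<in> borel_measurable M"
    and "integrable M (\<lambda>x. (l x) ^ 4)"
    and "(\<integral>x. (l x) ^ 4 \<partial>M) = 3 * (nsq g)\<^sup>2"
    and "(\<integral>x. iexp (t * l x) \<partial>M) = complex_of_real (exp (- (t\<^sup>2 * nsq g / 2)))"
proof -
  obtain I a where I: "finite I" "I \<subseteq> Q" "\<And>x. l x = (\<Sum>p\<in>I. a p * x p)" "\<And>q. g q = (\<Sum>p\<in>I. a p * box_ind p q)"
    using assms unfolding lin_pair_def by blast
  have l: "l = (\<lambda>x. \<Sum>p\<in>I. a p * x p)" using I(3) by blast
  show lm[measurable]: "l \<in> borel_measurable M" unfolding l by measurable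
  have g: "g = (\<lambda>q. \<Sum>p\<in>I. a p * box_ind p q)" using I(4) by blast
  \<comment> \<open>A value of the covariance integral alone says nothing about integrability, since
    a Bochner integral of a non-integrable function is 0. Integrability comes from the normal law of
    a single evaluation.\<close>
  have sq: "integrable M (\<lambda>x. (x p)\<^sup>2)" if "p \<in> Q" for p
  proof -
    have "centered_normal (distr M borel (\<lambda>x. x p))" using gaussian[of "{p}" "\<lambda>_. 1"] that by simp
    from centered_normal_moments[OF this] have "integrable (distr M borel (\<lambda>x. x p)) (\<lambda>y. y\<^sup>2)"
      by (auto simp: has_bochner_integral_iff)
    then show ?thesis by (subst (asm) integrable_distr_eq) auto
  qed
  have pr: "integrable M (\<lambda>x. x p * x q)" if "p \<in> Q" "q \<in> Q" for p q
  proof (rule Bochner_Integration.integrable_bound)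
    show "integrable M (\<lambda>x. (x p)\<^sup>2 + (x q)\<^sup>2)" using that by (auto intro: sq)
    have "\<bar>u * w\<bar> \<le> u\<^sup>2 + w\<^sup>2" for u w :: real
    proof -
      have "0 \<le> (\<bar>u\<bar> - \<bar>w\<bar>)\<^sup>2" by simp
      then have "2 * \<bar>u * w\<bar> \<le> u\<^sup>2 + w\<^sup>2" by (simp add: power2_diff abs_mult)
      then show ?thesis using abs_ge_zero[of "u * w"] by linarith
    qed
    then show "AE x in M. norm (x p * x q) \<le> norm ((x p)\<^sup>2 + (x q)\<^sup>2)" by (intro AE_I2) simp
  qed measurable
  have "(\<integral>x. (l x)\<^sup>2 \<partial>M) = (\<integral>x. (\<Sum>p\<in>I. \<Sum>q\<in>I. a p * a q * (x p * x q)) \<partial>M)"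
    unfolding I(3) by (simp add: power2_eq_square sum_product mult_ac)
  also have "\<dots> = (\<Sum>p\<in>I. \<Sum>q\<in>I. a p * a q * (\<integral>x. x p * x q \<partial>M))"
  proof -
    have i: "integrable M (\<lambda>x. a p * a q * (x p * x q))" if "p \<in> I" "q \<in> I" for p q
      using that I(2) by (intro integrable_mult_right pr) blast+
    have "(\<integral>x. (\<Sum>p\<in>I. \<Sum>q\<in>I. a p * a q * (x p * x q)) \<partial>M) = (\<Sum>p\<in>I. \<integral>x. (\<Sum>q\<in>I. a p * a q * (x p * x q)) \<partial>M)"
      by (intro Bochner_Integration.integral_sum Bochner_Integration.integrable_sum i)
    also have "\<dots> = (\<Sum>p\<in>I. \<Sum>q\<in>I. \<integral>x. a p * a q * (x p * x q) \<partial>M)"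
      by (intro sum.cong refl Bochner_Integration.integral_sum i)
    finally show ?thesis by simp
  qed
  also have "\<dots> = (\<Sum>p\<in>I. \<Sum>q\<in>I. a p * a q * ip (box_ind p) (box_ind q))"
  proof (intro sum.cong refl arg_cong2[where f="(*)"])
    fix p q assume "p \<in> I" "q \<in> I"
    then have pq: "p \<in> Q" "q \<in> Q" using I(2) by auto
    then show "(\<integral>x. x p * x q \<partial>M) = ip (box_ind p) (box_ind q)"
      using covariance[of "fst p" "snd p" "fst q" "snd q"] by (auto simp: ip_box_ind Qrect_def)
  qed
  also have "\<dots> = nsq g"
    unfolding g by (subst ip_sum_left) (auto simp: L2_sum L2_scale box_ind_L2 ip_scale_left ip_commute[of "box_ind _" "\<lambda>q. \<Sum>p\<in>I. a p * box_ind p q"]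
        ip_sum_left sum_distrib_left ip_commute[of "box_ind _" "box_ind _"] mult.assoc intro!: sum.cong)
  finally have var: "(\<integral>x. (l x)\<^sup>2 \<partial>M) = nsq g" .
  have "centered_normal (distr M borel l)" unfolding l using I by (intro gaussian)
  then obtain V where V: "has_bochner_integral (distr M borel l) (\<lambda>x. x\<^sup>2) V" "has_bochner_integral (distr M borel l) (\<lambda>x. x ^ 4) (3 * V\<^sup>2)"
    "\<And>t. (\<integral>x. iexp (t * x) \<partial>distr M borel l) = complex_of_real (exp (- (t\<^sup>2 * V / 2)))"
    using centered_normal_moments by blast
  have "V = nsq g" using V(1) var by (simp add: has_bochner_integral_iff integral_distr)
  then show "integrable M (\<lambda>x. (l x) ^ 4)" "(\<integral>x. (l x) ^ 4 \<partial>M) = 3 * (nsq g)\<^sup>2"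
    "(\<integral>x. iexp (t * l x) \<partial>M) = complex_of_real (exp (- (t\<^sup>2 * nsq g / 2)))"
    using V(2) V(3)[of t] by (simp_all add: has_bochner_integral_iff integral_distr integrable_distr_eq)
qed

lemma urs_tendsto: "bv_hk S T v \<Longrightarrow> x \<in> space M \<Longrightarrow> (\<lambda>N. urs v x N) \<longlonglongrightarrow> rs_integral S T v x"
  by (intro has_rs_integral_urs has_rs_integral_rs_integral) (auto simp: space_M)

lemma rs_integral_measurable:
  assumes v: "bv_hk S T v" shows "rs_integral S T v \<in> borel_measurable M"
  by (rule borel_measurable_LIMSEQ_real[OF urs_tendsto[OF v]]) auto

lemma lin_pair_urs: "lin_pair (\<lambda>x. urs v x N) (ustep v N)"
  using unif_tagged[OF less_add_one, of N] by (rule lin_pair_rs_sum)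

lemma rs_integral_char:
  assumes v: "bv_hk S T v"
  shows "(\<integral>x. iexp (t * rs_integral S T v x) \<partial>M) = complex_of_real (exp (- (t\<^sup>2 * nsq v / 2)))"
proof (rule LIMSEQ_unique)
  note [measurable] = rs_integral_measurable[OF v]
  show "(\<lambda>N. \<integral>x. iexp (t * urs v x N) \<partial>M) \<longlonglongrightarrow> (\<integral>x. iexp (t * rs_integral S T v x) \<partial>M)"
  proof (rule integral_dominated_convergence[where w="\<lambda>_. 1"])
    show "AE x in M. (\<lambda>N. iexp (t * urs v x N)) \<longlonglongrightarrow> iexp (t * rs_integral S T v x)"
      using urs_tendsto[OF v] by (intro AE_I2 tendsto_intros)
  qed auto
  show "(\<lambda>N. \<integral>x. iexp (t * urs v x N) \<partial>M) \<longlonglongrightarrow> complex_of_real (exp (- (t\<^sup>2 * nsq v / 2)))"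
    unfolding lin_pair_Gaussian(4)[OF lin_pair_urs] by (intro tendsto_intros ustep_nsq v) simp
qed

text \<open>Fatou along the Riemann sums; an upper bound is all that the maximal inequality asks
  for.\<close>

lemma rs_integral_fourth_moment:
  assumes v: "bv_hk S T v"
  shows "(\<integral>\<^sup>+x. ennreal ((rs_integral S T v x) ^ 4) \<partial>M) \<le> ennreal (3 * (nsq v)\<^sup>2)"
proof -
  have "(\<integral>\<^sup>+x. ennreal ((rs_integral S T v x) ^ 4) \<partial>M) = (\<integral>\<^sup>+x. liminf (\<lambda>N. ennreal ((urs v x N) ^ 4)) \<partial>M)"
    by (intro nn_integral_cong lim_imp_Liminf[symmetric] tendsto_intros urs_tendsto v) auto
  also have "\<dots> \<le> liminf (\<lambda>N. \<integral>\<^sup>+x. ennreal ((urs v x N) ^ 4) \<partial>M)"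
    by (rule nn_integral_liminf) measurable
  also have "(\<lambda>N. \<integral>\<^sup>+x. ennreal ((urs v x N) ^ 4) \<partial>M) = (\<lambda>N. ennreal (3 * (nsq (ustep v N))\<^sup>2))"
    using lin_pair_Gaussian(2,3)[OF lin_pair_urs] by (subst nn_integral_eq_integral) auto
  also have "liminf \<dots> = ennreal (3 * (nsq v)\<^sup>2)"
    by (intro lim_imp_Liminf tendsto_intros ustep_nsq v) auto
  finally show ?thesis .
qed

end

section \<open>Almost sure convergence of the Paley--Wiener--Zygmund series\<close>

text \<open>The constants are \<open>(11/10)^4 \<le> 3/2\<close> when \<open>y\<close> is at most a
  tenth of \<open>x\<close>, and \<open>11^4 = 14641\<close> otherwise. The first must be below 2
  for the recursion of the maximal inequality to close; the size of the second is
  immaterial.\<close>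

lemma fourth_power_add_le: "(x + y) ^ 4 \<le> 3/2 * x ^ 4 + 14641 * y ^ 4" if "0 \<le> x" "0 \<le> y" for x y :: real
proof (cases "10 * y \<le> x")
  case True
  then have "(x + y) ^ 4 \<le> (11/10 * x) ^ 4" using that by (intro power_mono) auto
  also have "\<dots> = 14641/10000 * x ^ 4" by (simp add: power_mult_distrib power_divide)
  also have "\<dots> \<le> 3/2 * x ^ 4" using that by (intro mult_right_mono) auto
  finally show ?thesis using that by (simp add: add_increasing2)
next
  case False
  then have "(x + y) ^ 4 \<le> (11 * y) ^ 4" using that by (intro power_mono) auto
  then show ?thesis using that by (simp add: power_mult_distrib add_increasing)
qed

text \<open>The maximal inequality behind almost sure convergence needs no independence: because the fourth
  moment of a block is quadratic in the variance, splitting the block at the middle of its variance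
  loses only a factor \<open>3/2 \<cdot> 2 \<cdot> (1/2)\<^sup>2 < 1\<close>.\<close>

lemma maximal_fourth_moment:
  fixes Y :: "nat \<Rightarrow> 'a \<Rightarrow> real" and d :: "nat \<Rightarrow> real"
  assumes Y[measurable]: "\<And>j. Y j \<in> borel_measurable M" and d: "\<And>j. 0 \<le> d j"
    and fm: "\<And>a b. (\<integral>\<^sup>+x. ennreal ((\<Sum>j=a..<b. Y j x) ^ 4) \<partial>M) \<le> ennreal (3 * (\<Sum>j=a..<b. d j)\<^sup>2)"
  shows "a \<le> b \<Longrightarrow> (\<integral>\<^sup>+x. (SUP k\<in>{a..b}. ennreal ((\<Sum>j=a..<k. Y j x) ^ 4)) \<partial>M) \<le> ennreal (175692 * (\<Sum>j=a..<b. d j)\<^sup>2)"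
proof (induction "b - a" arbitrary: a b rule: less_induct)
  case less
  define P where "P a b x = (SUP k\<in>{a..b}. ennreal ((\<Sum>j=a..<k. Y j x) ^ 4))" for a b :: nat and x
  have Pm[measurable]: "P a b \<in> borel_measurable M" for a b unfolding P_def[abs_def] by measurable
  define D where "D = (\<Sum>j=a..<b. d j)"
  have D0: "0 \<le> D" using d by (simp add: D_def sum_nonneg)
  show ?case
  proof (cases "a = b")
    case True then show ?thesis by simp
  next
    case False
    with less.prems have ab: "a < b" by simp
    \<comment> \<open>The last index up to which the variance is at most \<open>D / 2\<close>.
      Adding \<open>d m\<close> exceeds one half, so the variance beyond index \<open>m\<close> is
      also at most \<open>D / 2\<close>; the term \<open>m\<close> itself belongs to neither half
      but to the fixed block \<open>a..<Suc m\<close>.\<close>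
    define m where "m = (GREATEST m. a \<le> m \<and> m < b \<and> (\<Sum>j=a..<m. d j) \<le> D / 2)"
    have "a \<le> m \<and> m < b \<and> (\<Sum>j=a..<m. d j) \<le> D / 2"
      unfolding m_def by (rule GreatestI_nat[where k=a and b=b]) (use ab D0 in auto)
    then have m: "a \<le> m" "m < b" "(\<Sum>j=a..<m. d j) \<le> D / 2" by auto
    have mx: "k \<le> m" if "a \<le> k \<and> k < b \<and> (\<Sum>j=a..<k. d j) \<le> D / 2" for k
      unfolding m_def by (rule Greatest_le_nat[where b=b]) (use that in auto)
    have m2: "(\<Sum>j=Suc m..<b. d j) \<le> D / 2"
    proof (cases "Suc m < b")
      case True
      have "\<not> (\<Sum>j=a..<Suc m. d j) \<le> D / 2"
      proof
        assume "(\<Sum>j=a..<Suc m. d j) \<le> D / 2"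
        then have "Suc m \<le> m"
          using True m(1) by (intro mx) auto
        then show False by simp
      qed
      moreover have "D = (\<Sum>j=a..<Suc m. d j) + (\<Sum>j=Suc m..<b. d j)"
        unfolding D_def using m True by (subst sum.atLeastLessThan_concat) auto
      ultimately show ?thesis by simp
    next
      case False then show ?thesis using D0 by simp
    qed
    \<comment> \<open>A partial sum ending by \<open>m\<close> is covered by the maximum of the
      first half. A longer one is the fixed block up to \<open>Suc m\<close> plus a partial sum of
      the second half; the large constant falls on the fixed block, of which no maximum is
      taken.\<close>
    have pt: "P a b x \<le> ennreal (3/2) * P a m x + ennreal (3/2) * P (Suc m) b x + ennreal 14641 * ennreal ((\<Sum>j=a..<Suc m. Y j x) ^ 4)" (is "_ \<le> ?R") for x
      unfolding P_def[of a b]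
    proof (rule SUP_least)
      fix k assume k: "k \<in> {a..b}"
      show "ennreal ((\<Sum>j=a..<k. Y j x) ^ 4) \<le> ?R"
      proof (cases "k \<le> m")
        case True
        have "ennreal ((\<Sum>j=a..<k. Y j x) ^ 4) \<le> P a m x" unfolding P_def using k True by (intro SUP_upper) auto
        also have "\<dots> = 1 * P a m x" by simp
        also have "\<dots> \<le> ennreal (3/2) * P a m x" by (intro mult_right_mono) (auto simp flip: ennreal_1 intro!: ennreal_leI)
        also have "\<dots> \<le> ?R" by (simp add: add_increasing2 add.assoc)
        finally show ?thesis .
      next
        case False
        let ?u = "\<Sum>j=Suc m..<k. Y j x" and ?w = "\<Sum>j=a..<Suc m. Y j x"
        have "(\<Sum>j=a..<k. Y j x) = ?u + ?w"
          using m False by (subst add.commute, subst sum.atLeastLessThan_concat) auto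
        then have "(\<Sum>j=a..<k. Y j x) ^ 4 = \<bar>?u + ?w\<bar> ^ 4" by (simp add: power_even_abs)
        also have "\<dots> \<le> (\<bar>?u\<bar> + \<bar>?w\<bar>) ^ 4" by (intro power_mono abs_triangle_ineq) auto
        also have "\<dots> \<le> 3/2 * \<bar>?u\<bar> ^ 4 + 14641 * \<bar>?w\<bar> ^ 4" by (rule fourth_power_add_le) auto
        also have "\<dots> = 3/2 * ?u ^ 4 + 14641 * ?w ^ 4" by (simp add: power_even_abs)
        finally have "ennreal ((\<Sum>j=a..<k. Y j x) ^ 4) \<le> ennreal (3/2 * ?u ^ 4 + 14641 * ?w ^ 4)" by (rule ennreal_leI)
        also have "\<dots> = ennreal (3/2 * ?u ^ 4) + ennreal (14641 * ?w ^ 4)"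
          by (rule ennreal_plus) (auto intro!: mult_nonneg_nonneg zero_le_even_power)
        also have "\<dots> = ennreal (3/2) * ennreal (?u ^ 4) + ennreal 14641 * ennreal (?w ^ 4)"
          by (intro arg_cong2[where f="(+)"] ennreal_mult') auto
        also have "\<dots> \<le> ennreal (3/2) * P (Suc m) b x + ennreal 14641 * ennreal (?w ^ 4)"
          unfolding P_def using k False by (intro add_mono mult_left_mono SUP_upper) auto
        also have "\<dots> \<le> ?R" by (intro add_mono order_refl) (simp add: add_increasing)
        finally show ?thesis .
      qed
    qed
    have sq: "(\<Sum>j=a..<m. d j)\<^sup>2 \<le> D\<^sup>2 / 4" "(\<Sum>j=Suc m..<b. d j)\<^sup>2 \<le> D\<^sup>2 / 4" "(\<Sum>j=a..<Suc m. d j)\<^sup>2 \<le> D\<^sup>2"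
    proof -
      show "(\<Sum>j=a..<m. d j)\<^sup>2 \<le> D\<^sup>2 / 4" using power_mono[OF m(3), of 2] d by (simp add: sum_nonneg power_divide)
      show "(\<Sum>j=Suc m..<b. d j)\<^sup>2 \<le> D\<^sup>2 / 4" using power_mono[OF m2, of 2] d by (simp add: sum_nonneg power_divide)
      have "(\<Sum>j=a..<Suc m. d j) \<le> D" unfolding D_def using m d by (intro sum_mono2) auto
      then show "(\<Sum>j=a..<Suc m. d j)\<^sup>2 \<le> D\<^sup>2" using d by (intro power_mono sum_nonneg) auto
    qed
    have "(\<integral>\<^sup>+x. P a b x \<partial>M) \<le> (\<integral>\<^sup>+x. ennreal (3/2) * P a m x + ennreal (3/2) * P (Suc m) b x + ennreal 14641 * ennreal ((\<Sum>j=a..<Suc m. Y j x) ^ 4) \<partial>M)"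
      by (rule nn_integral_mono) (rule pt)
    also have "\<dots> = ennreal (3/2) * (\<integral>\<^sup>+x. P a m x \<partial>M) + ennreal (3/2) * (\<integral>\<^sup>+x. P (Suc m) b x \<partial>M) + ennreal 14641 * (\<integral>\<^sup>+x. ennreal ((\<Sum>j=a..<Suc m. Y j x) ^ 4) \<partial>M)"
      by (simp add: nn_integral_add nn_integral_cmult del: sum.op_ivl_Suc)
    also have "\<dots> \<le> ennreal (3/2) * ennreal (175692 * (D\<^sup>2 / 4)) + ennreal (3/2) * ennreal (175692 * (D\<^sup>2 / 4)) + ennreal 14641 * ennreal (3 * D\<^sup>2)"
    proof (intro add_mono mult_left_mono)
      show "(\<integral>\<^sup>+x. P a m x \<partial>M) \<le> ennreal (175692 * (D\<^sup>2 / 4))"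
        unfolding P_def using less.hyps[of m a] m sq(1) by (intro order_trans[OF less.hyps[of m a]] ennreal_leI mult_left_mono) auto
      show "(\<integral>\<^sup>+x. P (Suc m) b x \<partial>M) \<le> ennreal (175692 * (D\<^sup>2 / 4))"
        unfolding P_def using m sq(2) by (intro order_trans[OF less.hyps[of b "Suc m"]] ennreal_leI mult_left_mono) auto
      show "(\<integral>\<^sup>+x. ennreal ((\<Sum>j=a..<Suc m. Y j x) ^ 4) \<partial>M) \<le> ennreal (3 * D\<^sup>2)"
        using sq(3) by (intro order_trans[OF fm] ennreal_leI mult_left_mono) auto
    qed auto
    also have "\<dots> = ennreal (3/2 * (175692 * (D\<^sup>2 / 4)) + 3/2 * (175692 * (D\<^sup>2 / 4)) + 14641 * (3 * D\<^sup>2))"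
      by (simp only: ennreal_plus ennreal_mult' zero_le_power2 zero_le_mult_iff zero_le_divide_iff zero_le_numeral add_nonneg_nonneg simp_thms)
    \<comment> \<open>The constant solves \<open>C = 2 * 3/2 * C/4 + 3 * 14641\<close>, that is,
      \<open>C = 4 * 43923\<close>.\<close>
    also have "\<dots> = ennreal (175692 * D\<^sup>2)" by (rule arg_cong[of _ _ ennreal]) (simp add: field_simps)
    finally show ?thesis unfolding P_def D_def .
  qed
qed

text \<open>The maximal inequality for the block starting at \<open>a\<close> bounds the integral of
  \<open>Z a\<close> by a multiple of the squared tail of \<open>d\<close>. Hence the infimum of the
  \<open>Z a\<close> is 0 almost everywhere, which is the Cauchy criterion.\<close>

lemma AE_summable_fourth_moment:
  fixes Y :: "nat \<Rightarrow> 'a \<Rightarrow> real" and d :: "nat \<Rightarrow> real"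
  assumes Y[measurable]: "\<And>j. Y j \<in> borel_measurable M" and d: "\<And>j. 0 \<le> d j" and sd: "summable d"
    and fm: "\<And>a b. (\<integral>\<^sup>+x. ennreal ((\<Sum>j=a..<b. Y j x) ^ 4) \<partial>M) \<le> ennreal (3 * (\<Sum>j=a..<b. d j)\<^sup>2)"
  shows "AE x in M. summable (\<lambda>j. Y j x)"
proof -
  define Z where "Z a x = (SUP k. ennreal ((\<Sum>j=a..<k. Y j x) ^ 4))" for a :: nat and x
  have Zm[measurable]: "Z a \<in> borel_measurable M" for a unfolding Z_def[abs_def] by measurable
  define R where "R a = suminf d - (\<Sum>j<a. d j)" for a
  have part: "(\<Sum>j=a..<b. d j) \<le> R a" for a b
  proof (cases "a \<le> b")
    case True
    have "(\<Sum>j<a. d j) + (\<Sum>j=a..<b. d j) = (\<Sum>j<b. d j)"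
      using True by (simp add: lessThan_atLeast0 sum.atLeastLessThan_concat)
    moreover have "(\<Sum>j<b. d j) \<le> suminf d" by (rule sum_le_suminf[OF sd]) (auto simp: d)
    ultimately show ?thesis by (simp add: R_def)
  next
    case False
    then show ?thesis using sum_le_suminf[OF sd, of "{..<a}"] d by (simp add: R_def)
  qed
  have Zint: "(\<integral>\<^sup>+x. Z a x \<partial>M) \<le> ennreal (175692 * (R a)\<^sup>2)" for a
  proof -
    \<comment> \<open>Indices below \<open>a\<close> give empty sums, so the supremum over all
      \<open>k\<close> is an increasing limit of the finite maxima to which the maximal inequality
      applies.\<close>
    have Z_eq: "Z a x = (SUP n. SUP k\<in>{a..a + n}. ennreal ((\<Sum>j=a..<k. Y j x) ^ 4))" for x
    proof (rule antisym)
      show "Z a x \<le> (SUP n. SUP k\<in>{a..a + n}. ennreal ((\<Sum>j=a..<k. Y j x) ^ 4))"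
        unfolding Z_def
      proof (rule SUP_least)
        fix k
        show "ennreal ((\<Sum>j=a..<k. Y j x) ^ 4) \<le> (SUP n. SUP k\<in>{a..a + n}. ennreal ((\<Sum>j=a..<k. Y j x) ^ 4))"
        proof (cases "a \<le> k")
          case True
          then show ?thesis by (intro SUP_upper2[of "k - a"] SUP_upper2[of k]) auto
        qed simp
      qed
    qed (auto simp: Z_def intro!: SUP_least SUP_upper)
    have "(\<integral>\<^sup>+x. Z a x \<partial>M) = (SUP n. \<integral>\<^sup>+x. (SUP k\<in>{a..a + n}. ennreal ((\<Sum>j=a..<k. Y j x) ^ 4)) \<partial>M)"
      unfolding Z_eq
    proof (rule nn_integral_monotone_convergence_SUP)
      show "incseq (\<lambda>n x. SUP k\<in>{a..a + n}. ennreal ((\<Sum>j=a..<k. Y j x) ^ 4))"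
        by (auto simp: incseq_def le_fun_def intro!: SUP_subset_mono)
    qed measurable
    also have "\<dots> \<le> ennreal (175692 * (R a)\<^sup>2)"
    proof (rule SUP_least)
      fix n
      have "(\<Sum>j=a..<a + n. d j)\<^sup>2 \<le> (R a)\<^sup>2" using part[of a "a + n"] d by (intro power_mono sum_nonneg) auto
      then have "ennreal (175692 * (\<Sum>j=a..<a + n. d j)\<^sup>2) \<le> ennreal (175692 * (R a)\<^sup>2)"
        by (intro ennreal_leI mult_left_mono) auto
      then show "(\<integral>\<^sup>+x. (SUP k\<in>{a..a + n}. ennreal ((\<Sum>j=a..<k. Y j x) ^ 4)) \<partial>M) \<le> ennreal (175692 * (R a)\<^sup>2)"
        using maximal_fourth_moment[of Y M d, OF Y d fm, of a "a + n"] by (rule order_trans[rotated]) auto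
    qed
    finally show ?thesis .
  qed
  have "R \<longlonglongrightarrow> suminf d - suminf d"
    unfolding R_def[abs_def] using sd by (intro tendsto_diff tendsto_const summable_LIMSEQ)
  then have "(\<lambda>a. ennreal (175692 * (R a)\<^sup>2)) \<longlonglongrightarrow> ennreal (175692 * 0\<^sup>2)"
    by (intro tendsto_intros) simp
  then have lim: "(\<lambda>a. ennreal (175692 * (R a)\<^sup>2)) \<longlonglongrightarrow> 0" by simp
  have "(\<integral>\<^sup>+x. (INF a. Z a x) \<partial>M) \<le> 0"
  proof (rule LIMSEQ_le_const[OF lim], intro exI[of _ 0] allI impI)
    fix a
    have "(\<integral>\<^sup>+x. (INF a. Z a x) \<partial>M) \<le> (\<integral>\<^sup>+x. Z a x \<partial>M)" by (intro nn_integral_mono INF_lower) auto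
    then show "(\<integral>\<^sup>+x. (INF a. Z a x) \<partial>M) \<le> ennreal (175692 * (R a)\<^sup>2)" using Zint[of a] by (rule order_trans)
  qed
  then have "(\<integral>\<^sup>+x. (INF a. Z a x) \<partial>M) = 0" by simp
  then have "AE x in M. (INF a. Z a x) = 0" by (subst (asm) nn_integral_0_iff_AE) measurable
  then show ?thesis
  proof eventually_elim
    case (elim x)
    show ?case
      unfolding summable_Cauchy
    proof (intro allI impI)
      fix e :: real assume e: "e > 0"
      then have "(INF a. Z a x) < ennreal ((e/2)^4)" using elim by simp
      then obtain a where a: "Z a x < ennreal ((e/2)^4)" unfolding INF_less_iff by blast
      have k: "\<bar>\<Sum>j=a..<k. Y j x\<bar> < e / 2" for k
      proof -
        have "ennreal ((\<Sum>j=a..<k. Y j x) ^ 4) \<le> Z a x" unfolding Z_def by (intro SUP_upper) auto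
        with a have "ennreal ((\<Sum>j=a..<k. Y j x) ^ 4) < ennreal ((e/2)^4)" by (rule le_less_trans[rotated])
        then have "\<bar>\<Sum>j=a..<k. Y j x\<bar> ^ 4 < (e/2)^4" by (simp add: ennreal_less_iff power_even_abs)
        then show ?thesis using e by (intro power_less_imp_less_base[of _ 4 "e/2"]) auto
      qed
      have "norm (\<Sum>j=m..<n. Y j x) < e" if "m \<ge> a" for m n
      proof (cases "m \<le> n")
        case True
        have "(\<Sum>j=a..<m. Y j x) + (\<Sum>j=m..<n. Y j x) = (\<Sum>j=a..<n. Y j x)"
          using True that by (intro sum.atLeastLessThan_concat) auto
        then show ?thesis using k[of m] k[of n] by simp
      qed (use e in simp)
      then show "\<exists>N. \<forall>m\<ge>N. \<forall>n. norm (\<Sum>j=m..<n. Y j x) < e" by blast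
    qed
  qed
qed

section \<open>Law, scaling and linearity of the Paley-Wiener-Zygmund integral\<close>

context yeh_wiener
begin

abbreviation "X j \<equiv> rs_integral S T (\<phi> j)"

lemma X_measurable[measurable]: "X j \<in> borel_measurable M"
  by (rule rs_integral_measurable[OF phi_bv])

lemma rs_integral_comb:
  assumes "x \<in> C0 S T" shows "rs_integral S T (\<lambda>p. \<Sum>j\<in>J. c j * \<phi> j p) x = (\<Sum>j\<in>J. c j * X j x)"
  by (rule rs_integral_eq[OF rs_integral_sum[OF phi_bv assms]])

lemma bv_comb: "bv_hk S T (\<lambda>p. \<Sum>j\<in>J. c j * \<phi> j p)"
  by (rule bv_hk_sum[OF phi_bv])

lemma pwz_eq:
  assumes "x \<in> C0 S T" shows "pwz S T \<phi> v x = lim (\<lambda>n. \<Sum>j<n. co v j * X j x)"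
  unfolding pwz_def rs_integral_comb[OF assms] ..

abbreviation "pw \<equiv> pwz S T \<phi>"

text \<open>Carries the exceptional sets: \<open>pw\<close> is a \<open>lim\<close>, unspecified on
  divergent series, so its algebraic rules are stated under this condition.\<close>

definition pwz_conv :: "sheet \<Rightarrow> sheet \<Rightarrow> bool" where
  "pwz_conv v x \<longleftrightarrow> summable (\<lambda>j. co v j * X j x)"

lemma pwz_convD: "pwz_conv v x \<Longrightarrow> x \<in> C0 S T \<Longrightarrow> (\<lambda>n. \<Sum>j<n. co v j * X j x) \<longlonglongrightarrow> pw v x"
  unfolding pwz_conv_def pwz_eq summable_iff_convergent convergent_LIMSEQ_iff .

text \<open>A block of the series is itself the Riemann-Stieltjes integral of a combination of basis
  functions, whose square norm is the block of squared coefficients; these serve as the variances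
  \<open>d\<close>.\<close>

lemma pwz_conv_AE:
  assumes v: "v \<in> LL" shows "AE x in M. pwz_conv v x"
  unfolding pwz_conv_def
proof (rule AE_summable_fourth_moment[where d="\<lambda>j. (co v j)\<^sup>2"])
  show "summable (\<lambda>j. (co v j)\<^sup>2)" using Parseval[OF v] by (rule sums_summable)
  fix a b
  have "(\<integral>\<^sup>+x. ennreal ((\<Sum>j=a..<b. co v j * X j x) ^ 4) \<partial>M) = (\<integral>\<^sup>+x. ennreal ((rs_integral S T (\<lambda>p. \<Sum>j=a..<b. co v j * \<phi> j p) x) ^ 4) \<partial>M)"
    by (intro nn_integral_cong) (simp add: rs_integral_comb space_M)
  also have "\<dots> \<le> ennreal (3 * (\<Sum>j=a..<b. (co v j)\<^sup>2)\<^sup>2)"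
    using rs_integral_fourth_moment[OF bv_comb, of "co v" "{a..<b}"] by (simp add: nsq_comb)
  finally show "(\<integral>\<^sup>+x. ennreal ((\<Sum>j=a..<b. co v j * X j x) ^ 4) \<partial>M) \<le> ennreal (3 * (\<Sum>j=a..<b. (co v j)\<^sup>2)\<^sup>2)" .
qed auto

lemma pwz_measurable: "pw v \<in> borel_measurable M"
proof -
  have "(\<lambda>x. lim (\<lambda>n. \<Sum>j<n. co v j * X j x)) \<in> borel_measurable M"
    by (intro borel_measurable_lim_metric) measurable
  then show ?thesis by (rule measurable_cong[THEN iffD1, rotated]) (simp add: pwz_eq space_M)
qed

lemma pwz_char:
  assumes v: "v \<in> LL"
  shows "(\<integral>x. iexp (t * pw v x) \<partial>M) = complex_of_real (exp (- (t\<^sup>2 * nsq v / 2)))"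
proof (rule LIMSEQ_unique)
  note [measurable] = pwz_measurable
  show "(\<lambda>n. \<integral>x. iexp (t * (\<Sum>j<n. co v j * X j x)) \<partial>M) \<longlonglongrightarrow> (\<integral>x. iexp (t * pw v x) \<partial>M)"
  proof (rule integral_dominated_convergence[where w="\<lambda>_. 1"])
    show "AE x in M. (\<lambda>n. iexp (t * (\<Sum>j<n. co v j * X j x))) \<longlonglongrightarrow> iexp (t * pw v x)"
      using pwz_conv_AE[OF v] AE_space
      by eventually_elim (intro tendsto_intros pwz_convD, auto simp: space_M)
  qed auto
  have "(\<integral>x. iexp (t * (\<Sum>j<n. co v j * X j x)) \<partial>M) = complex_of_real (exp (- (t\<^sup>2 * (\<Sum>j<n. (co v j)\<^sup>2) / 2)))" for n
  proof -
    have "(\<integral>x. iexp (t * (\<Sum>j<n. co v j * X j x)) \<partial>M) =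
      (\<integral>x. iexp (t * rs_integral S T (\<lambda>p. \<Sum>j<n. co v j * \<phi> j p) x) \<partial>M)"
      by (intro Bochner_Integration.integral_cong refl) (simp only: rs_integral_comb space_M)
    then show ?thesis using rs_integral_char[OF bv_comb, of t "co v" "{..<n}"] by (simp add: nsq_comb)
  qed
  moreover have "(\<lambda>n. complex_of_real (exp (- (t\<^sup>2 * (\<Sum>j<n. (co v j)\<^sup>2) / 2)))) \<longlonglongrightarrow> complex_of_real (exp (- (t\<^sup>2 * nsq v / 2)))"
    using Parseval[OF v] by (intro tendsto_intros) (auto simp: sums_def)
  ultimately show "(\<lambda>n. \<integral>x. iexp (t * (\<Sum>j<n. co v j * X j x)) \<partial>M) \<longlonglongrightarrow> complex_of_real (exp (- (t\<^sup>2 * nsq v / 2)))"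
    by simp
qed

lemma scale_C0: "x \<in> C0 S T \<Longrightarrow> scale r x \<in> C0 S T"
  unfolding C0_def scale_def by (auto intro!: continuous_intros simp del: split_paired_All)

lemma X_scale: "x \<in> C0 S T \<Longrightarrow> X j (scale r x) = r * X j x"
  unfolding scale_def
  by (intro rs_integral_eq has_rs_integral_scale[OF rs_sum_simps(3)] has_rs_integral_rs_integral phi_bv)

lemma pwz_conv_scale: "x \<in> C0 S T \<Longrightarrow> pwz_conv v x \<Longrightarrow> pwz_conv v (scale r x)"
  unfolding pwz_conv_def using summable_mult[of "\<lambda>j. co v j * X j x" r] by (simp add: X_scale mult_ac)

lemma pwz_scale:
  assumes x: "x \<in> C0 S T" and c: "pwz_conv v x"
  shows "pw v (scale r x) = r * pw v x"
proof (rule LIMSEQ_unique)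
  show "(\<lambda>n. \<Sum>j<n. co v j * X j (scale r x)) \<longlonglongrightarrow> pw v (scale r x)"
    by (intro pwz_convD pwz_conv_scale scale_C0 x c)
  have "(\<lambda>n. r * (\<Sum>j<n. co v j * X j x)) \<longlonglongrightarrow> r * pw v x"
    by (intro tendsto_intros pwz_convD x c)
  then show "(\<lambda>n. \<Sum>j<n. co v j * X j (scale r x)) \<longlonglongrightarrow> r * pw v x"
    by (simp add: X_scale x sum_distrib_left mult_ac)
qed

lemma pwz_lin:
  assumes x: "x \<in> C0 S T" and c: "pwz_conv v x" "pwz_conv w x" and L: "v \<in> LL" "w \<in> LL"
  shows "pw (\<lambda>p. a * v p + b * w p) x = a * pw v x + b * pw w x"
proof -
  have co: "co (\<lambda>p. a * v p + b * w p) j * X j x = a * (co v j * X j x) + b * (co w j * X j x)" for j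
    by (simp add: ip_add_left L2_scale L phi_L2 ip_scale_left algebra_simps)
  have c': "pwz_conv (\<lambda>p. a * v p + b * w p) x"
    using c unfolding pwz_conv_def co by (intro summable_add summable_mult)
  have "(\<lambda>n. a * (\<Sum>j<n. co v j * X j x) + b * (\<Sum>j<n. co w j * X j x)) \<longlonglongrightarrow> a * pw v x + b * pw w x"
    by (intro tendsto_intros pwz_convD x c)
  moreover have "(\<lambda>n. \<Sum>j<n. co (\<lambda>p. a * v p + b * w p) j * X j x) = (\<lambda>n. a * (\<Sum>j<n. co v j * X j x) + b * (\<Sum>j<n. co w j * X j x))"
    unfolding co by (simp add: sum.distrib sum_distrib_left)
  ultimately show "pw (\<lambda>p. a * v p + b * w p) x = a * pw v x + b * pw w x"
    using pwz_convD[OF c' x] by (simp only:) (rule LIMSEQ_unique)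
qed

text \<open>Reduces scale-invariant statements to statements about almost all dilates
  \<open>scale \<rho> x\<close>. In one direction the null set is pulled back by
  \<open>scale (1 / \<rho>)\<close>. In the other, completeness makes every dilate of the bare set
  of counterexamples measurable.\<close>

lemma s_ae_iff: "s_ae (completion M) P \<longleftrightarrow> (\<forall>\<rho>>0. AE x in M. P (scale \<rho> x))"
proof
  assume "s_ae (completion M) P"
  then obtain N where N: "si_null (completion M) N" "\<And>x. x \<in> space (completion M) - N \<Longrightarrow> P x"
    unfolding s_ae_def by blast
  show "\<forall>\<rho>>0. AE x in M. P (scale \<rho> x)"
  proof (intro allI impI)
    fix \<rho> :: real assume \<rho>: "\<rho> > 0"
    then have "1 / \<rho> > 0" by simp
    then have "scale (1 / \<rho>) ` N \<in> null_sets (completion M)"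
      using N(1) unfolding si_null_def si_measurable_set_def by (blast intro: null_setsI)
    then have "AE x in completion M. x \<notin> scale (1 / \<rho>) ` N" by (rule AE_not_in)
    then have "AE x in M. x \<notin> scale (1 / \<rho>) ` N" by (simp only: AE_completion_iff)
    then show "AE x in M. P (scale \<rho> x)"
      using AE_space
    proof eventually_elim
      case (elim x)
      have "x = scale (1 / \<rho>) (scale \<rho> x)" using \<rho> by (simp add: scale_def)
      then have "scale \<rho> x \<notin> N" using elim(1) by blast
      moreover have "scale \<rho> x \<in> space (completion M)" using elim(2) by (simp add: space_M scale_C0)
      ultimately show ?case using N(2) by blast
    qed
  qed
next
  assume A: "\<forall>\<rho>>0. AE x in M. P (scale \<rho> x)"
  define N where "N = {x \<in> C0 S T. \<not> P x}"
  have null: "scale \<rho> ` N \<in> null_sets (completion M)" if \<rho>: "\<rho> > 0" for \<rho>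
  proof -
    have "1 / \<rho> > 0" using \<rho> by simp
    then have "AE x in completion M. P (scale (1 / \<rho>) x)" using A AE_completion by blast
    then obtain E where E: "E \<in> null_sets (completion M)" "{x \<in> space (completion M). \<not> P (scale (1 / \<rho>) x)} \<subseteq> E"
      unfolding eventually_ae_filter by blast
    have "scale \<rho> ` N \<subseteq> E"
    proof
      fix y assume "y \<in> scale \<rho> ` N"
      then obtain x where x: "x \<in> C0 S T" "\<not> P x" "y = scale \<rho> x" by (auto simp: N_def)
      then have "scale (1 / \<rho>) y = x" using \<rho> by (simp add: scale_def)
      then show "y \<in> E" using x scale_C0[of x \<rho>] E(2) by (auto simp: space_M)
    qed
    then show ?thesis using E(1) by (rule null_sets_completion_subset)
  qed
  have "si_null (completion M) N"
    unfolding si_null_def si_measurable_set_def using null by (blast dest: null_setsD1 null_setsD2)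
  then show "s_ae (completion M) P"
    unfolding s_ae_def by (intro exI[of _ N]) (auto simp: N_def space_M)
qed

end

section \<open>Analytic limits of Gaussian integrals\<close>

lemma Re_inverse_pos: "0 < Re l \<Longrightarrow> 0 < Re (inverse l)"
  by (cases "l = 0") (auto simp: Re_divide inverse_complex.sel intro!: divide_pos_pos add_pos_nonneg)

lemma norm_exp_minus_divide_le_1: "0 < Re l \<Longrightarrow> 0 \<le> a \<Longrightarrow> cmod (exp (- (complex_of_real a / l))) \<le> 1"
proof -
  assume "0 < Re l" "0 \<le> a"
  then have "0 \<le> Re (complex_of_real a / l)"
    using Re_inverse_pos[of l] by (simp add: divide_inverse less_imp_le)
  then show ?thesis by (simp add: norm_exp_eq_Re)
qed

text \<open>The bound is uniform in \<open>a\<close>: with \<open>s = Re (a / z)\<close> the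
  derivative has modulus \<open>exp (- s) * s / Re z\<close>, and
  \<open>s * exp (- s) \<le> 1\<close>. Uniformity matters because \<open>a\<close> will be a square
  norm, over which nothing is assumed integrable.\<close>

lemma exp_minus_divide_Lipschitz:
  assumes e: "0 < e" and a: "0 \<le> a" and l: "e < Re l" "e < Re l'"
  shows "cmod (exp (- (complex_of_real a / l)) - exp (- (complex_of_real a / l'))) \<le> 1 / e * cmod (l - l')"
proof (rule field_differentiable_bound[where S="{z. e < Re z}" and f'="\<lambda>z. exp (- (complex_of_real a / z)) * (complex_of_real a / z\<^sup>2)"])
  show "convex {z. e < Re z}" by (rule convex_halfspace_Re_gt)
  fix z assume "z \<in> {z. e < Re z}"
  then have z: "e < Re z" "z \<noteq> 0" using e by auto
  show "((\<lambda>z. exp (- (complex_of_real a / z))) has_field_derivative exp (- (complex_of_real a / z)) * (complex_of_real a / z\<^sup>2)) (at z within {z. e < Re z})"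
    using z by (auto intro!: derivative_eq_intros simp: power2_eq_square)
  define s where "s = a * Re z / (cmod z)\<^sup>2"
  have "Re (complex_of_real a / z) = s" by (simp add: s_def Re_divide cmod_power2)
  then have "cmod (exp (- (complex_of_real a / z)) * (complex_of_real a / z\<^sup>2)) = exp (- s) * (a / (cmod z)\<^sup>2)"
    using a by (simp add: norm_mult norm_exp_eq_Re norm_divide norm_power)
  also have "a / (cmod z)\<^sup>2 = s / Re z" using z e by (simp add: s_def)
  also have "exp (- s) * (s / Re z) \<le> 1 / Re z"
  proof -
    have "s \<le> exp s" using exp_ge_add_one_self[of s] by linarith
    then have "exp (- s) * s \<le> 1" by (simp add: exp_minus field_simps)
    then have "exp (- s) * s / Re z \<le> 1 / Re z" using z e by (intro divide_right_mono) auto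
    then show ?thesis by simp
  qed
  also have "\<dots> \<le> 1 / e" using z e by (intro divide_left_mono) auto
  finally show "cmod (exp (- (complex_of_real a / z)) * (complex_of_real a / z\<^sup>2)) \<le> 1 / e" .
qed (use l in auto)

lemma holomorphic_Gaussian_integral:
  fixes Z :: "'a \<Rightarrow> complex" and a :: "'a \<Rightarrow> real"
  assumes Z: "integrable N Z" and a[measurable]: "a \<in> borel_measurable N" and a0: "\<And>u. 0 \<le> a u"
  shows "(\<lambda>l. \<integral>u. Z u * exp (- (complex_of_real (a u) / l)) \<partial>N) holomorphic_on Cplus"
proof -
  note [measurable] = borel_measurable_integrable[OF Z]
  define J where "J l = (\<integral>u. Z u * exp (- (complex_of_real (a u) / l)) \<partial>N)" for l
  have int: "integrable N (\<lambda>u. Z u * exp (- (complex_of_real (a u) / l)))" if "0 < Re l" for l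
    by (rule Bochner_Integration.integrable_bound[OF Z])
      (use norm_exp_minus_divide_le_1[OF that a0] in \<open>auto simp: norm_mult intro!: AE_I2 mult_left_le\<close>)
  have "J field_differentiable (at l)" if l: "0 < Re l" for l
  proof -
    \<comment> \<open>Half the distance of \<open>l\<close> to the imaginary axis, so that the
      Lipschitz bound holds on a half-plane which is a neighbourhood of \<open>l\<close>; it then
      dominates the difference quotients under the integral.\<close>
    define e where "e = Re l / 2"
    have e: "0 < e" "e < Re l" using l by (auto simp: e_def)
    define D where "D = (\<integral>u. Z u * (exp (- (complex_of_real (a u) / l)) * (complex_of_real (a u) / l\<^sup>2)) \<partial>N)"
    have op: "open {z. e < Re z}" by (rule open_halfspace_Re_gt)
    have "((\<lambda>y. (J y - J l) / (y - l)) \<longlongrightarrow> D) (at l within {z. e < Re z})"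
      unfolding tendsto_at_iff_sequentially comp_def
    proof (intro allI impI)
      fix Y :: "nat \<Rightarrow> complex" assume Y: "\<forall>i. Y i \<in> {z. e < Re z} - {l}" "Y \<longlonglongrightarrow> l"
      have Yi: "e < Re (Y i)" "Y i \<noteq> l" "0 < Re (Y i)" for i using Y(1) e(1) by (auto intro: less_trans)
      have "(J (Y i) - J l) / (Y i - l) = (\<integral>u. Z u * ((exp (- (complex_of_real (a u) / Y i)) - exp (- (complex_of_real (a u) / l))) / (Y i - l)) \<partial>N)" for i
      proof -
        have "(J (Y i) - J l) / (Y i - l) = (\<integral>u. (Z u * exp (- (complex_of_real (a u) / Y i)) - Z u * exp (- (complex_of_real (a u) / l))) / (Y i - l) \<partial>N)"
          unfolding J_def by (simp only: Bochner_Integration.integral_diff[OF int[OF Yi(3)] int[OF l]] integral_divide_zero)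
        then show ?thesis by (simp add: right_diff_distrib[symmetric])
      qed
      moreover have "(\<lambda>i. \<integral>u. Z u * ((exp (- (complex_of_real (a u) / Y i)) - exp (- (complex_of_real (a u) / l))) / (Y i - l)) \<partial>N) \<longlonglongrightarrow> D"
        unfolding D_def
      proof (rule integral_dominated_convergence[where w="\<lambda>u. 1 / e * norm (Z u)"])
        show "AE u in N. (\<lambda>i. Z u * ((exp (- (complex_of_real (a u) / Y i)) - exp (- (complex_of_real (a u) / l))) / (Y i - l)))
            \<longlonglongrightarrow> Z u * (exp (- (complex_of_real (a u) / l)) * (complex_of_real (a u) / l\<^sup>2))"
        proof (rule AE_I2, rule tendsto_mult[OF tendsto_const])
          fix u
          have "l \<noteq> 0" using l by auto
          then have "((\<lambda>z. exp (- (complex_of_real (a u) / z))) has_field_derivative exp (- (complex_of_real (a u) / l)) * (complex_of_real (a u) / l\<^sup>2)) (at l)"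
            by (auto intro!: derivative_eq_intros simp: power2_eq_square)
          then have "((\<lambda>y. (exp (- (complex_of_real (a u) / y)) - exp (- (complex_of_real (a u) / l))) / (y - l))
            \<longlongrightarrow> exp (- (complex_of_real (a u) / l)) * (complex_of_real (a u) / l\<^sup>2)) (at l)"
            by (simp add: has_field_derivative_iff)
          then show "(\<lambda>i. (exp (- (complex_of_real (a u) / Y i)) - exp (- (complex_of_real (a u) / l))) / (Y i - l))
            \<longlonglongrightarrow> exp (- (complex_of_real (a u) / l)) * (complex_of_real (a u) / l\<^sup>2)"
            using Y unfolding tendsto_at_iff_sequentially comp_def by (auto dest: spec[of _ Y])
        qed
        show "AE u in N. cmod (Z u * ((exp (- (complex_of_real (a u) / Y i)) - exp (- (complex_of_real (a u) / l))) / (Y i - l))) \<le> 1 / e * norm (Z u)" for i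
        proof (rule AE_I2)
          fix u
          have "cmod (exp (- (complex_of_real (a u) / Y i)) - exp (- (complex_of_real (a u) / l))) / cmod (Y i - l) \<le> 1 / e"
            using exp_minus_divide_Lipschitz[OF e(1) a0 Yi(1) e(2), of u i] Yi(2)[of i]
            by (simp add: divide_le_eq)
          then have "cmod (Z u) * (cmod (exp (- (complex_of_real (a u) / Y i)) - exp (- (complex_of_real (a u) / l))) / cmod (Y i - l)) \<le> cmod (Z u) * (1 / e)"
            by (intro mult_left_mono) auto
          then show "cmod (Z u * ((exp (- (complex_of_real (a u) / Y i)) - exp (- (complex_of_real (a u) / l))) / (Y i - l))) \<le> 1 / e * norm (Z u)"
            by (simp only: norm_mult norm_divide mult.commute)
        qed
        show "integrable N (\<lambda>u. 1 / e * norm (Z u))" using Z by auto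
      qed measurable
      ultimately show "(\<lambda>i. (J (Y i) - J l) / (Y i - l)) \<longlonglongrightarrow> D" by (simp only:)
    qed
    then have "((\<lambda>y. (J y - J l) / (y - l)) \<longlongrightarrow> D) (at l)"
      using at_within_open[OF _ op, of l] e(2) by simp
    then have "(J has_field_derivative D) (at l)" by (simp add: has_field_derivative_iff)
    then show ?thesis unfolding field_differentiable_def by blast
  qed
  then show ?thesis
    unfolding holomorphic_on_def J_def[symmetric] Cplus_def
    by (auto intro: field_differentiable_at_within)
qed

text \<open>On the right half-plane the exponential has modulus at most 1, so
  \<open>norm (Z u)\<close> dominates up to the boundary, where
  \<open>1 / (- \<i> * q) = \<i> / q\<close>.\<close>

lemma tendsto_Gaussian_integral:
  fixes Z :: "'a \<Rightarrow> complex" and a :: "'a \<Rightarrow> real"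
  assumes Z: "integrable N Z" and a[measurable]: "a \<in> borel_measurable N" and a0: "\<And>u. 0 \<le> a u" and q: "q \<noteq> 0"
  shows "((\<lambda>l. \<integral>u. Z u * exp (- (complex_of_real (a u) / l)) \<partial>N) \<longlongrightarrow>
      (\<integral>u. Z u * exp (- (\<i> * complex_of_real (a u / q))) \<partial>N)) (at (- \<i> * complex_of_real q) within Cplus)"
  unfolding tendsto_at_iff_sequentially comp_def
proof (intro allI impI)
  note [measurable] = borel_measurable_integrable[OF Z]
  fix Y :: "nat \<Rightarrow> complex" assume Y: "\<forall>i. Y i \<in> Cplus - {- \<i> * complex_of_real q}" "Y \<longlonglongrightarrow> - \<i> * complex_of_real q"
  show "(\<lambda>i. \<integral>u. Z u * exp (- (complex_of_real (a u) / Y i)) \<partial>N) \<longlonglongrightarrow> (\<integral>u. Z u * exp (- (\<i> * complex_of_real (a u / q))) \<partial>N)"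
  proof (rule integral_dominated_convergence[where w="\<lambda>u. norm (Z u)"])
    have "complex_of_real (a u) / (- \<i> * complex_of_real q) = \<i> * complex_of_real (a u / q)" for u
      using q by (simp add: field_simps)
    moreover have "(\<lambda>i. Z u * exp (- (complex_of_real (a u) / Y i))) \<longlonglongrightarrow> Z u * exp (- (complex_of_real (a u) / (- \<i> * complex_of_real q)))" for u
      using q by (intro tendsto_intros Y(2)) auto
    ultimately show "AE u in N. (\<lambda>i. Z u * exp (- (complex_of_real (a u) / Y i))) \<longlonglongrightarrow> Z u * exp (- (\<i> * complex_of_real (a u / q)))"
      by simp
    have "cmod (exp (- (complex_of_real (a u) / Y i))) \<le> 1" for u i
      using Y(1) a0 by (intro norm_exp_minus_divide_le_1) (auto simp: Cplus_def)
    then show "AE u in N. cmod (Z u * exp (- (complex_of_real (a u) / Y i))) \<le> norm (Z u)" for i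
      by (auto simp: norm_mult intro!: AE_I2 mult_left_le)
  qed (use Z in auto)
qed

text \<open>The common shape of both analytic limits: \<open>a\<close> is a square norm divided by 2
  for the transform and by 4 for the convolution product, and the continuation just admits complex
  \<open>l\<close> in the explicit formula.\<close>

lemma has_analytic_limitI:
  fixes Z :: "'a \<Rightarrow> complex" and a :: "'a \<Rightarrow> real"
  assumes Z: "integrable N Z" and a: "a \<in> borel_measurable N" and a0: "\<And>u. 0 \<le> a u" and q: "q \<noteq> 0"
    and K: "\<And>l. l > 0 \<Longrightarrow> integrable my (K l)"
    and eq: "\<And>l. l > 0 \<Longrightarrow> (\<integral>x. K l x \<partial>my) = (\<integral>u. Z u * complex_of_real (exp (- (a u / l))) \<partial>N)"
  shows "has_analytic_limit my q K (\<integral>u. Z u * exp (- (\<i> * complex_of_real (a u / q))) \<partial>N)"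
  unfolding has_analytic_limit_def
proof (intro conjI allI impI exI[of _ "\<lambda>l. \<integral>u. Z u * exp (- (complex_of_real (a u) / l)) \<partial>N"])
  show "(\<lambda>l. \<integral>u. Z u * exp (- (complex_of_real (a u) / l)) \<partial>N) holomorphic_on Cplus"
    by (rule holomorphic_Gaussian_integral[OF Z a a0])
  show "((\<lambda>l. \<integral>u. Z u * exp (- (complex_of_real (a u) / l)) \<partial>N) \<longlongrightarrow>
      (\<integral>u. Z u * exp (- (\<i> * complex_of_real (a u / q))) \<partial>N)) (at (- \<i> * complex_of_real q) within Cplus)"
    by (rule tendsto_Gaussian_integral[OF Z a a0 q])
  fix l :: real assume "l > 0"
  then show "(\<integral>u. Z u * exp (- (complex_of_real (a u) / complex_of_real l)) \<partial>N) = (\<integral>x. K l x \<partial>my)"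
    by (simp add: eq exp_of_real[symmetric])
qed (rule K)

text \<open>The identity theorem on the half-plane, starting from the positive axis, fixes the
  continuation; as \<open>- \<i> * q\<close> is a limit point of the half-plane, the boundary value
  is fixed too. This gives the definite descriptions in \<open>transform\<close> and
  \<open>conv_product\<close> their value.\<close>

lemma has_analytic_limit_unique:
  assumes "has_analytic_limit my q K L" "has_analytic_limit my q K L'"
  shows "L = L'"
proof -
  obtain J where J: "J holomorphic_on Cplus" "\<And>l. l > 0 \<Longrightarrow> J (complex_of_real l) = (\<integral>x. K l x \<partial>my)"
    "(J \<longlongrightarrow> L) (at (- \<i> * complex_of_real q) within Cplus)"
    using assms(1) unfolding has_analytic_limit_def by blast
  obtain J' where J': "J' holomorphic_on Cplus" "\<And>l. l > 0 \<Longrightarrow> J' (complex_of_real l) = (\<integral>x. K l x \<partial>my)"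
    "(J' \<longlongrightarrow> L') (at (- \<i> * complex_of_real q) within Cplus)"
    using assms(2) unfolding has_analytic_limit_def by blast
  have op: "open Cplus" unfolding Cplus_def using open_halfspace_Re_gt[of 0] by simp
  have conn: "connected Cplus" unfolding Cplus_def using convex_halfspace_Re_gt[of 0] by (simp add: convex_connected)
  have eq: "J z - J' z = 0" if "z \<in> Cplus" for z
  proof (rule analytic_continuation[where S=Cplus and U="complex_of_real ` {0<..}" and \<xi>=1 and f="\<lambda>z. J z - J' z"])
    show "(\<lambda>z. J z - J' z) holomorphic_on Cplus" using J(1) J'(1) by (rule holomorphic_on_diff)
    show "1 islimpt complex_of_real ` {0<..}"
      unfolding islimpt_sequential
    proof (intro exI[of _ "\<lambda>n. complex_of_real (1 + 1 / real (Suc n))"] conjI allI)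
      have "(\<lambda>n. complex_of_real (1 + 1 / real (Suc n))) \<longlonglongrightarrow> complex_of_real (1 + 0)"
        by (intro tendsto_intros LIMSEQ_Suc lim_1_over_n)
      then show "(\<lambda>n. complex_of_real (1 + 1 / real (Suc n))) \<longlonglongrightarrow> 1" by simp
      fix n
      have "1 + 1 / real (Suc n) > 1" by simp
      then have "1 + 1 / real (Suc n) \<in> {0<..}" and "1 + 1 / real (Suc n) \<noteq> 1" unfolding greaterThan_iff by linarith+
      then show "complex_of_real (1 + 1 / real (Suc n)) \<in> complex_of_real ` {0<..} - {1}"
        by (simp only: Diff_iff image_eqI singleton_iff of_real_eq_1_iff simp_thms)
    qed
    show "J z - J' z = 0" if "z \<in> complex_of_real ` {0<..}" for z
      using that J(2) J'(2) by auto
  qed (use op conn that in \<open>auto simp: Cplus_def\<close>)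
  have nt: "at (- \<i> * complex_of_real q) within Cplus \<noteq> bot"
    unfolding trivial_limit_within not_not islimpt_sequential
  proof (intro exI[of _ "\<lambda>n. complex_of_real (1 / real (Suc n)) - \<i> * complex_of_real q"] conjI allI)
    have "(\<lambda>n. complex_of_real (1 / real (Suc n)) - \<i> * complex_of_real q) \<longlonglongrightarrow> complex_of_real 0 - \<i> * complex_of_real q"
      by (intro tendsto_diff tendsto_const tendsto_of_real LIMSEQ_Suc lim_1_over_n)
    then show "(\<lambda>n. complex_of_real (1 / real (Suc n)) - \<i> * complex_of_real q) \<longlonglongrightarrow> - \<i> * complex_of_real q" by simp
  qed (auto simp: Cplus_def complex_eq_iff)
  have "(J' \<longlongrightarrow> L) (at (- \<i> * complex_of_real q) within Cplus)"
    using J(3) by (rule Lim_transform_within[OF _ zero_less_one]) (use eq in auto)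
  then show ?thesis using J'(3) nt tendsto_unique by blast
qed

section \<open>Fubini for superpositions of exponentials of stochastic integrals\<close>

context yeh_wiener
begin

abbreviation "Lb \<equiv> L2_borel S T"

text \<open>Each term of the series is a function of \<open>w\<close> times a function of the path,
  so joint measurability comes down to that of the coefficients.\<close>

lemma pwz_joint_measurable:
  assumes [measurable]: "\<And>j. (\<lambda>w. co (g w) j) \<in> borel_measurable N"
  shows "(\<lambda>p. pw (g (fst p)) (snd p)) \<in> borel_measurable (N \<Otimes>\<^sub>M M)"
proof -
  have "(\<lambda>p. lim (\<lambda>n. \<Sum>j<n. co (g (fst p)) j * X j (snd p))) \<in> borel_measurable (N \<Otimes>\<^sub>M M)"
    by (intro borel_measurable_lim_metric) measurable
  then show ?thesis
    by (rule measurable_cong[THEN iffD1, rotated]) (auto simp: pwz_eq space_M space_pair_measure)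
qed

lemma pwz_measurable_fst:
  assumes [measurable]: "\<And>j. (\<lambda>w. co (g w) j) \<in> borel_measurable N" and "y \<in> C0 S T"
  shows "(\<lambda>w. pw (g w) y) \<in> borel_measurable N"
  unfolding pwz_eq[OF assms(2)] by (intro borel_measurable_lim_metric) measurable

text \<open>The null set of paths on which the series for \<open>g w\<close> diverges depends on
  \<open>w\<close>. Fubini trades it for a single null set of paths, off which the series converges
  for almost all \<open>w\<close>.\<close>

lemma pwz_conv_AE_swap:
  assumes N: "finite_measure N" and g: "\<forall>w\<in>space N. g w \<in> LL"
    and m[measurable]: "\<And>j. (\<lambda>w. co (g w) j) \<in> borel_measurable N"
  shows "AE x in M. AE w in N. pwz_conv (g w) x"
proof -
  interpret N: finite_measure N by fact
  interpret NM: pair_sigma_finite N M ..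
  have "AE w in N. AE x in M. pwz_conv (g w) x"
    by (intro AE_I2 pwz_conv_AE g[rule_format])
  moreover have "{p \<in> space (N \<Otimes>\<^sub>M M). pwz_conv (g (fst p)) (snd p)} \<in> sets (N \<Otimes>\<^sub>M M)"
    unfolding pwz_conv_def summable_iff_convergent Cauchy_convergent_iff[symmetric]
    by (intro sets_Collect_Cauchy) measurable
  ultimately show ?thesis by (subst (asm) NM.AE_commute) auto
qed

lemma char_Fubini:
  fixes Z :: "'w \<Rightarrow> complex"
  assumes N: "finite_measure N" and g: "\<forall>w\<in>space N. g w \<in> LL"
    and m: "\<And>j. (\<lambda>w. co (g w) j) \<in> borel_measurable N"
    and Z: "integrable N Z"
  shows "integrable M (\<lambda>x. \<integral>w. Z w * iexp (t * pw (g w) x) \<partial>N)"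
    and "(\<integral>x. (\<integral>w. Z w * iexp (t * pw (g w) x) \<partial>N) \<partial>M) =
         (\<integral>w. Z w * complex_of_real (exp (- (t\<^sup>2 * nsq (g w) / 2))) \<partial>N)"
proof -
  interpret N: finite_measure N by fact
  interpret NM: pair_sigma_finite N M ..
  note [measurable] = pwz_joint_measurable[OF m] borel_measurable_integrable[OF Z]
  define H where "H p = Z (fst p) * iexp (t * pw (g (fst p)) (snd p))" for p
  have Hm: "H \<in> borel_measurable (N \<Otimes>\<^sub>M M)" unfolding H_def[abs_def] by measurable
  have Hi: "integrable (N \<Otimes>\<^sub>M M) H"
  proof (rule NM.Fubini_integrable[OF Hm])
    show "integrable N (\<lambda>w. \<integral>x. norm (H (w, x)) \<partial>M)"
      using Z by (simp add: H_def norm_mult prob_space)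
    show "AE w in N. integrable M (\<lambda>x. H (w, x))"
    proof (rule AE_I2)
      fix w assume "w \<in> space N"
      then have [measurable]: "(\<lambda>x. H (w, x)) \<in> borel_measurable M" using Hm by measurable
      show "integrable M (\<lambda>x. H (w, x))"
      proof (rule integrable_const_bound)
        show "AE x in M. norm (H (w, x)) \<le> norm (Z w)" by (rule AE_I2) (simp add: H_def norm_mult)
      qed measurable
    qed
  qed
  have Hi': "integrable (N \<Otimes>\<^sub>M M) (case_prod (\<lambda>w x. H (w, x)))" using Hi by (simp add: case_prod_beta)
  show "integrable M (\<lambda>x. \<integral>w. Z w * iexp (t * pw (g w) x) \<partial>N)"
    using NM.integrable_snd[OF Hi'] by (simp add: H_def)
  have "(\<integral>x. (\<integral>w. H (w, x) \<partial>N) \<partial>M) = (\<integral>w. (\<integral>x. H (w, x) \<partial>M) \<partial>N)"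
    by (rule NM.Fubini_integral[OF Hi'])
  also have "\<dots> = (\<integral>w. Z w * complex_of_real (exp (- (t\<^sup>2 * nsq (g w) / 2))) \<partial>N)"
  proof (intro Bochner_Integration.integral_cong refl)
    fix w assume "w \<in> space N"
    then show "(\<integral>x. H (w, x) \<partial>M) = Z w * complex_of_real (exp (- (t\<^sup>2 * nsq (g w) / 2)))"
      unfolding H_def fst_conv snd_conv by (simp only: integral_mult_right_zero pwz_char[OF g[rule_format]])
  qed
  finally show "(\<integral>x. (\<integral>w. Z w * iexp (t * pw (g w) x) \<partial>N) \<partial>M) =
         (\<integral>w. Z w * complex_of_real (exp (- (t\<^sup>2 * nsq (g w) / 2))) \<partial>N)" by (simp add: H_def)
qed

end

section \<open>Uniqueness of the representing measure\<close>

definition dint :: "'w measure \<Rightarrow> ('w \<Rightarrow> complex) \<Rightarrow> ('w \<Rightarrow> 'a) \<Rightarrow> ('a \<Rightarrow> real) \<Rightarrow> complex" where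
  "dint N z \<pi> \<psi> = (\<integral>w. z w * complex_of_real (\<psi> (\<pi> w)) \<partial>N)"

lemma dint_integrable:
  assumes z: "integrable N z" and \<pi>[measurable]: "\<pi> \<in> measurable N L"
    and \<psi>[measurable]: "\<psi> \<in> borel_measurable L" and b: "\<And>u. u \<in> space L \<Longrightarrow> \<bar>\<psi> u\<bar> \<le> K"
  shows "integrable N (\<lambda>w. z w * complex_of_real (\<psi> (\<pi> w)))"
proof (rule Bochner_Integration.integrable_bound[where f="\<lambda>w. K * norm (z w)"])
  note [measurable] = borel_measurable_integrable[OF z]
  show "(\<lambda>w. z w * complex_of_real (\<psi> (\<pi> w))) \<in> borel_measurable N" by measurable
  show "AE w in N. norm (z w * complex_of_real (\<psi> (\<pi> w))) \<le> norm (K * norm (z w))"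
  proof (rule AE_I2)
    fix w assume "w \<in> space N"
    then have "\<pi> w \<in> space L" using \<pi> by (rule measurable_space[rotated])
    then have "\<bar>\<psi> (\<pi> w)\<bar> * cmod (z w) \<le> \<bar>K\<bar> * cmod (z w)" using b by (intro mult_right_mono) force+
    then show "norm (z w * complex_of_real (\<psi> (\<pi> w))) \<le> norm (K * norm (z w))"
      by (simp add: norm_mult abs_mult mult.commute)
  qed
qed (use z in auto)

lemma dint_tendsto:
  assumes z: "integrable N z" and \<pi>[measurable]: "\<pi> \<in> measurable N L"
    and f[measurable]: "\<And>n. f n \<in> borel_measurable L" and b: "\<And>n u. u \<in> space L \<Longrightarrow> \<bar>f n u\<bar> \<le> K"
    and l: "\<And>u. u \<in> space L \<Longrightarrow> (\<lambda>n. f n u) \<longlonglongrightarrow> \<psi> u"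
  shows "(\<lambda>n. dint N z \<pi> (f n)) \<longlonglongrightarrow> dint N z \<pi> \<psi>"
  unfolding dint_def
proof (rule integral_dominated_convergence[where w="\<lambda>w. K * norm (z w)"])
  note [measurable] = borel_measurable_integrable[OF z]
  have "\<psi> \<in> borel_measurable L" by (rule borel_measurable_LIMSEQ_real[OF l f])
  then show "(\<lambda>w. z w * complex_of_real (\<psi> (\<pi> w))) \<in> borel_measurable N" by measurable
  show "(\<lambda>w. z w * complex_of_real (f n (\<pi> w))) \<in> borel_measurable N" for n by measurable
  show "AE w in N. (\<lambda>n. z w * complex_of_real (f n (\<pi> w))) \<longlonglongrightarrow> z w * complex_of_real (\<psi> (\<pi> w))"
    using measurable_space[OF \<pi>] by (intro AE_I2 tendsto_intros l)
  show "AE w in N. norm (z w * complex_of_real (f n (\<pi> w))) \<le> K * norm (z w)" for n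
  proof (rule AE_I2)
    fix w assume "w \<in> space N"
    then have "\<bar>f n (\<pi> w)\<bar> * cmod (z w) \<le> K * cmod (z w)" using b measurable_space[OF \<pi>] by (intro mult_right_mono) auto
    then show "norm (z w * complex_of_real (f n (\<pi> w))) \<le> K * norm (z w)" by (simp add: norm_mult mult.commute)
  qed
qed (use z in auto)

context rectangle
begin

lemma ip_add_right: "u \<in> LL \<Longrightarrow> v \<in> LL \<Longrightarrow> w \<in> LL \<Longrightarrow> ip w (\<lambda>p. u p + v p) = ip w u + ip w v"
  unfolding inner2_def by (simp add: distrib_left L2_prod)

lemma ip_scale_right: "ip w (\<lambda>p. c * u p) = c * ip w u"
  by (simp add: inner2_def mult.left_commute)

lemma ip_zero_right: "ip w (\<lambda>p. 0) = 0"
  by (simp add: inner2_def)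

end

section \<open>From Gaussian bumps to Borel sets\<close>

locale bump_agreement = rectangle_basis S T \<phi> for S T \<phi> +
  fixes N1 :: "'w measure" and z1 :: "'w \<Rightarrow> complex" and \<pi>1 :: "'w \<Rightarrow> sheet"
    and N2 :: "'v measure" and z2 :: "'v \<Rightarrow> complex" and \<pi>2 :: "'v \<Rightarrow> sheet"
  assumes z1: "integrable N1 z1" and \<pi>1: "\<pi>1 \<in> measurable N1 (L2_borel S T)"
    and z2: "integrable N2 z2" and \<pi>2: "\<pi>2 \<in> measurable N2 (L2_borel S T)"
    and bump: "\<And>a d. 0 < a \<Longrightarrow> d \<in> L2 S T \<Longrightarrow>
       dint N1 z1 \<pi>1 (\<lambda>u. exp (- (a * nsq (\<lambda>p. u p - d p)))) = dint N2 z2 \<pi>2 (\<lambda>u. exp (- (a * nsq (\<lambda>p. u p - d p))))"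
begin

abbreviation "Lb \<equiv> L2_borel S T"

text \<open>A Gaussian bump up to a constant factor, by completing the square around
  \<open>w / (2 * a)\<close>. Written with a linear term, products of bumps merely add the
  parameters.\<close>

definition E :: "real \<Rightarrow> sheet \<Rightarrow> sheet \<Rightarrow> real" where
  "E a w u = exp (ip u w - a * nsq u)"

lemma ip_le_nsq:
  assumes a: "0 < a" and w: "w \<in> LL" and u: "u \<in> LL"
  shows "ip u w - a * nsq u = nsq w / (4 * a) - a * nsq (\<lambda>p. u p - (1 / (2 * a)) * w p)"
proof -
  have "nsq (\<lambda>p. u p - (1 / (2 * a)) * w p) = nsq u - 2 * ip u (\<lambda>p. (1 / (2 * a)) * w p) + nsq (\<lambda>p. (1 / (2 * a)) * w p)"
    by (rule nsq_diff[OF u L2_scale[OF w]])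
  also have "ip u (\<lambda>p. (1 / (2 * a)) * w p) = ip u w / (2 * a)"
    by (subst ip_scale_right) simp
  also have "nsq (\<lambda>p. (1 / (2 * a)) * w p) = nsq w / (4 * a\<^sup>2)"
    unfolding nsq_scale by (simp add: power_divide power_mult_distrib)
  finally show ?thesis using a by (simp add: field_simps power2_eq_square)
qed

lemma E_bounded:
  assumes a: "0 < a" and w: "w \<in> LL" and u: "u \<in> LL"
  shows "\<bar>E a w u\<bar> \<le> exp (nsq w / (4 * a))"
  unfolding E_def ip_le_nsq[OF a w u] using a by (simp add: nsq_nonneg)

lemma nsq_id_measurable: "(\<lambda>u. nsq u) \<in> borel_measurable Lb"
  by (rule nsq_measurable) (auto intro: ip_measurable phi_L2)

lemma E_measurable: "w \<in> LL \<Longrightarrow> E a w \<in> borel_measurable Lb"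
  unfolding E_def[abs_def] using nsq_id_measurable ip_measurable[of w] by measurable

lemma E_mult: "w \<in> LL \<Longrightarrow> v \<in> LL \<Longrightarrow> u \<in> LL \<Longrightarrow> E a w u * E b v u = E (a + b) (\<lambda>p. w p + v p) u"
  unfolding E_def by (simp add: ip_add_right algebra_simps flip: exp_add)

definition agree :: "(sheet \<Rightarrow> real) \<Rightarrow> bool" where
  "agree \<psi> \<longleftrightarrow> dint N1 z1 \<pi>1 \<psi> = dint N2 z2 \<pi>2 \<psi>"

lemma dint_cong: "(\<And>u. u \<in> LL \<Longrightarrow> f u = g u) \<Longrightarrow> dint N1 z1 \<pi>1 f = dint N1 z1 \<pi>1 g"
  "(\<And>u. u \<in> LL \<Longrightarrow> f u = g u) \<Longrightarrow> dint N2 z2 \<pi>2 f = dint N2 z2 \<pi>2 g"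
  unfolding dint_def using measurable_space[OF \<pi>1] measurable_space[OF \<pi>2]
  by (auto intro!: Bochner_Integration.integral_cong)

lemma agree_cong: "(\<And>u. u \<in> LL \<Longrightarrow> f u = g u) \<Longrightarrow> agree f \<longleftrightarrow> agree g"
  unfolding agree_def using dint_cong[of f g] by simp

lemma agree_E:
  assumes a: "0 < a" and w: "w \<in> LL" shows "agree (E a w)"
proof -
  have e: "E a w u = exp (nsq w / (4 * a)) * exp (- (a * nsq (\<lambda>p. u p - (1 / (2 * a)) * w p)))" if "u \<in> LL" for u
    unfolding E_def ip_le_nsq[OF a w that] by (simp flip: exp_add)
  have s: "dint N z \<pi> (\<lambda>u. c * f u) = complex_of_real c * dint N z \<pi> f" for N :: "'d measure" and z \<pi> c and f :: "sheet \<Rightarrow> real"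
    unfolding dint_def by (simp add: mult.left_commute)
  show ?thesis unfolding agree_def
    using dint_cong[of "E a w", OF e] bump[OF a L2_scale[OF w, of "1 / (2 * a)"]] by (simp add: s)
qed

lemma agree_lim:
  assumes "\<And>n. f n \<in> borel_measurable Lb" "\<And>n u. u \<in> LL \<Longrightarrow> \<bar>f n u\<bar> \<le> K"
    and "\<And>u. u \<in> LL \<Longrightarrow> (\<lambda>n. f n u) \<longlonglongrightarrow> \<psi> u" and "\<And>n. agree (f n)"
  shows "agree \<psi>"
proof -
  have "(\<lambda>n. dint N1 z1 \<pi>1 (f n)) \<longlonglongrightarrow> dint N1 z1 \<pi>1 \<psi>" by (rule dint_tendsto[OF z1 \<pi>1]) (use assms in auto)
  moreover have "(\<lambda>n. dint N2 z2 \<pi>2 (f n)) \<longlonglongrightarrow> dint N2 z2 \<pi>2 \<psi>" by (rule dint_tendsto[OF z2 \<pi>2]) (use assms in auto)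
  ultimately show ?thesis using assms(4) unfolding agree_def by (simp add: LIMSEQ_unique)
qed

lemma agree_lincomb:
  assumes f: "f \<in> borel_measurable Lb" "\<And>u. u \<in> LL \<Longrightarrow> \<bar>f u\<bar> \<le> K" "agree f"
    and g: "g \<in> borel_measurable Lb" "\<And>u. u \<in> LL \<Longrightarrow> \<bar>g u\<bar> \<le> K'" "agree g"
  shows "agree (\<lambda>u. a * f u + b * g u)"
proof -
  have d: "dint N z \<pi> (\<lambda>u. a * f u + b * g u) = complex_of_real a * dint N z \<pi> f + complex_of_real b * dint N z \<pi> g"
    if z: "integrable N z" and p: "\<pi> \<in> measurable N Lb" for N :: "'d measure" and z \<pi>
  proof -
    have i: "integrable N (\<lambda>w. z w * complex_of_real (f (\<pi> w)))" "integrable N (\<lambda>w. z w * complex_of_real (g (\<pi> w)))"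
      using dint_integrable[OF z p f(1), of K] dint_integrable[OF z p g(1), of K'] f(2) g(2) by auto
    have "dint N z \<pi> (\<lambda>u. a * f u + b * g u) = (\<integral>w. complex_of_real a * (z w * complex_of_real (f (\<pi> w))) + complex_of_real b * (z w * complex_of_real (g (\<pi> w))) \<partial>N)"
      unfolding dint_def by (intro Bochner_Integration.integral_cong refl) (simp add: algebra_simps)
    then show ?thesis using i by (simp add: dint_def)
  qed
  show ?thesis using f(3) g(3) unfolding agree_def d[OF z1 \<pi>1] d[OF z2 \<pi>2] by simp
qed

text \<open>Plain agreement is not stable under multiplication. Demanding it after multiplication by
  every \<open>E a w\<close> gives a property that survives further bump factors;
  \<open>a > 0\<close> keeps these factors bounded.\<close>

definition good :: "(sheet \<Rightarrow> real) \<Rightarrow> bool" where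
  "good \<psi> \<longleftrightarrow> \<psi> \<in> borel_measurable Lb \<and> (\<exists>K. \<forall>u\<in>LL. \<bar>\<psi> u\<bar> \<le> K) \<and>
     (\<forall>a>0. \<forall>w\<in>LL. agree (\<lambda>u. \<psi> u * E a w u))"

lemma good_1: "good (\<lambda>u. 1)"
  unfolding good_def by (auto intro!: agree_E exI[of _ 1] simp: agree_E[unfolded agree_def] agree_def cong: dint_cong)

lemma good_mult_E:
  assumes "good \<psi>" "0 < b" "v \<in> LL" shows "good (\<lambda>u. \<psi> u * E b v u)"
  unfolding good_def
proof (intro conjI allI impI ballI)
  show "(\<lambda>u. \<psi> u * E b v u) \<in> borel_measurable Lb"
    using assms E_measurable[OF assms(3), of b] unfolding good_def by (intro borel_measurable_times) auto
  obtain K where K: "\<And>u. u \<in> LL \<Longrightarrow> \<bar>\<psi> u\<bar> \<le> K" using assms unfolding good_def by blast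
  show "\<exists>K. \<forall>u\<in>LL. \<bar>\<psi> u * E b v u\<bar> \<le> K"
  proof (intro exI[of _ "K * exp (nsq v / (4 * b))"] ballI)
    fix u assume u: "u \<in> LL"
    show "\<bar>\<psi> u * E b v u\<bar> \<le> K * exp (nsq v / (4 * b))"
      unfolding abs_mult using K[OF u] E_bounded[OF assms(2,3) u] by (intro mult_mono) (auto intro: order_trans[OF abs_ge_zero])
  qed
  fix a w assume aw: "0 < (a::real)" "w \<in> LL"
  then have "agree (\<lambda>u. \<psi> u * E (b + a) (\<lambda>p. v p + w p) u)"
    using assms(1) L2_add[OF assms(3) aw(2)] add_pos_pos[OF assms(2) aw(1)] unfolding good_def by blast
  then show "agree (\<lambda>u. \<psi> u * E b v u * E a w u)"
    by (rule agree_cong[THEN iffD1, rotated]) (simp add: mult.assoc E_mult assms aw)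
qed

lemma good_lim:
  assumes f: "\<And>n. good (f n)" and b: "\<And>n u. u \<in> LL \<Longrightarrow> \<bar>f n u\<bar> \<le> K"
    and l: "\<And>u. u \<in> LL \<Longrightarrow> (\<lambda>n. f n u) \<longlonglongrightarrow> \<psi> u"
  shows "good \<psi>"
  unfolding good_def
proof (intro conjI allI impI ballI)
  have fm: "f n \<in> borel_measurable Lb" for n using f unfolding good_def by blast
  show "\<psi> \<in> borel_measurable Lb" by (rule borel_measurable_LIMSEQ_real[OF _ fm]) (use l in auto)
  have "\<bar>\<psi> u\<bar> \<le> K" if "u \<in> LL" for u
    by (rule LIMSEQ_le_const2[OF tendsto_rabs[OF l[OF that]]]) (use b that in auto)
  then show "\<exists>K. \<forall>u\<in>LL. \<bar>\<psi> u\<bar> \<le> K" by blast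
  fix a w assume aw: "0 < (a::real)" "w \<in> LL"
  show "agree (\<lambda>u. \<psi> u * E a w u)"
  proof (rule agree_lim[where f="\<lambda>n u. f n u * E a w u" and K="K * exp (nsq w / (4 * a))"])
    show "(\<lambda>u. f n u * E a w u) \<in> borel_measurable Lb" for n using fm E_measurable[OF aw(2)] by (rule borel_measurable_times)
    show "\<bar>f n u * E a w u\<bar> \<le> K * exp (nsq w / (4 * a))" if u: "u \<in> LL" for n u
      unfolding abs_mult using b[OF u] E_bounded[OF aw u] by (intro mult_mono) (auto intro: order_trans[OF abs_ge_zero])
    show "(\<lambda>n. f n u * E a w u) \<longlonglongrightarrow> \<psi> u * E a w u" if "u \<in> LL" for u
      by (intro tendsto_intros l that)
    show "agree (\<lambda>u. f n u * E a w u)" for n using f aw unfolding good_def by blast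
  qed
qed

lemma good_lincomb:
  assumes f: "good f" and g: "good g" shows "good (\<lambda>u. a * f u + b * g u)"
  unfolding good_def
proof (intro conjI allI impI ballI)
  have m: "f \<in> borel_measurable Lb" "g \<in> borel_measurable Lb" using f g unfolding good_def by auto
  then show "(\<lambda>u. a * f u + b * g u) \<in> borel_measurable Lb" by measurable
  obtain K K' where K: "\<And>u. u \<in> LL \<Longrightarrow> \<bar>f u\<bar> \<le> K" "\<And>u. u \<in> LL \<Longrightarrow> \<bar>g u\<bar> \<le> K'" using f g unfolding good_def by blast
  have "\<bar>a * f u + b * g u\<bar> \<le> \<bar>a\<bar> * K + \<bar>b\<bar> * K'" if "u \<in> LL" for u
    using K[OF that] by (intro order_trans[OF abs_triangle_ineq] add_mono) (simp_all add: abs_mult mult_left_mono)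
  then show "\<exists>K. \<forall>u\<in>LL. \<bar>a * f u + b * g u\<bar> \<le> K" by blast
  fix c w assume cw: "0 < (c::real)" "w \<in> LL"
  note Em = E_measurable[OF cw(2), of c]
  let ?e = "exp (nsq w / (4 * c))"
  have "agree (\<lambda>u. a * (f u * E c w u) + b * (g u * E c w u))"
  proof (rule agree_lincomb)
    show "\<bar>f u * E c w u\<bar> \<le> K * ?e" "\<bar>g u * E c w u\<bar> \<le> K' * ?e" if "u \<in> LL" for u
      unfolding abs_mult using K[OF that] E_bounded[OF cw that] by (auto intro!: mult_mono intro: order_trans[OF abs_ge_zero])
    show "agree (\<lambda>u. f u * E c w u)" "agree (\<lambda>u. g u * E c w u)" using f g cw unfolding good_def by auto
  qed (use m Em in auto)
  then show "agree (\<lambda>u. (a * f u + b * g u) * E c w u)" by (simp add: algebra_simps)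
qed

text \<open>The test factor is removed by \<open>E (1 / real (Suc n)) (\<lambda>p. 0)\<close>, which
  is bounded by 1 and tends to 1.\<close>

lemma good_agree:
  assumes "good \<psi>" shows "agree \<psi>"
proof -
  obtain K where K: "\<And>u. u \<in> LL \<Longrightarrow> \<bar>\<psi> u\<bar> \<le> K" using assms unfolding good_def by blast
  have E0: "E a (\<lambda>p. 0) u = exp (- (a * nsq u))" for a u
    by (simp add: E_def ip_zero_right)
  show ?thesis
  proof (rule agree_lim[where f="\<lambda>n u. \<psi> u * E (1 / real (Suc n)) (\<lambda>p. 0) u" and K=K])
    show "(\<lambda>u. \<psi> u * E (1 / real (Suc n)) (\<lambda>p. 0) u) \<in> borel_measurable Lb" for n
      using assms E_measurable[OF L2_zero] unfolding good_def by (intro borel_measurable_times) auto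
    show "\<bar>\<psi> u * E (1 / real (Suc n)) (\<lambda>p. 0) u\<bar> \<le> K" if "u \<in> LL" for n u
    proof -
      have "\<bar>\<psi> u\<bar> * exp (- (1 / real (Suc n) * nsq u)) \<le> K * 1"
        using K[OF that] nsq_nonneg[of u] by (intro mult_mono) (auto intro: order_trans[OF abs_ge_zero])
      then show ?thesis by (simp add: E0 abs_mult)
    qed
    show "(\<lambda>n. \<psi> u * E (1 / real (Suc n)) (\<lambda>p. 0) u) \<longlonglongrightarrow> \<psi> u" if "u \<in> LL" for u
    proof -
      have "(\<lambda>n. \<psi> u * exp (- (1 / real (Suc n) * nsq u))) \<longlonglongrightarrow> \<psi> u * exp (- (0 * nsq u))"
        by (intro tendsto_intros LIMSEQ_Suc lim_1_over_n)
      then show ?thesis by (simp add: E0)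
    qed
    show "agree (\<lambda>u. \<psi> u * E (1 / real (Suc n)) (\<lambda>p. 0) u)" for n
      using assms L2_zero unfolding good_def by auto
  qed
qed

text \<open>\<open>exp (- m (C e)^m)\<close> tends to the indicator of \<open>{C e < 1}\<close> and is a power series in the bump \<open>e\<close>.\<close>

lemma good_outside_ball:
  assumes \<psi>: "good \<psi>" and d: "d \<in> LL"
  shows "good (\<lambda>u. \<psi> u * indicator {u. nsq (\<lambda>p. u p - d p) > r} u)"
proof -
  obtain K where K: "\<And>u. u \<in> LL \<Longrightarrow> \<bar>\<psi> u\<bar> \<le> K" using \<psi> unfolding good_def by blast
  define e where "e u = exp (- nsq (\<lambda>p. u p - d p))" for u
  \<comment> \<open>The normalisation by \<open>exp r\<close> makes \<open>exp r * e u < 1\<close>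
    equivalent to lying outside the closed ball of squared radius \<open>r\<close>.\<close>
  define y where "y m u = (exp r * e u) ^ m" for m u
  have e1: "0 < e u" "e u \<le> 1" for u by (auto simp: e_def nsq_nonneg)
  have eE: "e u = exp (- nsq d) * E 1 (\<lambda>p. 2 * d p) u" if "u \<in> LL" for u
    unfolding e_def E_def using nsq_diff[OF that d] by (simp add: ip_scale_right flip: exp_add)
  have good_cong: "good f \<Longrightarrow> (\<And>u. u \<in> LL \<Longrightarrow> f u = g u) \<Longrightarrow> good g" for f g
  proof -
    assume f: "good f" and e: "\<And>u. u \<in> LL \<Longrightarrow> f u = g u"
    obtain K where K: "\<And>u. u \<in> LL \<Longrightarrow> \<bar>f u\<bar> \<le> K" using f unfolding good_def by blast
    show "good g" by (rule good_lim[where f="\<lambda>n. f" and K=K]) (use f K e in auto)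
  qed
  have good_scale: "good f \<Longrightarrow> good (\<lambda>u. c * f u)" for f c
    using good_lincomb[of f f c 0] by simp
  have pow: "good (\<lambda>u. \<psi> u * e u ^ k)" for k
  proof (induction k)
    case 0 then show ?case using \<psi> by simp
  next
    case (Suc k)
    have "good (\<lambda>u. exp (- nsq d) * ((\<psi> u * e u ^ k) * E 1 (\<lambda>p. 2 * d p) u))"
      by (intro good_scale good_mult_E Suc L2_scale d) simp
    then show ?case by (rule good_cong) (simp add: eE)
  qed
  have ser: "good (\<lambda>u. \<psi> u * (\<Sum>k<n. (- real m) ^ k / fact k * y m u ^ k))" for m n
  proof (induction n)
    case 0
    show ?case using good_scale[OF \<psi>, of 0] by simp
  next
    case (Suc n)
    have "good (\<lambda>u. 1 * (\<psi> u * (\<Sum>k<n. (- real m) ^ k / fact k * y m u ^ k)) +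
       (- real m) ^ n / fact n * exp r ^ (m * n) * (\<psi> u * e u ^ (m * n)))"
      by (intro good_lincomb Suc pow)
    then show ?case by (rule good_cong) (simp add: y_def power_mult_distrib power_mult[symmetric] algebra_simps)
  qed
  have y0: "0 \<le> y m u" "y m u \<le> exp r ^ m" for m u
    using e1[of u] unfolding y_def by (auto intro!: power_mono simp: mult_left_le)
  \<comment> \<open>Here \<open>m\<close> is fixed and the exponential series is summed; the bound
    may depend on \<open>m\<close>. The limit in \<open>m\<close> is taken afterwards, with a bound
    independent of \<open>m\<close>.\<close>
  have expg: "good (\<lambda>u. \<psi> u * exp (- (real m * y m u)))" for m
  proof (rule good_lim[OF ser[where m=m], where K="K * exp (real m * exp r ^ m)"])
    fix n u assume u: "u \<in> LL"
    have ss: "(\<lambda>k. (real m * y m u) ^ k / fact k) sums exp (real m * y m u)"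
      using exp_converges[of "real m * y m u"] by (simp add: divide_inverse mult.commute scaleR_conv_of_real)
    have "\<bar>\<Sum>k<n. (- real m) ^ k / fact k * y m u ^ k\<bar> \<le> (\<Sum>k<n. (real m * y m u) ^ k / fact k)"
      using y0[of m u] by (intro order_trans[OF sum_abs] sum_mono) (simp add: abs_mult power_abs power_mult_distrib)
    also have "\<dots> \<le> exp (real m * y m u)"
      unfolding sums_unique[OF ss] using y0[of m u] by (intro sum_le_suminf sums_summable[OF ss]) auto
    also have "\<dots> \<le> exp (real m * exp r ^ m)" using y0[of m u] by (simp add: mult_left_mono)
    finally show "\<bar>\<psi> u * (\<Sum>k<n. (- real m) ^ k / fact k * y m u ^ k)\<bar> \<le> K * exp (real m * exp r ^ m)"
      unfolding abs_mult using K[OF u] by (intro mult_mono) (auto intro: order_trans[OF abs_ge_zero])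
  next
    fix u assume "u \<in> LL"
    have "(\<lambda>k. (- real m * y m u) ^ k / fact k) sums exp (- real m * y m u)"
      using exp_converges[of "- real m * y m u"] by (simp add: divide_inverse mult.commute scaleR_conv_of_real)
    moreover have "(- real m) ^ k / fact k * y m u ^ k = (- real m * y m u) ^ k / fact k" for k
      by (subst power_mult_distrib) simp
    ultimately have "(\<lambda>n. \<Sum>k<n. (- real m) ^ k / fact k * y m u ^ k) \<longlonglongrightarrow> exp (- real m * y m u)"
      unfolding sums_def by (simp only:)
    then have "(\<lambda>n. \<Sum>k<n. (- real m) ^ k / fact k * y m u ^ k) \<longlonglongrightarrow> exp (- (real m * y m u))"
      by (simp only: mult_minus_left)
    then show "(\<lambda>n. \<psi> u * (\<Sum>k<n. (- real m) ^ k / fact k * y m u ^ k)) \<longlonglongrightarrow> \<psi> u * exp (- (real m * y m u))"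
      by (intro tendsto_intros)
  qed
  show ?thesis
  proof (rule good_lim[OF expg, where K=K])
    fix m u assume u: "u \<in> LL"
    have "\<bar>\<psi> u\<bar> * exp (- (real m * y m u)) \<le> K * 1"
      using K[OF u] y0[of m u] by (intro mult_mono) (auto intro: order_trans[OF abs_ge_zero])
    then show "\<bar>\<psi> u * exp (- (real m * y m u))\<bar> \<le> K" by (simp add: abs_mult)
  next
    fix u assume u: "u \<in> LL"
    define c where "c = exp r * e u"
    have c: "0 < c" using e1[of u] by (simp add: c_def)
    have ceq: "c = exp (r - nsq (\<lambda>p. u p - d p))" by (simp add: c_def e_def exp_diff exp_minus divide_inverse)
    have "(\<lambda>m. exp (- (real m * c ^ m))) \<longlonglongrightarrow> indicator {u. nsq (\<lambda>p. u p - d p) > r} u"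
    proof (cases "nsq (\<lambda>p. u p - d p) > r")
      case True
      then have "c < 1" by (simp add: ceq)
      then have "(\<lambda>m. real m * c ^ m) \<longlonglongrightarrow> 0" using c by (intro powser_times_n_limit_0) auto
      then have "(\<lambda>m. exp (- (real m * c ^ m))) \<longlonglongrightarrow> exp (- 0)" by (intro tendsto_intros)
      then show ?thesis using True by simp
    next
      case False
      \<comment> \<open>On the sphere, where \<open>c = 1\<close>, it is the extra factor
        \<open>m\<close> in the exponent that forces the limit 0, so exactly the complement of the
        closed ball is selected.\<close>
      then have c1: "1 \<le> c" by (simp add: ceq)
      have "(\<lambda>m. exp (- (real m * c ^ m))) \<longlonglongrightarrow> 0"
      proof (rule tendsto_sandwich[of "\<lambda>_. 0" _ _ "\<lambda>m. exp (- 1) ^ m"])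
        show "\<forall>\<^sub>F m in sequentially. exp (- (real m * c ^ m)) \<le> exp (- 1) ^ m"
        proof (rule always_eventually, rule allI)
          fix m
          have "real m * 1 \<le> real m * c ^ m" using c1 by (intro mult_left_mono one_le_power) auto
          then have "exp (- (real m * c ^ m)) \<le> exp (real m * (- 1))" by simp
          then show "exp (- (real m * c ^ m)) \<le> exp (- 1) ^ m" by (simp only: exp_of_nat_mult)
        qed
        show "(\<lambda>m. exp (- 1 :: real) ^ m) \<longlonglongrightarrow> 0" by (rule LIMSEQ_realpow_zero) auto
      qed auto
      then show ?thesis using False by simp
    qed
    then show "(\<lambda>m. \<psi> u * exp (- (real m * y m u))) \<longlonglongrightarrow> \<psi> u * indicator {u. nsq (\<lambda>p. u p - d p) > r} u"
      unfolding y_def c_def by (intro tendsto_intros)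
  qed
qed

lemma good_ball_algebra:
  assumes I: "finite I" "I \<subseteq> LL \<times> UNIV"
  shows "good (indicator (LL \<inter> \<Inter>((\<lambda>(d, r). closed_ball d r) ` I)))"
  using I
proof (induction I)
  case empty
  show ?case by (rule good_lim[OF good_1, where K=1]) auto
next
  case (insert x F)
  obtain d r where x: "x = (d, r)" by (cases x)
  let ?\<psi> = "indicator (LL \<inter> \<Inter>((\<lambda>(d, r). closed_ball d r) ` F)) :: sheet \<Rightarrow> real"
  have d: "d \<in> LL" using insert.prems x by auto
  have g: "good ?\<psi>" using insert by auto
  have "good (\<lambda>u. 1 * ?\<psi> u + (-1) * (?\<psi> u * indicator {u. nsq (\<lambda>p. u p - d p) > r} u))"
    by (intro good_lincomb good_outside_ball g d)
  then show ?case
    by (rule good_lim[where K=1]) (auto simp: x closed_ball_def indicator_def)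
qed

text \<open>Dynkin's argument: agreement passes to complements and disjoint unions, and its validity
  on finite intersections of balls comes from \<open>good\<close>.\<close>

lemma agree_indicator:
  assumes A: "A \<in> sets Lb" shows "agree (indicator A)"
proof -
  have A': "A \<in> sigma_sets LL ball_algebra" using A by (simp add: sets_L2_borel_balls)
  have pow: "ball_algebra \<subseteq> Pow LL" by (auto simp: ball_algebra_def)
  show ?thesis
  proof (rule sigma_sets_induct_disjoint[OF Int_stable_ball_algebra pow A', where P="\<lambda>A. agree (indicator A)"])
    fix A assume "A \<in> ball_algebra"
    then show "agree (indicator A)" unfolding ball_algebra_def using good_ball_algebra good_agree by blast
  next
    have "agree (\<lambda>u. 0 * (1::real) + 0 * 1)"
      by (rule agree_lincomb[where K=1 and K'=1]) (use good_agree[OF good_1] in auto)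
    then show "agree (indicator {})" by (simp add: indicator_def[abs_def])
  next
    fix A assume A: "A \<in> sigma_sets LL ball_algebra" "agree (indicator A)"
    have "agree (\<lambda>u. 1 * (1::real) + (-1) * indicator A u)"
      by (rule agree_lincomb[where K=1 and K'=1])
        (use good_agree[OF good_1] A in \<open>auto simp: sets_L2_borel_balls[symmetric] split: split_indicator\<close>)
    then show "agree (indicator (LL - A))"
      by (rule agree_cong[THEN iffD1, rotated]) (auto simp: indicator_def)
  next
    fix A :: "nat \<Rightarrow> sheet set"
    assume A: "disjoint_family A" "range A \<subseteq> sigma_sets LL ball_algebra" "\<And>i. agree (indicator (A i))"
    have Am: "A i \<in> sets Lb" for i using A(2) by (auto simp: sets_L2_borel_balls)
    have fin: "agree (indicator (\<Union>i<n. A i))" for n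
    proof (induction n)
      case 0
      have "agree (\<lambda>u. 0 * (1::real) + 0 * 1)"
        by (rule agree_lincomb[where K=1 and K'=1]) (use good_agree[OF good_1] in auto)
      then show ?case by (simp add: indicator_def[abs_def])
    next
      case (Suc n)
      have "agree (\<lambda>u. 1 * indicator (\<Union>i<n. A i) u + 1 * indicator (A n) u)"
        by (rule agree_lincomb[where K=1 and K'=1]) (use Suc A(3) Am in \<open>auto split: split_indicator\<close>)
      moreover have "1 * indicator (\<Union>i<n. A i) u + 1 * indicator (A n) u = (indicator (\<Union>i<Suc n. A i) u :: real)" for u
      proof -
        have "A i \<inter> A n = {}" if "i < n" for i
          using disjoint_family_onD[OF A(1), of i n] that by auto
        then have "(\<Union>i<n. A i) \<inter> A n = {}" by blast
        then show ?thesis by (auto simp: indicator_def less_Suc_eq)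
      qed
      ultimately show ?case by simp
    qed
    show "agree (indicator (\<Union> (range A)))"
    proof (rule agree_lim[where f="\<lambda>n. indicator (\<Union>i<n. A i)" and K=1])
      show "(\<lambda>n. indicator (\<Union>i<n. A i) u) \<longlonglongrightarrow> (indicator (\<Union> (range A)) u :: real)" for u
        by (rule LIMSEQ_indicator_UN)
    qed (use Am fin in \<open>auto split: split_indicator\<close>)
  qed
qed

lemma density_integrals_agree:
  fixes \<psi> :: "sheet \<Rightarrow> complex"
  assumes "\<psi> \<in> borel_measurable Lb" "\<And>u. cmod (\<psi> u) \<le> K"
  shows "(\<integral>w. z1 w * \<psi> (\<pi>1 w) \<partial>N1) = (\<integral>w. z2 w * \<psi> (\<pi>2 w) \<partial>N2)"
proof (rule complex_density_ext[OF z1 \<pi>1 z2 \<pi>2 _ assms])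
  fix A assume A: "A \<in> sets Lb"
  have "complex_of_real (indicator A u) = indicator A u" for u :: sheet by (simp add: indicator_def)
  then show "(\<integral>w. z1 w * indicator A (\<pi>1 w) \<partial>N1) = (\<integral>w. z2 w * indicator A (\<pi>2 w) \<partial>N2)"
    using agree_indicator[OF A] unfolding agree_def dint_def by simp
qed

end

section \<open>The transform of the convolution product\<close>

lemma integral_pair_mult:
  fixes f :: "'a \<Rightarrow> complex" and g :: "'b \<Rightarrow> complex"
  assumes A: "finite_measure A" and B: "finite_measure B" and f: "integrable A f" and g: "integrable B g"
  shows "integrable (A \<Otimes>\<^sub>M B) (\<lambda>w. f (fst w) * g (snd w))"
    and "(\<integral>w. f (fst w) * g (snd w) \<partial>(A \<Otimes>\<^sub>M B)) = (\<integral>u. f u \<partial>A) * (\<integral>v. g v \<partial>B)"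
proof -
  interpret A: finite_measure A by fact
  interpret B: finite_measure B by fact
  interpret AB: pair_sigma_finite A B ..
  note [measurable] = borel_measurable_integrable[OF f] borel_measurable_integrable[OF g]
  show i: "integrable (A \<Otimes>\<^sub>M B) (\<lambda>w. f (fst w) * g (snd w))"
  proof (rule AB.Fubini_integrable)
    show "integrable A (\<lambda>x. \<integral>y. norm (f (fst (x, y)) * g (snd (x, y))) \<partial>B)"
      using f by (simp add: norm_mult)
    show "AE x in A. integrable B (\<lambda>y. f (fst (x, y)) * g (snd (x, y)))" using g by simp
  qed measurable
  have "(\<integral>w. f (fst w) * g (snd w) \<partial>(A \<Otimes>\<^sub>M B)) = (\<integral>x. \<integral>y. f (fst (x, y)) * g (snd (x, y)) \<partial>B \<partial>A)"
    by (rule AB.integral_fst'[OF i, symmetric])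
  then show "(\<integral>w. f (fst w) * g (snd w) \<partial>(A \<Otimes>\<^sub>M B)) = (\<integral>u. f u \<partial>A) * (\<integral>v. g v \<partial>B)" by simp
qed

section \<open>Uniqueness and the choice made by \<open>measure_for\<close>\<close>

context yeh_wiener
begin

lemma co_measurable: "\<pi> \<in> measurable N Lb \<Longrightarrow> (\<lambda>w. co (\<pi> w) j) \<in> borel_measurable N"
  by (rule measurable_compose[OF _ ip_measurable[OF phi_L2]])

lemma measurable_L2: "\<pi> \<in> measurable N Lb \<Longrightarrow> w \<in> space N \<Longrightarrow> \<pi> w \<in> LL"
  using measurable_space[of \<pi> N Lb w] by simp

lemma measurable_L2_ball: "\<pi> \<in> measurable N Lb \<Longrightarrow> \<forall>w\<in>space N. \<pi> w \<in> LL"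
  by (intro ballI measurable_L2)

text \<open>A unimodular factor that does not depend on \<open>w\<close> moves the centre of the
  future bump from 0 to \<open>d\<close>, and the dilation sets its width. Both manipulations of
  \<open>pw\<close> are legitimate for almost every path only.\<close>

lemma pwz_shift_AE:
  fixes z :: "'w \<Rightarrow> complex"
  assumes N: "finite_measure N" and z: "integrable N z" and \<pi>: "\<pi> \<in> measurable N Lb" and d: "d \<in> LL"
  shows "AE x in M. (\<integral>w. z w * iexp (\<rho> * pw (\<lambda>p. \<pi> w p - d p) x) \<partial>N) =
    exp (- (\<i> * complex_of_real (\<rho> * pw d x))) * (\<integral>w. z w * iexp (pw (\<pi> w) (scale \<rho> x)) \<partial>N)"
  using pwz_conv_AE_swap[OF N measurable_L2_ball[OF \<pi>] co_measurable[OF \<pi>]] pwz_conv_AE[OF d] AE_space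
proof eventually_elim
  case (elim x)
  then have x: "x \<in> C0 S T" by (simp add: space_M)
  note [measurable] = borel_measurable_integrable[OF z] co_measurable[OF \<pi>]
  have m: "(\<lambda>w. co (\<lambda>p. \<pi> w p - d p) j) \<in> borel_measurable N" for j
  proof -
    have "(\<lambda>w. co (\<pi> w) j - co d j) \<in> borel_measurable N" by measurable
    then show ?thesis
      by (rule measurable_cong[THEN iffD1, rotated]) (simp add: ip_diff_left measurable_L2[OF \<pi>] d phi_L2)
  qed
  note [measurable] = pwz_measurable_fst[OF m x] pwz_measurable_fst[OF co_measurable[OF \<pi>] scale_C0[OF x]]
  have "(\<integral>w. z w * iexp (\<rho> * pw (\<lambda>p. \<pi> w p - d p) x) \<partial>N) =
    (\<integral>w. exp (- (\<i> * complex_of_real (\<rho> * pw d x))) * (z w * iexp (pw (\<pi> w) (scale \<rho> x))) \<partial>N)"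
  proof (rule integral_cong_AE)
    show "AE w in N. z w * iexp (\<rho> * pw (\<lambda>p. \<pi> w p - d p) x) =
        exp (- (\<i> * complex_of_real (\<rho> * pw d x))) * (z w * iexp (pw (\<pi> w) (scale \<rho> x)))"
      using elim(1) AE_space
    proof eventually_elim
      case (elim w)
      have "pw (\<lambda>p. \<pi> w p - d p) x = pw (\<pi> w) x - pw d x"
        using pwz_lin[OF x elim(1) \<open>pwz_conv d x\<close> measurable_L2[OF \<pi> elim(2)] d, of 1 "-1"] by simp
      moreover have "iexp (\<rho> * (A - D)) = exp (- (\<i> * complex_of_real (\<rho> * D))) * iexp (\<rho> * A)" for A D
        by (simp add: exp_add[symmetric] algebra_simps)
      ultimately show ?case
        by (simp only: pwz_scale[OF x elim(1)] mult.left_commute)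
    qed
  qed measurable
  then show ?case by (simp only: integral_mult_right_zero)
qed

text \<open>Equality s-a.e. is equality almost everywhere at every dilate, so bumps of every width
  become available: \<open>\<rho> = sqrt (2 * a)\<close> turns \<open>\<rho>^2 / 2\<close> into
  \<open>a\<close>. Integration over the paths yields the bump by the characteristic
  function.\<close>

lemma bump_agreement_of_s_ae:
  fixes z1 :: "'w \<Rightarrow> complex" and z2 :: "'v \<Rightarrow> complex"
  assumes 1: "finite_measure N1" "integrable N1 z1" "\<pi>1 \<in> measurable N1 Lb"
    and 2: "finite_measure N2" "integrable N2 z2" "\<pi>2 \<in> measurable N2 Lb"
    and eq: "s_ae (completion M) (\<lambda>y. (\<integral>w. z1 w * iexp (pw (\<pi>1 w) y) \<partial>N1) =
       (\<integral>w. z2 w * iexp (pw (\<pi>2 w) y) \<partial>N2))"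
  shows "bump_agreement S T \<phi> N1 z1 \<pi>1 N2 z2 \<pi>2"
proof (unfold_locales; (rule 1 2)?)
  fix a d assume a: "0 < (a::real)" and d: "d \<in> L2 S T"
  define \<rho> where "\<rho> = sqrt (2 * a)"
  have \<rho>: "\<rho> > 0" "\<rho>\<^sup>2 / 2 = a" using a by (auto simp: \<rho>_def)
  have D: "(\<integral>x. (\<integral>w. z w * iexp (\<rho> * pw (\<lambda>p. \<pi> w p - d p) x) \<partial>N) \<partial>M) =
      dint N z \<pi> (\<lambda>u. exp (- (a * nsq (\<lambda>p. u p - d p))))"
    "(\<lambda>x. \<integral>w. z w * iexp (\<rho> * pw (\<lambda>p. \<pi> w p - d p) x) \<partial>N) \<in> borel_measurable M"
    if N: "finite_measure N" "integrable N z" "\<pi> \<in> measurable N Lb" for N :: "'d measure" and z \<pi>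
  proof -
    note [measurable] = co_measurable[OF N(3)]
    have m: "(\<lambda>w. co (\<lambda>p. \<pi> w p - d p) j) \<in> borel_measurable N" for j
    proof -
      have "(\<lambda>w. co (\<pi> w) j - co d j) \<in> borel_measurable N" by measurable
      then show ?thesis
        by (rule measurable_cong[THEN iffD1, rotated]) (simp add: ip_diff_left measurable_L2[OF N(3)] d phi_L2)
    qed
    have "\<forall>w\<in>space N. (\<lambda>p. \<pi> w p - d p) \<in> LL" using measurable_L2[OF N(3)] by (blast intro: L2_diff d)
    note F = char_Fubini[OF N(1) this m N(2), where t=\<rho>]
    show "(\<lambda>x. \<integral>w. z w * iexp (\<rho> * pw (\<lambda>p. \<pi> w p - d p) x) \<partial>N) \<in> borel_measurable M"
      using F(1) by (rule borel_measurable_integrable)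
    have e: "\<rho>\<^sup>2 * n / 2 = a * n" for n using \<rho>(2) by (metis mult.commute times_divide_eq_right)
    show "(\<integral>x. (\<integral>w. z w * iexp (\<rho> * pw (\<lambda>p. \<pi> w p - d p) x) \<partial>N) \<partial>M) =
      dint N z \<pi> (\<lambda>u. exp (- (a * nsq (\<lambda>p. u p - d p))))"
      unfolding dint_def F(2) e ..
  qed
  have "AE x in M. (\<integral>w. z1 w * iexp (pw (\<pi>1 w) (scale \<rho> x)) \<partial>N1) =
       (\<integral>w. z2 w * iexp (pw (\<pi>2 w) (scale \<rho> x)) \<partial>N2)"
    using eq \<rho>(1) unfolding s_ae_iff by blast
  then have "AE x in M. (\<integral>w. z1 w * iexp (\<rho> * pw (\<lambda>p. \<pi>1 w p - d p) x) \<partial>N1) =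
     (\<integral>w. z2 w * iexp (\<rho> * pw (\<lambda>p. \<pi>2 w p - d p) x) \<partial>N2)"
    using pwz_shift_AE[OF 1 d, of \<rho>] pwz_shift_AE[OF 2 d, of \<rho>] by eventually_elim simp
  then have "(\<integral>x. (\<integral>w. z1 w * iexp (\<rho> * pw (\<lambda>p. \<pi>1 w p - d p) x) \<partial>N1) \<partial>M) =
     (\<integral>x. (\<integral>w. z2 w * iexp (\<rho> * pw (\<lambda>p. \<pi>2 w p - d p) x) \<partial>N2) \<partial>M)"
    by (intro integral_cong_AE D(2) 1 2)
  then show "dint N1 z1 \<pi>1 (\<lambda>u. exp (- (a * nsq (\<lambda>p. u p - d p)))) = dint N2 z2 \<pi>2 (\<lambda>u. exp (- (a * nsq (\<lambda>p. u p - d p))))"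
    unfolding D(1)[OF 1] D(1)[OF 2] .
qed

lemma s_ae_mono:
  assumes "s_ae (completion M) P" "\<And>x. x \<in> C0 S T \<Longrightarrow> P x \<Longrightarrow> R x"
  shows "s_ae (completion M) R"
  using assms unfolding s_ae_def by (auto simp: space_M)

lemma s_ae_conj:
  assumes "s_ae (completion M) P" "s_ae (completion M) R"
  shows "s_ae (completion M) (\<lambda>x. P x \<and> R x)"
  using assms unfolding s_ae_iff by auto

text \<open>A density form of the very measure selected by \<open>measure_for\<close>, as
  \<open>gauss_eval\<close> refers to that choice, together with the resulting formula for
  \<open>F\<close> s-a.e.\<close>

definition represents :: "(sheet \<Rightarrow> complex) \<Rightarrow> sheet measure \<Rightarrow> (sheet \<Rightarrow> complex) \<Rightarrow> bool" where
  "represents F N z \<longleftrightarrow> F \<in> S_class S T (completion M) \<phi> \<and> finite_measure N \<and> sets N = sets Lb \<and> integrable N z \<and>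
    (\<forall>\<psi> K. \<psi> \<in> borel_measurable Lb \<longrightarrow> (\<forall>u. cmod (\<psi> u) \<le> K) \<longrightarrow>
       cm_integral Lb (measure_for S T (completion M) \<phi> F) \<psi> = (\<integral>u. z u * \<psi> u \<partial>N)) \<and>
    s_ae (completion M) (\<lambda>x. F x = (\<integral>u. z u * iexp (pw u x) \<partial>N))"

lemma id_measurable_Lb: "(\<lambda>u. u) \<in> measurable Lb Lb" by simp

lemma norm_exp_i: "cmod (iexp a) = 1" "cmod (exp (- (\<i> * complex_of_real a))) = 1"
  using norm_exp_i_times[of a] norm_exp_i_times[of "- a"] by simp_all

lemma represents_ex:
  assumes F: "F \<in> S_class S T (completion M) \<phi>" obtains N z where "represents F N z"
proof -
  let ?f = "measure_for S T (completion M) \<phi> F"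
  have c: "corresponds S T (completion M) \<phi> F ?f"
    using F unfolding measure_for_def S_class_def mem_Collect_eq by (rule someI_ex)
  then have "complex_measure Lb ?f" by (simp add: corresponds_def)
  from cm_integral_density_ex[OF this] obtain N :: "sheet measure" and z :: "sheet \<Rightarrow> complex" where N: "finite_measure N" "sets N = sets Lb" "integrable N z"
    "\<And>\<psi> K. \<psi> \<in> borel_measurable Lb \<Longrightarrow> (\<And>u. cmod (\<psi> u) \<le> K) \<Longrightarrow> cm_integral Lb ?f \<psi> = (\<integral>u. z u * \<psi> u \<partial>N)"
    "\<And>A. A \<in> sets Lb \<Longrightarrow> ?f A = (\<integral>u. z u * indicator A u \<partial>N)"
    by blast
  have "s_ae (completion M) (\<lambda>x. F x = (\<integral>u. z u * iexp (pw u x) \<partial>N))"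
  proof (rule s_ae_mono)
    show "s_ae (completion M) (\<lambda>x. F x = cm_integral Lb ?f (\<lambda>u. iexp (pw u x)))"
      using c by (simp add: corresponds_def)
    fix x assume x: "x \<in> C0 S T" and e: "F x = cm_integral Lb ?f (\<lambda>u. iexp (pw u x))"
    note [measurable] = pwz_measurable_fst[OF co_measurable[OF id_measurable_Lb] x]
    show "F x = (\<integral>u. z u * iexp (pw u x) \<partial>N)"
      unfolding e
    proof (rule N(4)[of _ 1])
      show "(\<lambda>u. iexp (pw u x)) \<in> borel_measurable Lb" by measurable
      show "cmod (iexp (pw u x)) \<le> 1" for u unfolding norm_exp_i by simp
    qed
  qed
  then show ?thesis using F N by (intro that[of N z]) (auto simp: represents_def)
qed

lemma mult_bv_L2: "bv_hk S T h \<Longrightarrow> u \<in> LL \<Longrightarrow> (\<lambda>p. u p * h p) \<in> LL"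
  by (metis L2_mult_bounded bv_bounded bv_measurable)

text \<open>The bounded factor \<open>h\<close> moves to the other side of the inner product, which
  leaves a continuous functional of \<open>\<pi> w\<close>.\<close>

lemma mult_bv_co_measurable:
  assumes \<pi>: "\<pi> \<in> measurable N Lb" and h: "bv_hk S T h"
  shows "(\<lambda>w. co (\<lambda>p. \<pi> w p * h p) j) \<in> borel_measurable N"
proof -
  have "co (\<lambda>p. \<pi> w p * h p) j = ip (\<pi> w) (\<lambda>p. \<phi> j p * h p)" for w
    by (simp add: inner2_def mult_ac)
  then show ?thesis
    using measurable_compose[OF \<pi> ip_measurable[OF mult_bv_L2[OF h phi_L2, of j]]] by simp
qed

lemma represents_measurable: "represents F N z \<Longrightarrow> (\<lambda>u. u) \<in> measurable N Lb"
  by (auto simp: represents_def intro: measurable_ident_sets)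

lemma gauss_eval_represents:
  assumes r: "represents F N z" and x: "x \<in> C0 S T" and y: "y \<in> C0 S T" and h: "bv_hk S T h"
  shows "gauss_eval S T (completion M) \<phi> F b y c h x =
    (\<integral>u. z u * iexp (b * pw u y) * iexp (c * pw (\<lambda>p. u p * h p) x) \<partial>N)"
proof -
  let ?\<psi> = "\<lambda>u. iexp (b * pw u y) * iexp (c * pw (\<lambda>p. u p * h p) x)"
  note [measurable] = pwz_measurable_fst[OF co_measurable[OF id_measurable_Lb] y] pwz_measurable_fst[OF mult_bv_co_measurable[OF id_measurable_Lb h] x]
  have "gauss_eval S T (completion M) \<phi> F b y c h x = cm_integral Lb (measure_for S T (completion M) \<phi> F) ?\<psi>"
    unfolding gauss_eval_def by (simp add: exp_add[symmetric] mult_ac)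
  also have "\<dots> = (\<integral>u. z u * ?\<psi> u \<partial>N)"
  proof -
    have "?\<psi> \<in> borel_measurable Lb" by measurable
    moreover have "\<forall>u. cmod (?\<psi> u) \<le> 1" by (simp only: norm_mult norm_exp_i) simp
    ultimately show ?thesis using r unfolding represents_def by blast
  qed
  finally show ?thesis by (simp only: mult.assoc)
qed

lemma integrable_completionI:
  fixes f :: "sheet \<Rightarrow> complex"
  assumes "integrable M g" "\<forall>x\<in>C0 S T. f x = g x"
  shows "integrable (completion M) f" "(\<integral>x. f x \<partial>completion M) = (\<integral>x. g x \<partial>M)"
proof -
  have fi: "integrable M f" using assms by (subst Bochner_Integration.integrable_cong[of M M f g]) (auto simp: space_M)
  note fm = borel_measurable_integrable[OF fi]
  show "integrable (completion M) f" using fi fm by (simp add: integrable_completion)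
  have "(\<integral>x. f x \<partial>completion M) = (\<integral>x. f x \<partial>M)" using fm by (rule integral_completion)
  also have "\<dots> = (\<integral>x. g x \<partial>M)" using assms by (intro Bochner_Integration.integral_cong) (auto simp: space_M)
  finally show "(\<integral>x. f x \<partial>completion M) = (\<integral>x. g x \<partial>M)" .
qed

lemma represents_phase_integrable:
  assumes r: "represents F N z" and y: "y \<in> C0 S T"
  shows "integrable N (\<lambda>u. z u * iexp (b * pw u y))"
proof -
  have z: "integrable N z" using r by (simp add: represents_def)
  note [measurable] = borel_measurable_integrable[OF z] pwz_measurable_fst[OF co_measurable[OF represents_measurable[OF r]] y]
  show ?thesis
    by (rule Bochner_Integration.integrable_bound[OF z]) (measurable, simp only: norm_mult norm_exp_i mult_1_right order_refl eventually_True)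
qed

lemma has_transform_represents:
  assumes r: "represents F N z" and y: "y \<in> C0 S T" and h: "bv_hk S T h" and q: "q \<noteq> 0"
  shows "has_transform S T (completion M) \<phi> q h F y
    (\<integral>u. z u * iexp (pw u y) * exp (- (\<i> * complex_of_real (nsq (\<lambda>p. u p * h p) / 2 / q))) \<partial>N)"
proof -
  have N: "finite_measure N" and z: "integrable N z" and F: "F \<in> S_class S T (completion M) \<phi>"
    using r by (auto simp: represents_def)
  note id = represents_measurable[OF r]
  note hm = mult_bv_co_measurable[OF id h] and hL = mult_bv_L2[OF h measurable_L2[OF id]]
  have hb: "\<forall>u\<in>space N. (\<lambda>p. u p * h p) \<in> LL" using hL by blast
  have Z: "integrable N (\<lambda>u. z u * iexp (pw u y))"
    using represents_phase_integrable[OF r y, of 1] by simp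
  note cF = char_Fubini[OF N hb hm Z]
  show ?thesis
    unfolding has_transform_def
  proof (intro conjI F has_analytic_limitI[OF Z _ _ q])
    show "(\<lambda>u. nsq (\<lambda>p. u p * h p) / 2) \<in> borel_measurable N"
      using nsq_measurable[OF hL hm] by measurable
    show "0 \<le> nsq (\<lambda>p. u p * h p) / 2" for u by (simp add: nsq_nonneg)
    fix l :: real assume l: "l > 0"
    have e: "\<forall>x\<in>C0 S T. gauss_eval S T (completion M) \<phi> F 1 y (1 / sqrt l) h x =
      (\<integral>u. z u * iexp (pw u y) * iexp (1 / sqrt l * pw (\<lambda>p. u p * h p) x) \<partial>N)"
      using gauss_eval_represents[OF r _ y h, of _ 1 "1 / sqrt l"] by (simp only: mult_1) blast
    note I = integrable_completionI[OF cF(1)[of "1 / sqrt l"] e]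
    show "integrable (completion M) (\<lambda>x. gauss_eval S T (completion M) \<phi> F 1 y (1 / sqrt l) h x)" by (rule I(1))
    have "(1 / sqrt l)\<^sup>2 * a / 2 = a / 2 / l" for a using l by (simp add: power_divide)
    then show "(\<integral>x. gauss_eval S T (completion M) \<phi> F 1 y (1 / sqrt l) h x \<partial>completion M) =
      (\<integral>u. z u * iexp (pw u y) * complex_of_real (exp (- (nsq (\<lambda>p. u p * h p) / 2 / l))) \<partial>N)"
      unfolding I(2) cF(2) by (simp only:)
  qed
qed

lemma transform_represents:
  assumes r: "represents F N z" and y: "y \<in> C0 S T" and h: "bv_hk S T h" and q: "q \<noteq> 0"
  shows "transform_exists S T (completion M) \<phi> q h F y"
    and "transform S T (completion M) \<phi> q h F y =
      (\<integral>u. z u * iexp (pw u y) * exp (- (\<i> * complex_of_real (nsq (\<lambda>p. u p * h p) / 2 / q))) \<partial>N)"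
proof -
  note t = has_transform_represents[OF assms]
  show "transform_exists S T (completion M) \<phi> q h F y" unfolding transform_exists_def using t by blast
  show "transform S T (completion M) \<phi> q h F y =
      (\<integral>u. z u * iexp (pw u y) * exp (- (\<i> * complex_of_real (nsq (\<lambda>p. u p * h p) / 2 / q))) \<partial>N)"
    unfolding transform_def using t
    by (rule the_equality) (use t has_analytic_limit_unique in \<open>auto simp: has_transform_def\<close>)
qed

end

text \<open>Pointwise both sides differ by a multiple of \<open>u * v * (h^2 - k1 * k2)\<close>. All
  terms carry the weight 1/4: on the left through the scaling \<open>1 / sqrt 2\<close> of
  \<open>u + v\<close> and through the exponent of the convolution product, on the right through the
  factor \<open>1 / sqrt 2\<close> of \<open>s1\<close> and \<open>s2\<close>.\<close>

lemma (in rectangle) nsq_half_sum_identity: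
  assumes u: "u \<in> LL" and v: "v \<in> LL"
    and k1: "bv_hk S T k1" and k2: "bv_hk S T k2" and h: "bv_hk S T h" and s1: "bv_hk S T s1" and s2: "bv_hk S T s2"
    and hk: "AE p in LQ. (h p)\<^sup>2 = k1 p * k2 p"
    and s1k: "AE p in LQ. (s1 p)\<^sup>2 = (h p)\<^sup>2 + (k1 p)\<^sup>2" and s2k: "AE p in LQ. (s2 p)\<^sup>2 = (h p)\<^sup>2 + (k2 p)\<^sup>2"
  shows "nsq (\<lambda>p. (1 / sqrt 2 * u p + 1 / sqrt 2 * v p) * h p) / 2 + nsq (\<lambda>p. u p * k1 p - v p * k2 p) / 4 =
    nsq (\<lambda>p. u p * (s1 p / sqrt 2)) / 2 + nsq (\<lambda>p. v p * (s2 p / sqrt 2)) / 2"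
proof -
  have mL: "(\<lambda>p. w p * k p) \<in> LL" if "w \<in> LL" "bv_hk S T k" for w k
    using that by (metis L2_mult_bounded bv_bounded bv_measurable)
  have sq: "nsq w = (\<integral>p. (w p)\<^sup>2 \<partial>LQ)" for w by (simp add: inner2_def power2_eq_square)
  have L: "(\<lambda>p. (1 / sqrt 2 * u p + 1 / sqrt 2 * v p) * h p) \<in> LL" "(\<lambda>p. u p * k1 p - v p * k2 p) \<in> LL"
    by (intro mL L2_add L2_scale L2_diff u v h k1 k2)+
  have L': "(\<lambda>p. u p * (s1 p / sqrt 2)) \<in> LL" "(\<lambda>p. v p * (s2 p / sqrt 2)) \<in> LL"
    using mL[OF u bv_hk_scale[OF s1, of "1 / sqrt 2"]] mL[OF v bv_hk_scale[OF s2, of "1 / sqrt 2"]] by simp_all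
  note i = L2_square[OF L(1)] L2_square[OF L(2)] L2_square[OF L'(1)] L2_square[OF L'(2)]
  have "nsq (\<lambda>p. (1 / sqrt 2 * u p + 1 / sqrt 2 * v p) * h p) / 2 + nsq (\<lambda>p. u p * k1 p - v p * k2 p) / 4 =
    (\<integral>p. ((1 / sqrt 2 * u p + 1 / sqrt 2 * v p) * h p)\<^sup>2 / 2 + (u p * k1 p - v p * k2 p)\<^sup>2 / 4 \<partial>LQ)"
    unfolding sq using i by simp
  also have "\<dots> = (\<integral>p. (u p * (s1 p / sqrt 2))\<^sup>2 / 2 + (v p * (s2 p / sqrt 2))\<^sup>2 / 2 \<partial>LQ)"
  proof (rule integral_cong_AE)
    show "AE p in LQ. ((1 / sqrt 2 * u p + 1 / sqrt 2 * v p) * h p)\<^sup>2 / 2 + (u p * k1 p - v p * k2 p)\<^sup>2 / 4 =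
        (u p * (s1 p / sqrt 2))\<^sup>2 / 2 + (v p * (s2 p / sqrt 2))\<^sup>2 / 2"
      using hk s1k s2k
    proof eventually_elim
      case (elim p)
      define A U V D where "A = (u p + v p)\<^sup>2 * (h p)\<^sup>2" and "U = (u p)\<^sup>2 * ((h p)\<^sup>2 + (k1 p)\<^sup>2)"
        and "V = (v p)\<^sup>2 * ((h p)\<^sup>2 + (k2 p)\<^sup>2)" and "D = (u p * k1 p - v p * k2 p)\<^sup>2"
      have "((1 / sqrt 2 * u p + 1 / sqrt 2 * v p) * h p)\<^sup>2 = A / 2"
        by (simp add: A_def power_mult_distrib power_divide add_divide_distrib[symmetric])
      moreover have "(u p * (s1 p / sqrt 2))\<^sup>2 = U / 2" "(v p * (s2 p / sqrt 2))\<^sup>2 = V / 2"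
        by (simp_all add: U_def V_def power_mult_distrib power_divide elim)
      moreover have "A + D = U + V + 2 * u p * v p * ((h p)\<^sup>2 - k1 p * k2 p)"
        by (simp add: A_def U_def V_def D_def power2_eq_square algebra_simps)
      moreover have "2 * u p * v p * ((h p)\<^sup>2 - k1 p * k2 p) = 0" using elim(1) by simp
      ultimately show ?case unfolding D_def[symmetric] by simp
    qed
  qed (use i in \<open>auto intro!: borel_measurable_integrable\<close>)
  also have "\<dots> = nsq (\<lambda>p. u p * (s1 p / sqrt 2)) / 2 + nsq (\<lambda>p. v p * (s2 p / sqrt 2)) / 2"
    unfolding sq using i by simp
  finally show ?thesis .
qed

section \<open>The convolution product and its transform\<close>

context yeh_wiener
begin

text \<open>The product of the two evaluations is one integral over the product measure. The minus
  sign in the second argument combines the phases into the stochastic integral of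
  \<open>u * k1 - v * k2\<close>, so a single Gaussian characteristic function finishes the
  computation.\<close>

lemma conv_represents:
  assumes rF: "represents F N z" and rG: "represents G N' z'" and y: "y \<in> C0 S T"
    and k1: "bv_hk S T k1" and k2: "bv_hk S T k2" and q: "q \<noteq> 0"
  defines "P \<equiv> N \<Otimes>\<^sub>M N'"
  defines "n \<equiv> \<lambda>w. nsq (\<lambda>p. fst w p * k1 p - snd w p * k2 p)"
  shows "conv_product_exists S T (completion M) \<phi> q k1 k2 F G y"
    and "conv_product S T (completion M) \<phi> q k1 k2 F G y =
      (\<integral>w. z (fst w) * iexp (1 / sqrt 2 * pw (fst w) y) *
           (z' (snd w) * iexp (1 / sqrt 2 * pw (snd w) y)) *
           exp (- (\<i> * complex_of_real (n w / 4 / q))) \<partial>P)"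
proof -
  have N: "finite_measure N" and N': "finite_measure N'" and F: "F \<in> S_class S T (completion M) \<phi>" and G: "G \<in> S_class S T (completion M) \<phi>"
    using rF rG by (auto simp: represents_def)
  have P: "finite_measure P" unfolding P_def by (rule finite_measure_pair_measure[OF N' N])
  define Zy where "Zy w = z (fst w) * iexp (1 / sqrt 2 * pw (fst w) y) *
           (z' (snd w) * iexp (1 / sqrt 2 * pw (snd w) y))" for w
  note iF = represents_phase_integrable[OF rF y, of "1 / sqrt 2"] and iG = represents_phase_integrable[OF rG y, of "1 / sqrt 2"]
  have Zi: "integrable P Zy" unfolding P_def Zy_def[abs_def] by (rule integral_pair_mult(1)[OF N N' iF iG])
  have f: "fst \<in> measurable P Lb" and s: "snd \<in> measurable P Lb"
    using measurable_comp[OF measurable_fst represents_measurable[OF rF], of N'] measurable_comp[OF measurable_snd represents_measurable[OF rG], of N]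
    by (simp_all add: P_def comp_def)
  note m1 = mult_bv_co_measurable[OF f k1] and m2 = mult_bv_co_measurable[OF s k2]
  note L1 = mult_bv_L2[OF k1 measurable_L2[OF f]] and L2 = mult_bv_L2[OF k2 measurable_L2[OF s]]
  let ?g = "\<lambda>w p. fst w p * k1 p - snd w p * k2 p"
  have gL: "?g w \<in> LL" if "w \<in> space P" for w using that by (intro L2_diff L1 L2)
  have gm: "(\<lambda>w. co (?g w) j) \<in> borel_measurable P" for j
  proof -
    have "(\<lambda>w. co (\<lambda>p. fst w p * k1 p) j - co (\<lambda>p. snd w p * k2 p) j) \<in> borel_measurable P"
      using m1 m2 by (rule borel_measurable_diff)
    then show ?thesis by (rule measurable_cong[THEN iffD1, rotated]) (simp add: ip_diff_left L1 L2 phi_L2)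
  qed
  have gb: "\<forall>w\<in>space P. ?g w \<in> LL" using gL by blast
  have L1b: "\<forall>w\<in>space P. (\<lambda>p. fst w p * k1 p) \<in> LL" using L1 by blast
  have L2b: "\<forall>w\<in>space P. (\<lambda>p. snd w p * k2 p) \<in> LL" using L2 by blast
  have bF: "\<forall>u\<in>space N. (\<lambda>p. u p * k1 p) \<in> LL"
    using mult_bv_L2[OF k1 measurable_L2[OF represents_measurable[OF rF]]] by blast
  have bG: "\<forall>u\<in>space N'. (\<lambda>p. u p * k2 p) \<in> LL"
    using mult_bv_L2[OF k2 measurable_L2[OF represents_measurable[OF rG]]] by blast
  note cP = char_Fubini[OF P gb gm Zi]
  note hF = char_Fubini(1)[OF N bF mult_bv_co_measurable[OF represents_measurable[OF rF] k1] iF]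
  note hG = char_Fubini(1)[OF N' bG mult_bv_co_measurable[OF represents_measurable[OF rG] k2] iG]
  define KK where "KK l x = gauss_eval S T (completion M) \<phi> F (1 / sqrt 2) y (1 / sqrt l / sqrt 2) k1 x *
               gauss_eval S T (completion M) \<phi> G (1 / sqrt 2) y (- (1 / sqrt l / sqrt 2)) k2 x" for l x
  have K: "integrable (completion M) (KK l)"
    "(\<integral>x. KK l x \<partial>completion M) = (\<integral>w. Zy w * complex_of_real (exp (- (n w / 4 / l))) \<partial>P)" if l: "l > 0" for l
  proof -
    define c where "c = 1 / sqrt l / sqrt 2"
    define A where "A x = (\<integral>u. z u * iexp (1 / sqrt 2 * pw u y) * iexp (c * pw (\<lambda>p. u p * k1 p) x) \<partial>N)" for x
    define B where "B x = (\<integral>v. z' v * iexp (1 / sqrt 2 * pw v y) * iexp (- c * pw (\<lambda>p. v p * k2 p) x) \<partial>N')" for x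
    define H where "H x = (\<integral>w. Zy w * iexp (c * pw (?g w) x) \<partial>P)" for x
    have e: "KK l x = A x * B x" if "x \<in> C0 S T" for x
      unfolding KK_def A_def B_def c_def
      by (intro arg_cong2[where f="(*)"] gauss_eval_represents rF rG that y k1 k2)
    have [measurable]: "A \<in> borel_measurable M" "B \<in> borel_measurable M"
      unfolding A_def[abs_def] B_def[abs_def] using hF[of c] hG[of "-c"] by (auto dest: borel_measurable_integrable)
    have Hi: "integrable M H" unfolding H_def[abs_def] by (rule cP(1))
    \<comment> \<open>Only almost everywhere, since combining the two phases uses additivity of
      \<open>pw\<close>.\<close>
    have AB: "AE x in M. A x * B x = H x"
      using pwz_conv_AE_swap[OF P L1b m1] pwz_conv_AE_swap[OF P L2b m2] AE_space
    proof eventually_elim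
      case (elim x)
      then have x: "x \<in> C0 S T" by (simp add: space_M)
      note [measurable] = borel_measurable_integrable[OF Zi] pwz_measurable_fst[OF gm x] pwz_measurable_fst[OF m1 x] pwz_measurable_fst[OF m2 x]
      have iAF: "integrable N (\<lambda>u. z u * iexp (1 / sqrt 2 * pw u y) * iexp (c * pw (\<lambda>p. u p * k1 p) x))"
      proof (rule Bochner_Integration.integrable_bound[OF iF])
        note [measurable] = borel_measurable_integrable[OF iF] pwz_measurable_fst[OF mult_bv_co_measurable[OF represents_measurable[OF rF] k1] x]
        show "(\<lambda>u. z u * iexp (1 / sqrt 2 * pw u y) * iexp (c * pw (\<lambda>p. u p * k1 p) x)) \<in> borel_measurable N"
          by measurable
      qed (simp only: norm_mult norm_exp_i mult_1_right order_refl eventually_True)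
      have iAG: "integrable N' (\<lambda>v. z' v * iexp (1 / sqrt 2 * pw v y) * iexp (- c * pw (\<lambda>p. v p * k2 p) x))"
      proof (rule Bochner_Integration.integrable_bound[OF iG])
        note [measurable] = borel_measurable_integrable[OF iG] pwz_measurable_fst[OF mult_bv_co_measurable[OF represents_measurable[OF rG] k2] x]
        show "(\<lambda>v. z' v * iexp (1 / sqrt 2 * pw v y) * iexp (- c * pw (\<lambda>p. v p * k2 p) x)) \<in> borel_measurable N'"
          by measurable
      qed (simp only: norm_mult norm_exp_i mult_1_right order_refl eventually_True)
      have "A x * B x = (\<integral>w. (z (fst w) * iexp (1 / sqrt 2 * pw (fst w) y) * iexp (c * pw (\<lambda>p. fst w p * k1 p) x)) *
          (z' (snd w) * iexp (1 / sqrt 2 * pw (snd w) y) * iexp (- c * pw (\<lambda>p. snd w p * k2 p) x)) \<partial>P)"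
        unfolding A_def B_def P_def by (rule integral_pair_mult(2)[OF N N' iAF iAG, symmetric])
      also have "\<dots> = (\<integral>w. Zy w * (iexp (c * pw (\<lambda>p. fst w p * k1 p) x) * iexp (- c * pw (\<lambda>p. snd w p * k2 p) x)) \<partial>P)"
        unfolding Zy_def by (simp only: mult_ac)
      also have "\<dots> = H x"
        unfolding H_def
      proof (rule integral_cong_AE)
        show "AE w in P. Zy w * (iexp (c * pw (\<lambda>p. fst w p * k1 p) x) * iexp (- c * pw (\<lambda>p. snd w p * k2 p) x)) =
            Zy w * iexp (c * pw (?g w) x)"
          using elim(1,2) AE_space
        proof eventually_elim
          case (elim w)
          have "pw (?g w) x = pw (\<lambda>p. fst w p * k1 p) x - pw (\<lambda>p. snd w p * k2 p) x"
            using pwz_lin[OF x elim(1,2) L1[OF elim(3)] L2[OF elim(3)], of 1 "-1"] by simp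
          moreover have "iexp (c * A) * iexp (- c * D) = iexp (c * (A - D))" for A D
            by (simp add: exp_add[symmetric] algebra_simps)
          ultimately show ?case by (simp only:)
        qed
      qed measurable
      finally show ?case .
    qed
    have ABi: "integrable M (\<lambda>x. A x * B x)"
      using Hi by (rule Bochner_Integration.integrable_bound) (use AB in \<open>auto elim!: eventually_mono\<close>)
    have eb: "\<forall>x\<in>C0 S T. KK l x = A x * B x" using e by blast
    note I = integrable_completionI[OF ABi eb]
    show "integrable (completion M) (KK l)" using I(1) .
    have "(\<integral>x. A x * B x \<partial>M) = (\<integral>x. H x \<partial>M)"
      using AB Hi by (intro integral_cong_AE) auto
    \<comment> \<open>The \<open>sqrt 2\<close> in the arguments of the convolution product gives
      \<open>c\<^sup>2 = 1 / (2 * l)\<close>, hence the divisor 4 instead of 2.\<close>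
    moreover have "c\<^sup>2 * a / 2 = a / 4 / l" for a using l by (simp add: c_def power_divide power_mult_distrib)
    ultimately show "(\<integral>x. KK l x \<partial>completion M) = (\<integral>w. Zy w * complex_of_real (exp (- (n w / 4 / l))) \<partial>P)"
      unfolding I(2) H_def cP(2) n_def by (simp only:)
  qed
  have lim: "has_analytic_limit (completion M) q KK (\<integral>w. Zy w * exp (- (\<i> * complex_of_real (n w / 4 / q))) \<partial>P)"
  proof (rule has_analytic_limitI[OF Zi _ _ q])
    show "(\<lambda>w. n w / 4) \<in> borel_measurable P" unfolding n_def using nsq_measurable[OF gL gm] by measurable
    show "0 \<le> n w / 4" for w by (simp add: n_def nsq_nonneg)
  qed (rule K; assumption)+
  then have has: "has_conv_product S T (completion M) \<phi> q k1 k2 F G y (\<integral>w. Zy w * exp (- (\<i> * complex_of_real (n w / 4 / q))) \<partial>P)"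
    unfolding has_conv_product_def KK_def[abs_def] using F G by blast
  then show "conv_product_exists S T (completion M) \<phi> q k1 k2 F G y" unfolding conv_product_exists_def by blast
  have "conv_product S T (completion M) \<phi> q k1 k2 F G y = (\<integral>w. Zy w * exp (- (\<i> * complex_of_real (n w / 4 / q))) \<partial>P)"
    unfolding conv_product_def using has
    by (rule the_equality) (use has has_analytic_limit_unique in \<open>auto simp: has_conv_product_def\<close>)
  then show "conv_product S T (completion M) \<phi> q k1 k2 F G y =
      (\<integral>w. z (fst w) * iexp (1 / sqrt 2 * pw (fst w) y) *
           (z' (snd w) * iexp (1 / sqrt 2 * pw (snd w) y)) *
           exp (- (\<i> * complex_of_real (n w / 4 / q))) \<partial>P)"
    unfolding Zy_def .
qed

text \<open>The transform of the product is computed from the chosen density \<open>z3\<close> on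
  \<open>N3\<close>, about which nothing explicit is known; uniqueness replaces it by the explicit
  \<open>Z\<close> on \<open>P\<close>. There the integrand factors, and the double integral splits
  into the two transforms.\<close>

lemma transform_conv_product:
  assumes F: "F \<in> S_class S T (completion M) \<phi>" and G: "G \<in> S_class S T (completion M) \<phi>"
    and k1: "bv_hk S T k1" and k2: "bv_hk S T k2" and h: "bv_hk S T h" and s1: "bv_hk S T s1" and s2: "bv_hk S T s2"
    and hk: "AE p in LQ. (h p)\<^sup>2 = k1 p * k2 p"
    and s1k: "AE p in LQ. (s1 p)\<^sup>2 = (h p)\<^sup>2 + (k1 p)\<^sup>2" and s2k: "AE p in LQ. (s2 p)\<^sup>2 = (h p)\<^sup>2 + (k2 p)\<^sup>2"
    and q: "q \<noteq> 0"
  defines "my \<equiv> completion M"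
  shows "s_ae my (\<lambda>y.
        conv_product_exists S T my \<phi> q k1 k2 F G y \<and>
        transform_exists S T my \<phi> q h (conv_product S T my \<phi> q k1 k2 F G) y \<and>
        transform_exists S T my \<phi> q (\<lambda>p. s1 p / sqrt 2) F (\<lambda>p. y p / sqrt 2) \<and>
        transform_exists S T my \<phi> q (\<lambda>p. s2 p / sqrt 2) G (\<lambda>p. y p / sqrt 2) \<and>
        transform S T my \<phi> q h (conv_product S T my \<phi> q k1 k2 F G) y =
          transform S T my \<phi> q (\<lambda>p. s1 p / sqrt 2) F (\<lambda>p. y p / sqrt 2) *
          transform S T my \<phi> q (\<lambda>p. s2 p / sqrt 2) G (\<lambda>p. y p / sqrt 2))"
proof -
  obtain N z where rF: "represents F N z" using represents_ex[OF F] by blast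
  obtain N' z' where rG: "represents G N' z'" using represents_ex[OF G] by blast
  have N: "finite_measure N" and N': "finite_measure N'" and z: "integrable N z" and z': "integrable N' z'"
    using rF rG by (auto simp: represents_def)
  define P where "P = N \<Otimes>\<^sub>M N'"
  have P: "finite_measure P" unfolding P_def by (rule finite_measure_pair_measure[OF N' N])
  define n where "n w = nsq (\<lambda>p. fst w p * k1 p - snd w p * k2 p)" for w
  define H where "H = conv_product S T my \<phi> q k1 k2 F G"
  define \<pi> where "\<pi> w p = 1 / sqrt 2 * fst w p + 1 / sqrt 2 * snd w p" for w :: "sheet \<times> sheet" and p
  have f: "fst \<in> measurable P Lb" and s: "snd \<in> measurable P Lb"
    using measurable_comp[OF measurable_fst represents_measurable[OF rF], of N'] measurable_comp[OF measurable_snd represents_measurable[OF rG], of N]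
    by (simp_all add: P_def comp_def)
  have \<pi>: "\<pi> \<in> measurable P Lb"
  proof (rule L2_borel_measurableI)
    show "\<pi> w \<in> LL" if "w \<in> space P" for w
      unfolding \<pi>_def[abs_def] by (intro L2_add L2_scale measurable_L2[OF f that] measurable_L2[OF s that])
    fix j
    have "(\<lambda>w. 1 / sqrt 2 * co (fst w) j + 1 / sqrt 2 * co (snd w) j) \<in> borel_measurable P"
      by (intro borel_measurable_add borel_measurable_times borel_measurable_const co_measurable f s)
    then show "(\<lambda>w. co (\<pi> w) j) \<in> borel_measurable P"
      by (rule measurable_cong[THEN iffD1, rotated])
        (simp only: \<pi>_def[abs_def] ip_add_left L2_scale ip_scale_left measurable_L2[OF f] measurable_L2[OF s] phi_L2)
  qed
  have nm: "n \<in> borel_measurable P"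
    unfolding n_def[abs_def]
  proof (rule nsq_measurable)
    note m1 = mult_bv_co_measurable[OF f k1] and m2 = mult_bv_co_measurable[OF s k2]
    note L1 = mult_bv_L2[OF k1 measurable_L2[OF f]] and L2 = mult_bv_L2[OF k2 measurable_L2[OF s]]
    show "(\<lambda>p. fst w p * k1 p - snd w p * k2 p) \<in> LL" if "w \<in> space P" for w using that by (intro L2_diff L1 L2)
    show "(\<lambda>w. co (\<lambda>p. fst w p * k1 p - snd w p * k2 p) j) \<in> borel_measurable P" for j
    proof -
      have "(\<lambda>w. co (\<lambda>p. fst w p * k1 p) j - co (\<lambda>p. snd w p * k2 p) j) \<in> borel_measurable P"
        using m1 m2 by (rule borel_measurable_diff)
      then show ?thesis by (rule measurable_cong[THEN iffD1, rotated]) (simp add: ip_diff_left L1 L2 phi_L2)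
    qed
  qed
  define Z where "Z w = z (fst w) * z' (snd w) * exp (- (\<i> * complex_of_real (n w / 4 / q)))" for w
  have ZZi: "integrable P (\<lambda>w. z (fst w) * z' (snd w))" unfolding P_def by (rule integral_pair_mult(1)[OF N N' z z'])
  note [measurable] = borel_measurable_integrable[OF ZZi] nm
  have Zi: "integrable P Z" unfolding Z_def[abs_def]
    by (rule Bochner_Integration.integrable_bound[OF ZZi]) (measurable, simp only: norm_mult norm_exp_i mult_1_right order_refl eventually_True)
  note [measurable] = borel_measurable_integrable[OF Zi]
  \<comment> \<open>The paths at which both series converge for almost every pair, so that
    \<open>pw (\<pi> w) y\<close> splits. The remaining identities are established at these
    paths.\<close>
  define good where "good y \<longleftrightarrow> y \<in> C0 S T \<and> (AE w in P. pwz_conv (fst w) y \<and> pwz_conv (snd w) y)" for y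
  have good_ae: "s_ae my good"
    unfolding my_def s_ae_iff
  proof (intro allI impI)
    fix \<rho> :: real
    show "AE x in M. good (scale \<rho> x)"
      using pwz_conv_AE_swap[OF P measurable_L2_ball[OF f] co_measurable[OF f]]
        pwz_conv_AE_swap[OF P measurable_L2_ball[OF s] co_measurable[OF s]] AE_space
    proof eventually_elim
      case (elim x)
      then have x: "x \<in> C0 S T" by (simp add: space_M)
      have "AE w in P. pwz_conv (fst w) (scale \<rho> x) \<and> pwz_conv (snd w) (scale \<rho> x)"
        using elim(1,2) by eventually_elim (simp add: pwz_conv_scale[OF x])
      then show ?case unfolding good_def using scale_C0[OF x] by blast
    qed
  qed
  have pi_pwz: "pw (\<pi> w) y = 1 / sqrt 2 * pw (fst w) y + 1 / sqrt 2 * pw (snd w) y"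
    if "y \<in> C0 S T" "pwz_conv (fst w) y" "pwz_conv (snd w) y" "w \<in> space P" for w y
    unfolding \<pi>_def[abs_def] by (rule pwz_lin[OF that(1-3) measurable_L2[OF f that(4)] measurable_L2[OF s that(4)]])
  have Hrep: "H y = (\<integral>w. Z w * iexp (pw (\<pi> w) y) \<partial>P)" if g: "good y" for y
  proof -
    have y: "y \<in> C0 S T" using g by (simp add: good_def)
    note [measurable] = pwz_measurable_fst[OF co_measurable[OF f] y] pwz_measurable_fst[OF co_measurable[OF s] y] pwz_measurable_fst[OF co_measurable[OF \<pi>] y]
    have iw: "integrable P (\<lambda>w. z (fst w) * iexp (1 / sqrt 2 * pw (fst w) y) *
           (z' (snd w) * iexp (1 / sqrt 2 * pw (snd w) y)))"
      unfolding P_def by (rule integral_pair_mult(1)[OF N N' represents_phase_integrable[OF rF y] represents_phase_integrable[OF rG y]])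
    note [measurable] = borel_measurable_integrable[OF iw]
    have "H y = (\<integral>w. z (fst w) * iexp (1 / sqrt 2 * pw (fst w) y) *
           (z' (snd w) * iexp (1 / sqrt 2 * pw (snd w) y)) *
           exp (- (\<i> * complex_of_real (n w / 4 / q))) \<partial>P)"
      unfolding H_def my_def P_def n_def by (rule conv_represents(2)[OF rF rG y k1 k2 q])
    also have "\<dots> = (\<integral>w. Z w * iexp (pw (\<pi> w) y) \<partial>P)"
    proof (rule integral_cong_AE)
      show "AE w in P. z (fst w) * iexp (1 / sqrt 2 * pw (fst w) y) *
           (z' (snd w) * iexp (1 / sqrt 2 * pw (snd w) y)) *
           exp (- (\<i> * complex_of_real (n w / 4 / q))) = Z w * iexp (pw (\<pi> w) y)"
        using g[unfolded good_def, THEN conjunct2] AE_space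
      proof eventually_elim
        case (elim w)
        have "iexp (pw (\<pi> w) y) =
          iexp (1 / sqrt 2 * pw (fst w) y) * iexp (1 / sqrt 2 * pw (snd w) y)"
          using pi_pwz[OF y] elim by (simp only: exp_add[symmetric] of_real_add distrib_left)
        then show ?case unfolding Z_def by (simp only: mult_ac)
      qed
    qed measurable
    finally show ?thesis .
  qed
  \<comment> \<open>Its role is to show that the product lies in \<open>S_class\<close>, without
    which no transform of it is defined.\<close>
  define \<nu> where "\<nu> A = (\<integral>w. Z w * indicator A (\<pi> w) \<partial>P)" for A
  have "corresponds S T my \<phi> H \<nu>"
    unfolding corresponds_def
  proof (intro conjI)
    show "complex_measure Lb \<nu>" unfolding \<nu>_def[abs_def] by (rule complex_measure_density[OF Zi \<pi>])
    show "s_ae my (\<lambda>x. H x = cm_integral Lb \<nu> (\<lambda>u. iexp (pw u x)))"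
      unfolding my_def
    proof (rule s_ae_mono[OF good_ae[unfolded my_def]])
      fix y assume y: "y \<in> C0 S T" and g: "good y"
      note [measurable] = pwz_measurable_fst[OF co_measurable[OF id_measurable_Lb] y]
      have "cm_integral Lb \<nu> (\<lambda>u. iexp (pw u y)) = (\<integral>w. Z w * iexp (pw (\<pi> w) y) \<partial>P)"
        unfolding \<nu>_def[abs_def]
      proof (rule cm_integral_density[OF Zi \<pi>, where K=1])
        show "(\<lambda>u. iexp (pw u y)) \<in> borel_measurable Lb" by measurable
        show "cmod (iexp (pw u y)) \<le> 1" for u unfolding norm_exp_i by simp
      qed
      then show "H y = cm_integral Lb \<nu> (\<lambda>u. iexp (pw u y))" using Hrep[OF g] by simp
    qed
  qed
  then have "H \<in> S_class S T (completion M) \<phi>" unfolding S_class_def my_def by blast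
  then obtain N3 z3 where rH: "represents H N3 z3" using represents_ex by blast
  have N3: "finite_measure N3" "integrable N3 z3" using rH by (auto simp: represents_def)
  interpret B: bump_agreement S T \<phi> P Z \<pi> N3 z3 "\<lambda>u. u"
  proof (rule bump_agreement_of_s_ae[OF P Zi \<pi> N3 represents_measurable[OF rH]])
    have "s_ae (completion M) (\<lambda>x. H x = (\<integral>u. z3 u * iexp (pw u x) \<partial>N3))"
      using rH by (simp add: represents_def)
    from s_ae_conj[OF this good_ae[unfolded my_def]]
    show "s_ae (completion M) (\<lambda>y. (\<integral>w. Z w * iexp (pw (\<pi> w) y) \<partial>P) =
       (\<integral>w. z3 w * iexp (pw w y) \<partial>N3))"
      by (rule s_ae_mono) (use Hrep in auto)
  qed
  show ?thesis
    unfolding my_def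
  proof (rule s_ae_mono[OF good_ae[unfolded my_def]])
    fix y assume y: "y \<in> C0 S T" and g: "good y"
    have yeq: "(\<lambda>p. y p / sqrt 2) = scale (1 / sqrt 2) y" by (simp add: scale_def)
    have y2: "(\<lambda>p. y p / sqrt 2) \<in> C0 S T" unfolding yeq by (rule scale_C0[OF y])
    have s1': "bv_hk S T (\<lambda>p. s1 p / sqrt 2)" using bv_hk_scale[OF s1, of "1 / sqrt 2"] by simp
    have s2': "bv_hk S T (\<lambda>p. s2 p / sqrt 2)" using bv_hk_scale[OF s2, of "1 / sqrt 2"] by simp
    note tF = transform_represents[OF rF y2 s1' q] and tG = transform_represents[OF rG y2 s2' q] and tH = transform_represents[OF rH y h q]
    define a1 where "a1 u = exp (- (\<i> * complex_of_real (nsq (\<lambda>p. u p * (s1 p / sqrt 2)) / 2 / q)))" for u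
    define a2 where "a2 u = exp (- (\<i> * complex_of_real (nsq (\<lambda>p. u p * (s2 p / sqrt 2)) / 2 / q)))" for u
    define \<psi> where "\<psi> u = iexp (pw u y) * exp (- (\<i> * complex_of_real (nsq (\<lambda>p. u p * h p) / 2 / q)))" for u
    have nh: "(\<lambda>u. nsq (\<lambda>p. u p * k p)) \<in> borel_measurable Lb" if "bv_hk S T k" for k
      by (rule nsq_measurable[OF mult_bv_L2[OF that measurable_L2[OF id_measurable_Lb]] mult_bv_co_measurable[OF id_measurable_Lb that]])
    note [measurable] = nh[OF h] nh[OF s1'] nh[OF s2'] pwz_measurable_fst[OF co_measurable[OF id_measurable_Lb] y] pwz_measurable_fst[OF co_measurable[OF id_measurable_Lb] y2]
    have am: "a1 \<in> borel_measurable Lb" "a2 \<in> borel_measurable Lb" unfolding a1_def[abs_def] a2_def[abs_def] by measurable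
    have \<psi>m: "\<psi> \<in> borel_measurable Lb" unfolding \<psi>_def[abs_def] by measurable
    have "transform S T (completion M) \<phi> q h H y = (\<integral>u. z3 u * \<psi> u \<partial>N3)"
      unfolding tH(2) \<psi>_def by (simp only: mult.assoc)
    also have "\<dots> = (\<integral>w. Z w * \<psi> (\<pi> w) \<partial>P)"
      by (rule B.density_integrals_agree[OF \<psi>m, where K=1, symmetric]) (simp only: \<psi>_def norm_mult norm_exp_i mult_1_right order_refl)
    also have "\<dots> = (\<integral>w. (z (fst w) * iexp (pw (fst w) (\<lambda>p. y p / sqrt 2)) * a1 (fst w)) *
        (z' (snd w) * iexp (pw (snd w) (\<lambda>p. y p / sqrt 2)) * a2 (snd w)) \<partial>P)"
    proof (rule integral_cong_AE)
      show "AE w in P. Z w * \<psi> (\<pi> w) = (z (fst w) * iexp (pw (fst w) (\<lambda>p. y p / sqrt 2)) * a1 (fst w)) *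
        (z' (snd w) * iexp (pw (snd w) (\<lambda>p. y p / sqrt 2)) * a2 (snd w))"
        using g[unfolded good_def, THEN conjunct2] AE_space
      proof eventually_elim
        case (elim w)
        then have c: "pwz_conv (fst w) y" "pwz_conv (snd w) y" and w: "w \<in> space P" by auto
        note uL = measurable_L2[OF f w] and vL = measurable_L2[OF s w]
        have e1: "iexp (pw (\<pi> w) y) =
          iexp (pw (fst w) (\<lambda>p. y p / sqrt 2)) * iexp (pw (snd w) (\<lambda>p. y p / sqrt 2))"
          unfolding pi_pwz[OF y c w] yeq pwz_scale[OF y c(1)] pwz_scale[OF y c(2)]
          by (simp only: exp_add[symmetric] of_real_add distrib_left)
        have id: "nsq (\<lambda>p. \<pi> w p * h p) / 2 + n w / 4 = nsq (\<lambda>p. fst w p * (s1 p / sqrt 2)) / 2 + nsq (\<lambda>p. snd w p * (s2 p / sqrt 2)) / 2"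
          unfolding \<pi>_def n_def by (rule nsq_half_sum_identity[OF uL vL k1 k2 h s1 s2 hk s1k s2k])
        have "exp (- (\<i> * complex_of_real (n w / 4 / q))) * exp (- (\<i> * complex_of_real (nsq (\<lambda>p. \<pi> w p * h p) / 2 / q))) =
            exp (- (\<i> * complex_of_real ((nsq (\<lambda>p. \<pi> w p * h p) / 2 + n w / 4) / q)))"
          by (simp add: exp_add[symmetric] add_divide_distrib algebra_simps)
        also have "\<dots> = a1 (fst w) * a2 (snd w)"
          unfolding id a1_def a2_def by (simp add: exp_add[symmetric] add_divide_distrib algebra_simps)
        finally have e2: "exp (- (\<i> * complex_of_real (n w / 4 / q))) * exp (- (\<i> * complex_of_real (nsq (\<lambda>p. \<pi> w p * h p) / 2 / q))) = a1 (fst w) * a2 (snd w)" .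
        have "Z w * \<psi> (\<pi> w) = z (fst w) * z' (snd w) * iexp (pw (\<pi> w) y) *
           (exp (- (\<i> * complex_of_real (n w / 4 / q))) * exp (- (\<i> * complex_of_real (nsq (\<lambda>p. \<pi> w p * h p) / 2 / q))))"
          unfolding Z_def \<psi>_def by (simp only: mult_ac)
        then show ?case unfolding e1 e2 by (simp only: mult_ac)
      qed
      show "(\<lambda>w. Z w * \<psi> (\<pi> w)) \<in> borel_measurable P"
        using measurable_compose[OF \<pi> \<psi>m] by measurable
      note [measurable] = measurable_compose[OF f am(1)] measurable_compose[OF s am(2)]
        pwz_measurable_fst[OF co_measurable[OF f] y2] pwz_measurable_fst[OF co_measurable[OF s] y2]
      have "(\<lambda>w. (z (fst w) * z' (snd w)) * (iexp (pw (fst w) (\<lambda>p. y p / sqrt 2)) * a1 (fst w)) *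
        (iexp (pw (snd w) (\<lambda>p. y p / sqrt 2)) * a2 (snd w))) \<in> borel_measurable P" by measurable
      then show "(\<lambda>w. (z (fst w) * iexp (pw (fst w) (\<lambda>p. y p / sqrt 2)) * a1 (fst w)) *
        (z' (snd w) * iexp (pw (snd w) (\<lambda>p. y p / sqrt 2)) * a2 (snd w))) \<in> borel_measurable P"
        by (simp only: mult_ac)
    qed
    also have "\<dots> = (\<integral>u. z u * iexp (pw u (\<lambda>p. y p / sqrt 2)) * a1 u \<partial>N) *
        (\<integral>v. z' v * iexp (pw v (\<lambda>p. y p / sqrt 2)) * a2 v \<partial>N')"
      unfolding P_def
    proof (rule integral_pair_mult(2)[OF N N'])
      have i: "integrable K (\<lambda>u. x u * iexp (pw u (\<lambda>p. y p / sqrt 2)) * a u)"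
        if r: "represents E K x" and a: "a \<in> borel_measurable Lb" "\<And>u. cmod (a u) = 1" for E K x and a :: "sheet \<Rightarrow> complex"
      proof -
        have j: "integrable K (\<lambda>u. x u * iexp (pw u (\<lambda>p. y p / sqrt 2)))"
          using represents_phase_integrable[OF r y2, of 1] by simp
        note [measurable] = borel_measurable_integrable[OF j] measurable_compose[OF represents_measurable[OF r] a(1)]
        show ?thesis
          by (rule Bochner_Integration.integrable_bound[OF j]) (measurable, simp only: norm_mult[of _ "a _"] a(2) mult_1_right order_refl eventually_True)
      qed
      show "integrable N (\<lambda>u. z u * iexp (pw u (\<lambda>p. y p / sqrt 2)) * a1 u)"
        by (rule i[OF rF am(1)]) (simp only: a1_def norm_exp_i)
      show "integrable N' (\<lambda>v. z' v * iexp (pw v (\<lambda>p. y p / sqrt 2)) * a2 v)"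
        by (rule i[OF rG am(2)]) (simp only: a2_def norm_exp_i)
    qed
    also have "\<dots> = transform S T (completion M) \<phi> q (\<lambda>p. s1 p / sqrt 2) F (\<lambda>p. y p / sqrt 2) *
          transform S T (completion M) \<phi> q (\<lambda>p. s2 p / sqrt 2) G (\<lambda>p. y p / sqrt 2)"
      unfolding tF(2) tG(2) a1_def a2_def ..
    finally show "conv_product_exists S T (completion M) \<phi> q k1 k2 F G y \<and>
        transform_exists S T (completion M) \<phi> q h (conv_product S T (completion M) \<phi> q k1 k2 F G) y \<and>
        transform_exists S T (completion M) \<phi> q (\<lambda>p. s1 p / sqrt 2) F (\<lambda>p. y p / sqrt 2) \<and>
        transform_exists S T (completion M) \<phi> q (\<lambda>p. s2 p / sqrt 2) G (\<lambda>p. y p / sqrt 2) \<and>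
        transform S T (completion M) \<phi> q h (conv_product S T (completion M) \<phi> q k1 k2 F G) y =
          transform S T (completion M) \<phi> q (\<lambda>p. s1 p / sqrt 2) F (\<lambda>p. y p / sqrt 2) *
          transform S T (completion M) \<phi> q (\<lambda>p. s2 p / sqrt 2) G (\<lambda>p. y p / sqrt 2)"
      using conv_represents(1)[OF rF rG y k1 k2 q] tF(1) tG(1) tH(1) unfolding H_def my_def by blast
  qed
qed

end

lemma yeh_wiener_of_measure:
  assumes "S > 0" "T > 0" "yeh_wiener_measure S T my" "bv_complete_orthonormal S T \<phi>"
  obtains M where "my = completion M" "yeh_wiener S T \<phi> M"
proof -
  obtain M where C: "my = completion M \<and> space M = C0 S T \<and> sets M = sets (C0_borel S T) \<and> prob_space M \<and>
     (\<forall>I a. finite I \<and> I \<subseteq> Qrect S T \<longrightarrow> centered_normal (distr M borel (\<lambda>x. \<Sum>p\<in>I. a p * x p))) \<and>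
     (\<forall>s\<in>{0..S}. \<forall>t\<in>{0..T}. \<forall>s'\<in>{0..S}. \<forall>t'\<in>{0..T}. (\<integral>x. x (s, t) * x (s', t') \<partial>M) = min s s' * min t t')"
    using assms(3) unfolding yeh_wiener_measure_def by (rule exE)
  note M = C[THEN conjunct1] C[THEN conjunct2, THEN conjunct1] C[THEN conjunct2, THEN conjunct2, THEN conjunct1]
    C[THEN conjunct2, THEN conjunct2, THEN conjunct2, THEN conjunct1]
    C[THEN conjunct2, THEN conjunct2, THEN conjunct2, THEN conjunct2, THEN conjunct1]
    C[THEN conjunct2, THEN conjunct2, THEN conjunct2, THEN conjunct2, THEN conjunct2]
  interpret rectangle_basis S T \<phi> by unfold_locales (use assms in auto)
  interpret prob_space M by (rule M(4))
  have "yeh_wiener S T \<phi> M"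
  proof unfold_locales
    show "space M = C0 S T" "sets M = sets (C0_borel S T)" by (rule M(2), rule M(3))
    show "centered_normal (distr M borel (\<lambda>x. \<Sum>p\<in>I. a p * x p))" if "finite I" "I \<subseteq> Qrect S T" for I a
      using M(5) that by blast
    show "(\<integral>x. x (s, t) * x (s', t') \<partial>M) = min s s' * min t t'"
      if "s \<in> {0..S}" "t \<in> {0..T}" "s' \<in> {0..S}" "t' \<in> {0..T}" for s t s' t'
      using M(6) that by blast
  qed
  then show ?thesis using that M(1) by blast
qed

theorem theorem6p5:
  fixes S T :: real
    and my :: "(real \<times> real \<Rightarrow> real) measure"
    and \<phi> :: "nat \<Rightarrow> real \<times> real \<Rightarrow> real"
    and k1 k2 h s1 s2 :: "real \<times> real \<Rightarrow> real"
    and F G :: "(real \<times> real \<Rightarrow> real) \<Rightarrow> complex"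
    and f g :: "(real \<times> real \<Rightarrow> real) set \<Rightarrow> complex"
  assumes "S > 0" and "T > 0"
    and "yeh_wiener_measure S T my"
    and "bv_complete_orthonormal S T \<phi>"
    and "k1 \<in> Supp_BV S T" and "k2 \<in> Supp_BV S T" and "h \<in> Supp_BV S T"
    and "corresponds S T my \<phi> F f" and "corresponds S T my \<phi> G g"
    and "AE p in lebesgue_on (Qrect S T). (h p)\<^sup>2 = k1 p * k2 p"
    and "s1 \<in> Supp_BV S T"
    and "AE p in lebesgue_on (Qrect S T). (s1 p)\<^sup>2 = (h p)\<^sup>2 + (k1 p)\<^sup>2"
    and "s2 \<in> Supp_BV S T"
    and "AE p in lebesgue_on (Qrect S T). (s2 p)\<^sup>2 = (h p)\<^sup>2 + (k2 p)\<^sup>2"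
  shows "(\<forall>q. q \<noteq> 0 \<longrightarrow> s_ae my (\<lambda>y.
        conv_product_exists S T my \<phi> q k1 k2 F G y \<and>
        transform_exists S T my \<phi> q h (conv_product S T my \<phi> q k1 k2 F G) y \<and>
        transform_exists S T my \<phi> q (\<lambda>p. s1 p / sqrt 2) F (\<lambda>p. y p / sqrt 2) \<and>
        transform_exists S T my \<phi> q (\<lambda>p. s2 p / sqrt 2) G (\<lambda>p. y p / sqrt 2) \<and>
        transform S T my \<phi> q h (conv_product S T my \<phi> q k1 k2 F G) y =
          transform S T my \<phi> q (\<lambda>p. s1 p / sqrt 2) F (\<lambda>p. y p / sqrt 2) *
          transform S T my \<phi> q (\<lambda>p. s2 p / sqrt 2) G (\<lambda>p. y p / sqrt 2)))
    \<and> (\<forall>q. q \<noteq> 0 \<longrightarrow> s_ae my (\<lambda>y.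
        conv_product_exists S T my \<phi> q h h F G y \<and>
        transform_exists S T my \<phi> q h (conv_product S T my \<phi> q h h F G) y \<and>
        transform_exists S T my \<phi> q h F (\<lambda>p. y p / sqrt 2) \<and>
        transform_exists S T my \<phi> q h G (\<lambda>p. y p / sqrt 2) \<and>
        transform S T my \<phi> q h (conv_product S T my \<phi> q h h F G) y =
          transform S T my \<phi> q h F (\<lambda>p. y p / sqrt 2) *
          transform S T my \<phi> q h G (\<lambda>p. y p / sqrt 2)))"
proof -
  obtain M where my: "my = completion M" and yw: "yeh_wiener S T \<phi> M"
    using yeh_wiener_of_measure[OF assms(1-4)] by blast
  interpret yeh_wiener S T \<phi> M by (rule yw)
  have FG: "F \<in> S_class S T (completion M) \<phi>" "G \<in> S_class S T (completion M) \<phi>"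
    using assms(8,9) unfolding my S_class_def by blast+
  have bv: "bv_hk S T k1" "bv_hk S T k2" "bv_hk S T h" "bv_hk S T s1" "bv_hk S T s2"
    using assms(5-7,11,13) by (auto simp: Supp_BV_def)
  \<comment> \<open>For \<open>k1 = k2 = h\<close> an admissible root of
    \<open>h\<^sup>2 + h\<^sup>2\<close> is \<open>sqrt 2 * h\<close>, and dividing it by
    \<open>sqrt 2\<close> returns \<open>h\<close>. The second claim is thus an instance of the
    general identity.\<close>
  have r2: "bv_hk S T (\<lambda>p. sqrt 2 * h p)" by (rule bv_hk_scale[OF bv(3)])
  have sq: "AE p in LQ. (sqrt 2 * h p)\<^sup>2 = (h p)\<^sup>2 + (h p)\<^sup>2" by (simp add: power_mult_distrib)
  have hh: "AE p in LQ. (h p)\<^sup>2 = h p * h p" by (simp add: power2_eq_square)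
  have e: "(\<lambda>p. sqrt 2 * h p / sqrt 2) = h" by simp
  note special = transform_conv_product[OF FG bv(3) bv(3) bv(3) r2 r2 hh sq sq, unfolded e]
  show ?thesis
    unfolding my using special transform_conv_product[OF FG bv assms(10,12,14)] by blast
qed

end
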